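(* There is a constant $\gamma_0>0$, depending only on the coefficients $r,q,\kappa,\theta,\rho,\sigma$ of $A$, such that for $\gamma\in(0,\gamma_0)$ the following holds. Assume $r>0$. Suppose there are $M,m\in H^2(\mathcal O,\mathfrak w)$ such that $$m\le0\le M\ \text{on }\Gamma_1,\qquad m\le M\ \text{on }\mathcal O,\qquad Am\le AM\ \text{a.e. on }\mathcal O .$$ If $f\in L^2(\mathcal O,\mathfrak w)$ satisfies $Am\le f\le AM$ a.e. on $\mathcal O$, then there exists $u\in H^1_0(\mathcal O\cup\Gamma_0,\mathfrak w)$ such that $$a(u,v)=(f,v)_{L^2(\mathcal O,\mathfrak w)}\qquad\forall v\in H^1_0(\mathcal O\cup\Gamma_0,\mathfrak w),$$ and $m\le u\le M$ a.e. on $\mathcal O$. Moreover, if the domain $\mathcal O$ satisfies the domain conditions (D0), (D1), (D2) of the context and there is $\varphi\in H^2(\mathcal O,\mathfrak w)$ with $$A\varphi\ge0\ \text{a.e. on }\mathcal O,\quad A(m+\varphi)>0\ \text{a.e. on }\mathcal O,\quad \varphi\ge0\ \text{on }\mathcal O,\quad (1+y)\varphi\in L^2(\mathcal O,\mathfrak w),$$ $$(1+y)^{1/2}A\varphi\in L^2(\mathcal O,\mathfrak w),\qquad \operatorname*{ess\,sup}_{(x,y)\in\mathcal O}\frac{(1+y)(M+\varphi)(x,y)}{A(m+\varphi)(x,y)}<\infty,$$ then the solution $u$ is unique.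
   Context: **Operator.** $\mathbb H=\mathbb R\times(0,\infty)$ with coordinates $(x,y)$. The constants satisfy $\sigma\ne0$, $-1<\rho<1$, $\kappa>0$, $\theta>0$, $r\ge0$, $q\ge0$, and (standing normalization) $b_1:=r-q-\kappa\theta\rho/\sigma=0$. The Heston operator is $$Av=-\tfrac y2\left(v_{xx}+2\rho\sigma v_{xy}+\sigma^2v_{yy}\right)-\left(r-q-\tfrac y2\right)v_x-\kappa(\theta-y)v_y+rv .$$ Put $\beta=2\kappa\theta/\sigma^2$, $\mu=2\kappa/\sigma^2$, $a_1=\kappa\rho/\sigma-\tfrac12$ and $\mathfrak w(x,y)=y^{\beta-1}e^{-\gamma|x|-\mu y}$ on $\mathbb H$. **Domain.** $\mathcal O\subset\mathbb H$ is a possibly unbounded domain, $\Gamma_1:=\mathbb H\cap\partial\mathcal O$, and $\Gamma_0$ is the interior (in $\{y=0\}$) of $\{y=0\}\cap\partial\mathcal O$, assumed non-empty. **Spaces.** $L^2(\mathcal O,\mathfrak w)$ is the $L^2$ space for $\mathfrak w\,dx\,dy$. With distributional derivatives, $H^1(\mathcal O,\mathfrak w)$ and $H^2(\mathcal O,\mathfrak w)$ are the spaces with finite norms $$\|u\|_{H^1(\mathcal O,\mathfrak w)}^2=\int_{\mathcal O}\left(y|Du|^2+(1+y)u^2\right)\mathfrak w\,dx\,dy,$$ $$\|u\|_{H^2(\mathcal O,\mathfrak w)}^2=\int_{\mathcal O}\left(y^2|D^2u|^2+(1+y)^2|Du|^2+(1+y)u^2\right)\mathfrak w\,dx\,dy,$$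 and $H^1_0(\mathcal O\cup\Gamma_0,\mathfrak w)$ is the closure in $H^1(\mathcal O,\mathfrak w)$ of $C^\infty_0(\mathcal O\cup\Gamma_0)$ (smooth functions with compact support in $\mathcal O\cup\Gamma_0$). The condition $m\le0\le M$ on $\Gamma_1$ is understood in the trace sense, i.e. $m^+,M^-\in H^1_0(\mathcal O\cup\Gamma_0,\mathfrak w)$, where $w^+=\max\{w,0\}$, $w^-=-\min\{w,0\}$. **Bilinear form.** For $u,v\in H^1(\mathcal O,\mathfrak w)$, $$a(u,v)=\tfrac12\int_{\mathcal O}\left(u_xv_x+\rho\sigma u_yv_x+\rho\sigma u_xv_y+\sigma^2u_yv_y\right)y\,\mathfrak w\,dx\,dy-\tfrac\gamma2\int_{\mathcal O}(u_x+\rho\sigma u_y)v\,\operatorname{sign}(x)\,y\,\mathfrak w\,dx\,dy$$ $$\qquad-\int_{\mathcal O}a_1y\,u_xv\,\mathfrak w\,dx\,dy+\int_{\mathcal O}ruv\,\mathfrak w\,dx\,dy .$$ **Domain conditions.** (D0) There is $\delta_0>0$ such that for all $0<\delta\le\delta_0$: $\mathcal O\cap(\mathbb R\times(0,\delta))=\Gamma_0\times(0,\delta)$ and $\Gamma_1\cap(\mathbb R\times(0,\delta))=\partial\Gamma_0\times(0,\delta)$, where $\Gamma_0\subseteq\mathbb R$ is a finite union of open intervals. (D1) For some $\alpha\in(0,1)$ there is a locally finite open cover $\{U_j\}$ of $\Gamma_1\cap(\mathbb R\times(\delta_0/2,\infty))$ with $U_j\subset\mathbb R\times(\delta_0/4,\infty)$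 and $C^{2,\alpha}$-smooth one-to-one transformations $\Phi_j$ of $U_j$ onto $B(1)$, with inverses $\Psi_j$, where $B(R)=\{x^2+y^2<R^2\}$, such that: (1) for some $\delta_1>0$, with $U_j'=\Psi_j(B(1/2))$, $\bigcup_jU_j'\supset\{P\in\mathcal O:\operatorname{dist}(P,\Gamma_1)<\delta_1\}\cap(\mathbb R\times(\delta_0/2,\infty))$; (2) for some finite $R_1\ge1$, every collection of $R_1+1$ of the sets $U_j$ has empty intersection; (3) $\Phi_j(U_j\cap\mathcal O)=\{(x,y)\in B(1):x>0\}$; (4) for some finite $M_1$, all components of $\Phi_j$ and $\Psi_j$ and their partial derivatives of order $\le2$ are bounded by $M_1$, for every $j$. (D2) There is a bounded linear extension operator $E:H^1(\mathcal O)\to H^1(\mathbb H)$ between the standard (unweighted) Sobolev spaces with $Eu=u$ a.e. on $\mathcal O$. *)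

theory Defs
  imports "HOL-Probability.Essential_Supremum"
begin

type_synonym plane = "real \<times> real"

definition half_plane :: "plane set" where
  "half_plane = UNIV \<times> {0<..}"

definition ex :: plane where "ex = (1, 0)"
definition ey :: plane where "ey = (0, 1)"


section \<open>Classical derivatives\<close>

definition pd :: "plane \<Rightarrow> (plane \<Rightarrow> real) \<Rightarrow> plane \<Rightarrow> real" where
  "pd e u P = deriv (\<lambda>t::real. u (P + t *\<^sub>R e)) 0"

text \<open>Used for open \<open>U\<close> only.\<close>
primrec Ck_on :: "nat \<Rightarrow> plane set \<Rightarrow> (plane \<Rightarrow> real) \<Rightarrow> bool" where
  "Ck_on 0 U u \<longleftrightarrow> continuous_on U u"
| "Ck_on (Suc k) U u \<longleftrightarrow> u differentiable_on U \<and> Ck_on k U (pd ex u) \<and> Ck_on k U (pd ey u)"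

text \<open>\<open>C\<^sup>2\<^sup>,\<^sup>\<alpha>(U)\<close> for open \<open>U\<close>: the second derivatives are locally Hoelder continuous in \<open>U\<close>.\<close>
definition C2_Hoelder_on :: "real \<Rightarrow> plane set \<Rightarrow> (plane \<Rightarrow> real) \<Rightarrow> bool" where
  "C2_Hoelder_on \<alpha> U u \<longleftrightarrow> Ck_on 2 U u \<and>
     (\<forall>e\<in>{ex, ey}. \<forall>e'\<in>{ex, ey}. \<forall>P\<in>U. \<exists>\<epsilon>>0. \<exists>L. \<forall>Q\<in>U \<inter> ball P \<epsilon>. \<forall>Q'\<in>U \<inter> ball P \<epsilon>.
        \<bar>pd e (pd e' u) Q - pd e (pd e' u) Q'\<bar> \<le> L * dist Q Q' powr \<alpha>)"

definition derivs_le2_bounded :: "real \<Rightarrow> plane set \<Rightarrow> (plane \<Rightarrow> real) \<Rightarrow> bool" where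
  "derivs_le2_bounded B U u \<longleftrightarrow> (\<forall>P\<in>U. \<bar>u P\<bar> \<le> B \<and>
     (\<forall>e\<in>{ex, ey}. \<bar>pd e u P\<bar> \<le> B \<and> (\<forall>e'\<in>{ex, ey}. \<bar>pd e (pd e' u) P\<bar> \<le> B)))"

text \<open>\<open>C\<^sub>0\<^sup>\<infinity>(\<Omega> \<union> T)\<close> for open \<open>\<Omega>\<close> and a portion \<open>T\<close> of its boundary: smooth in \<open>\<Omega>\<close>, all
  derivatives extend continuously to \<open>\<Omega> \<union> T\<close>, and the support is a compact subset of
  \<open>\<Omega> \<union> T\<close> (so the functions need not vanish on \<open>T\<close>). Values outside \<open>\<Omega> \<union> T\<close> are
  irrelevant. With \<open>T = {}\<close> these are the usual test functions on \<open>\<Omega>\<close>.\<close>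
definition smooth_compact_support :: "plane set \<Rightarrow> plane set \<Rightarrow> (plane \<Rightarrow> real) set" where
  "smooth_compact_support \<Omega> T = {\<phi>.
     (\<forall>k. Ck_on k \<Omega> \<phi>) \<and> continuous_on (\<Omega> \<union> T) \<phi> \<and>
     (\<forall>i j. \<exists>g. continuous_on (\<Omega> \<union> T) g \<and> (\<forall>P\<in>\<Omega>. g P = (pd ex ^^ i) ((pd ey ^^ j) \<phi>) P)) \<and>
     (\<exists>K. compact K \<and> K \<subseteq> \<Omega> \<union> T \<and> (\<forall>P\<in>(\<Omega> \<union> T) - K. \<phi> P = 0))}"


section \<open>Distributional derivatives\<close>

definition locally_integrable :: "plane set \<Rightarrow> (plane \<Rightarrow> real) \<Rightarrow> bool" where
  "locally_integrable \<Omega> u \<longleftrightarrow> (\<forall>K. compact K \<and> K \<subseteq> \<Omega> \<longrightarrow> integrable (lebesgue_on K) u)"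

definition is_weak_deriv ::
    "plane set \<Rightarrow> plane \<Rightarrow> (plane \<Rightarrow> real) \<Rightarrow> (plane \<Rightarrow> real) \<Rightarrow> bool" where
  "is_weak_deriv \<Omega> e u g \<longleftrightarrow> locally_integrable \<Omega> u \<and> locally_integrable \<Omega> g \<and>
     (\<forall>\<phi>\<in>smooth_compact_support \<Omega> {}.
        (LINT P|lebesgue_on \<Omega>. u P * pd e \<phi> P) = - (LINT P|lebesgue_on \<Omega>. g P * \<phi> P))"

definition weakly_diff :: "plane set \<Rightarrow> plane \<Rightarrow> (plane \<Rightarrow> real) \<Rightarrow> bool" where
  "weakly_diff \<Omega> e u \<longleftrightarrow> (\<exists>g. is_weak_deriv \<Omega> e u g)"

text \<open>Determined up to null sets when \<open>weakly_diff \<Omega> e u\<close>, and arbitrary otherwise.\<close>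
definition wD :: "plane set \<Rightarrow> plane \<Rightarrow> (plane \<Rightarrow> real) \<Rightarrow> plane \<Rightarrow> real" where
  "wD \<Omega> e u = (SOME g. is_weak_deriv \<Omega> e u g)"

definition wgrad_sq :: "plane set \<Rightarrow> (plane \<Rightarrow> real) \<Rightarrow> plane \<Rightarrow> real" where
  "wgrad_sq \<Omega> u P = (wD \<Omega> ex u P)\<^sup>2 + (wD \<Omega> ey u P)\<^sup>2"

definition whess_sq :: "plane set \<Rightarrow> (plane \<Rightarrow> real) \<Rightarrow> plane \<Rightarrow> real" where
  "whess_sq \<Omega> u P = wgrad_sq \<Omega> (wD \<Omega> ex u) P + wgrad_sq \<Omega> (wD \<Omega> ey u) P"


section \<open>Function spaces\<close>

text \<open>Elements of the spaces are representatives; functions are identified only through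
  a.e. statements. The argument \<open>w\<close> is the density of the weighted measure.\<close>

definition L2 :: "(plane \<Rightarrow> real) \<Rightarrow> plane set \<Rightarrow> (plane \<Rightarrow> real) set" where
  "L2 w \<Omega> = {u \<in> borel_measurable (lebesgue_on \<Omega>).
     integrable (lebesgue_on \<Omega>) (\<lambda>P. (u P)\<^sup>2 * w P)}"

definition H1_density :: "(plane \<Rightarrow> real) \<Rightarrow> plane set \<Rightarrow> (plane \<Rightarrow> real) \<Rightarrow> plane \<Rightarrow> real" where
  "H1_density w \<Omega> u P = (snd P * wgrad_sq \<Omega> u P + (1 + snd P) * (u P)\<^sup>2) * w P"

definition H1 :: "(plane \<Rightarrow> real) \<Rightarrow> plane set \<Rightarrow> (plane \<Rightarrow> real) set" where
  "H1 w \<Omega> = {u. weakly_diff \<Omega> ex u \<and> weakly_diff \<Omega> ey u \<and>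
     integrable (lebesgue_on \<Omega>) (H1_density w \<Omega> u)}"

definition H1_norm :: "(plane \<Rightarrow> real) \<Rightarrow> plane set \<Rightarrow> (plane \<Rightarrow> real) \<Rightarrow> real" where
  "H1_norm w \<Omega> u = sqrt (LINT P|lebesgue_on \<Omega>. H1_density w \<Omega> u P)"

definition H2 :: "(plane \<Rightarrow> real) \<Rightarrow> plane set \<Rightarrow> (plane \<Rightarrow> real) set" where
  "H2 w \<Omega> = {u. weakly_diff \<Omega> ex u \<and> weakly_diff \<Omega> ey u \<and>
     (\<forall>e\<in>{ex, ey}. \<forall>e'\<in>{ex, ey}. weakly_diff \<Omega> e (wD \<Omega> e' u)) \<and>
     integrable (lebesgue_on \<Omega>) (\<lambda>P.
       ((snd P)\<^sup>2 * whess_sq \<Omega> u P + (1 + snd P)\<^sup>2 * wgrad_sq \<Omega> u P + (1 + snd P) * (u P)\<^sup>2) * w P)}"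

definition H1_zero :: "(plane \<Rightarrow> real) \<Rightarrow> plane set \<Rightarrow> plane set \<Rightarrow> (plane \<Rightarrow> real) set" where
  "H1_zero w \<Omega> T = {u \<in> H1 w \<Omega>. \<forall>\<epsilon>>0. \<exists>\<phi>\<in>smooth_compact_support \<Omega> T.
     H1_norm w \<Omega> (\<lambda>P. u P - \<phi> P) < \<epsilon>}"

definition H1_std :: "plane set \<Rightarrow> (plane \<Rightarrow> real) set" where
  "H1_std \<Omega> = {u. weakly_diff \<Omega> ex u \<and> weakly_diff \<Omega> ey u \<and>
     integrable (lebesgue_on \<Omega>) (\<lambda>P. wgrad_sq \<Omega> u P + (u P)\<^sup>2)}"

definition H1_std_norm :: "plane set \<Rightarrow> (plane \<Rightarrow> real) \<Rightarrow> real" where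
  "H1_std_norm \<Omega> u = sqrt (LINT P|lebesgue_on \<Omega>. wgrad_sq \<Omega> u P + (u P)\<^sup>2)"


section \<open>The domain and its boundary\<close>

text \<open>\<open>Gamma0\<close> is a subset of the line \<open>y = 0\<close>, identified with the reals.\<close>
definition Gamma0 :: "plane set \<Rightarrow> real set" where
  "Gamma0 \<Omega> = interior {x. (x, 0) \<in> frontier \<Omega>}"

definition Gamma1 :: "plane set \<Rightarrow> plane set" where
  "Gamma1 \<Omega> = half_plane \<inter> frontier \<Omega>"

definition heston_domain :: "plane set \<Rightarrow> bool" where
  "heston_domain \<Omega> \<longleftrightarrow> open \<Omega> \<and> connected \<Omega> \<and> \<Omega> \<subseteq> half_plane \<and> Gamma0 \<Omega> \<noteq> {}"

definition domain_D0 :: "real \<Rightarrow> plane set \<Rightarrow> bool" where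
  "domain_D0 \<delta>\<^sub>0 \<Omega> \<longleftrightarrow>
     (\<exists>\<I>. finite \<I> \<and> (\<forall>I\<in>\<I>. open I \<and> is_interval I) \<and> Gamma0 \<Omega> = \<Union>\<I>) \<and>
     (\<forall>\<delta>. 0 < \<delta> \<and> \<delta> \<le> \<delta>\<^sub>0 \<longrightarrow>
        \<Omega> \<inter> (UNIV \<times> {0<..<\<delta>}) = Gamma0 \<Omega> \<times> {0<..<\<delta>} \<and>
        Gamma1 \<Omega> \<inter> (UNIV \<times> {0<..<\<delta>}) = frontier (Gamma0 \<Omega>) \<times> {0<..<\<delta>})"

text \<open>A locally finite family of non-empty open sets in the plane is countable, so indexing by a
  set \<open>J\<close> of naturals is no restriction. The condition that \<open>P\<close> has distance less than \<open>\<delta>\<^sub>1\<close> from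
  \<open>Gamma1\<close> is written with a witness \<open>Q\<close> so that nothing is required when \<open>Gamma1\<close> is empty (where \<open>infdist\<close> would be \<open>0\<close>).\<close>
definition domain_D1 :: "real \<Rightarrow> plane set \<Rightarrow> bool" where
  "domain_D1 \<delta>\<^sub>0 \<Omega> \<longleftrightarrow>
     (\<exists>\<alpha> (J :: nat set) (U :: nat \<Rightarrow> plane set)
        (\<Phi> :: nat \<Rightarrow> plane \<Rightarrow> plane) (\<Psi> :: nat \<Rightarrow> plane \<Rightarrow> plane).
        0 < \<alpha> \<and> \<alpha> < 1 \<and>
        locally_finite_in euclidean (U ` J) \<and>
        Gamma1 \<Omega> \<inter> (UNIV \<times> {\<delta>\<^sub>0 / 2<..}) \<subseteq> (\<Union>j\<in>J. U j) \<and>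
        (\<forall>j\<in>J. open (U j) \<and> U j \<subseteq> UNIV \<times> {\<delta>\<^sub>0 / 4<..} \<and>
           bij_betw (\<Phi> j) (U j) (ball 0 1) \<and> (\<forall>P\<in>U j. \<Psi> j (\<Phi> j P) = P) \<and>
           C2_Hoelder_on \<alpha> (U j) (fst \<circ> \<Phi> j) \<and> C2_Hoelder_on \<alpha> (U j) (snd \<circ> \<Phi> j) \<and>
           C2_Hoelder_on \<alpha> (ball 0 1) (fst \<circ> \<Psi> j) \<and> C2_Hoelder_on \<alpha> (ball 0 1) (snd \<circ> \<Psi> j)) \<and>
        (\<exists>\<delta>\<^sub>1>0. {P\<in>\<Omega>. \<exists>Q\<in>Gamma1 \<Omega>. dist P Q < \<delta>\<^sub>1} \<inter> (UNIV \<times> {\<delta>\<^sub>0 / 2<..})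
           \<subseteq> (\<Union>j\<in>J. \<Psi> j ` ball 0 (1/2))) \<and>
        (\<exists>R\<^sub>1\<ge>1. \<forall>K\<subseteq>J. card K = R\<^sub>1 + 1 \<longrightarrow> (\<Inter>j\<in>K. U j) = {}) \<and>
        (\<forall>j\<in>J. \<Phi> j ` (U j \<inter> \<Omega>) = {P \<in> ball 0 1. fst P > 0}) \<and>
        (\<exists>M\<^sub>1. \<forall>j\<in>J.
           derivs_le2_bounded M\<^sub>1 (U j) (fst \<circ> \<Phi> j) \<and> derivs_le2_bounded M\<^sub>1 (U j) (snd \<circ> \<Phi> j) \<and>
           derivs_le2_bounded M\<^sub>1 (ball 0 1) (fst \<circ> \<Psi> j) \<and>
           derivs_le2_bounded M\<^sub>1 (ball 0 1) (snd \<circ> \<Psi> j)))"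

text \<open>\<open>E\<close> acts on representatives; linearity (a.e.) together with boundedness makes it well defined
  on a.e.-equivalence classes.\<close>
definition domain_D2 :: "plane set \<Rightarrow> bool" where
  "domain_D2 \<Omega> \<longleftrightarrow>
     (\<exists>(E :: (plane \<Rightarrow> real) \<Rightarrow> plane \<Rightarrow> real) C.
        (\<forall>u\<in>H1_std \<Omega>. E u \<in> H1_std half_plane \<and>
           H1_std_norm half_plane (E u) \<le> C * H1_std_norm \<Omega> u \<and>
           (AE P in lebesgue_on \<Omega>. E u P = u P)) \<and>
        (\<forall>u\<in>H1_std \<Omega>. \<forall>v\<in>H1_std \<Omega>. \<forall>a b. AE P in lebesgue_on half_plane.
           E (\<lambda>Q. a * u Q + b * v Q) P = a * E u P + b * E v P))"

definition domain_conditions :: "plane set \<Rightarrow> bool" where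
  "domain_conditions \<Omega> \<longleftrightarrow> (\<exists>\<delta>\<^sub>0>0. domain_D0 \<delta>\<^sub>0 \<Omega> \<and> domain_D1 \<delta>\<^sub>0 \<Omega>) \<and> domain_D2 \<Omega>"


section \<open>The Heston operator and its bilinear form\<close>

definition heston_weight :: "real \<Rightarrow> real \<Rightarrow> real \<Rightarrow> real \<Rightarrow> plane \<Rightarrow> real" where
  "heston_weight \<kappa> \<theta> \<sigma> \<gamma> = (\<lambda>(x, y).
     let \<beta> = 2 * \<kappa> * \<theta> / \<sigma>\<^sup>2; \<mu> = 2 * \<kappa> / \<sigma>\<^sup>2
     in y powr (\<beta> - 1) * exp (- \<gamma> * \<bar>x\<bar> - \<mu> * y))"

definition heston_op :: "real \<Rightarrow> real \<Rightarrow> real \<Rightarrow> real \<Rightarrow> real \<Rightarrow> real \<Rightarrow>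
    plane set \<Rightarrow> (plane \<Rightarrow> real) \<Rightarrow> plane \<Rightarrow> real" where
  "heston_op r q \<kappa> \<theta> \<rho> \<sigma> \<Omega> v P =
     (let y = snd P; vx = wD \<Omega> ex v; vy = wD \<Omega> ey v in
      - (y / 2) * (wD \<Omega> ex vx P + 2 * \<rho> * \<sigma> * wD \<Omega> ey vx P + \<sigma>\<^sup>2 * wD \<Omega> ey vy P)
      - (r - q - y / 2) * vx P - \<kappa> * (\<theta> - y) * vy P + r * v P)"

definition heston_form :: "real \<Rightarrow> real \<Rightarrow> real \<Rightarrow> real \<Rightarrow> real \<Rightarrow> real \<Rightarrow>
    plane set \<Rightarrow> (plane \<Rightarrow> real) \<Rightarrow> (plane \<Rightarrow> real) \<Rightarrow> real" where
  "heston_form r \<kappa> \<theta> \<rho> \<sigma> \<gamma> \<Omega> u v =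
     (let w = heston_weight \<kappa> \<theta> \<sigma> \<gamma>; a\<^sub>1 = \<kappa> * \<rho> / \<sigma> - 1 / 2;
          ux = wD \<Omega> ex u; uy = wD \<Omega> ey u; vx = wD \<Omega> ex v; vy = wD \<Omega> ey v in
      1 / 2 * (LINT P|lebesgue_on \<Omega>.
          (ux P * vx P + \<rho> * \<sigma> * uy P * vx P + \<rho> * \<sigma> * ux P * vy P + \<sigma>\<^sup>2 * uy P * vy P)
          * snd P * w P)
      - \<gamma> / 2 * (LINT P|lebesgue_on \<Omega>.
          (ux P + \<rho> * \<sigma> * uy P) * v P * sgn (fst P) * snd P * w P)
      - (LINT P|lebesgue_on \<Omega>. a\<^sub>1 * snd P * ux P * v P * w P)
      + (LINT P|lebesgue_on \<Omega>. r * u P * v P * w P))"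

end

theory Submission imports Defs "HOL-Library.Function_Algebras"
begin

text \<open>
Write \<open>w\<close> for the weight, \<open>V\<close> for the closure of the test functions, \<open>T\<close> for the portion of the line
\<open>y = 0\<close> in the boundary, and \<open>a\<close> for the bilinear form. All integrals below are over the domain.

Everything rests on coercivity of \<open>a\<close> on \<open>V\<close>. The function \<open>y w = y\<^sup>\<beta> exp (- \<gamma> |x| - \<mu> y)\<close> vanishes on \<open>y = 0\<close>
and has the \<open>y\<close>-derivative \<open>(\<beta> - \<mu> y) w\<close>, so integration by parts gives for \<open>v\<close> in \<open>V\<close> that \<open>\<mu> \<integral> y v\<^sup>2 w\<close> equals
\<open>\<beta> \<integral> v\<^sup>2 w + 2 \<integral> y v v\<^sub>y w\<close>; hence \<open>\<integral> y v\<^sup>2 w\<close> is bounded by a constant times \<open>\<integral> v\<^sup>2 w + \<integral> y v\<^sub>y\<^sup>2 w\<close>. The terms of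
\<open>a v v\<close> without a sign carry a factor \<open>\<gamma>\<close>: this is explicit in one of them, and the other one is
\<open>\<integral> y v\<^sub>x v w = (\<gamma> / 2) \<integral> sgn x y v\<^sup>2 w\<close>, again by parts. For small \<open>\<gamma>\<close> the principal part, which is elliptic
because \<open>|\<rho>| < 1\<close>, and \<open>r \<integral> v\<^sup>2 w\<close> absorb them (\<open>coercive\<close>). The Lax-Milgram theorem (\<open>lax_milgram\<close>) then gives
exactly one solution \<open>u\<close> of the variational equation.

For the upper barrier \<open>M\<close>, two integrations by parts give \<open>a M v = \<integral> (A M) v w\<close> for \<open>v\<close> in \<open>V\<close> (\<open>green\<close>); the
first order terms match because \<open>r - q = \<kappa> \<theta> \<rho> / \<sigma>\<close>. The positive part \<open>h\<close> of \<open>u - M\<close> belongs to \<open>V\<close>, and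
\<open>a h h = a (u - M) h = \<integral> (f - A M) h w \<le> 0\<close>, so \<open>h = 0\<close> by coercivity (\<open>comparison\<close>). The lower barrier
follows by passing to \<open>- u\<close> and \<open>- m\<close>.

The largest part of the text is the theory of the weighted Sobolev space. Its main point is that \<open>h\<close>
belongs to \<open>V\<close>, for a domain without any regularity. Since \<open>u - M = g - N\<close> with
\<open>g = u + M\<^sup>-\<close> in \<open>V\<close> and \<open>N = M + M\<^sup>- \<ge> 0\<close>, one can replace \<open>g\<close> by a test function \<open>\<phi>\<close> and cut at a level \<open>\<epsilon> > 0\<close>.
Then \<open>max (\<phi> - N - \<epsilon>) 0\<close> is supported in the compact set \<open>{\<phi> \<ge> \<epsilon>}\<close>, and near this set domain and \<open>T\<close> together
fill the closed half plane (\<open>superlevel_set\<close>). Mollifying with a kernel that takes values only from higher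
points therefore yields test functions, without any extension across \<open>y = 0\<close>, and their norms stay
bounded (\<open>compactly_supported_in_V\<close>). Bounded sequences in \<open>V\<close> that converge as distributions have their limits in \<open>V\<close>
(\<open>V_weakly_closed\<close>); this is used for the mollification, and again to let \<open>\<epsilon>\<close> tend to \<open>0\<close> and \<open>\<phi>\<close> to \<open>g\<close>.
\<close>

section \<open>Smooth functions\<close>

abbreviation testfun :: "plane set \<Rightarrow> plane set \<Rightarrow> (plane \<Rightarrow> real) set" where
 "testfun \<equiv> smooth_compact_support"

lemmas meas_times = borel_measurable_times
lemmas lint_cong = Bochner_Integration.integral_cong
lemmas integrable_le = Bochner_Integration.integrable_bound

lemma pd_eqI:
 assumes "(f has_derivative D) (at P)"
 shows "pd e f P = D e"
proof -
 have "((\<lambda>t. P + t *\<^sub>R e) has_derivative (\<lambda>t. t *\<^sub>R e)) (at (0::real))"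
  by (auto intro!: derivative_eq_intros)
 then have "((\<lambda>t. f (P + t *\<^sub>R e)) has_derivative (\<lambda>t. D (t *\<^sub>R e))) (at 0)"
  by (rule has_derivative_compose) (use assms in simp)
 moreover have "(\<lambda>t. D (t *\<^sub>R e)) = (\<lambda>t. D e * t)"
  using has_derivative_linear[OF assms] by (simp add: linear_cmul mult.commute)
 ultimately have "((\<lambda>t. f (P + t *\<^sub>R e)) has_real_derivative D e) (at 0)"
  by (simp add: has_field_derivative_def)
 then show ?thesis by (simp add: pd_def DERIV_imp_deriv)
qed

lemma pd_cong:
 assumes "open U" "P \<in> U" "\<And>Q. Q \<in> U \<Longrightarrow> f Q = g Q"
 shows "pd e f P = pd e g P"
proof -
 have "\<forall>\<^sub>F t in nhds (0::real). P + t *\<^sub>R e \<in> U"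
 proof -
  have "((\<lambda>t::real. P + t *\<^sub>R e) \<longlongrightarrow> P + 0 *\<^sub>R e) (nhds 0)"
   by (intro tendsto_intros) (simp add: filterlim_ident)
  then show ?thesis using assms(1,2) by (auto dest: topological_tendstoD)
 qed
 then have "\<forall>\<^sub>F t in nhds (0::real). f (P + t *\<^sub>R e) = g (P + t *\<^sub>R e)"
  by eventually_elim (rule assms(3))
 then show ?thesis unfolding pd_def by (rule deriv_cong_ev) simp
qed

lemma Ck_on_SucI:
 assumes "open U" and D: "\<And>P. P \<in> U \<Longrightarrow> (f has_derivative (\<lambda>h. fst h * fx P + snd h * fy P)) (at P)"
  and "Ck_on k U fx" "Ck_on k U fy"
 shows "Ck_on (Suc k) U f"
proof -
 have *: "pd ex f P = fx P" "pd ey f P = fy P" if "P \<in> U" for P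
  using pd_eqI[OF D[OF that]] by (auto simp: ex_def ey_def)
 have cong: "Ck_on k U f" if "Ck_on k U g" "\<And>P. P \<in> U \<Longrightarrow> f P = g P" for f g k
  using that
 proof (induction k arbitrary: f g)
  case 0 then show ?case using continuous_on_cong[of U U f g] by simp
 next
  case (Suc k)
  have "f differentiable (at P)" if P: "P \<in> U" for P
  proof -
   obtain D where "(g has_derivative D) (at P)"
    using Suc.prems(1) P assms(1) by (auto simp: differentiable_on_eq_differentiable_at differentiable_def)
   then have "(f has_derivative D) (at P)"
    by (rule has_derivative_transform_within_open[OF _ assms(1) P]) (simp add: Suc.prems(2))
   then show ?thesis by (rule differentiableI)
  qed
  then have "f differentiable_on U" using assms(1) by (simp add: differentiable_on_eq_differentiable_at)
  moreover have "pd e f P = pd e g P" if "P \<in> U" for e P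
   using pd_cong[OF assms(1) that] Suc.prems(2) by blast
  ultimately show ?case using Suc.IH[of "pd ex g" "pd ex f"] Suc.IH[of "pd ey g" "pd ey f"] Suc.prems(1) by auto
 qed
 have "f differentiable_on U"
  unfolding differentiable_on_def using D has_derivative_at_withinI differentiableI by blast
 then show ?thesis using cong[OF assms(3)] cong[OF assms(4)] * by simp
qed

lemma Ck_on_SucD:
 assumes "open U" "Ck_on (Suc k) U f" "P \<in> U"
 shows "(f has_derivative (\<lambda>h. fst h * pd ex f P + snd h * pd ey f P)) (at P)"
proof -
 have "f differentiable (at P)"
  using assms differentiable_on_eq_differentiable_at by auto
 then obtain D where D: "(f has_derivative D) (at P)" by (auto simp: differentiable_def)
 have "D h = fst h * pd ex f P + snd h * pd ey f P" for h
 proof -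
  interpret linear D using has_derivative_linear[OF D] .
  have "h = fst h *\<^sub>R ex + snd h *\<^sub>R ey" by (simp add: ex_def ey_def prod_eq_iff)
  then have "D h = fst h *\<^sub>R D ex + snd h *\<^sub>R D ey" by (metis add scaleR)
  then show ?thesis using pd_eqI[OF D] by simp
 qed
 then have "D = (\<lambda>h. fst h * pd ex f P + snd h * pd ey f P)" by (rule ext)
 then show ?thesis using D by simp
qed

lemma Ck_on_Suc_imp: "open U \<Longrightarrow> Ck_on (Suc k) U f \<Longrightarrow> Ck_on k U f"
proof (induction k arbitrary: f)
 case 0
 then show ?case by (simp add: differentiable_imp_continuous_on)
next
 case (Suc k)
 have "f differentiable_on U" "Ck_on (Suc k) U (pd ex f)" "Ck_on (Suc k) U (pd ey f)"
  using Suc.prems(2) unfolding Ck_on.simps(2)[of "Suc k"] by blast+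
 then show ?case using Suc.IH[OF Suc.prems(1)] unfolding Ck_on.simps(2)[of k] by blast
qed

lemma Ck_on_mono: "open U \<Longrightarrow> Ck_on k U f \<Longrightarrow> j \<le> k \<Longrightarrow> Ck_on j U f"
 by (induction k) (auto simp: le_Suc_eq dest: Ck_on_Suc_imp simp del: Ck_on.simps(2))

lemma Ck_on_continuous: "open U \<Longrightarrow> Ck_on k U f \<Longrightarrow> continuous_on U f"
 using Ck_on_mono[of U k f 0] by simp

lemma Ck_on_cong:
 assumes "open U" "\<And>P. P \<in> U \<Longrightarrow> f P = g P" "Ck_on k U g"
 shows "Ck_on k U f"
proof (cases k)
 case 0 then show ?thesis using assms continuous_on_cong[of U U f g] by simp
next
 case (Suc j)
 have "(f has_derivative (\<lambda>h. fst h * pd ex g P + snd h * pd ey g P)) (at P)" if "P \<in> U" for P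
  by (rule has_derivative_transform_within_open[OF Ck_on_SucD[OF assms(1)]])
    (use assms that Suc in auto)
 then show ?thesis using Ck_on_SucI[OF assms(1), of f "pd ex g" "pd ey g" j] assms(3) unfolding Suc Ck_on.simps(2)
  by blast
qed

declare Ck_on.simps(2) [simp del]

lemma Ck_on_pd: "Ck_on (Suc k) U f \<Longrightarrow> Ck_on k U (pd ex f)" "Ck_on (Suc k) U f \<Longrightarrow> Ck_on k U (pd ey f)"
 by (simp_all add: Ck_on.simps(2))

lemma Ck_on_subset: "open U \<Longrightarrow> V \<subseteq> U \<Longrightarrow> Ck_on k U f \<Longrightarrow> Ck_on k V f"
 by (induction k arbitrary: f) (auto simp: Ck_on.simps(2) intro: continuous_on_subset differentiable_on_subset)

lemma Ck_on_const: "open U \<Longrightarrow> Ck_on k U (\<lambda>_. c)"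
proof (induction k arbitrary: c)
 case (Suc k)
 show ?case by (rule Ck_on_SucI[where fx="\<lambda>_. 0" and fy="\<lambda>_. 0"]) (use Suc in auto)
qed simp

lemma Ck_on_fst: "open U \<Longrightarrow> Ck_on k U fst"
proof (cases k)
 case (Suc j)
 assume "open U" then show ?thesis unfolding Suc
  by (intro Ck_on_SucI[where fx="\<lambda>_. 1" and fy="\<lambda>_. 0"]) (auto intro!: Ck_on_const derivative_eq_intros)
qed (simp add: continuous_on_fst)

lemma Ck_on_snd: "open U \<Longrightarrow> Ck_on k U snd"
proof (cases k)
 case (Suc j)
 assume "open U" then show ?thesis unfolding Suc
  by (intro Ck_on_SucI[where fx="\<lambda>_. 0" and fy="\<lambda>_. 1"]) (auto intro!: Ck_on_const derivative_eq_intros)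
qed (simp add: continuous_on_snd)

lemma Ck_on_add:
 assumes "open U"
 shows "Ck_on k U f \<Longrightarrow> Ck_on k U g \<Longrightarrow> Ck_on k U (\<lambda>P. f P + g P)"
proof (induction k arbitrary: f g)
 case (Suc k)
 show ?case
 proof (rule Ck_on_SucI[OF assms])
  fix P assume P: "P \<in> U"
  show "((\<lambda>P. f P + g P) has_derivative (\<lambda>h. fst h * (pd ex f P + pd ex g P) + snd h * (pd ey f P + pd ey g P))) (at P)"
   using has_derivative_add[OF Ck_on_SucD[OF assms Suc.prems(1) P] Ck_on_SucD[OF assms Suc.prems(2) P]]
   by (simp add: algebra_simps)
 qed (use Suc in \<open>auto intro: Ck_on_pd\<close>)
qed (auto intro: continuous_intros)

lemma Ck_on_mult:
 assumes "open U"
 shows "Ck_on k U f \<Longrightarrow> Ck_on k U g \<Longrightarrow> Ck_on k U (\<lambda>P. f P * g P)"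
proof (induction k arbitrary: f g)
 case (Suc k)
 note k = Ck_on_Suc_imp[OF assms Suc.prems(1)] Ck_on_Suc_imp[OF assms Suc.prems(2)]
 show ?case
 proof (rule Ck_on_SucI[OF assms])
  fix P assume P: "P \<in> U"
  show "((\<lambda>P. f P * g P) has_derivative (\<lambda>h. fst h * (f P * pd ex g P + pd ex f P * g P) + snd h * (f P * pd ey g P + pd ey f P * g P))) (at P)"
   using has_derivative_mult[OF Ck_on_SucD[OF assms Suc.prems(1) P] Ck_on_SucD[OF assms Suc.prems(2) P]]
   by (simp add: algebra_simps)
 qed (use Suc k in \<open>auto intro!: Ck_on_add assms intro: Ck_on_pd\<close>)
qed (auto intro: continuous_intros)

lemma pd_add:
 assumes "open U" "P \<in> U" "Ck_on 1 U f" "Ck_on 1 U g"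
 shows "pd ex (\<lambda>P. f P + g P) P = pd ex f P + pd ex g P" "pd ey (\<lambda>P. f P + g P) P = pd ey f P + pd ey g P"
 using pd_eqI[OF has_derivative_add[OF Ck_on_SucD[OF assms(1) _ assms(2)] Ck_on_SucD[OF assms(1) _ assms(2)]], of 0 f 0 g]
  assms(3,4) by (auto simp: ex_def ey_def)

lemma pd_mult:
 assumes "open U" "P \<in> U" "Ck_on 1 U f" "Ck_on 1 U g"
 shows "pd ex (\<lambda>P. f P * g P) P = f P * pd ex g P + pd ex f P * g P"
  "pd ey (\<lambda>P. f P * g P) P = f P * pd ey g P + pd ey f P * g P"
 using pd_eqI[OF has_derivative_mult[OF Ck_on_SucD[OF assms(1) _ assms(2)] Ck_on_SucD[OF assms(1) _ assms(2)]], of 0 f 0 g]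
  assms(3,4) by (auto simp: ex_def ey_def)

lemma has_derivative_chain:
 assumes "(F has_real_derivative d) (at (f P))"
  and "(f has_derivative (\<lambda>h. fst h * a + snd h * b)) (at P)"
 shows "((\<lambda>P. F (f P)) has_derivative (\<lambda>h. fst h * (d * a) + snd h * (d * b))) (at P)"
proof -
 have "(F has_derivative (\<lambda>t. d * t)) (at (f P))"
  using assms(1) by (simp add: has_field_derivative_def)
 from has_derivative_compose[OF assms(2) this] show ?thesis
  by (simp add: distrib_left mult.left_commute)
qed

text \<open>A family of functions whose derivatives are again built from the family is smooth. The
 order has to be raised for all members simultaneously, so the statement is about the family.\<close>
lemma Ck_on_compose_family:
 fixes F :: "nat \<Rightarrow> real \<Rightarrow> real"
 assumes "open U" and f: "\<And>k. Ck_on k U f"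
  and F: "\<And>n P. P \<in> U \<Longrightarrow> (F n has_real_derivative G n (f P)) (at (f P))"
  and G: "\<And>n k. (\<And>m. Ck_on k U (\<lambda>P. F m (f P))) \<Longrightarrow> Ck_on k U (\<lambda>P. G n (f P))"
 shows "Ck_on k U (\<lambda>P. F n (f P))"
proof (induction k arbitrary: n)
 case 0
 show ?case
  using has_derivative_continuous[OF has_derivative_chain[OF F Ck_on_SucD[OF assms(1) f]]]
  by (auto intro!: continuous_at_imp_continuous_on)
next
 case (Suc k)
 show ?case
  by (rule Ck_on_SucI[OF assms(1), where fx="\<lambda>P. G n (f P) * pd ex f P" and fy="\<lambda>P. G n (f P) * pd ey f P"])
    (use f[of "Suc k"] in \<open>auto intro!: Ck_on_mult G Suc assms(1) has_derivative_chain[where F="F n" and f=f] F Ck_on_SucD[OF assms(1) f] intro: Ck_on_pd\<close>)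
qed

lemma Ck_on_exp:
 assumes "open U" "\<And>k. Ck_on k U f" shows "Ck_on k U (\<lambda>P. exp (f P))"
 by (rule Ck_on_compose_family[OF assms, where F="\<lambda>_. exp" and G="\<lambda>_. exp"]) (auto intro!: derivative_eq_intros)

lemma Ck_on_powr:
 assumes "open U" and f: "\<And>k. Ck_on k U f" and pos: "\<And>P. P \<in> U \<Longrightarrow> f P > 0"
 shows "Ck_on k U (\<lambda>P. f P powr a)"
proof (induction k arbitrary: a)
 case 0
 then show ?case using f[of 0] pos by (auto intro!: continuous_intros) (metis less_irrefl)
next
 case (Suc k)
 show ?case
  by (rule Ck_on_SucI[OF assms(1), where fx="\<lambda>P. (a * f P powr (a - 1)) * pd ex f P" and fy="\<lambda>P. (a * f P powr (a - 1)) * pd ey f P"])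
    (use f[of "Suc k"] pos in \<open>auto intro!: Ck_on_mult Ck_on_const Suc assms(1) has_derivative_chain[where F="\<lambda>t. t powr a" and f=f] has_real_derivative_powr Ck_on_SucD[OF assms(1) f] intro: Ck_on_pd\<close>)
qed

definition smooth :: "plane set \<Rightarrow> (plane \<Rightarrow> real) \<Rightarrow> bool" where
 "smooth U f \<longleftrightarrow> (\<forall>k. Ck_on k U f)"

named_theorems smooth_intros

lemma smooth_Ck: "smooth U f \<Longrightarrow> Ck_on k U f" by (simp add: smooth_def)

lemma smooth_const [smooth_intros]: "open U \<Longrightarrow> smooth U (\<lambda>_. c)" by (simp add: smooth_def Ck_on_const)
lemma smooth_fst [smooth_intros]: "open U \<Longrightarrow> smooth U fst" by (simp add: smooth_def Ck_on_fst)
lemma smooth_snd [smooth_intros]: "open U \<Longrightarrow> smooth U snd" by (simp add: smooth_def Ck_on_snd)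
lemma smooth_add [smooth_intros]: "open U \<Longrightarrow> smooth U f \<Longrightarrow> smooth U g \<Longrightarrow> smooth U (\<lambda>P. f P + g P)"
 by (simp add: smooth_def Ck_on_add)
lemma smooth_mult [smooth_intros]: "open U \<Longrightarrow> smooth U f \<Longrightarrow> smooth U g \<Longrightarrow> smooth U (\<lambda>P. f P * g P)"
 by (simp add: smooth_def Ck_on_mult)
lemma smooth_exp [smooth_intros]: "open U \<Longrightarrow> smooth U f \<Longrightarrow> smooth U (\<lambda>P. exp (f P))"
 by (simp add: smooth_def Ck_on_exp)
lemma smooth_powr [smooth_intros]:
 "open U \<Longrightarrow> smooth U f \<Longrightarrow> (\<And>P. P \<in> U \<Longrightarrow> f P > 0) \<Longrightarrow> smooth U (\<lambda>P. f P powr a)"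
 by (simp add: smooth_def Ck_on_powr)
lemma smooth_cong: "open U \<Longrightarrow> (\<And>P. P \<in> U \<Longrightarrow> f P = g P) \<Longrightarrow> smooth U g \<Longrightarrow> smooth U f"
 using Ck_on_cong unfolding smooth_def by blast
lemma smooth_subset: "open U \<Longrightarrow> V \<subseteq> U \<Longrightarrow> smooth U f \<Longrightarrow> smooth V f"
 using Ck_on_subset unfolding smooth_def by blast
lemma smooth_cmult [smooth_intros]: "open U \<Longrightarrow> smooth U f \<Longrightarrow> smooth U (\<lambda>P. c * f P)"
 by (intro smooth_intros)
lemma smooth_diff [smooth_intros]: "open U \<Longrightarrow> smooth U f \<Longrightarrow> smooth U g \<Longrightarrow> smooth U (\<lambda>P. f P - g P)"
 using smooth_add[of U f "\<lambda>P. -1 * g P"] smooth_cmult[of U g "-1"] by simp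
lemma smooth_sum: "open U \<Longrightarrow> (\<And>i. i \<in> I \<Longrightarrow> smooth U (f i)) \<Longrightarrow> smooth U (\<lambda>P. \<Sum>i\<in>I. f i P)"
 by (induction I rule: infinite_finite_induct) (auto intro: smooth_intros)
lemma smooth_pd: "smooth U f \<Longrightarrow> e \<in> {ex, ey} \<Longrightarrow> smooth U (pd e f)"
 unfolding smooth_def using Ck_on_pd by blast
lemma smooth_pd_pow: "smooth U f \<Longrightarrow> e \<in> {ex, ey} \<Longrightarrow> smooth U ((pd e ^^ i) f)"
 by (induction i) (simp_all add: smooth_pd)
lemma smooth_cont: "open U \<Longrightarrow> smooth U f \<Longrightarrow> continuous_on U f"
 using Ck_on_continuous smooth_def by blast

lemma Ck_on_Un:
 assumes "open U" "open V"
 shows "Ck_on k U f \<Longrightarrow> Ck_on k V f \<Longrightarrow> Ck_on k (U \<union> V) f"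
proof (induction k arbitrary: f)
 case 0 then show ?case using assms by (simp add: continuous_on_open_Un)
next
 case (Suc k)
 then have "f differentiable_on (U \<union> V)"
  using assms by (auto simp: Ck_on.simps(2) differentiable_on_eq_differentiable_at open_Un)
 then show ?case using Suc by (simp add: Ck_on.simps(2))
qed

definition zext :: "plane set \<Rightarrow> (plane \<Rightarrow> real) \<Rightarrow> plane \<Rightarrow> real" where
 "zext U f P = (if P \<in> U then f P else 0)"

text \<open>The domain and the complement of the support are open, cover the plane, and the extension
 is regular on both of them.\<close>
lemma Ck_on_zext:
 assumes U: "open U" and K: "closed K" "K \<subseteq> U" and f: "Ck_on k U f" and z: "\<And>P. P \<in> U - K \<Longrightarrow> f P = 0"
 shows "Ck_on k UNIV (zext U f)"
proof -
 have "Ck_on k (- K) (zext U f)"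
  by (rule Ck_on_cong[OF _ _ Ck_on_const[where c=0]]) (use K z in \<open>auto simp: zext_def\<close>)
 moreover have "Ck_on k U (zext U f)"
  by (rule Ck_on_cong[OF U _ f]) (simp add: zext_def)
 ultimately have "Ck_on k (U \<union> - K) (zext U f)"
  using K(1) U by (intro Ck_on_Un) auto
 moreover have "U \<union> - K = UNIV" using K(2) by auto
 ultimately show ?thesis by simp
qed

lemma smooth_zext:
 assumes "open U" "closed K" "K \<subseteq> U" "smooth U f" "\<And>P. P \<in> U - K \<Longrightarrow> f P = 0"
 shows "smooth UNIV (zext U f)"
 using Ck_on_zext assms unfolding smooth_def by blast

section \<open>Flat functions, steps and bumps\<close>

text \<open>The derivatives of \<open>exp (- (1 / t))\<close> are linear combinations of these functions, which makes
 them a family for \<open>Ck_on_compose_family\<close>.\<close>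
definition flat :: "nat \<Rightarrow> real \<Rightarrow> real" where
 "flat n t = (if t \<le> 0 then 0 else (1 / t) ^ n * exp (- (1 / t)))"

lemma flat_tendsto_0: "(flat n \<longlongrightarrow> 0) (at 0)"
proof -
 have "((\<lambda>s::real. s ^ n / exp s) \<longlongrightarrow> 0) at_top" by (rule tendsto_power_div_exp_0)
 then have "((\<lambda>t::real. inverse t ^ n / exp (inverse t)) \<longlongrightarrow> 0) (at_right 0)"
  by (rule filterlim_compose) (rule filterlim_inverse_at_top_right)
 then have "(flat n \<longlongrightarrow> 0) (at_right 0)"
  by (rule Lim_transform_eventually) (auto simp: eventually_at_filter flat_def exp_minus field_simps)
 moreover have "(flat n \<longlongrightarrow> 0) (at_left 0)"
  by (rule Lim_transform_eventually[OF tendsto_const]) (auto simp: eventually_at_filter flat_def)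
 ultimately show ?thesis by (simp add: filterlim_split_at)
qed

lemma flat_deriv: "(flat n has_real_derivative (flat (n + 2) t - real n * flat (n + 1) t)) (at t)"
proof -
 consider "t < 0" | "t = 0" | "t > 0" by linarith
 then show ?thesis
 proof cases
  case 1
  have "((\<lambda>_. 0) has_real_derivative 0) (at t)" by simp
  then have "(flat n has_real_derivative 0) (at t)"
   by (rule has_field_derivative_transform_within_open[where S="{..<0}"]) (use 1 in \<open>auto simp: flat_def\<close>)
  then show ?thesis using 1 by (simp add: flat_def)
 next
  case 2
  have "(\<lambda>h. (flat n (0 + h) - flat n 0) / h) = flat (n + 1)"
   by (auto simp: flat_def fun_eq_iff)
  then have "(flat n has_real_derivative 0) (at 0)"
   unfolding DERIV_def using flat_tendsto_0[of "n+1"] by simp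
  then show ?thesis using 2 by (simp add: flat_def)
 next
  case 3
  have i: "((\<lambda>t. 1 / t) has_real_derivative - ((1 / t)^2)) (at t)"
   using 3 by (auto intro!: derivative_eq_intros simp: power2_eq_square)
  have "((\<lambda>t. (1 / t) ^ n * exp (- (1 / t))) has_real_derivative
    real n * (- ((1 / t)^2) * (1 / t) ^ (n - Suc 0)) * exp (- (1 / t)) + exp (- (1 / t)) * (1 / t)^2 * (1 / t) ^ n) (at t)"
   using DERIV_mult[OF DERIV_power[OF i, of n] DERIV_fun_exp[OF DERIV_minus[OF i]]] by (simp add: mult.assoc)
  moreover have "real n * (- ((1 / t)^2) * (1 / t) ^ (n - Suc 0)) * exp (- (1 / t)) + exp (- (1 / t)) * (1 / t)^2 * (1 / t) ^ n
    = flat (n + 2) t - real n * flat (n + 1) t"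
  proof -
   define s where "s = 1 / t"
   have "real n * (- (s^2) * s ^ (n - Suc 0)) * E + E * s^2 * s ^ n = s ^ (n + 2) * E - real n * (s ^ (n + 1) * E)" for E
    by (cases n) (simp_all add: power2_eq_square algebra_simps)
   then show ?thesis using 3 by (simp add: flat_def s_def[symmetric])
  qed
  ultimately have "((\<lambda>t. (1 / t) ^ n * exp (- (1 / t))) has_real_derivative (flat (n + 2) t - real n * flat (n + 1) t)) (at t)"
   by simp
  then show ?thesis
   by (rule has_field_derivative_transform_within_open[where S="{0<..}"]) (use 3 in \<open>auto simp: flat_def\<close>)
 qed
qed

lemma smooth_flat [smooth_intros]:
 assumes "open U" "smooth U f" shows "smooth U (\<lambda>P. flat n (f P))"
proof -
 have "Ck_on k U (\<lambda>P. flat n (f P))" for k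
 proof (rule Ck_on_compose_family[where F=flat and G="\<lambda>n t. flat (n + 2) t - real n * flat (n + 1) t", OF assms(1)])
  fix n k assume *: "\<And>m. Ck_on k U (\<lambda>P. flat m (f P))"
  have "Ck_on k U (\<lambda>P. flat (n + 2) (f P) + (- real n) * flat (n + 1) (f P))"
   by (intro Ck_on_add Ck_on_mult Ck_on_const * assms(1))
  then show "Ck_on k U (\<lambda>P. flat (n + 2) (f P) - real n * flat (n + 1) (f P))" by simp
 qed (use assms flat_deriv in \<open>auto simp: smooth_def\<close>)
 then show ?thesis by (simp add: smooth_def)
qed

definition step :: "real \<Rightarrow> real" where
 "step t = flat 0 t * (flat 0 t + flat 0 (1 - t)) powr (-1)"

lemma step_denom: "flat 0 t + flat 0 (1 - t) > 0"
 by (auto simp: flat_def add_pos_nonneg)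

lemma smooth_step [smooth_intros]: "open U \<Longrightarrow> smooth U f \<Longrightarrow> smooth U (\<lambda>P. step (f P))"
 unfolding step_def by (intro smooth_intros step_denom)

lemma step_0: "t \<le> 0 \<Longrightarrow> step t = 0" and step_1: "t \<ge> 1 \<Longrightarrow> step t = 1"
 and step_pos: "t > 0 \<Longrightarrow> step t > 0" and step_ge0: "step t \<ge> 0" and step_le1: "step t \<le> 1"
proof -
 have f: "flat 0 t \<ge> 0" for t by (simp add: flat_def)
 have eq: "step t = flat 0 t / (flat 0 t + flat 0 (1 - t))"
  using step_denom[of t] by (simp add: step_def powr_minus divide_inverse)
 show "t \<le> 0 \<Longrightarrow> step t = 0" by (simp add: step_def flat_def)
 show "t \<ge> 1 \<Longrightarrow> step t = 1" by (simp add: eq flat_def)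
 show "t > 0 \<Longrightarrow> step t > 0" using step_denom[of t] by (simp add: eq flat_def)
 show "step t \<ge> 0" "step t \<le> 1" using step_denom[of t] f[of t] f[of "1-t"] by (auto simp: eq)
qed

definition bump :: "real \<Rightarrow> plane \<Rightarrow> plane \<Rightarrow> plane \<Rightarrow> real" where
 "bump n l u P = step (n * (fst P - fst l)) * step (n * (fst u - fst P)) *
   (step (n * (snd P - snd l)) * step (n * (snd u - snd P)))"

lemma smooth_bump: "open U \<Longrightarrow> smooth U (bump n l u)"
 unfolding bump_def by (intro smooth_intros)

lemma bump_ge0: "bump n l u P \<ge> 0" and bump_le1: "bump n l u P \<le> 1"
 by (auto simp: bump_def step_ge0 step_le1 intro!: mult_le_one mult_nonneg_nonneg)

lemma in_box_plane: "(P::plane) \<in> box l u \<longleftrightarrow> fst l < fst P \<and> fst P < fst u \<and> snd l < snd P \<and> snd P < snd u"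
 by (auto simp: box_def Basis_prod_def inner_prod_def)

lemma bump_pos: "n > 0 \<Longrightarrow> P \<in> box l u \<Longrightarrow> bump n l u P > 0"
 by (auto simp: bump_def in_box_plane intro!: mult_pos_pos step_pos)

lemma bump_0: "n > 0 \<Longrightarrow> P \<notin> box l u \<Longrightarrow> bump n l u P = 0"
 by (auto simp: bump_def in_box_plane step_0 not_less mult_nonneg_nonpos)

lemma bump_tendsto: "(\<lambda>n. bump (real n) l u P) \<longlonglongrightarrow> indicator (box l u) P"
proof (cases "P \<in> box l u")
 case True
 have ev: "\<forall>\<^sub>F n in sequentially. step (real n * t) = 1" if "t > 0" for t
 proof -
  have "\<forall>\<^sub>F n in sequentially. real n \<ge> 1 / t"
   using eventually_ge_at_top real_arch_simple by (metis filterlim_at_top filterlim_real_sequentially)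
  then show ?thesis by eventually_elim (use that in \<open>simp add: step_1 field_simps\<close>)
 qed
 have pos: "fst P - fst l > 0" "fst u - fst P > 0" "snd P - snd l > 0" "snd u - snd P > 0"
  using True unfolding in_box_plane by auto
 have "\<forall>\<^sub>F n in sequentially. bump (real n) l u P = 1"
  using ev[OF pos(1)] ev[OF pos(2)] ev[OF pos(3)] ev[OF pos(4)] by eventually_elim (simp add: bump_def)
 then show ?thesis using True by (simp add: tendsto_eventually)
next
 case False
 have "\<forall>\<^sub>F n in sequentially. bump (real n) l u P = 0"
  by (rule eventually_mono[OF eventually_gt_at_top[of 0]]) (use False bump_0 in auto)
 then show ?thesis using False by (simp add: tendsto_eventually)
qed

lemma scs_emptyI:
 assumes "open U" "smooth U f" "compact K" "K \<subseteq> U" "\<And>P. P \<in> U - K \<Longrightarrow> f P = 0"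
 shows "f \<in> testfun U {}"
proof -
 have "continuous_on U ((pd ex ^^ i) ((pd ey ^^ j) f))" for i j
  using smooth_pd_pow assms(1,2) by (intro smooth_cont) auto
 then have "\<forall>i j. \<exists>g. continuous_on (U \<union> {}) g \<and> (\<forall>P\<in>U. g P = (pd ex ^^ i) ((pd ey ^^ j) f) P)"
  unfolding Un_empty_right by blast
 moreover have "\<exists>K. compact K \<and> K \<subseteq> U \<union> {} \<and> (\<forall>P\<in>(U \<union> {}) - K. f P = 0)"
  using assms(3-5) unfolding Un_empty_right by blast
 moreover have "\<forall>k. Ck_on k U f" "continuous_on (U \<union> {}) f"
  using assms(2) smooth_cont[OF assms(1,2)] by (simp_all add: smooth_def)
 ultimately show ?thesis
  unfolding smooth_compact_support_def by blast
qed

lemma scsD: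
 assumes "f \<in> testfun U T"
 shows "smooth U f" "continuous_on (U \<union> T) f"
  "\<exists>K. compact K \<and> K \<subseteq> U \<union> T \<and> (\<forall>P\<in>(U \<union> T) - K. f P = 0)"
 using assms unfolding smooth_compact_support_def smooth_def by auto

declare split_paired_All [simp del]

section \<open>Integration by parts\<close>

lemma zext_indicator: "zext S f = (\<lambda>x. indicator S x *\<^sub>R f x)"
 by (auto simp: zext_def fun_eq_iff)

lemma zext_integrable: "S \<in> sets lebesgue \<Longrightarrow> integrable (lebesgue_on S) f \<longleftrightarrow> integrable lebesgue (zext S f)"
 unfolding zext_indicator by (rule integrable_restrict_space) simp

lemma zext_integral: "S \<in> sets lebesgue \<Longrightarrow> integral\<^sup>L (lebesgue_on S) f = integral\<^sup>L lebesgue (zext S f)"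
 unfolding zext_indicator by (rule integral_restrict_space) simp

lemma zext_measurable: "S \<in> sets lebesgue \<Longrightarrow>
  f \<in> borel_measurable (lebesgue_on S) \<longleftrightarrow> zext S f \<in> borel_measurable lebesgue"
 unfolding zext_indicator by (rule borel_measurable_restrict_space_iff) simp

lemma zext_eq: "K \<subseteq> S \<Longrightarrow> (\<And>x. x \<in> S - K \<Longrightarrow> f x = 0) \<Longrightarrow> zext S f = zext K f"
 by (auto simp: zext_def fun_eq_iff)

lemma open_lebesgue: "open (U::plane set) \<Longrightarrow> U \<in> sets lebesgue"
 by (simp add: lmeasurable_open sets_completionI_sets)
lemma compact_lebesgue: "compact (U::plane set) \<Longrightarrow> U \<in> sets lebesgue"
 by (simp add: borel_compact sets_completionI_sets)

lemma integrable_support: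
 fixes f :: "plane \<Rightarrow> real"
 assumes "K \<subseteq> S" "\<And>x. x \<in> S - K \<Longrightarrow> f x = 0" "S \<in> sets lebesgue" "K \<in> sets lebesgue"
 shows "integrable (lebesgue_on S) f \<longleftrightarrow> integrable (lebesgue_on K) f"
  and "integral\<^sup>L (lebesgue_on S) f = integral\<^sup>L (lebesgue_on K) f"
 using zext_eq[OF assms(1,2)] zext_integrable zext_integral assms(3,4) by auto

lemma integrable_continuous_compact:
 fixes f :: "plane \<Rightarrow> real"
 assumes "compact K" "continuous_on K f"
 shows "integrable (lebesgue_on K) f"
proof -
 have "integrable lborel (\<lambda>x. indicator K x *\<^sub>R f x)"
  by (rule borel_integrable_compact[OF assms])
 then have "integrable lebesgue (zext K f)"
  unfolding zext_indicator by (subst integrable_completion) auto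
 then show ?thesis by (simp add: zext_integrable[OF compact_lebesgue[OF assms(1)]])
qed

lemma integrable_csupport:
 fixes f :: "plane \<Rightarrow> real"
 assumes "open U" "compact K" "K \<subseteq> U" "continuous_on U f" "\<And>P. P \<in> U - K \<Longrightarrow> f P = 0"
 shows "integrable (lebesgue_on U) f"
proof -
 have "integrable (lebesgue_on K) f"
  by (rule integrable_continuous_compact[OF assms(2) continuous_on_subset[OF assms(4,3)]])
 then show ?thesis
  using integrable_support(1)[OF assms(3), of f] assms(5) open_lebesgue[OF assms(1)] compact_lebesgue[OF assms(2)]
  by simp
qed

lemma bounded_csupport:
 fixes f :: "plane \<Rightarrow> real"
 assumes "continuous_on UNIV f" "compact K" "\<And>P. P \<notin> K \<Longrightarrow> f P = 0"
 obtains B where "B \<ge> 0" "\<And>P. \<bar>f P\<bar> \<le> B"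
proof -
 have "bounded (f ` K)"
  using assms(1,2) by (meson compact_continuous_image compact_imp_bounded continuous_on_subset subset_UNIV)
 then obtain B where B: "\<And>P. P \<in> K \<Longrightarrow> \<bar>f P\<bar> \<le> B" by (auto simp: bounded_iff)
 show ?thesis
  by (rule that[of "max B 0"]) (use B assms(3) in \<open>force simp: max_def\<close>)+
qed

lemma pd_vanishes:
 assumes "closed K" "\<And>P. P \<notin> K \<Longrightarrow> f P = 0" "P \<notin> K" shows "pd e f P = 0"
proof -
 have "pd e f P = pd e (\<lambda>_. 0) P"
  by (rule pd_cong[where U="- K"]) (use assms in auto)
 then show ?thesis by (simp add: pd_eqI[OF has_derivative_const])
qed

lemma pd_field_derivative:
 assumes "Ck_on 1 UNIV g" "e \<in> {ex, ey}"
 shows "((\<lambda>t. g (P + t *\<^sub>R e)) has_real_derivative pd e g (P + t *\<^sub>R e)) (at t)"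
proof -
 have D: "(g has_derivative (\<lambda>h. fst h * pd ex g (P + t *\<^sub>R e) + snd h * pd ey g (P + t *\<^sub>R e))) (at (P + t *\<^sub>R e))"
  by (rule Ck_on_SucD) (use assms in auto)
 have "((\<lambda>t. P + t *\<^sub>R e) has_derivative (\<lambda>t. t *\<^sub>R e)) (at t)"
  by (auto intro!: derivative_eq_intros)
 from has_derivative_compose[OF this D] show ?thesis
  unfolding has_field_derivative_def
  by (rule has_derivative_eq_rhs) (use assms(2) in \<open>auto simp: ex_def ey_def fun_eq_iff\<close>)
qed

lemma lborel_integral_translate:
 fixes f :: "plane \<Rightarrow> real"
 assumes "f \<in> borel_measurable borel"
 shows "(LINT x|lborel. f (a + x)) = integral\<^sup>L lborel f"
 using integral_distr[of "(+) a" lborel borel f] assms lborel_distr_plus[of a] by simp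

text \<open>The integral of a difference quotient vanishes by translation invariance, and dominated convergence.\<close>
lemma integral_pd_zero:
 assumes g: "Ck_on 1 UNIV g" and e: "e \<in> {ex, ey}" and K: "compact K" "\<And>P. P \<notin> K \<Longrightarrow> g P = 0"
 shows "integrable lborel (pd e g)" "integral\<^sup>L lborel (pd e g) = 0"
proof -
 have contg: "continuous_on UNIV g" using Ck_on_continuous[OF _ g] by simp
 have contd: "continuous_on UNIV (pd e g)"
  using g e Ck_on_pd[of 0 UNIV g] by auto
 have z: "pd e g P = 0" if "P \<notin> K" for P
  using pd_vanishes[OF compact_imp_closed[OF K(1)] K(2) that] .
 have [measurable]: "g \<in> borel_measurable borel" "pd e g \<in> borel_measurable borel"
  using contg contd by (auto intro: borel_measurable_continuous_onI)
 obtain B where B: "B \<ge> 0" "\<And>P. \<bar>pd e g P\<bar> \<le> B"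

  by (rule bounded_csupport[OF contd K(1)]) (use z in blast)+
 obtain R where R: "\<And>P. P \<in> K \<Longrightarrow> norm P \<le> R"
  using compact_imp_bounded[OF K(1)] by (auto simp: bounded_iff)
 define C where "C = cball (0::plane) (R + 1)"
 define D where "D n P = (g (inverse (real (Suc n)) *\<^sub>R e + P) - g P) * real (Suc n)" for n P
 have ne: "norm e = 1" using e by (auto simp: ex_def ey_def)
 have Dz: "D n P = 0" if "P \<notin> C" for n P
 proof -
  have nP: "norm P > R + 1" using that by (simp add: C_def)
  have le: "norm (inverse (real (Suc n)) *\<^sub>R e) \<le> 1" by (simp add: ne field_simps)
  have "norm (inverse (real (Suc n)) *\<^sub>R e + P) \<ge> norm P - norm (inverse (real (Suc n)) *\<^sub>R e)"
   by (metis add.commute norm_diff_ineq)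
  then have "norm (inverse (real (Suc n)) *\<^sub>R e + P) > R" using nP le by linarith
  then have "inverse (real (Suc n)) *\<^sub>R e + P \<notin> K" "P \<notin> K"
   using R[of P] R[of "inverse (real (Suc n)) *\<^sub>R e + P"] nP by auto
  then show ?thesis by (simp add: D_def K(2))
 qed
 have Db: "\<bar>D n P\<bar> \<le> B" for n P
 proof -
  have "norm (g (P + inverse (real (Suc n)) *\<^sub>R e) - g (P + 0 *\<^sub>R e)) \<le> B * norm (inverse (real (Suc n)) - 0)"
   by (rule field_differentiable_bound[of UNIV "\<lambda>t. g (P + t *\<^sub>R e)" "\<lambda>t. pd e g (P + t *\<^sub>R e)" B])
    (use pd_field_derivative[OF g e] B(2) in simp_all)
  then have "\<bar>g (inverse (real (Suc n)) *\<^sub>R e + P) - g P\<bar> \<le> B * inverse (real (Suc n))"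
   by (simp add: add.commute)
  from mult_right_mono[OF this, of "real (Suc n)"]
  have "\<bar>g (inverse (real (Suc n)) *\<^sub>R e + P) - g P\<bar> * real (Suc n) \<le> B"
   by (simp only: mult.assoc left_inverse of_nat_0_less_iff of_nat_eq_0_iff nat.simps mult_1_right not_False_eq_True of_nat_0_le_iff simp_thms)
  then show ?thesis
   by (simp add: D_def abs_mult del: of_nat_Suc)
 qed
 have bound: "norm (D n P) \<le> B * indicator C P" for n P
  using Dz[of P n] Db[of n P] by (auto simp: indicator_def)
 have Bi: "integrable lborel (\<lambda>P. B * indicator C P)"
  by (intro integrable_mult_right integrable_real_indicator) (use emeasure_bounded_finite[OF bounded_cball, of "0::plane" "R + 1"] in \<open>auto simp: C_def less_top\<close>)
 have lim: "(\<lambda>n. D n P) \<longlonglongrightarrow> pd e g P" for P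
 proof -
  have "((\<lambda>t. (g (P + (0 + t) *\<^sub>R e) - g (P + 0 *\<^sub>R e)) / t) \<longlongrightarrow> pd e g (P + 0 *\<^sub>R e)) (at 0)"
   using pd_field_derivative[OF g e, of P 0] unfolding DERIV_def .
  moreover have "filterlim (\<lambda>n. inverse (real (Suc n))) (at 0) sequentially"
   unfolding filterlim_at using LIMSEQ_inverse_real_of_nat by (simp add: always_eventually)
  ultimately have "((\<lambda>n. (g (P + (0 + inverse (real (Suc n))) *\<^sub>R e) - g (P + 0 *\<^sub>R e)) / inverse (real (Suc n))) \<longlongrightarrow> pd e g (P + 0 *\<^sub>R e)) sequentially"
   by (rule filterlim_compose)
  then show ?thesis by (simp add: D_def add.commute divide_inverse)
 qed
 have meas: "D n \<in> borel_measurable lborel" for n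
  unfolding D_def[abs_def] by measurable
 show "integrable lborel (pd e g)"
  by (rule integrable_dominated_convergence[where s=D, OF _ meas Bi]) (use lim bound in auto)
 have gi: "integrable lborel g"
  using integrable_continuous_compact[OF K(1) continuous_on_subset[OF contg subset_UNIV]]
   integrable_support(1)[of K UNIV g] K(2) compact_lebesgue[OF K(1)]
  by (simp add: lebesgue_on_UNIV_eq integrable_completion)
 have gti: "integrable lborel (\<lambda>P. g (a + P))" for a
  using integrable_distr_eq[of "(+) a" lborel borel g] lborel_distr_plus[of a] gi by simp
 have "integral\<^sup>L lborel (D n) = 0" for n
  unfolding D_def[abs_def] using gti gi
  by (simp add: lborel_integral_translate)
 moreover have "(\<lambda>n. integral\<^sup>L lborel (D n)) \<longlonglongrightarrow> integral\<^sup>L lborel (pd e g)"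
  by (rule integral_dominated_convergence[where s=D, OF _ meas Bi]) (use lim bound in auto)
 ultimately have "(\<lambda>n::nat. 0) \<longlonglongrightarrow> integral\<^sup>L lborel (pd e g)" by simp
 from LIMSEQ_unique[OF this tendsto_const] show "integral\<^sup>L lborel (pd e g) = 0" .
qed

lemma pd_add': "open U \<Longrightarrow> P \<in> U \<Longrightarrow> Ck_on 1 U f \<Longrightarrow> Ck_on 1 U g \<Longrightarrow> e \<in> {ex, ey} \<Longrightarrow>
  pd e (\<lambda>P. f P + g P) P = pd e f P + pd e g P"
 using pd_add by blast

lemma pd_mult': "open U \<Longrightarrow> P \<in> U \<Longrightarrow> Ck_on 1 U f \<Longrightarrow> Ck_on 1 U g \<Longrightarrow> e \<in> {ex, ey} \<Longrightarrow>
  pd e (\<lambda>P. f P * g P) P = f P * pd e g P + pd e f P * g P"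
 using pd_mult by blast

lemma integration_by_parts:
 assumes U: "open U" and f: "Ck_on 1 U f" and \<psi>: "Ck_on 1 U \<psi>" and e: "e \<in> {ex, ey}"
  and K: "compact K" "K \<subseteq> U" "\<And>P. P \<in> U - K \<Longrightarrow> \<psi> P = 0"
 shows "(LINT P|lebesgue_on U. f P * pd e \<psi> P) = - (LINT P|lebesgue_on U. pd e f P * \<psi> P)"
proof -
 have psi0: "pd e \<psi> P = 0" if P: "P \<in> U - K" for P
 proof -
  have "pd e \<psi> P = pd e (\<lambda>_. 0) P"
   by (rule pd_cong[where U="U - K"]) (use U K P open_Diff[OF U compact_imp_closed] in auto)
  then show ?thesis by (simp add: pd_eqI[OF has_derivative_const])
 qed
 let ?h = "\<lambda>P. f P * \<psi> P"
 have h: "Ck_on 1 U ?h" by (intro Ck_on_mult U f \<psi>)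
 have g: "Ck_on 1 UNIV (zext U ?h)"
  by (rule Ck_on_zext[OF U compact_imp_closed[OF K(1)] K(2) h]) (simp add: K(3))
 have gz: "zext U ?h P = 0" if "P \<notin> K" for P using that K by (auto simp: zext_def)
 have pg: "pd e (zext U ?h) = zext U (\<lambda>P. f P * pd e \<psi> P + pd e f P * \<psi> P)"
 proof
  fix P show "pd e (zext U ?h) P = zext U (\<lambda>P. f P * pd e \<psi> P + pd e f P * \<psi> P) P"
  proof (cases "P \<in> U")
   case True
   have "pd e (zext U ?h) P = pd e ?h P"
    by (rule pd_cong[OF U True]) (simp add: zext_def)
   then show ?thesis using True pd_mult'[OF U True f \<psi> e] by (simp add: zext_def)
  next
   case False
   then have "P \<notin> K" using K(2) by blast
   have "pd e (zext U ?h) P = 0"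
    by (rule pd_vanishes[OF compact_imp_closed[OF K(1)]]) (use gz \<open>P \<notin> K\<close> in blast)+
   then show ?thesis using False by (simp add: zext_def)
  qed
 qed
 have c: "continuous_on U f" "continuous_on U \<psi>" "continuous_on U (pd e f)" "continuous_on U (pd e \<psi>)"
  using Ck_on_continuous[OF U] f \<psi> e Ck_on_pd[of 0 U f] Ck_on_pd[of 0 U \<psi>] by auto
 have i1: "integrable (lebesgue_on U) (\<lambda>P. f P * pd e \<psi> P)"
  by (rule integrable_csupport[OF U K(1,2)]) (use c psi0 in \<open>auto intro!: continuous_intros\<close>)
 have i2: "integrable (lebesgue_on U) (\<lambda>P. pd e f P * \<psi> P)"
  by (rule integrable_csupport[OF U K(1,2)]) (use c K(3) in \<open>auto intro!: continuous_intros\<close>)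
 have "(LINT P|lebesgue_on U. f P * pd e \<psi> P) + (LINT P|lebesgue_on U. pd e f P * \<psi> P)
   = integral\<^sup>L (lebesgue_on U) (\<lambda>P. f P * pd e \<psi> P + pd e f P * \<psi> P)"
  using i1 i2 by simp
 also have "\<dots> = integral\<^sup>L lebesgue (pd e (zext U ?h))"
  unfolding pg by (rule zext_integral[OF open_lebesgue[OF U]])
 also have "\<dots> = integral\<^sup>L lborel (pd e (zext U ?h))"
  by (rule integral_completion[OF borel_measurable_integrable[OF integral_pd_zero(1)[OF g e K(1) gz]]])
 also have "\<dots> = 0" by (rule integral_pd_zero(2)[OF g e K(1) gz])
 finally show ?thesis by linarith
qed

section \<open>Symmetry of second derivatives\<close>

text \<open>Otherwise the two mixed derivatives would be separated on a small square, while both of them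
 take, by the mean value theorem, the value of the same second difference quotient.\<close>
lemma schwarz:
 assumes "Ck_on 2 UNIV f"
 shows "pd ex (pd ey f) P = pd ey (pd ex f) P"
proof (rule ccontr)
 let ?a = "pd ey (pd ex f)" and ?b = "pd ex (pd ey f)"
 assume "?b P \<noteq> ?a P"
 then have d: "dist (?a P) (?b P) / 2 > 0" by simp
 have c2: "Ck_on (Suc 1) UNIV f" using assms by (simp add: numeral_2_eq_2)
 have f1: "Ck_on 1 UNIV f" "Ck_on 1 UNIV (pd ex f)" "Ck_on 1 UNIV (pd ey f)"
  using c2 Ck_on_pd Ck_on_Suc_imp by auto
 have "continuous_on UNIV ?a" "continuous_on UNIV ?b"
  using f1 Ck_on_pd[of 0] by auto
 then have "isCont ?a P" "isCont ?b P" by (simp_all add: continuous_on_eq_continuous_at)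
 then obtain r s where rs: "r > 0" "\<And>Q. dist Q P < r \<Longrightarrow> dist (?a Q) (?a P) < dist (?a P) (?b P) / 2"
   "s > 0" "\<And>Q. dist Q P < s \<Longrightarrow> dist (?b Q) (?b P) < dist (?a P) (?b P) / 2"
  using d unfolding continuous_at_eps_delta by (metis dist_commute)
 define h where "h = min r s / 3"
 have h: "h > 0" "3 * h \<le> r" "3 * h \<le> s" using rs by (auto simp: h_def)
 obtain x y where P: "P = (x, y)" by (cases P)
 have dx: "((\<lambda>x. g (x, y)) has_real_derivative pd ex g (x, y)) (at x)" if "Ck_on 1 UNIV g" for g x y
  using pd_field_derivative[OF that, of ex "(0, y)" x] by (simp add: ex_def)
 have dy: "((\<lambda>y. g (x, y)) has_real_derivative pd ey g (x, y)) (at y)" if "Ck_on 1 UNIV g" for g x y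
  using pd_field_derivative[OF that, of ey "(x, 0)" y] by (simp add: ey_def)
 let ?\<Delta> = "f (x + h, y + h) - f (x + h, y) - f (x, y + h) + f (x, y)"
 have "\<exists>\<xi>>x. \<xi> < x + h \<and> (f (x + h, y + h) - f (x + h, y)) - (f (x, y + h) - f (x, y))
   = (x + h - x) * (pd ex f (\<xi>, y + h) - pd ex f (\<xi>, y))"
  by (rule MVT2) (use h in \<open>auto intro!: DERIV_diff dx f1\<close>)
 then obtain \<xi> where \<xi>: "x < \<xi>" "\<xi> < x + h" "?\<Delta> = h * (pd ex f (\<xi>, y + h) - pd ex f (\<xi>, y))" by auto
 have "\<exists>\<eta>>y. \<eta> < y + h \<and> pd ex f (\<xi>, y + h) - pd ex f (\<xi>, y) = (y + h - y) * ?a (\<xi>, \<eta>)"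
  by (rule MVT2) (use h in \<open>auto intro!: dy f1\<close>)
 then obtain \<eta> where \<eta>: "y < \<eta>" "\<eta> < y + h" "?\<Delta> = h * (h * ?a (\<xi>, \<eta>))" using \<xi>(3) by auto
 have "\<exists>\<eta>>y. \<eta> < y + h \<and> (f (x + h, y + h) - f (x, y + h)) - (f (x + h, y) - f (x, y))
   = (y + h - y) * (pd ey f (x + h, \<eta>) - pd ey f (x, \<eta>))"
  by (rule MVT2) (use h in \<open>auto intro!: DERIV_diff dy f1\<close>)
 then obtain \<eta>' where \<eta>': "y < \<eta>'" "\<eta>' < y + h" "?\<Delta> = h * (pd ey f (x + h, \<eta>') - pd ey f (x, \<eta>'))" by auto
 have "\<exists>\<xi>>x. \<xi> < x + h \<and> pd ey f (x + h, \<eta>') - pd ey f (x, \<eta>') = (x + h - x) * ?b (\<xi>, \<eta>')"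
  by (rule MVT2) (use h in \<open>auto intro!: dx f1\<close>)
 then obtain \<xi>' where \<xi>': "x < \<xi>'" "\<xi>' < x + h" "?\<Delta> = h * (h * ?b (\<xi>', \<eta>'))" using \<eta>'(3) by auto
 have near: "dist (u, v) P < 3 * h" if "x < u" "u < x + h" "y < v" "v < y + h" for u v
 proof -
  have "dist (u, v) P \<le> \<bar>u - x\<bar> + \<bar>v - y\<bar>"
   unfolding P dist_Pair_Pair dist_real_def using sqrt_sum_squares_le_sum_abs[of "u - x" "v - y"] by simp
  also have "\<dots> < 3 * h" using that h by auto
  finally show ?thesis .
 qed
 have "?a (\<xi>, \<eta>) = ?b (\<xi>', \<eta>')" using \<eta>(3) \<xi>'(3) h by simp
 moreover have "dist (?a (\<xi>, \<eta>)) (?a P) < dist (?a P) (?b P) / 2"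
  using rs(2) near[OF \<xi>(1,2) \<eta>(1,2)] h by fastforce
 moreover have "dist (?b (\<xi>', \<eta>')) (?b P) < dist (?a P) (?b P) / 2"
  using rs(4) near[OF \<xi>'(1,2) \<eta>'(1,2)] h by fastforce
 moreover have "dist (?a P) (?b P) \<le> dist (?a (\<xi>, \<eta>)) (?a P) + dist (?a (\<xi>, \<eta>)) (?b P)"
  by (rule dist_triangle3)
 ultimately show False by simp
qed

section \<open>Cutoff functions\<close>

text \<open>Finitely many bumps over boxes in \<open>U\<close> have a sum that is positive on the compact set \<open>K\<close>; a step
 function of a multiple of the sum is \<open>1\<close> there.\<close>
lemma cutoff:
 assumes "compact K" "K \<subseteq> U" "open U"
 obtains \<zeta> C where "smooth UNIV \<zeta>" "compact C" "C \<subseteq> U" "\<And>P. P \<notin> C \<Longrightarrow> \<zeta> P = 0" "\<And>P. P \<in> K \<Longrightarrow> \<zeta> P = 1"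
  "\<And>P. 0 \<le> \<zeta> P" "\<And>P. \<zeta> P \<le> 1"
proof -
 have "\<forall>x\<in>K. \<exists>p. x \<in> box (fst p) (snd p) \<and> cbox (fst p) (snd p) \<subseteq> U"
 proof
  fix x assume "x \<in> K"
  then have "x \<in> U" using assms(2) by blast
  obtain a b where "cbox a b \<subseteq> U" "x \<in> box a b"
   by (rule open_contains_cbox[OF assms(3) \<open>x \<in> U\<close>])
  then show "\<exists>p. x \<in> box (fst p) (snd p) \<and> cbox (fst p) (snd p) \<subseteq> U"
   by (intro exI[of _ "(a, b)"]) simp
 qed
 then obtain p where p: "\<forall>x\<in>K. x \<in> box (fst (p x)) (snd (p x)) \<and> cbox (fst (p x)) (snd (p x)) \<subseteq> U"
  using bchoice[of K "\<lambda>x p. x \<in> box (fst p) (snd p) \<and> cbox (fst p) (snd p) \<subseteq> U"] by blast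
 define l u where "l x = fst (p x)" and "u x = snd (p x)" for x
 have lu: "\<And>x. x \<in> K \<Longrightarrow> x \<in> box (l x) (u x)" "\<And>x. x \<in> K \<Longrightarrow> cbox (l x) (u x) \<subseteq> U"
  using p by (auto simp: l_def u_def)
 obtain F where F: "F \<subseteq> K" "finite F" "K \<subseteq> (\<Union>x\<in>F. box (l x) (u x))"
 proof -
  have "K \<subseteq> (\<Union>x\<in>K. box (l x) (u x))" using lu(1) by blast
  then show ?thesis
   by (rule compactE_image[OF assms(1), rotated]) (use that in auto)
 qed
 define S where "S P = (\<Sum>x\<in>F. bump 1 (l x) (u x) P)" for P
 have sS: "smooth UNIV S" unfolding S_def by (intro smooth_sum smooth_bump) auto
 have Spos: "S P > 0" if "P \<in> K" for P
 proof -
  obtain x where "x \<in> F" "P \<in> box (l x) (u x)" using F(3) \<open>P \<in> K\<close> by blast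
  then have "bump 1 (l x) (u x) P > 0" by (intro bump_pos) auto
  then show ?thesis unfolding S_def
   by (rule sum_pos2[OF F(2) \<open>x \<in> F\<close>]) (rule bump_ge0)
 qed
 have "\<exists>c>0. \<forall>P\<in>K. S P \<ge> c"
 proof (cases "K = {}")
  case False
  have "continuous_on K S" using smooth_cont[OF _ sS] continuous_on_subset by auto
  then obtain Q where "Q \<in> K" "\<forall>P\<in>K. S Q \<le> S P"
   using continuous_attains_inf[OF assms(1) False] by blast
  then show ?thesis using Spos by blast
 qed (intro exI[of _ 1], simp)
 then obtain c where c: "c > 0" "\<And>P. P \<in> K \<Longrightarrow> S P \<ge> c" by blast
 define C where "C = (\<Union>x\<in>F. cbox (l x) (u x))"
 show ?thesis
 proof
  show "smooth UNIV (\<lambda>P. step (inverse c * S P))" by (intro smooth_intros sS) auto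
  show "compact C" unfolding C_def using F(2) by (intro compact_UN) auto
  show "C \<subseteq> U" unfolding C_def using lu(2) F(1) by blast
  show "step (inverse c * S P) = 0" if "P \<notin> C" for P
  proof -
   have "S P = 0" unfolding S_def using that box_subset_cbox
    by (intro sum.neutral ballI bump_0) (auto simp: C_def)
   then show ?thesis by (simp add: step_0)
  qed
  show "step (inverse c * S P) = 1" if "P \<in> K" for P
   using c(1) c(2)[OF that] by (intro step_1) (simp add: field_simps)
 qed (auto simp: step_ge0 step_le1)
qed

section \<open>Smoothness of convolutions\<close>

lemma has_derivative_quadratic:
 fixes f :: "plane \<Rightarrow> real"
 assumes "bounded_linear L" "C \<ge> 0" "\<And>v. \<bar>f (P + v) - f P - L v\<bar> \<le> C * (norm v)^2"
 shows "(f has_derivative L) (at P)"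
 unfolding has_derivative_at
proof (intro conjI assms(1))
 have "((\<lambda>v::plane. C * norm v) \<longlongrightarrow> C * norm (0::plane)) (at 0)"
 proof -
  have "isCont (\<lambda>v::plane. C * norm v) 0" by (intro continuous_intros)
  then show ?thesis unfolding isCont_def .
 qed
 then show "((\<lambda>h. norm (f (P + h) - f P - L h) / norm h) \<longlongrightarrow> 0) (at 0)"
 proof (rule Lim_null_comparison[rotated, OF tendsto_eq_rhs])
  show "\<forall>\<^sub>F v in at 0. norm (norm (f (P + v) - f P - L v) / norm v) \<le> C * norm v"
   by (rule always_eventually)
     (use assms(2,3) in \<open>auto simp: divide_le_eq power2_eq_square mult.assoc\<close>)
 qed simp
qed

lemma abs_fst_snd_le: "\<bar>fst v\<bar> \<le> norm v" "\<bar>snd v\<bar> \<le> norm (v :: plane)"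
 using norm_fst_le[of "fst v" "snd v"] norm_snd_le[of "snd v" "fst v"] by auto

lemma lipschitz_of_pd_bound:
 assumes f: "Ck_on 1 UNIV f" and B: "\<And>P. \<bar>pd ex f P\<bar> \<le> B" "\<And>P. \<bar>pd ey f P\<bar> \<le> B"
 shows "\<bar>f P - f Q\<bar> \<le> 2 * B * norm (P - Q)"
proof -
 have "norm (f P - f Q) \<le> 2 * B * norm (P - Q)"
 proof (rule differentiable_bound[of UNIV _ "\<lambda>P h. fst h * pd ex f P + snd h * pd ey f P"])
  show "(f has_derivative (\<lambda>h. fst h * pd ex f x + snd h * pd ey f x)) (at x)" for x
   by (rule Ck_on_SucD) (use f in auto)
  show "onorm (\<lambda>h. fst h * pd ex f x + snd h * pd ey f x) \<le> 2 * B" for x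
  proof (rule onorm_le)
   fix h :: plane
   have "\<bar>fst h * pd ex f x\<bar> \<le> norm h * B" "\<bar>snd h * pd ey f x\<bar> \<le> norm h * B"
    unfolding abs_mult by (intro mult_mono abs_fst_snd_le B; simp)+
   then show "norm (fst h * pd ex f x + snd h * pd ey f x) \<le> 2 * B * norm h" by (simp add: algebra_simps)
  qed
 qed auto
 then show ?thesis by simp
qed

text \<open>The uniform remainder is what allows differentiation under the integral in a convolution with
 a merely integrable function.\<close>
lemma taylor_quadratic:
 assumes k: "smooth UNIV k" and K: "compact K" "\<And>P. P \<notin> K \<Longrightarrow> k P = 0"
 shows "\<exists>C\<ge>0. \<forall>z v. \<bar>k (z - v) - k z + (fst v * pd ex k z + snd v * pd ey k z)\<bar> \<le> C * (norm v)^2"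
proof -
 have z1: "pd e k P = 0" if "P \<notin> K" for P e
  using pd_vanishes[OF compact_imp_closed[OF K(1)] K(2) that] .
 have z2: "pd e (pd e' k) P = 0" if "P \<notin> K" for P e e'
  using pd_vanishes[OF compact_imp_closed[OF K(1)] z1 that] .
 have "\<exists>B\<ge>0. \<forall>P. \<bar>pd e (pd e' k) P\<bar> \<le> B" if "e \<in> {ex, ey}" "e' \<in> {ex, ey}" for e e'
 proof -
  have "continuous_on UNIV (pd e (pd e' k))"
   by (rule smooth_cont[OF open_UNIV smooth_pd[OF smooth_pd[OF k that(2)] that(1)]])
  then show ?thesis
   by (rule bounded_csupport[OF _ K(1)]) (use z2 in blast)+
 qed
 note bd = this
 obtain B1 where B1: "B1 \<ge> 0" "\<And>P. \<bar>pd ex (pd ex k) P\<bar> \<le> B1" using bd[of ex ex] by blast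
 obtain B2 where B2: "B2 \<ge> 0" "\<And>P. \<bar>pd ex (pd ey k) P\<bar> \<le> B2" using bd[of ex ey] by blast
 obtain B3 where B3: "B3 \<ge> 0" "\<And>P. \<bar>pd ey (pd ex k) P\<bar> \<le> B3" using bd[of ey ex] by blast
 obtain B4 where B4: "B4 \<ge> 0" "\<And>P. \<bar>pd ey (pd ey k) P\<bar> \<le> B4" using bd[of ey ey] by blast
 define M where "M = B1 + B2 + B3 + B4"
 have M: "\<bar>pd e (pd e' k) P\<bar> \<le> M" if "e \<in> {ex, ey}" "e' \<in> {ex, ey}" for e e' P
  using that B1(1) B2(1) B3(1) B4(1) B1(2)[of P] B2(2)[of P] B3(2)[of P] B4(2)[of P]
  unfolding M_def by (elim insertE emptyE; simp)
 have M0: "M \<ge> 0" using M[of ex ex 0] by simp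
 have Lip: "\<bar>pd e k P - pd e k Q\<bar> \<le> 2 * M * norm (P - Q)" if "e \<in> {ex, ey}" for e P Q
  by (rule lipschitz_of_pd_bound) (use that M smooth_Ck[OF smooth_pd[OF k]] in auto)
 show ?thesis
 proof (intro exI[of _ "4 * M"] conjI allI)
  show "\<bar>k (z - v) - k z + (fst v * pd ex k z + snd v * pd ey k z)\<bar> \<le> 4 * M * (norm v)^2" for z v
  proof -
   define q where "q a = k a - (fst a * pd ex k z + snd a * pd ey k z)" for a
   have "norm (q (z - v) - q z) \<le> 4 * M * norm v * norm (z - v - z)"
   proof (rule differentiable_bound[of "cball z (norm v)" _
       "\<lambda>a h. fst h * (pd ex k a - pd ex k z) + snd h * (pd ey k a - pd ey k z)"])
    fix a assume a: "a \<in> cball z (norm v)"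
    have "(k has_derivative (\<lambda>h. fst h * pd ex k a + snd h * pd ey k a)) (at a)"
     by (rule Ck_on_SucD) (use smooth_Ck[OF k, of 1] in auto)
    then have "(q has_derivative (\<lambda>h. fst h * (pd ex k a - pd ex k z) + snd h * (pd ey k a - pd ey k z))) (at a)"
     unfolding q_def[abs_def]
     by (rule has_derivative_eq_rhs[OF has_derivative_diff])
       (auto intro!: derivative_eq_intros simp: algebra_simps)
    then show "(q has_derivative (\<lambda>h. fst h * (pd ex k a - pd ex k z) + snd h * (pd ey k a - pd ey k z))) (at a within cball z (norm v))"
     by (rule has_derivative_at_withinI)
    have n: "norm (a - z) \<le> norm v" using a by (simp add: dist_norm norm_minus_commute)
    have b: "\<bar>pd ex k a - pd ex k z\<bar> \<le> 2 * M * norm v" "\<bar>pd ey k a - pd ey k z\<bar> \<le> 2 * M * norm v"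
     using Lip[of ex a z] Lip[of ey a z] mult_left_mono[OF n, of "2 * M"] M0 by auto
    show "onorm (\<lambda>h. fst h * (pd ex k a - pd ex k z) + snd h * (pd ey k a - pd ey k z)) \<le> 4 * M * norm v"
    proof (rule onorm_le)
     fix h :: plane
     have "\<bar>fst h * (pd ex k a - pd ex k z)\<bar> \<le> norm h * (2 * M * norm v)"
      "\<bar>snd h * (pd ey k a - pd ey k z)\<bar> \<le> norm h * (2 * M * norm v)"
      unfolding abs_mult by (intro mult_mono abs_fst_snd_le b; simp)+
     then show "norm (fst h * (pd ex k a - pd ex k z) + snd h * (pd ey k a - pd ey k z)) \<le> 4 * M * norm v * norm h"
      by (simp add: algebra_simps)
    qed
   qed (auto simp: dist_norm)
   moreover have "q (z - v) - q z = k (z - v) - k z + (fst v * pd ex k z + snd v * pd ey k z)"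
    by (simp add: q_def algebra_simps)
   ultimately show ?thesis by (simp add: power2_eq_square)
  qed
 qed (use M0 in simp)
qed

definition conv :: "(plane \<Rightarrow> real) \<Rightarrow> (plane \<Rightarrow> real) \<Rightarrow> plane \<Rightarrow> real" where
 "conv h k P = (LINT Q|lebesgue. h Q * k (Q - P))"

lemma lebesgue_measurable_continuous:
 fixes k :: "plane \<Rightarrow> real"
 assumes "continuous_on UNIV k" shows "k \<in> borel_measurable lebesgue"
 using borel_measurable_continuous_onI[OF assms] by (simp add: measurable_completion)

lemma conv_integrable:
 fixes h k :: "plane \<Rightarrow> real"
 assumes "integrable lebesgue h" "continuous_on UNIV k" "compact K" "\<And>P. P \<notin> K \<Longrightarrow> k P = 0"
 shows "integrable lebesgue (\<lambda>Q. h Q * k (Q - P))"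
proof -
 obtain B where B: "\<And>P. \<bar>k P\<bar> \<le> B" using bounded_csupport[OF assms(2-4)] by blast
 have "(\<lambda>Q. k (Q - P)) \<in> borel_measurable lebesgue"
  by (intro lebesgue_measurable_continuous continuous_on_compose2[OF assms(2)] continuous_intros) auto
 moreover have "norm (h Q * k (Q - P)) \<le> norm (h Q * B)" for Q
  unfolding real_norm_def abs_mult by (intro mult_left_mono order_trans[OF B abs_ge_self]) simp
 ultimately show ?thesis
  using assms(1) by (intro integrable_le[OF integrable_mult_left[OF assms(1), of B]]) auto
qed

lemma conv_deriv:
 assumes h: "integrable lebesgue h" and k: "smooth UNIV k" and K: "compact K" "\<And>P. P \<notin> K \<Longrightarrow> k P = 0"
 shows "(conv h k has_derivative (\<lambda>v. fst v * conv h (\<lambda>P. - pd ex k P) P + snd v * conv h (\<lambda>P. - pd ey k P) P)) (at P)"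
proof -
 obtain C where C: "C \<ge> 0" "\<And>z v. \<bar>k (z - v) - k z + (fst v * pd ex k z + snd v * pd ey k z)\<bar> \<le> C * (norm v)^2"
  using taylor_quadratic[OF k K] by blast
 have z1: "- pd e k P = 0" if "P \<notin> K" for P e
  using pd_vanishes[OF compact_imp_closed[OF K(1)] K(2) that] by simp
 have ck: "continuous_on UNIV k" "continuous_on UNIV (\<lambda>P. - pd ex k P)" "continuous_on UNIV (\<lambda>P. - pd ey k P)"
  using smooth_cont[OF open_UNIV] k smooth_pd[OF k, of ex] smooth_pd[OF k, of ey] by (auto intro!: continuous_intros)
 note i = conv_integrable[OF h ck(1) K] conv_integrable[OF h ck(2) K(1) z1] conv_integrable[OF h ck(3) K(1) z1]
 show ?thesis
 proof (rule has_derivative_quadratic)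
  show "bounded_linear (\<lambda>v. fst v * conv h (\<lambda>P. - pd ex k P) P + snd v * conv h (\<lambda>P. - pd ey k P) P)"
   by (intro bounded_linear_add bounded_linear_mult_const bounded_linear_fst bounded_linear_snd)
  show "0 \<le> C * (LINT Q|lebesgue. \<bar>h Q\<bar>)" using C by simp
  fix v
  let ?R = "\<lambda>Q. k (Q - P - v) - k (Q - P) + (fst v * pd ex k (Q - P) + snd v * pd ey k (Q - P))"
  have "conv h k (P + v) - conv h k P - (fst v * conv h (\<lambda>P. - pd ex k P) P + snd v * conv h (\<lambda>P. - pd ey k P) P)
    = (LINT Q|lebesgue. h Q * k (Q - (P + v)) - h Q * k (Q - P) - (fst v * (h Q * - pd ex k (Q - P)) + snd v * (h Q * - pd ey k (Q - P))))"
   unfolding conv_def using i by (simp del: mult_minus_right)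
  also have "\<dots> = (LINT Q|lebesgue. h Q * ?R Q)"
   by (rule lint_cong) (simp_all add: algebra_simps)
  also have "\<bar>\<dots>\<bar> \<le> (LINT Q|lebesgue. \<bar>h Q\<bar> * (C * (norm v)^2))"
  proof (rule order_trans[OF integral_abs_bound], rule integral_mono')
   show "\<bar>h Q * ?R Q\<bar> \<le> \<bar>h Q\<bar> * (C * (norm v)^2)" for Q
    unfolding abs_mult using C(2)[of "Q - P" v] by (intro mult_left_mono) auto
  qed (use h C in auto)
  finally show "\<bar>conv h k (P + v) - conv h k P - (fst v * conv h (\<lambda>P. - pd ex k P) P + snd v * conv h (\<lambda>P. - pd ey k P) P)\<bar>
    \<le> C * (LINT Q|lebesgue. \<bar>h Q\<bar>) * (norm v)^2" using h by (simp add: mult.commute mult.left_commute)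
 qed
qed

lemma smooth_conv:
 assumes h: "integrable lebesgue h" and k: "smooth UNIV k" and K: "compact K" "\<And>P. P \<notin> K \<Longrightarrow> k P = 0"
 shows "smooth UNIV (conv h k)" and "e \<in> {ex, ey} \<Longrightarrow> pd e (conv h k) P = conv h (\<lambda>P. - pd e k P) P"
proof -
 have "Ck_on n UNIV (conv h k)" if "smooth UNIV k" "\<And>P. P \<notin> K \<Longrightarrow> k P = 0" for n k
  using that
 proof (induction n arbitrary: k)
  case 0
  show ?case using has_derivative_continuous[OF conv_deriv[OF h 0(1) K(1) 0(2)]]
   by (simp add: continuous_on_eq_continuous_at)
 next
  case (Suc n)
  have z: "- pd e k P = 0" if "P \<notin> K" for P e
   using pd_vanishes[OF compact_imp_closed[OF K(1)] Suc.prems(2) that] by simp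
  have s: "smooth UNIV (\<lambda>P. - pd e k P)" if "e \<in> {ex, ey}" for e
   using smooth_cmult[OF open_UNIV smooth_pd[OF Suc.prems(1) that], of "-1"] by simp
  show ?case
   by (rule Ck_on_SucI[OF open_UNIV conv_deriv[OF h Suc.prems(1) K(1) Suc.prems(2)]])
     (use Suc.IH z s in auto)
 qed
 then show "smooth UNIV (conv h k)" using k K by (simp add: smooth_def)
 show "e \<in> {ex, ey} \<Longrightarrow> pd e (conv h k) P = conv h (\<lambda>P. - pd e k P) P"
  using pd_eqI[OF conv_deriv[OF h k K], of e P] by (auto simp: ex_def ey_def)
qed

section \<open>Weak derivatives\<close>

lemma scs_emptyE:
 assumes "\<psi> \<in> testfun U {}"
 obtains K where "compact K" "K \<subseteq> U" "\<And>P. P \<in> U - K \<Longrightarrow> \<psi> P = 0"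
 using scsD(3)[OF assms] by auto

lemma pd_vanishes_on:
 assumes "open U" "compact K" "\<And>P. P \<in> U - K \<Longrightarrow> f P = 0" "P \<in> U - K"
 shows "pd e f P = 0"
proof -
 have "pd e f P = pd e (\<lambda>_. 0) P"
  by (rule pd_cong[where U="U - K"]) (use assms open_Diff[OF assms(1) compact_imp_closed[OF assms(2)]] in auto)
 then show ?thesis by (simp add: pd_eqI[OF has_derivative_const])
qed

lemma scs_pd:
 assumes "open U" "\<psi> \<in> testfun U {}" "e \<in> {ex, ey}"
 shows "pd e \<psi> \<in> testfun U {}"
proof (rule scs_emptyE[OF assms(2)])
 fix K assume K: "compact K" "K \<subseteq> U" "\<And>P. P \<in> U - K \<Longrightarrow> \<psi> P = 0"
 show ?thesis
  by (rule scs_emptyI[OF assms(1) smooth_pd[OF scsD(1)[OF assms(2)] assms(3)] K(1,2)])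
   (rule pd_vanishes_on[OF assms(1) K(1,3)])
qed

lemma scs_mult:
 assumes "open U" "\<psi> \<in> testfun U {}" "smooth U f"
 shows "(\<lambda>P. f P * \<psi> P) \<in> testfun U {}"
proof (rule scs_emptyE[OF assms(2)])
 fix K assume K: "compact K" "K \<subseteq> U" "\<And>P. P \<in> U - K \<Longrightarrow> \<psi> P = 0"
 show ?thesis
  by (rule scs_emptyI[OF assms(1) smooth_mult[OF assms(1,3) scsD(1)[OF assms(2)]] K(1,2)]) (simp add: K(3))
qed

lemma li_measurable:
 assumes "open U" "locally_integrable U u"
 shows "u \<in> borel_measurable (lebesgue_on U)"
proof (rule open_Union_compact_subsets[OF assms(1)])
 fix C :: "nat \<Rightarrow> plane set"
 assume C: "\<And>n. compact (C n)" "\<And>n. C n \<subseteq> U" "\<And>n. C n \<subseteq> interior (C (Suc n))" "\<Union> (range C) = U"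
 have m: "zext (C n) u \<in> borel_measurable lebesgue" for n
 proof -
  have "integrable (lebesgue_on (C n)) u" using assms(2) C(1,2)[of n] unfolding locally_integrable_def by blast
  then show ?thesis unfolding zext_integrable[OF compact_lebesgue[OF C(1)]] by (rule borel_measurable_integrable)
 qed
 have mono: "C m \<subseteq> C n" if "m \<le> n" for m n
  using that by (rule lift_Suc_mono_le[rotated]) (use C(3) interior_subset in blast)
 have "(\<lambda>n. zext (C n) u P) \<longlonglongrightarrow> zext U u P" for P
 proof (cases "P \<in> U")
  case True
  then obtain m where "P \<in> C m" using C(4) by blast
  then have "\<forall>\<^sub>F n in sequentially. zext (C n) u P = zext U u P"
   using mono True by (intro eventually_sequentiallyI[of m]) (auto simp: zext_def)
  then show ?thesis by (rule tendsto_eventually)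
 next
  case False
  then have "zext (C n) u P = 0" "zext U u P = 0" for n using C(2) by (auto simp: zext_def)
  then show ?thesis by simp
 qed
 then have "zext U u \<in> borel_measurable lebesgue"
  by (intro borel_measurable_LIMSEQ_real[OF _ m]) auto
 then show ?thesis using zext_measurable open_lebesgue[OF assms(1)] by blast
qed

lemma li_mult_integrable:
 assumes U: "open U" and u: "locally_integrable U u" and K: "compact K" "K \<subseteq> U"
  and h: "continuous_on U h" "\<And>P. P \<in> U - K \<Longrightarrow> h P = 0"
 shows "integrable (lebesgue_on U) (\<lambda>P. u P * h P)"
proof -
 have hK: "continuous_on K h" using h(1) K(2) continuous_on_subset by blast
 then have "bounded (h ` K)" using K(1) compact_continuous_image compact_imp_bounded by blast
 then obtain B where B: "\<And>P. P \<in> K \<Longrightarrow> \<bar>h P\<bar> \<le> B" by (auto simp: bounded_iff)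
 have ui: "integrable (lebesgue_on K) u" using u K unfolding locally_integrable_def by blast
 have hm: "h \<in> borel_measurable (lebesgue_on K)"
  using integrable_continuous_compact[OF K(1) hK] by (rule borel_measurable_integrable)
 have "integrable (lebesgue_on K) (\<lambda>P. u P * h P)"
 proof (rule integrable_le[OF integrable_mult_left[OF ui, of B]])
  show "AE P in lebesgue_on K. norm (u P * h P) \<le> norm (u P * B)"
  proof (rule AE_I2)
   fix P assume "P \<in> space (lebesgue_on K)"
   then have "\<bar>h P\<bar> \<le> \<bar>B\<bar>" using B[of P] by simp
   then show "norm (u P * h P) \<le> norm (u P * B)" by (simp add: abs_mult mult_left_mono)
  qed
 qed (use ui hm in auto)
 then show ?thesis
  using integrable_support(1)[OF K(2), of "\<lambda>P. u P * h P"] h(2) open_lebesgue[OF U] compact_lebesgue[OF K(1)]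
  by simp
qed

lemma li_test:
 assumes "open U" "locally_integrable U u" "\<psi> \<in> testfun U {}"
 shows "integrable (lebesgue_on U) (\<lambda>P. u P * \<psi> P)"
proof (rule scs_emptyE[OF assms(3)])
 fix K assume K: "compact K" "K \<subseteq> U" "\<And>P. P \<in> U - K \<Longrightarrow> \<psi> P = 0"
 show ?thesis
  by (rule li_mult_integrable[OF assms(1,2) K(1,2) smooth_cont[OF assms(1) scsD(1)[OF assms(3)]] K(3)])
qed

lemma continuous_li:
 assumes "continuous_on U u" shows "locally_integrable U u"
 unfolding locally_integrable_def
 by (intro allI impI integrable_continuous_compact continuous_on_subset[OF assms]) auto

text \<open>A function whose integral over every box vanishes is zero: its positive and negative part
 are densities of the same measure.\<close>
lemma integral_boxes_zero:
 fixes G :: "plane \<Rightarrow> real"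
 assumes G: "integrable lebesgue G" and z: "\<And>a b. (LINT P|lebesgue. G P * indicator (box a b) P) = 0"
 shows "AE P in lebesgue. G P = 0"
proof -
 obtain G' where G'[measurable]: "G' \<in> borel_measurable lborel" and eq: "AE P in lborel. G P = G' P"
  using completion_ex_borel_measurable_real[OF borel_measurable_integrable[OF G]] by blast
 have eqc: "AE P in lebesgue. G P = G' P" using eq by (rule AE_completion)
 have m': "G' \<in> borel_measurable lebesgue" using G' by (rule measurable_completion)
 have iG': "integrable lborel G'"
  using integrable_cong_AE[OF borel_measurable_integrable[OF G] m' eqc] G integrable_completion[OF G'] by blast
 have z': "(LINT P|lborel. G' P * indicator (box a b) P) = 0" for a b
 proof -
  have "(LINT P|lborel. G' P * indicator (box a b) P) = (LINT P|lebesgue. G' P * indicator (box a b) P)"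
   by (rule integral_completion[symmetric]) measurable
  also have "\<dots> = (LINT P|lebesgue. G P * indicator (box a b) P)"
   by (rule integral_cong_AE) (use eqc m' G in \<open>auto intro!: meas_times borel_measurable_indicator intro: borel_measurable_integrable\<close>)
  finally show ?thesis using z by simp
 qed
 let ?M = "density lborel (\<lambda>P. ennreal (G' P))" and ?N = "density lborel (\<lambda>P. ennreal (- G' P))"
 have imax: "integrable lborel (\<lambda>P. max 0 (g P) * indicator A P)"
  if "integrable lborel g" "A \<in> sets borel" for g :: "plane \<Rightarrow> real" and A
  using integrable_mult_indicator[of A lborel "\<lambda>P. max 0 (g P)"] integrable_max[OF _ that(1), of "\<lambda>_. 0"] that(2)
  by (simp add: mult.commute)
 have em: "emeasure (density lborel (\<lambda>P. ennreal (g P))) A = ennreal (LINT P|lborel. max 0 (g P) * indicator A P)"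
  if g: "integrable lborel g" and A[measurable]: "A \<in> sets borel" for g :: "plane \<Rightarrow> real" and A
 proof -
  have [measurable]: "g \<in> borel_measurable lborel" using g by auto
  have "emeasure (density lborel (\<lambda>P. ennreal (g P))) A = (\<integral>\<^sup>+ P. ennreal (g P) * indicator A P \<partial>lborel)"
   by (rule emeasure_density) auto
  also have "\<dots> = (\<integral>\<^sup>+ P. ennreal (max 0 (g P) * indicator A P) \<partial>lborel)"
   by (rule nn_integral_cong) (auto simp: indicator_def ennreal_neg max_def)
  also have "\<dots> = ennreal (LINT P|lborel. max 0 (g P) * indicator A P)"
   by (intro nn_integral_eq_integral imax g A) auto
  finally show ?thesis .
 qed
 have "?M = ?N"
 proof (rule measure_eqI_generator_eq)
  let ?E = "range (\<lambda>(a, b). box a b::plane set)"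
  let ?A = "\<lambda>n::nat. box (- (real n *\<^sub>R One)) (real n *\<^sub>R One) :: plane set"
  show "Int_stable ?E"
  proof (rule Int_stableI)
   fix X Y assume "X \<in> ?E" "Y \<in> ?E"
   then obtain a b c d where "X = box a b" "Y = box c d" by fast
   then have "X \<inter> Y = (\<lambda>(a, b). box a b) (\<Sum>i\<in>Basis. max (a \<bullet> i) (c \<bullet> i) *\<^sub>R i, \<Sum>i\<in>Basis. min (b \<bullet> i) (d \<bullet> i) *\<^sub>R i)"
    by (simp add: box_Int_box)
   then show "X \<inter> Y \<in> ?E" by (rule image_eqI) simp
  qed
  show "?E \<subseteq> Pow UNIV" "sets ?M = sigma_sets UNIV ?E" "sets ?N = sigma_sets UNIV ?E"
   by (simp_all add: borel_eq_box)
  show "range ?A \<subseteq> ?E" "(\<Union>i. ?A i) = UNIV" unfolding UN_box_eq_UNIV by auto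
  show "emeasure ?M (?A i) \<noteq> \<infinity>" for i by (subst em[OF iG']) auto
  show "emeasure ?M X = emeasure ?N X" if "X \<in> ?E" for X
  proof -
   obtain a b where X: "X = box a b" using \<open>X \<in> ?E\<close> by fast
   have i: "integrable lborel (\<lambda>P. max 0 (g P) * indicator (box a b) P)" if "integrable lborel g" for g :: "plane \<Rightarrow> real"
    by (rule imax[OF that]) simp
   have "(LINT P|lborel. max 0 (G' P) * indicator (box a b) P) - (LINT P|lborel. max 0 (- G' P) * indicator (box a b) P)
     = (LINT P|lborel. max 0 (G' P) * indicator (box a b) P - max 0 (- G' P) * indicator (box a b) P)"
    using i[OF iG'] i[of "\<lambda>P. - G' P"] iG' by simp
   also have "\<dots> = (LINT P|lborel. G' P * indicator (box a b) P)"
    by (rule lint_cong) (auto simp: indicator_def max_def)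
   finally show ?thesis unfolding X using z' iG' by (simp add: em)
  qed
 qed
 then have "AE P in lborel. ennreal (G' P) = ennreal (- G' P)"
  by (intro sigma_finite_measure.density_unique[OF sigma_finite_lborel]) auto
 then have "AE P in lborel. G' P = 0"
 proof eventually_elim
  fix P assume eq: "ennreal (G' P) = ennreal (- G' P)"
  show "G' P = 0"
  proof (cases "G' P \<ge> 0")
   case True then show ?thesis using eq ennreal_neg[of "- G' P"] by simp
  next
   case False then show ?thesis using eq ennreal_neg[of "G' P"] by simp
  qed
 qed
 then have "AE P in lborel. G P = 0" using eq by eventually_elim simp
 then show ?thesis by (rule AE_completion)
qed

text \<open>Bumps converge to indicator functions of boxes, so this reduces to \<open>integral_boxes_zero\<close>.\<close>
lemma fundamental_lemma:
 assumes U: "open U" and g: "locally_integrable U g"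
  and z: "\<And>\<psi>. \<psi> \<in> testfun U {} \<Longrightarrow> (LINT P|lebesgue_on U. g P * \<psi> P) = 0"
 shows "AE P in lebesgue_on U. g P = 0"
proof -
 have box: "AE P in lebesgue. P \<in> box l u \<longrightarrow> g P = 0" if lu: "cbox l u \<subseteq> U" for l u :: plane
 proof -
  define G where "G = zext (box l u) g"
  have gc: "integrable (lebesgue_on (cbox l u)) g"
   using g lu unfolding locally_integrable_def by auto
  have G: "integrable lebesgue G"
  proof -
   have "integrable lebesgue (zext (cbox l u) g)"
    using gc zext_integrable compact_lebesgue[OF compact_cbox] by blast
   then have "integrable lebesgue (\<lambda>x. indicator (box l u) x *\<^sub>R zext (cbox l u) g x)"
    by (intro integrable_mult_indicator) auto
   moreover have "(\<lambda>x. indicator (box l u) x *\<^sub>R zext (cbox l u) g x) = G"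
    using box_subset_cbox by (auto simp: G_def zext_def fun_eq_iff indicator_def)
   ultimately show ?thesis by simp
  qed
  have "(LINT P|lebesgue. G P * indicator (box a b) P) = 0" for a b
  proof -
   define a' where "a' = (max (fst a) (fst l), max (snd a) (snd l))"
   define b' where "b' = (min (fst b) (fst u), min (snd b) (snd u))"
   have ab: "box a b \<inter> box l u = box a' b'"
    by (auto simp: in_box_plane a'_def b'_def set_eq_iff)
   have "(\<lambda>n. LINT P|lebesgue_on U. g P * bump (real (Suc n)) a' b' P) \<longlonglongrightarrow> (LINT P|lebesgue. G P * indicator (box a b) P)"
   proof -
    have b0: "bump (real (Suc n)) a' b' P = 0" if "P \<notin> box l u" for n P
     using that ab by (intro bump_0) auto
    have eq: "(LINT P|lebesgue_on U. g P * bump (real (Suc n)) a' b' P) = (LINT P|lebesgue. G P * bump (real (Suc n)) a' b' P)" for n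
    proof -
     have "zext U (\<lambda>P. g P * bump (real (Suc n)) a' b' P) = (\<lambda>P. G P * bump (real (Suc n)) a' b' P)"
      using b0 lu box_subset_cbox[of l u] by (auto simp: zext_def G_def fun_eq_iff)
     then show ?thesis using zext_integral[OF open_lebesgue[OF U]] by metis
    qed
    have cb: "continuous_on UNIV (bump (real (Suc n)) a' b')" for n
     by (rule smooth_cont[OF open_UNIV smooth_bump[OF open_UNIV]])
    have "(\<lambda>n. LINT P|lebesgue. G P * bump (real (Suc n)) a' b' P) \<longlonglongrightarrow> (LINT P|lebesgue. G P * indicator (box a b) P)"
    proof (rule integral_dominated_convergence[where w="\<lambda>P. \<bar>G P\<bar>"])
     show "AE P in lebesgue. (\<lambda>n. G P * bump (real (Suc n)) a' b' P) \<longlonglongrightarrow> G P * indicator (box a b) P"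
     proof (rule AE_I2)
      fix P
      have "(\<lambda>n. G P * bump (real (Suc n)) a' b' P) \<longlonglongrightarrow> G P * indicator (box a' b') P"
       by (intro tendsto_intros LIMSEQ_Suc[OF bump_tendsto])
      moreover have "G P * indicator (box a' b') P = G P * indicator (box a b) P"
       unfolding ab[symmetric] by (auto simp: G_def zext_def indicator_def)
      ultimately show "(\<lambda>n. G P * bump (real (Suc n)) a' b' P) \<longlonglongrightarrow> G P * indicator (box a b) P" by simp
     qed
     show "AE P in lebesgue. norm (G P * bump (real (Suc n)) a' b' P) \<le> \<bar>G P\<bar>" for n
      using bump_ge0 bump_le1 by (intro AE_I2) (simp add: abs_mult mult_left_le)
     show "(\<lambda>P. G P * bump (real (Suc n)) a' b' P) \<in> borel_measurable lebesgue" for n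
      by (intro meas_times borel_measurable_integrable[OF G] lebesgue_measurable_continuous[OF cb])
     show "(\<lambda>P. G P * indicator (box a b) P) \<in> borel_measurable lebesgue"
      by (intro meas_times borel_measurable_integrable[OF G] borel_measurable_indicator) auto
     show "integrable lebesgue (\<lambda>P. \<bar>G P\<bar>)" using G by simp
    qed
    then show ?thesis unfolding eq .
   qed
   moreover have "(LINT P|lebesgue_on U. g P * bump (real (Suc n)) a' b' P) = 0" for n
   proof (rule z, rule scs_emptyI[OF U smooth_bump[OF U] compact_cbox[of l u] lu])
    show "bump (real (Suc n)) a' b' P = 0" if "P \<in> U - cbox l u" for P
     using that ab box_subset_cbox[of l u] by (intro bump_0) auto
   qed
   ultimately have "(\<lambda>n::nat. 0) \<longlonglongrightarrow> (LINT P|lebesgue. G P * indicator (box a b) P)" by simp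
   from LIMSEQ_unique[OF this tendsto_const] show ?thesis .
  qed
  from integral_boxes_zero[OF G this] show ?thesis
   by eventually_elim (auto simp: G_def zext_def)
 qed
 define D where "D = {p :: plane \<times> plane. cbox (fst p) (snd p) \<subseteq> U}"
 define \<D> where "\<D> = (\<lambda>p. box (fst p) (snd p)) ` D"
 have "\<And>B. B \<in> \<D> \<Longrightarrow> open B" by (auto simp: \<D>_def)
 then obtain F where F: "F \<subseteq> \<D>" "countable F" "\<Union>F = \<Union>\<D>"
  using Lindelof[of \<D>] by blast
 have cov: "U \<subseteq> \<Union>F"
 proof
  fix x assume x: "x \<in> U"
  obtain a b where "cbox a b \<subseteq> U" "x \<in> box a b"
   by (rule open_contains_cbox[OF U x])
  then show "x \<in> \<Union>F" unfolding F(3) \<D>_def D_def by (intro UN_I[of "(a, b)"]) auto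
 qed
 have "AE P in lebesgue. \<forall>B\<in>F. P \<in> B \<longrightarrow> g P = 0"
 proof (rule AE_ball_countable'[OF _ F(2)])
  fix B assume "B \<in> F"
  then obtain p where "B = box (fst p) (snd p)" "cbox (fst p) (snd p) \<subseteq> U" using F(1) unfolding \<D>_def D_def by blast
  then show "AE P in lebesgue. P \<in> B \<longrightarrow> g P = 0" using box by auto
 qed
 then have "AE P in lebesgue. P \<in> U \<longrightarrow> g P = 0"
  by eventually_elim (use cov in blast)
 then show ?thesis using open_lebesgue[OF U] by (simp add: AE_restrict_space_iff)
qed

lemma weak_derivD:
 assumes "is_weak_deriv U e u g"
 shows "locally_integrable U u" "locally_integrable U g"
  "\<And>\<psi>. \<psi> \<in> testfun U {} \<Longrightarrow> (LINT P|lebesgue_on U. u P * pd e \<psi> P) = - (LINT P|lebesgue_on U. g P * \<psi> P)"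
 using assms unfolding is_weak_deriv_def by blast+

lemma li_linear:
 assumes "locally_integrable U u" "locally_integrable U v"
 shows "locally_integrable U (\<lambda>P. a * u P + b * v P)"
 using assms unfolding locally_integrable_def by simp

lemma weak_deriv_linear:
 assumes U: "open U" and e: "e \<in> {ex, ey}" and u: "is_weak_deriv U e u g" and v: "is_weak_deriv U e v h"
 shows "is_weak_deriv U e (\<lambda>P. a * u P + b * v P) (\<lambda>P. a * g P + b * h P)"
 unfolding is_weak_deriv_def
proof (intro conjI ballI li_linear)
 fix \<psi> assume \<psi>: "\<psi> \<in> testfun U {}"
 have lin: "(LINT P|lebesgue_on U. (a * p P + b * q P) * \<phi> P)
   = a * (LINT P|lebesgue_on U. p P * \<phi> P) + b * (LINT P|lebesgue_on U. q P * \<phi> P)"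
  if "locally_integrable U p" "locally_integrable U q" "\<phi> \<in> testfun U {}" for p q \<phi>
  using li_test[OF U that(1,3)] li_test[OF U that(2,3)]
  by (simp add: distrib_right mult.assoc)
 show "(LINT P|lebesgue_on U. (a * u P + b * v P) * pd e \<psi> P) = - (LINT P|lebesgue_on U. (a * g P + b * h P) * \<psi> P)"
  using lin[OF weak_derivD(1)[OF u] weak_derivD(1)[OF v] scs_pd[OF U \<psi> e]]
   lin[OF weak_derivD(2)[OF u] weak_derivD(2)[OF v] \<psi>]
   weak_derivD(3)[OF u \<psi>] weak_derivD(3)[OF v \<psi>] by simp
qed (use weak_derivD(1,2)[OF u] weak_derivD(1,2)[OF v] in auto)

lemma weak_deriv_unique:
 assumes U: "open U" and e: "e \<in> {ex, ey}" and u: "is_weak_deriv U e u g" and v: "is_weak_deriv U e v h"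
  and ae: "AE P in lebesgue_on U. u P = v P"
 shows "AE P in lebesgue_on U. g P = h P"
proof -
 have "AE P in lebesgue_on U. 1 * g P + (-1) * h P = 0"
 proof (rule fundamental_lemma[OF U li_linear])
  fix \<psi> assume \<psi>: "\<psi> \<in> testfun U {}"
  have "(LINT P|lebesgue_on U. (1 * u P + (-1) * v P) * pd e \<psi> P) = 0"
   by (rule integral_eq_zero_AE) (use ae in \<open>eventually_elim, simp\<close>)
  then show "(LINT P|lebesgue_on U. (1 * g P + (-1) * h P) * \<psi> P) = 0"
   using weak_derivD(3)[OF weak_deriv_linear[OF U e u v, of 1 "-1"] \<psi>] by linarith
 qed (use weak_derivD(2)[OF u] weak_derivD(2)[OF v] in auto)
 then show ?thesis by eventually_elim simp
qed

lemma wD_weak_deriv: "is_weak_deriv U e u g \<Longrightarrow> is_weak_deriv U e u (wD U e u)"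
 unfolding wD_def by (rule someI[where P="is_weak_deriv U e u"])

lemma weakly_diffD: "weakly_diff U e u \<Longrightarrow> is_weak_deriv U e u (wD U e u)"
 unfolding weakly_diff_def using wD_weak_deriv by blast

lemma weakly_diffI: "is_weak_deriv U e u g \<Longrightarrow> weakly_diff U e u"
 unfolding weakly_diff_def by blast

lemma wD_AE:
 assumes "open U" "e \<in> {ex, ey}" "is_weak_deriv U e u g"
 shows "AE P in lebesgue_on U. wD U e u P = g P"
 by (rule weak_deriv_unique[OF assms(1,2) wD_weak_deriv[OF assms(3)] assms(3)]) simp

lemma wD_linear:
 assumes "open U" "e \<in> {ex, ey}" "weakly_diff U e u" "weakly_diff U e v"
 shows "AE P in lebesgue_on U. wD U e (\<lambda>P. a * u P + b * v P) P = a * wD U e u P + b * wD U e v P"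
 by (rule wD_AE[OF assms(1,2) weak_deriv_linear[OF assms(1,2) weakly_diffD[OF assms(3)] weakly_diffD[OF assms(4)]]])

lemma weak_deriv_mult:
 assumes U: "open U" and e: "e \<in> {ex, ey}" and u: "is_weak_deriv U e u g" and f: "smooth U f"
 shows "is_weak_deriv U e (\<lambda>P. u P * f P) (\<lambda>P. g P * f P + u P * pd e f P)"
proof -
 have li: "locally_integrable U (\<lambda>P. p P * q P)" if p: "locally_integrable U p" and q: "continuous_on U q" for p q
  unfolding locally_integrable_def
 proof (intro allI impI)
  fix K assume K: "compact K \<and> K \<subseteq> U"
  then have K': "compact K" "K \<subseteq> U" by auto
  obtain \<zeta> C where z: "smooth UNIV \<zeta>" "compact C" "C \<subseteq> U" "\<And>P. P \<notin> C \<Longrightarrow> \<zeta> P = 0" "\<And>P. P \<in> K \<Longrightarrow> \<zeta> P = 1"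
   by (rule cutoff[OF K' U]) (rule that)
  have "integrable (lebesgue_on U) (\<lambda>P. p P * (q P * \<zeta> P))"
   by (rule li_mult_integrable[OF U p z(2,3)])
     (use z smooth_cont[OF U smooth_subset[OF open_UNIV _ z(1)]] q in \<open>auto intro!: continuous_intros\<close>)
  then have "integrable lebesgue (zext U (\<lambda>P. p P * (q P * \<zeta> P)))" using zext_integrable open_lebesgue[OF U] by blast
  then have "integrable lebesgue (\<lambda>P. indicator K P *\<^sub>R zext U (\<lambda>P. p P * (q P * \<zeta> P)) P)"
   by (rule integrable_mult_indicator[rotated]) (use K compact_lebesgue in blast)
  moreover have "(\<lambda>P. indicator K P *\<^sub>R zext U (\<lambda>P. p P * (q P * \<zeta> P)) P) = zext K (\<lambda>P. p P * q P)"
   using K z(5) by (auto simp: zext_def fun_eq_iff indicator_def)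
  ultimately show "integrable (lebesgue_on K) (\<lambda>P. p P * q P)"
   using zext_integrable[OF compact_lebesgue] K by simp
 qed
 note u' = weak_derivD[OF u]
 have cf: "continuous_on U f" "continuous_on U (pd e f)"
  using smooth_cont[OF U] f smooth_pd[OF f e] by auto
 show ?thesis
  unfolding is_weak_deriv_def
 proof (intro conjI ballI)
  show "locally_integrable U (\<lambda>P. u P * f P)" by (rule li[OF u'(1) cf(1)])
  show "locally_integrable U (\<lambda>P. g P * f P + u P * pd e f P)"
   using li_linear[OF li[OF u'(2) cf(1)] li[OF u'(1) cf(2)], of 1 1] by simp
  fix \<psi> assume \<psi>: "\<psi> \<in> testfun U {}"
  have s: "Ck_on 1 U f" "Ck_on 1 U \<psi>" using f scsD(1)[OF \<psi>] by (auto simp: smooth_def)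
  note t1 = scs_mult[OF U scs_pd[OF U \<psi> e] f] and t2 = scs_mult[OF U \<psi> smooth_pd[OF f e]] and t3 = scs_mult[OF U \<psi> f]
  have "(LINT P|lebesgue_on U. u P * pd e (\<lambda>P. f P * \<psi> P) P)
    = (LINT P|lebesgue_on U. u P * (f P * pd e \<psi> P) + u P * (pd e f P * \<psi> P))"
   by (rule lint_cong) (use pd_mult'[OF U _ s e] in \<open>auto simp: distrib_left\<close>)
  also have "\<dots> = (LINT P|lebesgue_on U. u P * (f P * pd e \<psi> P)) + (LINT P|lebesgue_on U. u P * (pd e f P * \<psi> P))"
   using li_test[OF U u'(1) t1] li_test[OF U u'(1) t2] by simp
  finally have "(LINT P|lebesgue_on U. u P * (f P * pd e \<psi> P))
   = - ((LINT P|lebesgue_on U. g P * (f P * \<psi> P)) + (LINT P|lebesgue_on U. u P * (pd e f P * \<psi> P)))"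
   using u'(3)[OF t3] by simp
  moreover have "(LINT P|lebesgue_on U. (g P * f P + u P * pd e f P) * \<psi> P)
   = (LINT P|lebesgue_on U. g P * (f P * \<psi> P)) + (LINT P|lebesgue_on U. u P * (pd e f P * \<psi> P))"
   using li_test[OF U u'(2) t3] li_test[OF U u'(1) t2] by (simp add: distrib_right mult.assoc)
  ultimately show "(LINT P|lebesgue_on U. u P * f P * pd e \<psi> P) = - (LINT P|lebesgue_on U. (g P * f P + u P * pd e f P) * \<psi> P)"
   by (simp add: mult.assoc)
 qed
qed

text \<open>Weak derivatives pass to limits in the sense of distributions.\<close>
lemma weak_deriv_limit:
 assumes U: "open U" and e: "e \<in> {ex, ey}" and li: "locally_integrable U u" "locally_integrable U g"
  and n: "\<And>n. is_weak_deriv U e (u' n) (g' n)"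
  and u: "\<And>\<psi>. \<psi> \<in> testfun U {} \<Longrightarrow> (\<lambda>n. LINT P|lebesgue_on U. u' n P * \<psi> P) \<longlonglongrightarrow> (LINT P|lebesgue_on U. u P * \<psi> P)"
  and g: "\<And>\<psi>. \<psi> \<in> testfun U {} \<Longrightarrow> (\<lambda>n. LINT P|lebesgue_on U. g' n P * \<psi> P) \<longlonglongrightarrow> (LINT P|lebesgue_on U. g P * \<psi> P)"
 shows "is_weak_deriv U e u g"
 unfolding is_weak_deriv_def
proof (intro conjI ballI li)
 fix \<psi> assume \<psi>: "\<psi> \<in> testfun U {}"
 have "(\<lambda>n. LINT P|lebesgue_on U. u' n P * pd e \<psi> P) \<longlonglongrightarrow> - (LINT P|lebesgue_on U. g P * \<psi> P)"
  unfolding weak_derivD(3)[OF n \<psi>] by (intro tendsto_minus g \<psi>)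
 then show "(LINT P|lebesgue_on U. u P * pd e \<psi> P) = - (LINT P|lebesgue_on U. g P * \<psi> P)"
  using LIMSEQ_unique[OF u[OF scs_pd[OF U \<psi> e]]] by blast
qed

lemma weak_deriv_classical:
 assumes U: "open U" and e: "e \<in> {ex, ey}" and f: "Ck_on 1 U f"
 shows "is_weak_deriv U e f (pd e f)"
 unfolding is_weak_deriv_def
proof (intro conjI ballI)
 show "locally_integrable U f" "locally_integrable U (pd e f)"
  using Ck_on_continuous[OF U f] e f Ck_on_pd[of 0 U f] by (auto intro!: continuous_li)
 fix \<psi> assume \<psi>: "\<psi> \<in> testfun U {}"
 show "(LINT P|lebesgue_on U. f P * pd e \<psi> P) = - (LINT P|lebesgue_on U. pd e f P * \<psi> P)"
 proof (rule scs_emptyE[OF \<psi>])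
  fix K assume K: "compact K" "K \<subseteq> U" "\<And>P. P \<in> U - K \<Longrightarrow> \<psi> P = 0"
  show ?thesis
   by (rule integration_by_parts[OF U f smooth_Ck[OF scsD(1)[OF \<psi>]] e K])
 qed
qed

text \<open>Mixed second derivatives of a test function commute, so the derivatives can be moved to the
 test function, exchanged, and moved back.\<close>
lemma weak_deriv_symmetric:
 assumes U: "open U" and x: "is_weak_deriv U ex u ux" and y: "is_weak_deriv U ey u uy"
  and xy: "is_weak_deriv U ey ux uxy"
 shows "is_weak_deriv U ex uy uxy"
 unfolding is_weak_deriv_def
proof (intro conjI ballI)
 show "locally_integrable U uy" "locally_integrable U uxy"
  using weak_derivD[OF y] weak_derivD[OF xy] by blast+
 fix \<psi> assume \<psi>: "\<psi> \<in> testfun U {}"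
 have sch: "pd ex (pd ey \<psi>) P = pd ey (pd ex \<psi>) P" if P: "P \<in> U" for P
 proof (rule scs_emptyE[OF \<psi>])
  fix K assume K: "compact K" "K \<subseteq> U" "\<And>P. P \<in> U - K \<Longrightarrow> \<psi> P = 0"
  have s: "smooth UNIV (zext U \<psi>)"
   by (rule smooth_zext[OF U compact_imp_closed[OF K(1)] K(2) scsD(1)[OF \<psi>] K(3)])
  have 1: "pd e (zext U \<psi>) Q = pd e \<psi> Q" if "Q \<in> U" for Q e
   by (rule pd_cong[OF U that]) (simp add: zext_def)
  have "pd e (pd e' (zext U \<psi>)) P = pd e (pd e' \<psi>) P" for e e'
   by (rule pd_cong[OF U P 1])
  then show ?thesis using schwarz[OF smooth_Ck[OF s], of P] by simp
 qed
 have "(LINT P|lebesgue_on U. uy P * pd ex \<psi> P) = - (LINT P|lebesgue_on U. u P * pd ey (pd ex \<psi>) P)"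
  using weak_derivD(3)[OF y scs_pd[OF U \<psi>, of ex]] by simp
 also have "(LINT P|lebesgue_on U. u P * pd ey (pd ex \<psi>) P) = (LINT P|lebesgue_on U. u P * pd ex (pd ey \<psi>) P)"
  by (rule lint_cong) (simp_all add: sch)
 also have "\<dots> = - (LINT P|lebesgue_on U. ux P * pd ey \<psi> P)"
  using weak_derivD(3)[OF x scs_pd[OF U \<psi>, of ey]] by simp
 also have "(LINT P|lebesgue_on U. ux P * pd ey \<psi> P) = - (LINT P|lebesgue_on U. uxy P * \<psi> P)"
  by (rule weak_derivD(3)[OF xy \<psi>])
 finally show "(LINT P|lebesgue_on U. uy P * pd ex \<psi> P) = - (LINT P|lebesgue_on U. uxy P * \<psi> P)" by simp
qed

section \<open>Hilbert space methods\<close>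

instantiation "fun" :: (type, real_vector) real_vector
begin
definition "a *\<^sub>R f = (\<lambda>x. a *\<^sub>R f x)"
instance by standard (auto simp: scaleR_fun_def fun_eq_iff scaleR_add_right scaleR_add_left)
end

locale hilbert =
 fixes H :: "'v::real_vector set" and B :: "'v \<Rightarrow> 'v \<Rightarrow> real"
 assumes sub: "subspace H"
  and sym: "u \<in> H \<Longrightarrow> v \<in> H \<Longrightarrow> B u v = B v u"
  and add: "u \<in> H \<Longrightarrow> v \<in> H \<Longrightarrow> z \<in> H \<Longrightarrow> B (u + v) z = B u z + B v z"
  and scale: "u \<in> H \<Longrightarrow> z \<in> H \<Longrightarrow> B (a *\<^sub>R u) z = a * B u z"
  and nonneg: "u \<in> H \<Longrightarrow> B u u \<ge> 0"
  and complete: "(\<And>n. X n \<in> H) \<Longrightarrow>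
   (\<And>e. e > 0 \<Longrightarrow> \<exists>N. \<forall>m\<ge>N. \<forall>n\<ge>N. B (X m - X n) (X m - X n) < e) \<Longrightarrow>
   \<exists>L\<in>H. (\<lambda>n. B (X n - L) (X n - L)) \<longlonglongrightarrow> 0"
begin

lemma mem: "u \<in> H \<Longrightarrow> v \<in> H \<Longrightarrow> u + v \<in> H" "u \<in> H \<Longrightarrow> v \<in> H \<Longrightarrow> u - v \<in> H"
  "u \<in> H \<Longrightarrow> a *\<^sub>R u \<in> H" "0 \<in> H"
 using sub by (auto simp: subspace_add subspace_diff subspace_scale subspace_0)

lemma diff: "u \<in> H \<Longrightarrow> v \<in> H \<Longrightarrow> z \<in> H \<Longrightarrow> B (u - v) z = B u z - B v z"
 using add[of u "(-1) *\<^sub>R v" z] scale[of v z "-1"] mem(3)[of v "-1"] by simp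

lemma add2: "u \<in> H \<Longrightarrow> v \<in> H \<Longrightarrow> z \<in> H \<Longrightarrow> B z (u + v) = B z u + B z v"
 using add[of u v z] sym mem by simp
lemma diff2: "u \<in> H \<Longrightarrow> v \<in> H \<Longrightarrow> z \<in> H \<Longrightarrow> B z (u - v) = B z u - B z v"
 using diff[of u v z] sym mem by simp
lemma scale2: "u \<in> H \<Longrightarrow> z \<in> H \<Longrightarrow> B z (a *\<^sub>R u) = a * B z u"
 using scale[of u z a] sym mem by simp
lemmas bil = add diff scale add2 diff2 scale2 mem

lemma cauchy_schwarz:
 assumes u: "u \<in> H" and v: "v \<in> H"
 shows "(B u v)^2 \<le> B u u * B v v"
proof -
 have q: "0 \<le> B u u - 2 * t * B u v + t^2 * B v v" for t
  using nonneg[of "u - t *\<^sub>R v"] u v sym[OF v u] by (simp add: bil power2_eq_square algebra_simps)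
 show ?thesis
 proof (cases "B v v = 0")
  case True
  have "B u v = 0"
  proof (rule ccontr)
   assume "B u v \<noteq> 0"
   then show False using q[of "(B u u + 1) / (2 * B u v)"] True by simp
  qed
  then show ?thesis using True by simp
 next
  case False
  then have "B v v > 0" using nonneg[OF v] by simp
  then show ?thesis using q[of "B u v / B v v"] by (simp add: power2_eq_square field_simps)
 qed
qed

definition nrm :: "'v \<Rightarrow> real" where "nrm u = sqrt (B u u)"

lemma nrm_sq: "u \<in> H \<Longrightarrow> (nrm u)^2 = B u u" by (simp add: nrm_def nonneg)
lemma nrm_ge0: "u \<in> H \<Longrightarrow> nrm u \<ge> 0" by (simp add: nrm_def nonneg)
lemma CS: "u \<in> H \<Longrightarrow> v \<in> H \<Longrightarrow> \<bar>B u v\<bar> \<le> nrm u * nrm v"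
 unfolding nrm_def real_sqrt_mult[symmetric] using cauchy_schwarz[of u v]
 by (metis real_sqrt_abs real_sqrt_le_mono)

lemma nrm_triangle:
 assumes "u \<in> H" "v \<in> H" shows "nrm (u + v) \<le> nrm u + nrm v"
proof -
 have "(nrm (u + v))^2 = B u u + 2 * B u v + B v v"
  using assms sym[of v u] by (simp add: nrm_sq bil)
 also have "\<dots> \<le> (nrm u + nrm v)^2"
  using CS[OF assms] nrm_sq assms by (simp add: power2_sum)
 finally show ?thesis using nrm_ge0 assms by (meson add_nonneg_nonneg power2_le_imp_le)
qed

lemma nrm_scale: "u \<in> H \<Longrightarrow> nrm (a *\<^sub>R u) = \<bar>a\<bar> * nrm u"
 unfolding nrm_def by (simp add: bil real_sqrt_mult power2_eq_square[symmetric] mult.assoc[symmetric])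

lemma nrm_tendsto:
 assumes "\<And>n. X n \<in> H" "L \<in> H" "(\<lambda>n. B (X n - L) (X n - L)) \<longlonglongrightarrow> 0" "v \<in> H"
 shows "(\<lambda>n. nrm (X n - L)) \<longlonglongrightarrow> 0" "(\<lambda>n. B (X n) v) \<longlonglongrightarrow> B L v" "(\<lambda>n. B (X n) (X n)) \<longlonglongrightarrow> B L L"
proof -
 show n0: "(\<lambda>n. nrm (X n - L)) \<longlonglongrightarrow> 0"
  using tendsto_real_sqrt[OF assms(3)] by (simp add: nrm_def)
 have c: "(\<lambda>n. B (X n) v) \<longlonglongrightarrow> B L v" if "v \<in> H" for v
 proof -
  have "(\<lambda>n. B (X n) v - B L v) \<longlonglongrightarrow> 0"
  proof (rule Lim_null_comparison)
   show "\<forall>\<^sub>F n in sequentially. norm (B (X n) v - B L v) \<le> nrm (X n - L) * nrm v"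
    using CS[OF mem(2)[OF assms(1,2)] that] assms(1,2) that by (intro always_eventually) (simp add: bil)
   show "(\<lambda>n. nrm (X n - L) * nrm v) \<longlonglongrightarrow> 0" by (rule tendsto_mult_left_zero[OF n0])
  qed
  then show ?thesis by (rule LIM_zero_cancel)
 qed
 show "(\<lambda>n. B (X n) v) \<longlonglongrightarrow> B L v" by (rule c[OF assms(4)])
 have "B (X n) (X n) = B (X n - L) (X n - L) + 2 * B (X n) L - B L L" for n
  using assms(1,2) sym[OF assms(2) assms(1)] by (simp add: bil)
 moreover have "(\<lambda>n. B (X n - L) (X n - L) + 2 * B (X n) L - B L L) \<longlonglongrightarrow> 0 + 2 * B L L - B L L"
  by (intro tendsto_intros assms(3) c assms(2))
 ultimately show "(\<lambda>n. B (X n) (X n)) \<longlonglongrightarrow> B L L" by simp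
qed

text \<open>By the parallelogram law, almost minimizing elements of decreasing midpoint-convex sets form
 a Cauchy sequence. A hyperplane as
 constant \<open>C\<close> gives the Riesz representation theorem, the convex hulls of tails of a sequence give weak compactness.\<close>
lemma convex_minimizing:
 assumes C: "\<And>n. C n \<subseteq> H" "\<And>n. C n \<noteq> {}" "\<And>n. C (Suc n) \<subseteq> C n"
  and mid: "\<And>n u v. u \<in> C n \<Longrightarrow> v \<in> C n \<Longrightarrow> (1/2) *\<^sub>R (u + v) \<in> C n"
  and bd: "\<And>n. \<exists>u\<in>C n. B u u \<le> K"
 obtains Y L where "\<And>n. Y n \<in> C n" "L \<in> H" "(\<lambda>n. B (Y n - L) (Y n - L)) \<longlonglongrightarrow> 0"
  "\<And>n u. u \<in> (\<Inter>n. C n) \<Longrightarrow> B L L \<le> B u u"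
proof -
 define d where "d n = Inf ((\<lambda>u. B u u) ` C n)" for n
 have bb: "bdd_below ((\<lambda>u. B u u) ` C n)" for n
  using C(1) nonneg by (intro bdd_belowI[of _ 0]) auto
 have dle: "d n \<le> B u u" if "u \<in> C n" for n u
  unfolding d_def by (rule cInf_lower[OF _ bb]) (use that in auto)
 have mono: "d n \<le> d (Suc n)" for n
  unfolding d_def by (intro cInf_superset_mono image_mono C(3) bb) (use C(2) in auto)
 have dK: "d n \<le> K" for n using bd[of n] dle by (meson order_trans)
 have "incseq d" by (rule incseq_SucI) (rule mono)
 moreover have "Bseq d"
 proof (rule BseqI'[of _ "\<bar>d 0\<bar> + \<bar>K\<bar>"])
  show "norm (d n) \<le> \<bar>d 0\<bar> + \<bar>K\<bar>" for n using dK[of n] incseqD[OF \<open>incseq d\<close>, of 0 n] by simp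
 qed
 ultimately have "convergent d" using Bseq_monoseq_convergent incseq_imp_monoseq by blast
 then have cau: "Cauchy d" by (simp add: Cauchy_convergent_iff)
 have "\<exists>u. u \<in> C n \<and> B u u < d n + inverse (real (Suc n))" for n
 proof -
  have "Inf ((\<lambda>u. B u u) ` C n) < d n + inverse (real (Suc n))" unfolding d_def[symmetric] by simp
  from cInf_lessD[OF _ this] C(2) show ?thesis by blast
 qed
 then have "\<forall>n. \<exists>u. u \<in> C n \<and> B u u < d n + inverse (real (Suc n))" by blast
 from choice[OF this] obtain Y where Y: "\<And>n. Y n \<in> C n" "\<And>n. B (Y n) (Y n) < d n + inverse (real (Suc n))" by blast
 have YH: "Y n \<in> H" for n using Y C by blast
 have Cm: "C m \<subseteq> C n" if "n \<le> m" for m n using that by (rule lift_Suc_antimono_le[rotated]) (rule C(3))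
 have dm: "d n \<le> d m" if "n \<le> m" for m n using that by (rule lift_Suc_mono_le[rotated]) (rule mono)
 have key: "B (Y m - Y n) (Y m - Y n) \<le> 2 * (d m - d n) + 4 * inverse (real (Suc n))" if "n \<le> m" for m n
 proof -
  have "(1/2) *\<^sub>R (Y m + Y n) \<in> C n" using mid Y(1) Cm[OF that] by blast
  note le = dle[OF this]
  have "B ((1/2) *\<^sub>R (Y m + Y n)) ((1/2) *\<^sub>R (Y m + Y n)) = (B (Y m) (Y m) + 2 * B (Y m) (Y n) + B (Y n) (Y n)) / 4"
   by (simp add: bil YH sym[OF YH[of n] YH[of m]] add_divide_distrib)
  then have "4 * d n \<le> B (Y m) (Y m) + 2 * B (Y m) (Y n) + B (Y n) (Y n)" using le by simp
  moreover have "inverse (real (Suc m)) \<le> inverse (real (Suc n))" using that by simp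
  moreover have "B (Y m - Y n) (Y m - Y n) = B (Y m) (Y m) + B (Y n) (Y n) - 2 * B (Y m) (Y n)"
   using YH sym[OF YH[of n] YH[of m]] by (simp add: bil)
  moreover define a b where "a = inverse (real (Suc m))" and "b = inverse (real (Suc n))"
  ultimately show ?thesis using Y(2)[of m] Y(2)[of n]
   unfolding a_def[symmetric] b_def[symmetric] by argo
 qed
 have "\<exists>L\<in>H. (\<lambda>n. B (Y n - L) (Y n - L)) \<longlonglongrightarrow> 0"
 proof (rule complete[OF YH])
  fix e :: real assume e: "e > 0"
  obtain N1 where N1: "\<And>m n. m \<ge> N1 \<Longrightarrow> n \<ge> N1 \<Longrightarrow> dist (d m) (d n) < e / 4"
   using cau e unfolding Cauchy_def by (meson divide_pos_pos zero_less_numeral)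
  obtain N2 where N2: "inverse (real (Suc N2)) < e / 8" using reals_Archimedean[of "e/8"] e by auto
  have *: "B (Y m - Y n) (Y m - Y n) < e" if "n \<le> m" "n \<ge> max N1 N2" for m n
  proof -
   have "inverse (real (Suc n)) \<le> inverse (real (Suc N2))" using that by simp
   from le_less_trans[OF this N2] have 1: "inverse (real (Suc n)) < e / 8" .
   have 2: "d m - d n < e / 4" using le_less_trans[OF abs_ge_self, of "d m - d n" "e / 4"] N1[of m n] that by (simp add: dist_real_def)
   show ?thesis using key[OF that(1)] 1 2 by argo
  qed
  have comm: "B (Y m - Y n) (Y m - Y n) = B (Y n - Y m) (Y n - Y m)" for m n
   using YH sym[OF YH YH] by (simp add: bil)
  show "\<exists>N. \<forall>m\<ge>N. \<forall>n\<ge>N. B (Y m - Y n) (Y m - Y n) < e"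
  proof (intro exI allI impI)
   fix m n assume "m \<ge> max N1 N2" "n \<ge> max N1 N2"
   then show "B (Y m - Y n) (Y m - Y n) < e" using *[of n m] *[of m n] comm[of m n] by (cases "n \<le> m") auto
  qed
 qed
 then obtain L where L: "L \<in> H" "(\<lambda>n. B (Y n - L) (Y n - L)) \<longlonglongrightarrow> 0" by blast
 show thesis
 proof (rule that[OF Y(1) L])
  fix n :: nat and u assume u: "u \<in> (\<Inter>n. C n)"
  have "(\<lambda>n. B (Y n) (Y n) - inverse (real (Suc n))) \<longlonglongrightarrow> B L L - 0"
   by (intro tendsto_diff nrm_tendsto(3)[OF YH L L(1)] LIMSEQ_inverse_real_of_nat)
  moreover have "B (Y n) (Y n) - inverse (real (Suc n)) \<le> B u u" for n
   using Y(2)[of n] dle[of u n] u by (simp del: of_nat_Suc)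
  ultimately have "B L L - 0 \<le> B u u"
   by (intro LIMSEQ_le_const2) auto
  then show "B L L \<le> B u u" by simp
 qed
qed

text \<open>The representing vector is a multiple of the element of least norm in the hyperplane \<open>F v = 1\<close>.\<close>
lemma riesz:
 assumes lin: "\<And>u v. u \<in> H \<Longrightarrow> v \<in> H \<Longrightarrow> F (u + v) = F u + F v" "\<And>a u. u \<in> H \<Longrightarrow> F (a *\<^sub>R u) = a * F u"
  and bd: "\<And>u. u \<in> H \<Longrightarrow> \<bar>F u\<bar> \<le> K * nrm u"
 shows "\<exists>u\<in>H. \<forall>v\<in>H. B u v = F v"
proof (cases "\<forall>v\<in>H. F v = 0")
 case True
 then show ?thesis using scale[OF mem(4), of _ 0] mem(4) by (intro bexI[of _ 0]) auto
next
 case False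
 then obtain v0 where v0: "v0 \<in> H" "F v0 \<noteq> 0" by blast
 define v1 where "v1 = (1 / F v0) *\<^sub>R v0"
 have v1: "v1 \<in> H" "F v1 = 1" using v0 by (auto simp: v1_def lin mem)
 define C where "C = {v\<in>H. F v = 1}"
 obtain Y u where Y: "\<And>n::nat. Y n \<in> C" and u: "u \<in> H" and lim: "(\<lambda>n. B (Y n - u) (Y n - u)) \<longlonglongrightarrow> 0"
  and min: "\<And>n v. v \<in> (\<Inter>n::nat. C) \<Longrightarrow> B u u \<le> B v v"
  by (rule convex_minimizing[of "\<lambda>_::nat. C" "B v1 v1"]) (use v1 in \<open>auto simp: C_def lin mem\<close>)
 have YH: "Y n \<in> H" "F (Y n) = 1" for n using Y[of n] by (auto simp: C_def)
 have Fd: "F (a - b) = F a - F b" if "a \<in> H" "b \<in> H" for a b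
  using lin(1)[OF that(1) mem(3)[OF that(2)], of "-1"] lin(2)[OF that(2), of "-1"] by simp
 have Fu: "F u = 1"
 proof -
  have "(\<lambda>n. F (Y n - u)) \<longlonglongrightarrow> 0"
  proof (rule Lim_null_comparison)
   show "\<forall>\<^sub>F n in sequentially. norm (F (Y n - u)) \<le> K * nrm (Y n - u)"
    using bd YH u mem by (intro always_eventually) auto
   show "(\<lambda>n. K * nrm (Y n - u)) \<longlonglongrightarrow> 0"
    by (rule tendsto_mult_right_zero[OF nrm_tendsto(1)[OF YH(1) u lim u]])
  qed
  then have "(\<lambda>n::nat. 1 - F u) \<longlonglongrightarrow> 0" using Fd YH u by simp
  from LIMSEQ_unique[OF this tendsto_const] show ?thesis by simp
 qed
 have orth: "B u z = 0" if z: "z \<in> H" "F z = 0" for z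
 proof -
  have "0 \<le> 2 * t * B u z + t^2 * B z z" for t
  proof -
   have "u + t *\<^sub>R z \<in> (\<Inter>n::nat. C)" using z u Fu by (auto simp: C_def lin mem)
   from min[OF this] show ?thesis using z u sym[OF z(1) u] by (simp add: bil power2_eq_square algebra_simps)
  qed
  note q = this
  show ?thesis
  proof (rule ccontr)
   assume nz: "B u z \<noteq> 0"
   have bz: "B z z \<ge> 0" by (rule nonneg[OF z(1)])
   define t where "t = - B u z / (B z z + 1)"
   have t: "B u z = - (t * (B z z + 1))" "t \<noteq> 0" using bz nz by (auto simp: t_def field_simps)
   have "0 \<le> 2 * t * B u z + t^2 * B z z" by (rule q)
   also have "\<dots> = - (t^2 * (B z z + 2))" unfolding t(1) by (simp add: power2_eq_square algebra_simps)
   also have "\<dots> < 0" using t(2) bz by simp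
   finally show False by simp
  qed
 qed
 have pos: "B u u > 0"
 proof -
  have "1 \<le> K * nrm u" using bd[OF u] Fu by simp
  then have "nrm u \<noteq> 0" by auto
  then show ?thesis using nonneg[OF u] by (auto simp: nrm_def less_le)
 qed
 show ?thesis
 proof (intro bexI ballI)
  fix v assume v: "v \<in> H"
  have "B u (v - F v *\<^sub>R u) = 0"
   by (rule orth) (use v u Fu in \<open>simp_all add: Fd lin mem\<close>)
  then have "B u v = F v * B u u" using u v by (simp add: bil)
  then show "B ((1 / B u u) *\<^sub>R u) v = F v" using u v pos by (simp add: bil)
 qed (use u mem in auto)
qed

lemma geometric_cauchy:
 assumes X: "\<And>n. X n \<in> H" and D: "\<And>n. nrm (X (Suc n) - X n) \<le> K * s ^ n" and s: "0 \<le> s" "s < 1" and K: "K \<ge> 0"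
 shows "\<exists>L\<in>H. (\<lambda>n. B (X n - L) (X n - L)) \<longlonglongrightarrow> 0"
proof (rule complete[OF X])
 have g: "nrm (X (n + k) - X n) \<le> K * s ^ n * (1 - s ^ k) / (1 - s)" for n k
 proof (induction k)
  case 0
  show ?case by (simp add: nrm_def scale[OF mem(4) mem(4), of 0, simplified])
 next
  case (Suc k)
  have "X (n + Suc k) - X n = (X (Suc (n + k)) - X (n + k)) + (X (n + k) - X n)" by simp
  then have "nrm (X (n + Suc k) - X n) \<le> nrm (X (Suc (n + k)) - X (n + k)) + nrm (X (n + k) - X n)"
   using nrm_triangle X mem by metis
  also have "\<dots> \<le> K * s ^ (n + k) + K * s ^ n * (1 - s ^ k) / (1 - s)" using D Suc by (intro add_mono) auto
  also have "\<dots> = K * s ^ n * (1 - s ^ Suc k) / (1 - s)" using s by (simp add: field_simps power_add)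
  finally show ?case .
 qed
 have bound: "nrm (X (n + k) - X n) \<le> K / (1 - s) * s ^ n" for n k
 proof -
  have "K * s ^ n * (1 - s ^ k) \<le> K * s ^ n * 1" using s K by (intro mult_left_mono) auto
  then have "K * s ^ n * (1 - s ^ k) / (1 - s) \<le> K * s ^ n / (1 - s)" using s by (simp add: divide_right_mono)
  then show ?thesis using g[of n k] by (simp add: mult.commute)
 qed
 fix e :: real assume e: "e > 0"
 have "(\<lambda>n. K / (1 - s) * s ^ n) \<longlonglongrightarrow> K / (1 - s) * 0"
  by (intro tendsto_mult_left LIMSEQ_realpow_zero s)
 then have "\<forall>\<^sub>F n in sequentially. K / (1 - s) * s ^ n < sqrt e"
  using e by (intro order_tendstoD(2)) auto
 then obtain N where N: "\<And>n. n \<ge> N \<Longrightarrow> K / (1 - s) * s ^ n < sqrt e" by (auto simp: eventually_sequentially)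
 have *: "B (X m - X n) (X m - X n) < e" if "n \<le> m" "n \<ge> N" for m n
 proof -
  have "nrm (X m - X n) < sqrt e" using bound[of n "m - n"] N[OF that(2)] that(1) by simp
  then show ?thesis unfolding nrm_def by simp
 qed
 have comm: "B (X m - X n) (X m - X n) = B (X n - X m) (X n - X m)" for m n
  using X sym[OF X X] by (simp add: bil)
 show "\<exists>N. \<forall>m\<ge>N. \<forall>n\<ge>N. B (X m - X n) (X m - X n) < e"
 proof (intro exI allI impI)
  fix m n assume "m \<ge> N" "n \<ge> N"
  then show "B (X m - X n) (X m - X n) < e" using *[of n m] *[of m n] comm[of m n] by (cases "n \<le> m") auto
 qed
qed

text \<open>The map \<open>u \<mapsto> u - \<tau> R u\<close> with \<open>R u\<close> representing the residual \<open>A u - F\<close> is a contraction for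
 \<open>\<tau> = c / C\<^sup>2\<close>, and its fixed point is the solution.\<close>
lemma lax_milgram:
 assumes A: "\<And>u v z. u \<in> H \<Longrightarrow> v \<in> H \<Longrightarrow> z \<in> H \<Longrightarrow> A (u + v) z = A u z + A v z"
   "\<And>a u z. u \<in> H \<Longrightarrow> z \<in> H \<Longrightarrow> A (a *\<^sub>R u) z = a * A u z"
   "\<And>u v z. u \<in> H \<Longrightarrow> v \<in> H \<Longrightarrow> z \<in> H \<Longrightarrow> A z (u + v) = A z u + A z v"
   "\<And>a u z. u \<in> H \<Longrightarrow> z \<in> H \<Longrightarrow> A z (a *\<^sub>R u) = a * A z u"
  and bd: "\<And>u v. u \<in> H \<Longrightarrow> v \<in> H \<Longrightarrow> \<bar>A u v\<bar> \<le> C0 * nrm u * nrm v"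
  and coercive: "\<And>u. u \<in> H \<Longrightarrow> c * B u u \<le> A u u" and c: "c > 0"
  and F: "\<And>u v. u \<in> H \<Longrightarrow> v \<in> H \<Longrightarrow> F (u + v) = F u + F v" "\<And>a u. u \<in> H \<Longrightarrow> F (a *\<^sub>R u) = a * F u"
   "\<And>u. u \<in> H \<Longrightarrow> \<bar>F u\<bar> \<le> K * nrm u"
 shows "\<exists>u\<in>H. \<forall>v\<in>H. A u v = F v"
proof -
 define C where "C = max C0 c"
 have C: "C > 0" "c \<le> C" using c by (auto simp: C_def)
 have bd': "\<bar>A u v\<bar> \<le> C * nrm u * nrm v" if "u \<in> H" "v \<in> H" for u v
  using order_trans[OF bd[OF that] mult_right_mono[OF mult_right_mono[of C0 C "nrm u"]]] nrm_ge0 that by (simp add: C_def)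
 have "\<exists>R\<in>H. \<forall>v\<in>H. B R v = A u v - F v" if u: "u \<in> H" for u
 proof (rule riesz[where K="C * nrm u + K"])
  show "\<bar>A u v - F v\<bar> \<le> (C * nrm u + K) * nrm v" if "v \<in> H" for v
   using bd'[OF u that] F(3)[OF that] by (simp add: distrib_right)
 qed (use u A F in \<open>auto simp: algebra_simps\<close>)
 then have "\<forall>u\<in>H. \<exists>R. R \<in> H \<and> (\<forall>v\<in>H. B R v = A u v - F v)" by blast
 from bchoice[OF this] obtain R where R: "\<And>u. u \<in> H \<Longrightarrow> R u \<in> H" "\<And>u v. u \<in> H \<Longrightarrow> v \<in> H \<Longrightarrow> B (R u) v = A u v - F v" by blast
 define \<tau> where "\<tau> = c / C^2"
 define X where "X = rec_nat 0 (\<lambda>_ u. u - \<tau> *\<^sub>R R u)"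
 have X0: "X 0 = 0" and XS: "X (Suc n) = X n - \<tau> *\<^sub>R R (X n)" for n by (simp_all add: X_def)
 have XH: "X n \<in> H" for n by (induction n) (simp_all add: X0 XS mem R)
 define D where "D n = X (Suc n) - X n" for n
 have DH: "D n \<in> H" for n by (simp add: D_def XH mem)
 define q where "q = 1 - (c^2) / C^2"
 have q: "0 \<le> q" "q < 1" using c C by (auto simp: q_def divide_le_eq power_mono)
 have step: "B (D (Suc n)) (D (Suc n)) \<le> q * B (D n) (D n)" for n
 proof -
  define E where "E = R (X (Suc n)) - R (X n)"
  have EH: "E \<in> H" by (simp add: E_def R XH mem)
  have Adiff: "A (X (Suc n)) v - A (X n) v = A (D n) v" if "v \<in> H" for v
  proof -
   have "A (X (Suc n)) v = A (D n + X n) v" by (simp add: D_def)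
   then show ?thesis using A(1)[OF DH XH that] by simp
  qed
  have BE: "B E v = A (D n) v" if "v \<in> H" for v
   unfolding E_def using that Adiff[OF that] by (simp add: diff R XH)
  have DS: "D (Suc n) = D n - \<tau> *\<^sub>R E"
   by (simp add: D_def E_def XS algebra_simps)
  have "B E E \<le> C^2 * B (D n) (D n)"
  proof -
   have "(nrm E)^2 \<le> C * nrm (D n) * nrm E" using abs_le_D1[OF bd'[OF DH EH]] BE[OF EH] by (simp add: nrm_sq EH)
   then have "nrm E \<le> C * nrm (D n)"
    using nrm_ge0[OF EH] C nrm_ge0[OF DH[of n]] by (cases "nrm E = 0") (auto simp: power2_eq_square)
   then have "(nrm E)^2 \<le> (C * nrm (D n))^2" using nrm_ge0[OF EH] by (rule power_mono)
   then show ?thesis by (simp add: nrm_sq EH DH power_mult_distrib)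
  qed
  then have "\<tau>^2 * B E E \<le> \<tau>^2 * (C^2 * B (D n) (D n))" by (rule mult_left_mono) simp
  moreover have "2 * \<tau> * (c * B (D n) (D n)) \<le> 2 * \<tau> * B E (D n)"
   using coercive[OF DH] BE[OF DH] c by (intro mult_left_mono) (auto simp: \<tau>_def)
  moreover have "B (D (Suc n)) (D (Suc n)) = B (D n) (D n) - 2 * \<tau> * B E (D n) + \<tau>^2 * B E E"
   unfolding DS using DH EH sym[OF DH EH] by (simp add: bil power2_eq_square algebra_simps)
  moreover have "\<tau>^2 * (C^2 * B (D n) (D n)) - 2 * \<tau> * (c * B (D n) (D n)) = (q - 1) * B (D n) (D n)"
   using C by (simp add: \<tau>_def q_def power2_eq_square field_simps)
  ultimately show ?thesis by (simp add: algebra_simps)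
 qed
 have "B (D n) (D n) \<le> q ^ n * B (D 0) (D 0)" for n
 proof (induction n)
  case (Suc n)
  then show ?case using step[of n] mult_left_mono[OF Suc q(1)] by (simp add: mult.assoc)
 qed simp
 then have "nrm (D n) \<le> nrm (D 0) * sqrt q ^ n" for n
  unfolding nrm_def by (metis mult.commute real_sqrt_le_mono real_sqrt_mult real_sqrt_power)
 then obtain u where u: "u \<in> H" "(\<lambda>n. B (X n - u) (X n - u)) \<longlonglongrightarrow> 0"
  using geometric_cauchy[of X "nrm (D 0)" "sqrt q"] XH q nrm_ge0[OF DH] unfolding D_def by auto
 have "A u v = F v" if v: "v \<in> H" for v
 proof -
  have n0: "(\<lambda>n. nrm (X n - u)) \<longlonglongrightarrow> 0" by (rule nrm_tendsto(1)[OF XH u u(1)])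
  have "(\<lambda>n. A (X n - u) v) \<longlonglongrightarrow> 0"
  proof (rule Lim_null_comparison)
   show "\<forall>\<^sub>F n in sequentially. norm (A (X n - u) v) \<le> C * nrm v * nrm (X n - u)"
    using bd'[OF mem(2)[OF XH u(1)] v] by (intro always_eventually) (simp add: mult.assoc mult.commute mult.left_commute)
   show "(\<lambda>n. C * nrm v * nrm (X n - u)) \<longlonglongrightarrow> 0" by (rule tendsto_mult_right_zero[OF n0])
  qed
  moreover have "A (X n - u) v = A (X n) v - A u v" for n
   using A(1)[OF mem(2)[OF XH u(1)] u(1) v, of n] by simp
  moreover have "A (X n) v = F v + (1 / \<tau>) * (B (X n) v - B (X (Suc n)) v)" for n
   using v c C unfolding XS by (simp add: bil R XH \<tau>_def)
  ultimately have l0: "(\<lambda>n. F v + (1 / \<tau>) * (B (X n) v - B (X (Suc n)) v) - A u v) \<longlonglongrightarrow> 0" by simp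
  have "(\<lambda>n. F v + (1 / \<tau>) * (B (X n) v - B (X (Suc n)) v) - A u v) \<longlonglongrightarrow> F v + (1 / \<tau>) * (B u v - B u v) - A u v"
   by (intro tendsto_intros nrm_tendsto(2)[OF XH u v] LIMSEQ_Suc)
  from LIMSEQ_unique[OF l0 this] show ?thesis by simp
 qed
 then show ?thesis using u(1) by blast
qed

end

section \<open>Square integrable functions\<close>

definition sqi :: "'a measure \<Rightarrow> ('a \<Rightarrow> real) \<Rightarrow> bool" where
 "sqi M f \<longleftrightarrow> f \<in> borel_measurable M \<and> integrable M (\<lambda>x. (f x)^2)"

lemma sqiD: "sqi M f \<Longrightarrow> f \<in> borel_measurable M" "sqi M f \<Longrightarrow> integrable M (\<lambda>x. (f x)^2)"
 by (simp_all add: sqi_def)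

lemma abs_mult_le_squares: "\<bar>a * b\<bar> \<le> (a^2 + b^2 :: real)"
proof -
 have "2 * \<bar>a * b\<bar> \<le> a^2 + b^2"
  using sum_squares_bound[of "\<bar>a\<bar>" "\<bar>b\<bar>"] by (simp add: abs_mult mult.assoc)
 then show ?thesis using zero_le_power2[of a] zero_le_power2[of b] by linarith
qed

lemma sqi_mult:
 assumes "sqi M f" "sqi M g" shows "integrable M (\<lambda>x. f x * g x)"
proof (rule integrable_le)
 show "integrable M (\<lambda>x. (f x)^2 + (g x)^2)"
  by (intro Bochner_Integration.integrable_add sqiD(2) assms)
 show "AE x in M. norm (f x * g x) \<le> norm ((f x)^2 + (g x)^2)"
 proof (rule AE_I2)
  show "norm (f x * g x) \<le> norm ((f x)^2 + (g x)^2)" for x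
   using abs_mult_le_squares[of "f x" "g x"] by simp
 qed
 show "(\<lambda>x. f x * g x) \<in> borel_measurable M"
  by (intro meas_times sqiD(1) assms)
qed

lemma sqi_bound:
 assumes "sqi M g" "f \<in> borel_measurable M" "AE x in M. \<bar>f x\<bar> \<le> C * \<bar>g x\<bar>"
 shows "sqi M f"
 unfolding sqi_def
proof (rule conjI[OF assms(2)], rule integrable_le[of M "\<lambda>x. C^2 * (g x)^2"])
 show "integrable M (\<lambda>x. C^2 * (g x)^2)" using assms(1) by (simp add: sqi_def)
 show "AE x in M. norm ((f x)^2) \<le> norm (C^2 * (g x)^2)"
  using assms(3)
 proof eventually_elim
  fix x assume "\<bar>f x\<bar> \<le> C * \<bar>g x\<bar>"
  from power_mono[OF this, of 2] show "norm ((f x)^2) \<le> norm (C^2 * (g x)^2)"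
   by (simp add: power_mult_distrib)
 qed
 show "(\<lambda>x. (f x)^2) \<in> borel_measurable M" using assms(2) by (rule borel_measurable_power)
qed

lemma sqi_add: assumes "sqi M f" "sqi M g" shows "sqi M (\<lambda>x. f x + g x)"
proof -
 have "(f x + g x)^2 = (f x)^2 + 2 * (f x * g x) + (g x)^2" for x by (simp add: power2_sum)
 then show ?thesis using assms sqi_mult[OF assms] by (auto simp: sqi_def)
qed

lemma sqi_scale: "sqi M f \<Longrightarrow> sqi M (\<lambda>x. c * f x)"
 by (auto simp: sqi_def power_mult_distrib)

lemma sqi_diff: "sqi M f \<Longrightarrow> sqi M g \<Longrightarrow> sqi M (\<lambda>x. f x - g x)"
 using sqi_add[of M f "\<lambda>x. -1 * g x"] sqi_scale[of M g "-1"] by simp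

lemma sqi_abs: "sqi M f \<Longrightarrow> sqi M (\<lambda>x. \<bar>f x\<bar>)"
 by (auto simp: sqi_def)

lemma L2_cauchy_schwarz:
 assumes f: "sqi M f" and g: "sqi M g"
 shows "(LINT x|M. f x * g x)^2 \<le> (LINT x|M. (f x)^2) * (LINT x|M. (g x)^2)"
proof -
 let ?a = "LINT x|M. (f x)^2" and ?b = "LINT x|M. f x * g x" and ?c = "LINT x|M. (g x)^2"
 have q: "0 \<le> ?a - 2 * t * ?b + t^2 * ?c" for t
 proof -
  have "0 \<le> (LINT x|M. (f x - t * g x)^2)" by simp
  also have "(\<lambda>x. (f x - t * g x)^2) = (\<lambda>x. (f x)^2 - 2 * t * (f x * g x) + t^2 * (g x)^2)"
   by (simp add: power2_eq_square algebra_simps)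
  also have "(LINT x|M. (f x)^2 - 2 * t * (f x * g x) + t^2 * (g x)^2) = ?a - 2 * t * ?b + t^2 * ?c"
   using sqiD(2)[OF f] sqiD(2)[OF g] sqi_mult[OF f g] by simp
  finally show ?thesis .
 qed
 have c0: "?c \<ge> 0" by simp
 show ?thesis
 proof (cases "?c = 0")
  case True
  have "?b = 0"
  proof (rule ccontr)
   assume "?b \<noteq> 0"
   then show False using q[of "(?a + 1) / (2 * ?b)"] True by simp
  qed
  then show ?thesis using True by simp
 next
  case False
  then have "?c > 0" using c0 by linarith
  then show ?thesis using q[of "?b / ?c"] by (simp add: power2_eq_square field_simps)
 qed
qed

lemma L2_cauchy_schwarz':
 assumes f: "sqi M f" and g: "sqi M g"
 shows "\<bar>LINT x|M. f x * g x\<bar> \<le> sqrt (LINT x|M. (f x)^2) * sqrt (LINT x|M. (g x)^2)"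
 unfolding real_sqrt_mult[symmetric] using L2_cauchy_schwarz[OF assms]
 by (metis real_sqrt_abs real_sqrt_le_mono)

lemma L2_AE_convergent_subseq:
 assumes F: "\<And>n. sqi M (F n)" and D: "\<And>n. (LINT x|M. (F (Suc n) x - F n x)^2) \<le> (1/8) ^ n"
 shows "AE x in M. Cauchy (\<lambda>n. F n x)"
proof -
 define d where "d n x = 4 ^ n * (F (Suc n) x - F n x)^2" for n x
 have m[measurable]: "F n \<in> borel_measurable M" for n using F by (simp add: sqi_def)
 have di: "integrable M (d n)" for n
  unfolding d_def[abs_def] using sqi_diff[OF F F] by (simp add: sqi_def)
 have "(\<integral>\<^sup>+x. (\<Sum>n. ennreal (d n x)) \<partial>M) = (\<Sum>n. \<integral>\<^sup>+x. ennreal (d n x) \<partial>M)"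
  by (rule nn_integral_suminf) (simp add: d_def[abs_def])
 also have "\<dots> \<le> (\<Sum>n. ennreal ((1/2) ^ n))"
 proof (rule suminf_le)
  fix n
  have "(\<integral>\<^sup>+x. ennreal (d n x) \<partial>M) = ennreal (LINT x|M. d n x)"
   by (rule nn_integral_eq_integral[OF di]) (simp add: d_def)
  also have "\<dots> \<le> ennreal ((1/2) ^ n)"
  proof (rule ennreal_leI)
   have "(LINT x|M. d n x) = 4 ^ n * (LINT x|M. (F (Suc n) x - F n x)^2)" by (simp add: d_def)
   also have "\<dots> \<le> 4 ^ n * (1/8) ^ n" by (intro mult_left_mono D) simp
   also have "\<dots> = (4 * (1/8)) ^ n" by (rule power_mult_distrib[symmetric])
   finally show "(LINT x|M. d n x) \<le> (1/2) ^ n" by simp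
  qed
  finally show "(\<integral>\<^sup>+x. ennreal (d n x) \<partial>M) \<le> ennreal ((1/2) ^ n)" .
 qed (rule summableI)+
 also have "\<dots> = ennreal (\<Sum>n. (1/2) ^ n)"
  by (rule suminf_ennreal2) (auto intro: summable_geometric)
 also have "\<dots> < \<infinity>" by simp
 finally have "AE x in M. (\<Sum>n. ennreal (d n x)) \<noteq> \<infinity>"
  by (intro nn_integral_PInf_AE) (auto simp: d_def[abs_def])
 then show ?thesis
 proof eventually_elim
  fix x assume fin: "(\<Sum>n. ennreal (d n x)) \<noteq> \<infinity>"
  then have "summable (\<lambda>n. d n x)"
   by (rule summable_suminf_not_top[rotated, unfolded infinity_ennreal_def[symmetric]]) (simp add: d_def)
  then have "(\<lambda>n. d n x) \<longlonglongrightarrow> 0" by (rule summable_LIMSEQ_zero)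
  then have "Bseq (\<lambda>n. d n x)" by (rule convergent_imp_Bseq[OF convergentI])
  then obtain K where K: "K > 0" "\<And>n. norm (d n x) \<le> K" by (rule BseqE) (rule that, auto)
  have b: "norm (F (Suc n) x - F n x) \<le> sqrt K * (1/2) ^ n" for n
  proof -
   have "(F (Suc n) x - F n x)^2 \<le> K * (1/4) ^ n"
    using K(2)[of n] by (simp add: d_def abs_mult power_divide field_simps)
   then have "sqrt ((F (Suc n) x - F n x)^2) \<le> sqrt (K * (1/4) ^ n)" by (rule real_sqrt_le_mono)
   moreover have "sqrt ((1/4::real) ^ n) = (1/2) ^ n"
    by (simp add: real_sqrt_power real_sqrt_divide)
   ultimately show ?thesis by (simp add: real_sqrt_mult)
  qed
  have "summable (\<lambda>n. F (Suc n) x - F n x)"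
   by (rule summable_comparison_test'[OF summable_mult[OF summable_geometric[of "1/2::real"]], of 0 _ "sqrt K"])
     (use b in auto)
  then have "convergent (\<lambda>n. \<Sum>i<n. F (Suc i) x - F i x)" by (simp add: summable_iff_convergent)
  moreover have "(\<Sum>i<n. F (Suc i) x - F i x) = F n x - F 0 x" for n
   by (rule sum_lessThan_telescope)
  ultimately have "convergent (\<lambda>n. F n x - F 0 x)" by simp
  then have "convergent (\<lambda>n. F n x)"
   using convergent_add_const_right_iff[of "\<lambda>n. F n x" "- F 0 x"] by simp
  then show "Cauchy (\<lambda>n. F n x)" by (simp add: Cauchy_convergent_iff)
 qed
qed

text \<open>A subsequence with geometrically decreasing differences converges almost everywhere, and Fatou's lemma
 identifies the limit of the whole sequence.\<close>
lemma L2_complete: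
 assumes F: "\<And>n. sqi M (F n)"
  and cau: "\<And>e. e > 0 \<Longrightarrow> \<exists>N. \<forall>m\<ge>N. \<forall>n\<ge>N. (LINT x|M. (F m x - F n x)^2) < e"
 shows "\<exists>f. sqi M f \<and> (\<lambda>n. LINT x|M. (F n x - f x)^2) \<longlonglongrightarrow> 0"
proof -
 have "\<forall>k. \<exists>N. \<forall>m\<ge>N. \<forall>n\<ge>N. (LINT x|M. (F m x - F n x)^2) < (1/8) ^ k" using cau by simp
 from choice[OF this] obtain N where N: "\<And>k m n. m \<ge> N k \<Longrightarrow> n \<ge> N k \<Longrightarrow> (LINT x|M. (F m x - F n x)^2) < (1/8) ^ k" by blast
 define r where "r k = (\<Sum>i\<le>k. N i) + k" for k
 have rN: "r k \<ge> N k" for k unfolding r_def by (simp add: member_le_sum trans_le_add1)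
 have rS: "r k \<le> r (Suc k)" for k by (simp add: r_def)
 have rk: "r k \<ge> k" for k by (simp add: r_def)
 have AEc: "AE x in M. Cauchy (\<lambda>k. F (r k) x)"
  by (rule L2_AE_convergent_subseq[OF F less_imp_le[OF N[OF order_trans[OF rN rS] rN]]])
 define f where "f x = lim (\<lambda>k. F (r k) x)" for x
 have m[measurable]: "F n \<in> borel_measurable M" for n using F by (simp add: sqi_def)
 have fm[measurable]: "f \<in> borel_measurable M" unfolding f_def[abs_def] by (rule borel_measurable_lim_metric) auto
 have lim: "AE x in M. (\<lambda>k. F (r k) x) \<longlonglongrightarrow> f x"
  using AEc unfolding f_def by eventually_elim (simp add: Cauchy_convergent_iff convergent_LIMSEQ_iff)
 have nn: "(\<integral>\<^sup>+x. ennreal ((F m x - f x)^2) \<partial>M) \<le> ennreal e"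
  if e: "e > 0" and mk: "\<And>n. n \<ge> K \<Longrightarrow> (LINT x|M. (F m x - F n x)^2) < e" for m e K
 proof -
  have "(\<integral>\<^sup>+x. ennreal ((F m x - f x)^2) \<partial>M) = (\<integral>\<^sup>+x. liminf (\<lambda>k. ennreal ((F m x - F (r (k + K)) x)^2)) \<partial>M)"
  proof (rule nn_integral_cong_AE)
   show "AE x in M. ennreal ((F m x - f x)^2) = liminf (\<lambda>k. ennreal ((F m x - F (r (k + K)) x)^2))"
    using lim
   proof eventually_elim
    fix x assume "(\<lambda>k. F (r k) x) \<longlonglongrightarrow> f x"
    then have "(\<lambda>k. ennreal ((F m x - F (r (k + K)) x)^2)) \<longlonglongrightarrow> ennreal ((F m x - f x)^2)"
     by (intro tendsto_ennrealI tendsto_intros LIMSEQ_ignore_initial_segment)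
    from lim_imp_Liminf[OF _ this] show "ennreal ((F m x - f x)^2) = liminf (\<lambda>k. ennreal ((F m x - F (r (k + K)) x)^2))"
     by simp
   qed
  qed
  also have "\<dots> \<le> liminf (\<lambda>k. \<integral>\<^sup>+x. ennreal ((F m x - F (r (k + K)) x)^2) \<partial>M)"
   by (rule nn_integral_liminf) simp
  also have "\<dots> \<le> liminf (\<lambda>k. ennreal e)"
  proof (rule Liminf_mono, rule always_eventually, rule allI)
   fix k
   have "(\<integral>\<^sup>+x. ennreal ((F m x - F (r (k + K)) x)^2) \<partial>M) = ennreal (LINT x|M. (F m x - F (r (k + K)) x)^2)"
    using sqi_diff[OF F F] by (intro nn_integral_eq_integral) (auto simp: sqi_def)
   also have "\<dots> \<le> ennreal e" using mk[of "r (k + K)"] rk[of "k + K"] by (intro ennreal_leI) simp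
   finally show "(\<integral>\<^sup>+x. ennreal ((F m x - F (r (k + K)) x)^2) \<partial>M) \<le> ennreal e" .
  qed
  also have "\<dots> = ennreal e" by (simp add: Liminf_const)
  finally show ?thesis .
 qed
 have i: "integrable M (\<lambda>x. (F m x - f x)^2)" if "m \<ge> N 0" for m
  by (rule integrableI_bounded) (use nn[of 1 "N 0" m] N[of 0 m] that in \<open>auto intro: le_less_trans\<close>)
 have "sqi M (\<lambda>x. F (N 0) x - (F (N 0) x - f x))"
  by (rule sqi_diff[OF F]) (use i[of "N 0"] in \<open>simp add: sqi_def\<close>)
 then have f: "sqi M f" by simp
 have "(\<lambda>n. LINT x|M. (F n x - f x)^2) \<longlonglongrightarrow> 0"
 proof (rule LIMSEQ_I)
  fix e :: real assume e: "e > 0"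
  then obtain K where K: "\<And>m n. m \<ge> K \<Longrightarrow> n \<ge> K \<Longrightarrow> (LINT x|M. (F m x - F n x)^2) < e / 2"
   using cau[of "e / 2"] by auto
  show "\<exists>no. \<forall>n\<ge>no. norm ((LINT x|M. (F n x - f x)^2) - 0) < e"
  proof (intro exI allI impI)
   fix n assume n: "n \<ge> K"
   have "ennreal (LINT x|M. (F n x - f x)^2) = (\<integral>\<^sup>+x. ennreal ((F n x - f x)^2) \<partial>M)"
    using sqi_diff[OF F f] by (intro nn_integral_eq_integral[symmetric]) (auto simp: sqi_def)
   also have "\<dots> \<le> ennreal (e / 2)" using nn[of "e/2" K n] K n e by simp
   finally show "norm ((LINT x|M. (F n x - f x)^2) - 0) < e" using e by simp
  qed
 qed
 then show ?thesis using f by blast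
qed

section \<open>The weighted Sobolev space\<close>

text \<open>Test functions need not vanish on \<open>T\<close>, so \<open>scs_H1\<close> is a condition on the weight near \<open>T\<close>.\<close>
locale weighted =
 fixes \<Omega> T :: "plane set" and w :: "plane \<Rightarrow> real"
 assumes open_dom: "open \<Omega>" and half: "\<Omega> \<subseteq> half_plane"
  and cont_w: "continuous_on \<Omega> w" and w_pos: "\<And>P. P \<in> \<Omega> \<Longrightarrow> w P > 0"
  and scs_H1: "testfun \<Omega> T \<subseteq> H1 w \<Omega>"
begin

abbreviation "M \<equiv> lebesgue_on \<Omega>"

definition sa :: "plane \<Rightarrow> real" where "sa P = sqrt ((1 + snd P) * w P)"
definition sb :: "plane \<Rightarrow> real" where "sb P = sqrt (snd P * w P)"

lemma y_pos: "P \<in> \<Omega> \<Longrightarrow> snd P > 0" using half by (auto simp: half_plane_def)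
lemma sa_pos: "P \<in> \<Omega> \<Longrightarrow> sa P > 0" and sb_pos: "P \<in> \<Omega> \<Longrightarrow> sb P > 0"
 using y_pos w_pos by (auto simp: sa_def sb_def add_pos_pos)
lemma sa_sq: "P \<in> \<Omega> \<Longrightarrow> (sa P)^2 = (1 + snd P) * w P" and sb_sq: "P \<in> \<Omega> \<Longrightarrow> (sb P)^2 = snd P * w P"
 using y_pos[of P] w_pos[of P] by (simp_all add: sa_def sb_def)
lemma cont_sa: "continuous_on \<Omega> sa" and cont_sb: "continuous_on \<Omega> sb"
 unfolding sa_def[abs_def] sb_def[abs_def] by (intro continuous_intros cont_w)+
lemma cont_meas: "continuous_on \<Omega> h \<Longrightarrow> h \<in> borel_measurable M"
 by (rule continuous_imp_measurable_on_sets_lebesgue) (auto simp: open_lebesgue open_dom)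
lemmas sa_meas = cont_meas[OF cont_sa] and sb_meas = cont_meas[OF cont_sb] and w_meas = cont_meas[OF cont_w]

lemma sqi_li:
 assumes f: "sqi M f" and c: "continuous_on \<Omega> c"
 shows "locally_integrable \<Omega> (\<lambda>P. f P * c P)"
 unfolding locally_integrable_def
proof (intro allI impI)
 fix K assume K: "compact K \<and> K \<subseteq> \<Omega>"
 note Kl = compact_lebesgue[of K]
 have z: "zext K f = (\<lambda>P. indicator K P * zext \<Omega> f P)" using K by (auto simp: zext_def fun_eq_iff indicator_def)
 have z2: "zext K (\<lambda>P. (f P)^2) = (\<lambda>P. indicator K P *\<^sub>R zext \<Omega> (\<lambda>P. (f P)^2) P)" using K by (auto simp: zext_def fun_eq_iff indicator_def)
 have fm: "f \<in> borel_measurable (lebesgue_on K)"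
  unfolding zext_measurable[OF Kl[OF conjunct1[OF K]]] z
  using f K Kl zext_measurable[OF open_lebesgue[OF open_dom]] by (auto simp: sqi_def intro!: meas_times borel_measurable_indicator)
 have "integrable (lebesgue_on K) (\<lambda>P. (f P)^2)"
  unfolding zext_integrable[OF Kl[OF conjunct1[OF K]]] z2
  using f K Kl zext_integrable[OF open_lebesgue[OF open_dom]] by (intro integrable_mult_indicator) (auto simp: sqi_def)
 then have "sqi (lebesgue_on K) f" using fm by (simp add: sqi_def)
 moreover have "continuous_on K c" using c K continuous_on_subset by blast
 then have "sqi (lebesgue_on K) c"
  unfolding sqi_def using K integrable_continuous_compact[of K c] integrable_continuous_compact[of K "\<lambda>P. (c P)^2"]
  by (auto intro!: continuous_intros borel_measurable_integrable)
 ultimately show "integrable (lebesgue_on K) (\<lambda>P. f P * c P)" by (rule sqi_mult)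
qed

lemma sqi_continuous_compact_support:
 assumes "continuous_on \<Omega> h" "compact K" "K \<subseteq> \<Omega>" "\<And>P. P \<in> \<Omega> - K \<Longrightarrow> h P = 0"
 shows "sqi M h"
 unfolding sqi_def
 using integrable_csupport[OF open_dom assms(2,3), of "\<lambda>P. (h P)^2"] assms(1,4) cont_meas
 by (auto intro!: continuous_intros)

lemma H1_wD: "u \<in> H1 w \<Omega> \<Longrightarrow> e \<in> {ex, ey} \<Longrightarrow> is_weak_deriv \<Omega> e u (wD \<Omega> e u)"
 unfolding H1_def using weakly_diffD[of \<Omega> ex u] weakly_diffD[of \<Omega> ey u] by auto

lemma H1_density_eq:
 "P \<in> \<Omega> \<Longrightarrow> H1_density w \<Omega> u P = (sa P * u P)^2 + (sb P * wD \<Omega> ex u P)^2 + (sb P * wD \<Omega> ey u P)^2"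
 by (simp add: H1_density_def wgrad_sq_def power_mult_distrib sa_sq sb_sq algebra_simps)

lemma H1_iff:
 "u \<in> H1 w \<Omega> \<longleftrightarrow> weakly_diff \<Omega> ex u \<and> weakly_diff \<Omega> ey u \<and>
   sqi M (\<lambda>P. sa P * u P) \<and> sqi M (\<lambda>P. sb P * wD \<Omega> ex u P) \<and> sqi M (\<lambda>P. sb P * wD \<Omega> ey u P)"
proof (cases "weakly_diff \<Omega> ex u \<and> weakly_diff \<Omega> ey u")
 case True
 have m: "(\<lambda>P. sa P * u P) \<in> borel_measurable M" "(\<lambda>P. sb P * wD \<Omega> ex u P) \<in> borel_measurable M"
   "(\<lambda>P. sb P * wD \<Omega> ey u P) \<in> borel_measurable M"
  using weak_derivD(1,2)[OF weakly_diffD[OF conjunct1[OF True]]] weak_derivD(2)[OF weakly_diffD[OF conjunct2[OF True]]]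
  by (auto intro!: meas_times sa_meas sb_meas intro: li_measurable[OF open_dom])
 have "integrable M (H1_density w \<Omega> u) \<longleftrightarrow>
  integrable M (\<lambda>P. (sa P * u P)^2 + (sb P * wD \<Omega> ex u P)^2 + (sb P * wD \<Omega> ey u P)^2)"
  by (rule Bochner_Integration.integrable_cong) (auto simp: H1_density_eq)
 also have "\<dots> \<longleftrightarrow> sqi M (\<lambda>P. sa P * u P) \<and> sqi M (\<lambda>P. sb P * wD \<Omega> ex u P) \<and> sqi M (\<lambda>P. sb P * wD \<Omega> ey u P)"
 proof
  assume i: "integrable M (\<lambda>P. (sa P * u P)^2 + (sb P * wD \<Omega> ex u P)^2 + (sb P * wD \<Omega> ey u P)^2)"
  have "integrable M (\<lambda>P. (h P)^2)" if "h \<in> borel_measurable M"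
   "\<And>P. (h P)^2 \<le> (sa P * u P)^2 + (sb P * wD \<Omega> ex u P)^2 + (sb P * wD \<Omega> ey u P)^2" for h

  proof (rule integrable_le[OF i _ AE_I2])
   show "(\<lambda>P. (h P)^2) \<in> borel_measurable M" using that(1) by (rule borel_measurable_power)
   show "norm ((h P)^2) \<le> norm ((sa P * u P)^2 + (sb P * wD \<Omega> ex u P)^2 + (sb P * wD \<Omega> ey u P)^2)" for P
    using that(2)[of P] by simp
  qed
  then show "sqi M (\<lambda>P. sa P * u P) \<and> sqi M (\<lambda>P. sb P * wD \<Omega> ex u P) \<and> sqi M (\<lambda>P. sb P * wD \<Omega> ey u P)"
   unfolding sqi_def using m by auto
 qed (auto simp: sqi_def)
 finally show ?thesis using True by (simp add: H1_def)
qed (auto simp: H1_def)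

definition ip :: "(plane \<Rightarrow> real) \<Rightarrow> (plane \<Rightarrow> real) \<Rightarrow> real" where
 "ip u v = (LINT P|M. (sa P * u P) * (sa P * v P)) + (LINT P|M. (sb P * wD \<Omega> ex u P) * (sb P * wD \<Omega> ex v P))
   + (LINT P|M. (sb P * wD \<Omega> ey u P) * (sb P * wD \<Omega> ey v P))"

lemma H1_norm_ip:
 assumes "u \<in> H1 w \<Omega>" shows "H1_norm w \<Omega> u = sqrt (ip u u)"
proof -
 have "(LINT P|M. H1_density w \<Omega> u P) = (LINT P|M. (sa P * u P)^2 + (sb P * wD \<Omega> ex u P)^2 + (sb P * wD \<Omega> ey u P)^2)"
  by (rule lint_cong) (auto simp: H1_density_eq)
 also have "\<dots> = ip u u" using assms unfolding H1_iff ip_def by (simp add: sqi_def power2_eq_square)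
 finally show ?thesis by (simp add: H1_norm_def)
qed

lemma H1_linear:
 assumes "u \<in> H1 w \<Omega>" "v \<in> H1 w \<Omega>"
 shows "(\<lambda>P. a * u P + b * v P) \<in> H1 w \<Omega>"
proof -
 note wu = H1_wD[OF assms(1)] and wv = H1_wD[OF assms(2)]
 have "sqi M (\<lambda>P. sa P * (a * u P + b * v P))"
  using sqi_add[OF sqi_scale[of M "\<lambda>P. sa P * u P" a] sqi_scale[of M "\<lambda>P. sa P * v P" b]] assms
  unfolding H1_iff by (simp add: algebra_simps)
 moreover have "sqi M (\<lambda>P. sb P * wD \<Omega> e (\<lambda>P. a * u P + b * v P) P)" if e: "e \<in> {ex, ey}" for e
 proof -
  have wd: "weakly_diff \<Omega> e u" "weakly_diff \<Omega> e v" using wu[OF e] wv[OF e] weakly_diffI by blast+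
  have m: "wD \<Omega> e (\<lambda>P. a * u P + b * v P) \<in> borel_measurable M"
   using wD_weak_deriv[OF weak_deriv_linear[OF open_dom e wu[OF e] wv[OF e]]] weak_derivD(2) li_measurable[OF open_dom] by blast
  have s: "sqi M (\<lambda>P. sb P * (a * wD \<Omega> e u P + b * wD \<Omega> e v P))"
   using sqi_add[OF sqi_scale[of M "\<lambda>P. sb P * wD \<Omega> e u P" a] sqi_scale[of M "\<lambda>P. sb P * wD \<Omega> e v P" b]] assms e
   unfolding H1_iff by (auto simp: algebra_simps)
  show ?thesis
   by (rule sqi_bound[OF s, of _ 1])
     (use m sb_meas wD_linear[OF open_dom e wd, of a b] in \<open>auto intro!: meas_times elim!: eventually_mono\<close>)
 qed
 ultimately show ?thesis
  unfolding H1_iff using weakly_diffI[OF weak_deriv_linear[OF open_dom _ wu wv]] by simp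
qed

text \<open>The inner product can be computed with any representative of the weak derivatives.\<close>
lemma ip_eq:
 assumes "is_weak_deriv \<Omega> ex u ux" "is_weak_deriv \<Omega> ey u uy" "is_weak_deriv \<Omega> ex v vx" "is_weak_deriv \<Omega> ey v vy"
 shows "ip u v = (LINT P|M. (sa P * u P) * (sa P * v P)) + (LINT P|M. (sb P * ux P) * (sb P * vx P))
   + (LINT P|M. (sb P * uy P) * (sb P * vy P))"
proof -
 have *: "(LINT P|M. (sb P * wD \<Omega> e u P) * (sb P * wD \<Omega> e v P)) = (LINT P|M. (sb P * g P) * (sb P * h P))"
  if e: "e \<in> {ex, ey}" and g: "is_weak_deriv \<Omega> e u g" and h: "is_weak_deriv \<Omega> e v h" for e g h
 proof -
  note m = li_measurable[OF open_dom weak_derivD(2)[OF g]] li_measurable[OF open_dom weak_derivD(2)[OF h]]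
   li_measurable[OF open_dom weak_derivD(2)[OF wD_weak_deriv[OF g]]] li_measurable[OF open_dom weak_derivD(2)[OF wD_weak_deriv[OF h]]]
  have ae: "AE P in M. (sb P * wD \<Omega> e u P) * (sb P * wD \<Omega> e v P) = (sb P * g P) * (sb P * h P)"
   using wD_AE[OF open_dom e g] wD_AE[OF open_dom e h] by eventually_elim simp
  show ?thesis
   by (rule integral_cong_AE[OF _ _ ae]; intro meas_times sb_meas m)
 qed
 show ?thesis unfolding ip_def using *[of ex ux vx] *[of ey uy vy] assms by simp
qed

lemma H1I:
 assumes "is_weak_deriv \<Omega> ex u ux" "is_weak_deriv \<Omega> ey u uy"
  "sqi M (\<lambda>P. sa P * u P)" "sqi M (\<lambda>P. sb P * ux P)" "sqi M (\<lambda>P. sb P * uy P)"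
 shows "u \<in> H1 w \<Omega>"
proof -
 have "sqi M (\<lambda>P. sb P * wD \<Omega> e u P)"
  if e: "e \<in> {ex, ey}" and g: "is_weak_deriv \<Omega> e u g" "sqi M (\<lambda>P. sb P * g P)" for e g
  by (rule sqi_bound[OF g(2), of _ 1])
    (use wD_AE[OF open_dom e g(1)] li_measurable[OF open_dom weak_derivD(2)[OF wD_weak_deriv[OF g(1)]]] sb_meas
    in \<open>auto intro!: meas_times elim!: eventually_mono\<close>)
 then show ?thesis unfolding H1_iff using assms weakly_diffI by auto
qed

end

lemma fun_diff_eq: "u - v = (\<lambda>P. 1 * u P + (-1) * (v P :: real))" by (simp add: fun_eq_iff)
lemma fun_add_eq: "u + v = (\<lambda>P. 1 * u P + 1 * (v P :: real))" by (simp add: fun_eq_iff)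
lemma fun_scale_eq: "a *\<^sub>R u = (\<lambda>P. a * u P + 0 * (u P :: real))" by (simp add: fun_eq_iff scaleR_fun_def)

lemma pd_pow_linear:
 assumes U: "open U" and e: "e \<in> {ex, ey}" and f: "smooth U f" and g: "smooth U g"
 shows "P \<in> U \<Longrightarrow> (pd e ^^ i) (\<lambda>P. a * f P + b * g P) P = a * (pd e ^^ i) f P + b * (pd e ^^ i) g P"
proof (induction i arbitrary: P)
 case (Suc i)
 have s: "smooth U ((pd e ^^ i) f)" "smooth U ((pd e ^^ i) g)" using smooth_pd_pow e f g by auto
 have s': "smooth U (\<lambda>P. c * (pd e ^^ i) f P)" "smooth U (\<lambda>P. c * (pd e ^^ i) g P)" for c
  by (rule smooth_cmult[OF U s(1)], rule smooth_cmult[OF U s(2)])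
 have c: "pd e (\<lambda>P. c * h P) P = c * pd e h P" if "smooth U h" for c h
  using pd_mult'[OF U Suc.prems Ck_on_const[OF U, of 1 c] smooth_Ck[OF that] e]
  by (simp add: pd_eqI[OF has_derivative_const])
 have "(pd e ^^ Suc i) (\<lambda>P. a * f P + b * g P) P = pd e (\<lambda>P. a * (pd e ^^ i) f P + b * (pd e ^^ i) g P) P"
  by (simp, rule pd_cong[OF U Suc.prems Suc.IH])
 also have "\<dots> = a * pd e ((pd e ^^ i) f) P + b * pd e ((pd e ^^ i) g) P"
  using pd_add'[OF U Suc.prems smooth_Ck[OF s'(1)] smooth_Ck[OF s'(2)] e] c[OF s(1)] c[OF s(2)] by simp
 finally show ?case by simp
qed simp

lemma scs_linear:
 assumes U: "open U" and f: "f \<in> testfun U T" and g: "g \<in> testfun U T"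
 shows "(\<lambda>P. a * f P + b * g P) \<in> testfun U T"
proof -
 have s: "smooth U f" "smooth U g" using f g scsD(1) by blast+
 have "smooth U (\<lambda>P. a * f P + b * g P)" by (intro smooth_intros U s)
 then have 1: "\<forall>k. Ck_on k U (\<lambda>P. a * f P + b * g P)" by (simp add: smooth_def)
 have 2: "continuous_on (U \<union> T) (\<lambda>P. a * f P + b * g P)"
  by (intro continuous_intros scsD(2)[OF f] scsD(2)[OF g])
 have 3: "\<exists>h. continuous_on (U \<union> T) h \<and> (\<forall>P\<in>U. h P = (pd ex ^^ i) ((pd ey ^^ j) (\<lambda>P. a * f P + b * g P)) P)" for i j
 proof -
  obtain h1 where h1: "continuous_on (U \<union> T) h1" "\<forall>P\<in>U. h1 P = (pd ex ^^ i) ((pd ey ^^ j) f) P"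
   using f unfolding smooth_compact_support_def by blast
  obtain h2 where h2: "continuous_on (U \<union> T) h2" "\<forall>P\<in>U. h2 P = (pd ex ^^ i) ((pd ey ^^ j) g) P"
   using g unfolding smooth_compact_support_def by blast
  have sj: "smooth U ((pd ey ^^ j) f)" "smooth U ((pd ey ^^ j) g)" by (rule smooth_pd_pow[OF s(1)], simp, rule smooth_pd_pow[OF s(2)], simp)
  have cong: "(pd ex ^^ i) p P = (pd ex ^^ i) q P" if "\<And>P. P \<in> U \<Longrightarrow> p P = q P" "P \<in> U" for p q P
   using that
  proof (induction i arbitrary: P)
   case (Suc i)
   show ?case by (simp, rule pd_cong[OF U Suc.prems(2) Suc.IH[OF Suc.prems(1)]])
  qed simp
  have "(pd ex ^^ i) ((pd ey ^^ j) (\<lambda>P. a * f P + b * g P)) P = a * h1 P + b * h2 P" if P: "P \<in> U" for P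
  proof -
   have "(pd ex ^^ i) ((pd ey ^^ j) (\<lambda>P. a * f P + b * g P)) P
     = (pd ex ^^ i) (\<lambda>P. a * (pd ey ^^ j) f P + b * (pd ey ^^ j) g P) P"
    by (rule cong[OF pd_pow_linear[OF U _ s] P]) simp_all
   also have "\<dots> = a * h1 P + b * h2 P"
    using pd_pow_linear[OF U _ sj P, of ex i a b] h1(2) h2(2) P by simp
   finally show ?thesis .
  qed
  then show ?thesis
   using h1(1) h2(1) by (intro exI[of _ "\<lambda>P. a * h1 P + b * h2 P"]) (auto intro!: continuous_intros)
 qed
 obtain K1 where K1: "compact K1" "K1 \<subseteq> U \<union> T" "\<forall>P\<in>(U \<union> T) - K1. f P = 0" using scsD(3)[OF f] by blast
 obtain K2 where K2: "compact K2" "K2 \<subseteq> U \<union> T" "\<forall>P\<in>(U \<union> T) - K2. g P = 0" using scsD(3)[OF g] by blast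
 have 4: "\<exists>K. compact K \<and> K \<subseteq> U \<union> T \<and> (\<forall>P\<in>(U \<union> T) - K. a * f P + b * g P = 0)"
  using K1 K2 by (intro exI[of _ "K1 \<union> K2"]) (simp add: compact_Un)
 show ?thesis unfolding smooth_compact_support_def using 1 2 3 4 by blast
qed

lemma sqi_cong: "(\<And>x. x \<in> space M \<Longrightarrow> f x = g x) \<Longrightarrow> sqi M f \<longleftrightarrow> sqi M g"
 unfolding sqi_def using measurable_cong[of M f g borel] Bochner_Integration.integrable_cong[of M M "\<lambda>x. (f x)^2" "\<lambda>x. (g x)^2"]
 by simp

lemma L2_test_convergence:
 assumes "\<And>n. sqi M (F n)" "sqi M f" "(\<lambda>n. LINT x|M. (F n x - f x)^2) \<longlonglongrightarrow> 0" "sqi M g"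
 shows "(\<lambda>n. LINT x|M. F n x * g x) \<longlonglongrightarrow> (LINT x|M. f x * g x)"
proof -
 have "(\<lambda>n. (LINT x|M. F n x * g x) - (LINT x|M. f x * g x)) \<longlonglongrightarrow> 0"
 proof (rule Lim_null_comparison)
  show "\<forall>\<^sub>F n in sequentially. norm ((LINT x|M. F n x * g x) - (LINT x|M. f x * g x))
   \<le> sqrt (LINT x|M. (F n x - f x)^2) * sqrt (LINT x|M. (g x)^2)"
  proof (rule always_eventually, rule allI)
   fix n
   have "(LINT x|M. F n x * g x) - (LINT x|M. f x * g x) = (LINT x|M. (F n x - f x) * g x)"
    using sqi_mult[OF assms(1,4)] sqi_mult[OF assms(2,4)] by (simp add: left_diff_distrib)
   then show "norm ((LINT x|M. F n x * g x) - (LINT x|M. f x * g x))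
    \<le> sqrt (LINT x|M. (F n x - f x)^2) * sqrt (LINT x|M. (g x)^2)"
    using L2_cauchy_schwarz'[OF sqi_diff[OF assms(1,2)] assms(4), of n] by simp
  qed
  have "(\<lambda>n. sqrt (LINT x|M. (F n x - f x)^2)) \<longlonglongrightarrow> 0" using tendsto_real_sqrt[OF assms(3)] by simp
  then show "(\<lambda>n. sqrt (LINT x|M. (F n x - f x)^2) * sqrt (LINT x|M. (g x)^2)) \<longlonglongrightarrow> 0"
   by (rule tendsto_mult_left_zero)
 qed
 then show ?thesis by (rule LIM_zero_cancel)
qed

context weighted begin

lemma weak_deriv_diff:
 assumes "e \<in> {ex, ey}" "is_weak_deriv \<Omega> e u g" "is_weak_deriv \<Omega> e v h"
 shows "is_weak_deriv \<Omega> e (u - v) (g - h)"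
 unfolding fun_diff_eq by (rule weak_deriv_linear[OF open_dom assms])

lemma ip_diff:
 assumes u: "is_weak_deriv \<Omega> ex u ux" "is_weak_deriv \<Omega> ey u uy" and v: "is_weak_deriv \<Omega> ex v vx" "is_weak_deriv \<Omega> ey v vy"
 shows "ip (u - v) (u - v) = (LINT P|M. (sa P * u P - sa P * v P)^2) + (LINT P|M. (sb P * ux P - sb P * vx P)^2)
   + (LINT P|M. (sb P * uy P - sb P * vy P)^2)"
proof -
 have x: "is_weak_deriv \<Omega> ex (u - v) (ux - vx)" by (rule weak_deriv_diff) (use assms in auto)
 have y: "is_weak_deriv \<Omega> ey (u - v) (uy - vy)" by (rule weak_deriv_diff) (use assms in auto)
 show ?thesis
  using ip_eq[OF x y x y] by (simp add: power2_eq_square right_diff_distrib)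
qed

text \<open>The three weighted components converge in \<open>L\<^sup>2\<close>. The weights are bounded below on compact subsets,
 so the limits remain related by weak differentiation.\<close>
lemma H1_complete:
 assumes X: "\<And>n. X n \<in> H1 w \<Omega>"
  and cau: "\<And>e. e > 0 \<Longrightarrow> \<exists>N. \<forall>m\<ge>N. \<forall>n\<ge>N. ip (X m - X n) (X m - X n) < e"
 shows "\<exists>L\<in>H1 w \<Omega>. (\<lambda>n. ip (X n - L) (X n - L)) \<longlonglongrightarrow> 0"
proof -
 define F0 where "F0 n P = sa P * X n P" for n P
 define F1 where "F1 n P = sb P * wD \<Omega> ex (X n) P" for n P
 define F2 where "F2 n P = sb P * wD \<Omega> ey (X n) P" for n P
 note wx = H1_wD[OF X, of ex, simplified] and wy = H1_wD[OF X, of ey, simplified]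
 have s: "sqi M (F0 n)" "sqi M (F1 n)" "sqi M (F2 n)" for n
  using X[of n] unfolding H1_iff F0_def[abs_def] F1_def[abs_def] F2_def[abs_def] by auto
 have ipX: "ip (X m - X n) (X m - X n) = (LINT P|M. (F0 m P - F0 n P)^2) + (LINT P|M. (F1 m P - F1 n P)^2) + (LINT P|M. (F2 m P - F2 n P)^2)" for m n
  unfolding ip_diff[OF wx wy wx wy] F0_def F1_def F2_def by simp
 have le: "(LINT P|M. (F0 m P - F0 n P)^2) \<le> ip (X m - X n) (X m - X n)"
  "(LINT P|M. (F1 m P - F1 n P)^2) \<le> ip (X m - X n) (X m - X n)"
  "(LINT P|M. (F2 m P - F2 n P)^2) \<le> ip (X m - X n) (X m - X n)" for m n
  unfolding ipX by simp_all
 have c: "\<exists>N. \<forall>m\<ge>N. \<forall>n\<ge>N. (LINT P|M. (F m P - F n P)^2) < e"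
  if le: "\<And>m n. (LINT P|M. (F m P - F n P)^2) \<le> ip (X m - X n) (X m - X n)" and e: "e > 0" for F :: "nat \<Rightarrow> plane \<Rightarrow> real" and e
 proof -
  obtain N where "\<forall>m\<ge>N. \<forall>n\<ge>N. ip (X m - X n) (X m - X n) < e" using cau[OF e] by blast
  then show ?thesis by (intro exI[of _ N] allI impI le_less_trans[OF le]) blast
 qed
 obtain f0 where f0: "sqi M f0" "(\<lambda>n. LINT P|M. (F0 n P - f0 P)^2) \<longlonglongrightarrow> 0"
  using L2_complete[OF s(1) c[OF le(1)]] by blast
 obtain f1 where f1: "sqi M f1" "(\<lambda>n. LINT P|M. (F1 n P - f1 P)^2) \<longlonglongrightarrow> 0"
  using L2_complete[OF s(2) c[OF le(2)]] by blast
 obtain f2 where f2: "sqi M f2" "(\<lambda>n. LINT P|M. (F2 n P - f2 P)^2) \<longlonglongrightarrow> 0"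
  using L2_complete[OF s(3) c[OF le(3)]] by blast
 define u where "u P = f0 P * inverse (sa P)" for P
 define ux where "ux P = f1 P * inverse (sb P)" for P
 define uy where "uy P = f2 P * inverse (sb P)" for P
 have ca: "continuous_on \<Omega> (\<lambda>P. inverse (sa P))" using cont_sa sa_pos by (intro continuous_on_inverse) (auto simp: less_imp_neq[symmetric])
 have cb: "continuous_on \<Omega> (\<lambda>P. inverse (sb P))" using cont_sb sb_pos by (intro continuous_on_inverse) (auto simp: less_imp_neq[symmetric])
 have li: "locally_integrable \<Omega> u" "locally_integrable \<Omega> ux" "locally_integrable \<Omega> uy"
  unfolding u_def[abs_def] ux_def[abs_def] uy_def[abs_def]
  by (rule sqi_li[OF f0(1) ca], rule sqi_li[OF f1(1) cb], rule sqi_li[OF f2(1) cb])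
 have test: "(\<lambda>n. LINT P|M. Y n P * \<psi> P) \<longlonglongrightarrow> (LINT P|M. (f P * inverse (s P)) * \<psi> P)"
  if F: "\<And>n. sqi M (F n)" "sqi M f" "(\<lambda>n. LINT P|M. (F n P - f P)^2) \<longlonglongrightarrow> 0"
   and Fs: "\<And>n P. F n P = s P * Y n P" and sp: "\<And>P. P \<in> \<Omega> \<Longrightarrow> s P > 0" and cs: "continuous_on \<Omega> (\<lambda>P. inverse (s P))"
   and \<psi>: "\<psi> \<in> testfun \<Omega> {}" for F :: "nat \<Rightarrow> plane \<Rightarrow> real" and Y s f \<psi>
 proof (rule scs_emptyE[OF \<psi>])
  fix K assume K: "compact K" "K \<subseteq> \<Omega>" "\<And>P. P \<in> \<Omega> - K \<Longrightarrow> \<psi> P = 0"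
  have g: "sqi M (\<lambda>P. inverse (s P) * \<psi> P)"
   by (rule sqi_continuous_compact_support[OF _ K(1,2)])
     (use K(3) in \<open>auto intro!: continuous_intros cs smooth_cont[OF open_dom scsD(1)[OF \<psi>]]\<close>)
  have "(\<lambda>n. LINT P|M. F n P * (inverse (s P) * \<psi> P)) \<longlonglongrightarrow> (LINT P|M. f P * (inverse (s P) * \<psi> P))"
   by (rule L2_test_convergence[OF F g])
  moreover have "(LINT P|M. F n P * (inverse (s P) * \<psi> P)) = (LINT P|M. Y n P * \<psi> P)" for n
  proof (rule lint_cong)
   fix P assume "P \<in> space M"
   then have "s P > 0" using sp by simp
   then show "F n P * (inverse (s P) * \<psi> P) = Y n P * \<psi> P" by (simp add: Fs field_simps)
  qed simp
  ultimately show ?thesis by (simp add: mult.assoc)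
 qed
 note t0 = test[OF s(1) f0 F0_def sa_pos ca] and t1 = test[OF s(2) f1 F1_def sb_pos cb] and t2 = test[OF s(3) f2 F2_def sb_pos cb]
 have dx: "is_weak_deriv \<Omega> ex u ux"
  by (rule weak_deriv_limit[OF open_dom _ li(1,2) wx]) (use t0 t1 in \<open>auto simp: u_def ux_def\<close>)
 have dy: "is_weak_deriv \<Omega> ey u uy"
  by (rule weak_deriv_limit[OF open_dom _ li(1,3) wy]) (use t0 t2 in \<open>auto simp: u_def uy_def\<close>)
 have eq: "sa P * u P = f0 P" "sb P * ux P = f1 P" "sb P * uy P = f2 P" if "P \<in> \<Omega>" for P
  using sa_pos[OF that] sb_pos[OF that] by (simp_all add: u_def ux_def uy_def)
 have "u \<in> H1 w \<Omega>"
 proof (rule H1I[OF dx dy])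
  show "sqi M (\<lambda>P. sa P * u P)" using f0(1) eq(1) sqi_cong[of M "\<lambda>P. sa P * u P" f0] by simp
  show "sqi M (\<lambda>P. sb P * ux P)" using f1(1) eq(2) sqi_cong[of M "\<lambda>P. sb P * ux P" f1] by simp
  show "sqi M (\<lambda>P. sb P * uy P)" using f2(1) eq(3) sqi_cong[of M "\<lambda>P. sb P * uy P" f2] by simp
 qed
 moreover have "(\<lambda>n. ip (X n - u) (X n - u)) \<longlonglongrightarrow> 0"
 proof -
  have "ip (X n - u) (X n - u) = (LINT P|M. (F0 n P - f0 P)^2) + (LINT P|M. (F1 n P - f1 P)^2) + (LINT P|M. (F2 n P - f2 P)^2)" for n
   unfolding ip_diff[OF wx wy dx dy] F0_def F1_def F2_def
   by (intro arg_cong2[of _ _ _ _ "(+)"] lint_cong refl) (simp_all add: eq)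
  then show ?thesis using tendsto_add[OF tendsto_add[OF f0(2) f1(2)] f2(2)] by simp
 qed
 ultimately show ?thesis by blast
qed

lemma ip_sym: "ip u v = ip v u"
 unfolding ip_def by (simp add: mult.commute)

lemma ip_lin:
 assumes "u \<in> H1 w \<Omega>" "v \<in> H1 w \<Omega>" "z \<in> H1 w \<Omega>"
 shows "ip (\<lambda>P. a * u P + b * v P) z = a * ip u z + b * ip v z"
proof -
 note wu = H1_wD[OF assms(1)] and wv = H1_wD[OF assms(2)] and wz = H1_wD[OF assms(3)]
 have x: "is_weak_deriv \<Omega> ex (\<lambda>P. a * u P + b * v P) (\<lambda>P. a * wD \<Omega> ex u P + b * wD \<Omega> ex v P)"
  by (rule weak_deriv_linear[OF open_dom]) (auto intro: wu wv)
 have y: "is_weak_deriv \<Omega> ey (\<lambda>P. a * u P + b * v P) (\<lambda>P. a * wD \<Omega> ey u P + b * wD \<Omega> ey v P)"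
  by (rule weak_deriv_linear[OF open_dom]) (auto intro: wu wv)
 have lin: "(LINT P|M. (s P * (a * f P + b * g P)) * (s P * h P)) = a * (LINT P|M. (s P * f P) * (s P * h P)) + b * (LINT P|M. (s P * g P) * (s P * h P))"
  if "sqi M (\<lambda>P. s P * f P)" "sqi M (\<lambda>P. s P * g P)" "sqi M (\<lambda>P. s P * h P)" for s f g h :: "plane \<Rightarrow> real"
 proof -
  have "(LINT P|M. (s P * (a * f P + b * g P)) * (s P * h P)) = (LINT P|M. a * ((s P * f P) * (s P * h P)) + b * ((s P * g P) * (s P * h P)))"
   by (rule lint_cong) (simp_all add: algebra_simps)
  then show ?thesis using sqi_mult[OF that(1,3)] sqi_mult[OF that(2,3)] by simp
 qed
 have s: "sqi M (\<lambda>P. sa P * f P)" "sqi M (\<lambda>P. sb P * wD \<Omega> ex f P)" "sqi M (\<lambda>P. sb P * wD \<Omega> ey f P)" if "f \<in> H1 w \<Omega>" for f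
  using that by (simp_all add: H1_iff)
 note uvz = s[OF assms(1)] s[OF assms(2)] s[OF assms(3)]
 have eq: "ip (\<lambda>P. a * u P + b * v P) z = (LINT P|M. (sa P * (a * u P + b * v P)) * (sa P * z P))
   + (LINT P|M. (sb P * (a * wD \<Omega> ex u P + b * wD \<Omega> ex v P)) * (sb P * wD \<Omega> ex z P))
   + (LINT P|M. (sb P * (a * wD \<Omega> ey u P + b * wD \<Omega> ey v P)) * (sb P * wD \<Omega> ey z P))"
  by (rule ip_eq[OF x y]) (auto intro: wz)
 show ?thesis
  unfolding eq lin[OF uvz(1,4,7)] lin[OF uvz(2,5,8)] lin[OF uvz(3,6,9)]
  unfolding ip_def distrib_left by linarith
qed

lemma H1_nonempty: "0 \<in> H1 w \<Omega>"
proof -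
 have "(0 :: plane \<Rightarrow> real) \<in> testfun \<Omega> {}"
  unfolding zero_fun_def by (rule scs_emptyI[OF open_dom smooth_const[OF open_dom], of "{}"]) auto
 have z: "is_weak_deriv \<Omega> e 0 (\<lambda>_. 0)" if "e \<in> {ex, ey}" for e
  using weak_deriv_classical[OF open_dom that Ck_on_const[OF open_dom, of 1 0]]
  by (simp add: zero_fun_def pd_eqI[OF has_derivative_const] fun_eq_iff is_weak_deriv_def)
 show ?thesis
  by (rule H1I[OF z z]) (auto simp: sqi_def zero_fun_def)
qed

sublocale H: hilbert "H1 w \<Omega>" ip
proof
 show "subspace (H1 w \<Omega>)"
  unfolding subspace_def fun_add_eq fun_scale_eq using H1_nonempty H1_linear by blast
 show "ip u v = ip v u" for u v by (rule ip_sym)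
 show "ip (u + v) z = ip u z + ip v z" if "u \<in> H1 w \<Omega>" "v \<in> H1 w \<Omega>" "z \<in> H1 w \<Omega>" for u v z
  unfolding fun_add_eq using ip_lin[OF that, of 1 1] by simp
 show "ip (a *\<^sub>R u) z = a * ip u z" if "u \<in> H1 w \<Omega>" "z \<in> H1 w \<Omega>" for u z a
  unfolding fun_scale_eq using ip_lin[OF that(1,1,2), of a 0] by simp
 show "0 \<le> ip u u" for u unfolding ip_def by (simp add: integral_nonneg_AE)
 show "\<exists>L\<in>H1 w \<Omega>. (\<lambda>n. ip (X n - L) (X n - L)) \<longlonglongrightarrow> 0" if "\<And>n. X n \<in> H1 w \<Omega>"
   "\<And>e. 0 < e \<Longrightarrow> \<exists>N. \<forall>m\<ge>N. \<forall>n\<ge>N. ip (X m - X n) (X m - X n) < e" for X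
  using H1_complete[OF that] by blast
qed

definition V :: "(plane \<Rightarrow> real) set" where "V = H1_zero w \<Omega> T"

lemma V_H1: "u \<in> V \<Longrightarrow> u \<in> H1 w \<Omega>" by (simp add: V_def H1_zero_def)

lemma V_iff: "u \<in> V \<longleftrightarrow> u \<in> H1 w \<Omega> \<and> (\<forall>\<epsilon>>0. \<exists>\<phi>\<in>testfun \<Omega> T. H.nrm (u - \<phi>) < \<epsilon>)"
proof (cases "u \<in> H1 w \<Omega>")
 case True
 have "H1_norm w \<Omega> (\<lambda>P. u P - \<phi> P) = H.nrm (u - \<phi>)" if "\<phi> \<in> testfun \<Omega> T" for \<phi>
  using H1_norm_ip[OF H.mem(2)[OF True, of \<phi>]] that scs_H1 unfolding H.nrm_def by (auto simp: fun_diff_def)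
 then show ?thesis using True unfolding V_def H1_zero_def by auto
qed (auto simp: V_def H1_zero_def)

lemma V_approx:
 assumes "u \<in> V" "\<epsilon> > 0"
 obtains \<phi> where "\<phi> \<in> testfun \<Omega> T" "\<phi> \<in> H1 w \<Omega>" "H.nrm (u - \<phi>) < \<epsilon>"
 using assms scs_H1 unfolding V_iff by blast

lemma scs_V: "\<phi> \<in> testfun \<Omega> T \<Longrightarrow> \<phi> \<in> V"
proof -
 assume "\<phi> \<in> testfun \<Omega> T"
 moreover have "H.nrm (\<phi> - \<phi>) = 0" using H.scale[OF H.mem(4) H.mem(4), of 0] by (simp add: H.nrm_def)
 ultimately show ?thesis unfolding V_iff using scs_H1 by (auto intro!: bexI[of _ \<phi>])
qed

lemma V_linear:
 assumes u: "u \<in> V" and v: "v \<in> V" shows "(\<lambda>P. a * u P + b * v P) \<in> V"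
 unfolding V_iff
proof (intro conjI allI impI)
 show "(\<lambda>P. a * u P + b * v P) \<in> H1 w \<Omega>" by (intro H1_linear V_H1 u v)
 fix \<epsilon> :: real assume e: "\<epsilon> > 0"
 define c where "c = \<bar>a\<bar> + \<bar>b\<bar> + 1"
 have c: "c > 0" by (simp add: c_def)
 obtain \<phi> where \<phi>: "\<phi> \<in> testfun \<Omega> T" "\<phi> \<in> H1 w \<Omega>" "H.nrm (u - \<phi>) < \<epsilon> / c"
  by (rule V_approx[OF u divide_pos_pos[OF e c]])
 obtain \<psi> where \<psi>: "\<psi> \<in> testfun \<Omega> T" "\<psi> \<in> H1 w \<Omega>" "H.nrm (v - \<psi>) < \<epsilon> / c"
  by (rule V_approx[OF v divide_pos_pos[OF e c]])
 have m: "u - \<phi> \<in> H1 w \<Omega>" "v - \<psi> \<in> H1 w \<Omega>" by (intro H.mem V_H1 u v \<phi>(2) \<psi>(2))+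
 have eq: "(\<lambda>P. a * u P + b * v P) - (\<lambda>P. a * \<phi> P + b * \<psi> P) = a *\<^sub>R (u - \<phi>) + b *\<^sub>R (v - \<psi>)"
  by (simp add: fun_eq_iff scaleR_fun_def algebra_simps)
 have "H.nrm (a *\<^sub>R (u - \<phi>) + b *\<^sub>R (v - \<psi>)) \<le> \<bar>a\<bar> * H.nrm (u - \<phi>) + \<bar>b\<bar> * H.nrm (v - \<psi>)"
  using H.nrm_triangle[OF H.mem(3)[OF m(1), of a] H.mem(3)[OF m(2), of b]] by (simp add: H.nrm_scale m)
 also have "\<dots> \<le> \<bar>a\<bar> * (\<epsilon> / c) + \<bar>b\<bar> * (\<epsilon> / c)" using \<phi>(3) \<psi>(3) by (intro add_mono mult_left_mono) auto
 also have "\<dots> = \<epsilon> * ((\<bar>a\<bar> + \<bar>b\<bar>) / c)" by (simp add: add_divide_distrib distrib_left mult.commute)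
 also have "\<dots> < \<epsilon> * 1" using e c by (intro mult_strict_left_mono) (simp_all add: c_def)
 finally show "\<exists>\<phi>\<in>testfun \<Omega> T. H.nrm ((\<lambda>P. a * u P + b * v P) - \<phi>) < \<epsilon>"
  using scs_linear[OF open_dom \<phi>(1) \<psi>(1), of a b] eq by (intro bexI[of _ "\<lambda>P. a * \<phi> P + b * \<psi> P"]) auto
qed

lemma V_closed:
 assumes X: "\<And>n. X n \<in> V" and L: "L \<in> H1 w \<Omega>" and lim: "(\<lambda>n. ip (X n - L) (X n - L)) \<longlonglongrightarrow> 0"
 shows "L \<in> V"
 unfolding V_iff
proof (intro conjI allI impI L)
 fix \<epsilon> :: real assume e: "\<epsilon> > 0"
 have "(\<lambda>n. H.nrm (X n - L)) \<longlonglongrightarrow> 0" by (rule H.nrm_tendsto(1)[OF V_H1[OF X] L lim L])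
 then have "\<forall>\<^sub>F n in sequentially. H.nrm (X n - L) < \<epsilon> / 2" using e by (intro order_tendstoD(2)) auto
 then obtain n where n: "H.nrm (X n - L) < \<epsilon> / 2" using eventually_happens'[OF sequentially_bot] by fast
 obtain \<phi> where \<phi>: "\<phi> \<in> testfun \<Omega> T" "\<phi> \<in> H1 w \<Omega>" "H.nrm (X n - \<phi>) < \<epsilon> / 2"
  by (rule V_approx[OF X half_gt_zero[OF e]])
 have m: "(-1) *\<^sub>R (X n - L) \<in> H1 w \<Omega>" "X n - \<phi> \<in> H1 w \<Omega>" "X n - L \<in> H1 w \<Omega>"
  by (intro H.mem V_H1[OF X] L \<phi>(2))+
 have "L - \<phi> = (-1) *\<^sub>R (X n - L) + (X n - \<phi>)" by simp
 then have "H.nrm (L - \<phi>) \<le> H.nrm ((-1) *\<^sub>R (X n - L)) + H.nrm (X n - \<phi>)"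
  using H.nrm_triangle[OF m(1,2)] by simp
 also have "H.nrm ((-1) *\<^sub>R (X n - L)) = H.nrm (X n - L)" using H.nrm_scale[OF m(3), of "-1"] by simp
 finally have "H.nrm (L - \<phi>) < \<epsilon>" using n \<phi>(3) by linarith
 then show "\<exists>\<phi>\<in>testfun \<Omega> T. H.nrm (L - \<phi>) < \<epsilon>" using \<phi>(1) by (rule bexI)
qed

lemma V_subspace: "subspace V"
 unfolding subspace_def fun_add_eq fun_scale_eq
proof (intro conjI ballI allI V_linear)
 show "0 \<in> V"
 proof (rule scs_V)
  show "0 \<in> testfun \<Omega> T"
   unfolding smooth_compact_support_def mem_Collect_eq
  proof (intro conjI allI)
   have p0: "(pd e ^^ i) (0::plane \<Rightarrow> real) = 0" for e i
   proof -
    have "pd e (0::plane \<Rightarrow> real) = 0"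
     by (rule ext) (simp add: zero_fun_def pd_eqI[OF has_derivative_const])
    then show ?thesis by (induction i) simp_all
   qed
   show "Ck_on k \<Omega> 0" for k unfolding zero_fun_def by (rule Ck_on_const[OF open_dom])
   show "continuous_on (\<Omega> \<union> T) 0" by (simp add: zero_fun_def)
   show "\<exists>g. continuous_on (\<Omega> \<union> T) g \<and> (\<forall>P\<in>\<Omega>. g P = (pd ex ^^ i) ((pd ey ^^ j) 0) P)" for i j
    unfolding p0 by (intro exI[of _ "\<lambda>_. 0"]) simp
   show "\<exists>K. compact K \<and> K \<subseteq> \<Omega> \<union> T \<and> (\<forall>P\<in>\<Omega> \<union> T - K. (0::plane \<Rightarrow> real) P = 0)" by (intro exI[of _ "{}"]) simp
  qed
 qed
qed

sublocale V: hilbert V ip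
proof
 show "subspace V" by (rule V_subspace)
 show "ip u v = ip v u" for u v by (rule ip_sym)
 show "ip (u + v) z = ip u z + ip v z" if "u \<in> V" "v \<in> V" "z \<in> V" for u v z
  by (intro H.add V_H1 that)
 show "ip (a *\<^sub>R u) z = a * ip u z" if "u \<in> V" "z \<in> V" for u z a
  by (intro H.scale V_H1 that)
 show "0 \<le> ip u u" if "u \<in> V" for u by (intro H.nonneg V_H1 that)
 show "\<exists>L\<in>V. (\<lambda>n. ip (X n - L) (X n - L)) \<longlonglongrightarrow> 0" if X: "\<And>n. X n \<in> V"
   "\<And>e. 0 < e \<Longrightarrow> \<exists>N. \<forall>m\<ge>N. \<forall>n\<ge>N. ip (X m - X n) (X m - X n) < e" for X
 proof -
  obtain L where L: "L \<in> H1 w \<Omega>" "(\<lambda>n. ip (X n - L) (X n - L)) \<longlonglongrightarrow> 0"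
   using H1_complete[OF V_H1[OF X(1)] X(2)] by blast
  then show ?thesis using V_closed[OF X(1) L] by blast
 qed
qed

lemma H1_tests_converge:
 assumes X: "\<And>n. X n \<in> H1 w \<Omega>" and L: "L \<in> H1 w \<Omega>" and lim: "(\<lambda>n. ip (X n - L) (X n - L)) \<longlonglongrightarrow> 0"
  and g: "sqi M g"
 shows "(\<lambda>n. LINT P|M. (sa P * X n P) * g P) \<longlonglongrightarrow> (LINT P|M. (sa P * L P) * g P)"
  "e \<in> {ex, ey} \<Longrightarrow> (\<lambda>n. LINT P|M. (sb P * wD \<Omega> e (X n) P) * g P) \<longlonglongrightarrow> (LINT P|M. (sb P * wD \<Omega> e L P) * g P)"
proof -
 note wX = H1_wD[OF X] and wL = H1_wD[OF L]
 have ipX: "ip (X n - L) (X n - L) = (LINT P|M. (sa P * X n P - sa P * L P)^2) + (LINT P|M. (sb P * wD \<Omega> ex (X n) P - sb P * wD \<Omega> ex L P)^2)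
   + (LINT P|M. (sb P * wD \<Omega> ey (X n) P - sb P * wD \<Omega> ey L P)^2)" for n
  by (rule ip_diff) (auto intro: wX wL)
 have sq: "(\<lambda>n. LINT P|M. (F n P)^2) \<longlonglongrightarrow> 0" if "\<And>n. (LINT P|M. (F n P)^2) \<le> ip (X n - L) (X n - L)" for F :: "nat \<Rightarrow> plane \<Rightarrow> real"
  by (rule tendsto_sandwich[OF _ _ tendsto_const lim]) (use that in \<open>auto intro!: always_eventually\<close>)
 show "(\<lambda>n. LINT P|M. (sa P * X n P) * g P) \<longlonglongrightarrow> (LINT P|M. (sa P * L P) * g P)"
  by (rule L2_test_convergence[OF _ _ sq g]) (use X L in \<open>auto simp: H1_iff ipX\<close>)
 show "e \<in> {ex, ey} \<Longrightarrow> (\<lambda>n. LINT P|M. (sb P * wD \<Omega> e (X n) P) * g P) \<longlonglongrightarrow> (LINT P|M. (sb P * wD \<Omega> e L P) * g P)"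
  by (rule L2_test_convergence[OF _ _ sq g]) (use X L in \<open>auto simp: H1_iff ipX\<close>)
qed

lemma sqi_test_over_sa:
 assumes \<psi>: "\<psi> \<in> testfun \<Omega> {}"
 shows "sqi M (\<lambda>P. \<psi> P * inverse (sa P))" "(LINT P|M. u P * \<psi> P) = (LINT P|M. (sa P * u P) * (\<psi> P * inverse (sa P)))"
proof -
 show "sqi M (\<lambda>P. \<psi> P * inverse (sa P))"
 proof (rule scs_emptyE[OF \<psi>])
  fix K assume K: "compact K" "K \<subseteq> \<Omega>" "\<And>P. P \<in> \<Omega> - K \<Longrightarrow> \<psi> P = 0"
  show ?thesis
   by (rule sqi_continuous_compact_support[OF _ K(1,2)])
     (use K(3) sa_pos in \<open>auto intro!: continuous_intros cont_sa smooth_cont[OF open_dom scsD(1)[OF \<psi>]] simp: less_imp_neq[symmetric]\<close>)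
 qed
 show "(LINT P|M. u P * \<psi> P) = (LINT P|M. (sa P * u P) * (\<psi> P * inverse (sa P)))"
 proof (rule lint_cong)
  fix P assume "P \<in> space M"
  then have "sa P > 0" using sa_pos by simp
  then show "u P * \<psi> P = (sa P * u P) * (\<psi> P * inverse (sa P))" by (simp add: field_simps)
 qed simp
qed

text \<open>A bounded sequence in \<open>V\<close> that converges in the sense of distributions has its limit in \<open>V\<close>:
 minimizing the norm over convex hulls of tails turns it into a norm convergent sequence.\<close>
lemma V_weakly_closed:
 assumes h: "\<And>n. h n \<in> V" and K: "\<And>n. ip (h n) (h n) \<le> K" and li: "locally_integrable \<Omega> g"
  and lim: "\<And>\<psi>. \<psi> \<in> testfun \<Omega> {} \<Longrightarrow> (\<lambda>n. LINT P|M. h n P * \<psi> P) \<longlonglongrightarrow> (LINT P|M. g P * \<psi> P)"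
 shows "g \<in> V"
proof -
 define C where "C n = convex hull (h ` {n..})" for n :: nat
 have CV: "C n \<subseteq> V" for n
  unfolding C_def by (intro hull_minimal subspace_imp_convex V_subspace) (use h in auto)
 have mem: "h m \<in> C n" if "n \<le> m" for m n unfolding C_def by (rule hull_inc) (use that in auto)
 have mid: "(1/2) *\<^sub>R (u + v) \<in> C n" if "u \<in> C n" "v \<in> C n" for n u v
  using convexD[OF convex_convex_hull that[unfolded C_def], of "1/2" "1/2"] unfolding C_def by (simp add: scaleR_add_right)
 obtain Y L where Y: "\<And>n. Y n \<in> C n" and L: "L \<in> V" and YL: "(\<lambda>n. ip (Y n - L) (Y n - L)) \<longlonglongrightarrow> 0"
 proof (rule V.convex_minimizing[of C K])
  show "C n \<noteq> {}" for n using mem by blast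
  show "C (Suc n) \<subseteq> C n" for n unfolding C_def by (rule hull_mono) auto
  show "\<exists>u\<in>C n. ip u u \<le> K" for n using mem[of n n] K[of n] by blast
 qed (use CV mid that in blast)+
 have "(LINT P|M. L P * \<psi> P) = (LINT P|M. g P * \<psi> P)" if \<psi>: "\<psi> \<in> testfun \<Omega> {}" for \<psi>
 proof -
  define l where "l u = (LINT P|M. u P * \<psi> P)" for u :: "plane \<Rightarrow> real"
  have int: "integrable M (\<lambda>P. u P * \<psi> P)" if "u \<in> V" for u
   using li_test[OF open_dom weak_derivD(1)[OF H1_wD[OF V_H1[OF that], of ex]] \<psi>] by simp
  have ll: "l (a *\<^sub>R u + b *\<^sub>R v) = a * l u + b * l v" if "u \<in> V" "v \<in> V" for a b u v
   using int[OF that(1)] int[OF that(2)] unfolding l_def by (simp add: scaleR_fun_def distrib_right mult.assoc)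
  have "(\<lambda>n. l (Y n)) \<longlonglongrightarrow> l g"
  proof (rule LIMSEQ_I)
   fix e :: real assume e: "e > 0"
   have "(\<lambda>n. l (h n)) \<longlonglongrightarrow> l g" unfolding l_def by (rule lim[OF \<psi>])
   from LIMSEQ_D[OF this, of "e/2"] e obtain N where N: "\<And>n. n \<ge> N \<Longrightarrow> \<bar>l (h n) - l g\<bar> < e / 2" by auto
   define S where "S = {u \<in> V. \<bar>l u - l g\<bar> \<le> e / 2}"
   have "convex S"
   proof (rule convexI)
    fix u v :: "plane \<Rightarrow> real" and a b :: real assume uv: "u \<in> S" "v \<in> S" "0 \<le> a" "0 \<le> b" "a + b = 1"
    have "l (a *\<^sub>R u + b *\<^sub>R v) - l g = a * (l u - l g) + b * (l v - l g)"
    proof -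
     have lg: "a * l g + b * l g = l g" unfolding distrib_right[symmetric] uv(5) by simp
     have "l (a *\<^sub>R u + b *\<^sub>R v) = a * l u + b * l v" by (rule ll) (use uv in \<open>auto simp: S_def\<close>)
     then show ?thesis using lg by (simp add: right_diff_distrib)
    qed
    also have "\<bar>\<dots>\<bar> \<le> a * (e / 2) + b * (e / 2)"
     using uv mult_left_mono[of "\<bar>l u - l g\<bar>" "e / 2" a] mult_left_mono[of "\<bar>l v - l g\<bar>" "e / 2" b]
     by (intro order_trans[OF abs_triangle_ineq] add_mono) (auto simp: abs_mult S_def)
    also have "\<dots> = e / 2" using uv(5) by (metis distrib_right mult_1)
    finally show "a *\<^sub>R u + b *\<^sub>R v \<in> S" using uv V.mem by (simp add: S_def)
   qed
   moreover have "h ` {N..} \<subseteq> S" using N h by (auto simp: S_def intro: less_imp_le)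
   ultimately have "C N \<subseteq> S" unfolding C_def by (rule hull_minimal[rotated])
   moreover have "C n \<subseteq> C N" if "n \<ge> N" for n unfolding C_def by (rule hull_mono) (use that in auto)
   ultimately have "\<bar>l (Y n) - l g\<bar> \<le> e / 2" if "n \<ge> N" for n using Y[of n] that by (force simp: S_def)
   then show "\<exists>no. \<forall>n\<ge>no. norm (l (Y n) - l g) < e" using e by (intro exI[of _ N]) force
  qed
  moreover have "(\<lambda>n. l (Y n)) \<longlonglongrightarrow> l L"
   unfolding l_def sqi_test_over_sa(2)[OF \<psi>]
   by (rule H1_tests_converge(1)[OF _ _ YL sqi_test_over_sa(1)[OF \<psi>]]) (use Y CV L V_H1 in blast)+
  ultimately have "l g = l L" by (rule LIMSEQ_unique)
  then show ?thesis by (simp add: l_def)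
 qed
 note dist = this
 have LH: "L \<in> H1 w \<Omega>" by (rule V_H1[OF L])
 note wL = H1_wD[OF LH]
 have lL: "locally_integrable \<Omega> L" using weak_derivD(1)[OF wL[of ex]] by simp
 have "AE P in M. 1 * L P + (-1) * g P = 0"
 proof (rule fundamental_lemma[OF open_dom li_linear[OF lL li]])
  fix \<psi> assume \<psi>: "\<psi> \<in> testfun \<Omega> {}"
  show "(LINT P|M. (1 * L P + (-1) * g P) * \<psi> P) = 0"
   using dist[OF \<psi>] li_test[OF open_dom lL \<psi>] li_test[OF open_dom li \<psi>]
   by (simp add: left_diff_distrib)
 qed
 then have ae: "AE P in M. L P = g P" by eventually_elim simp
 have wg: "is_weak_deriv \<Omega> e g (wD \<Omega> e L)" if e: "e \<in> {ex, ey}" for e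
  unfolding is_weak_deriv_def
 proof (intro conjI ballI li weak_derivD(2)[OF wL[OF e]])
  fix \<psi> assume \<psi>: "\<psi> \<in> testfun \<Omega> {}"
  show "(LINT P|M. g P * pd e \<psi> P) = - (LINT P|M. wD \<Omega> e L P * \<psi> P)"
   using dist[OF scs_pd[OF open_dom \<psi> e]] weak_derivD(3)[OF wL[OF e] \<psi>] by simp
 qed
 have "sqi M (\<lambda>P. sa P * g P)"
 proof (rule sqi_bound[of M "\<lambda>P. sa P * L P" _ 1])
  show "sqi M (\<lambda>P. sa P * L P)" using LH by (simp add: H1_iff)
  show "(\<lambda>P. sa P * g P) \<in> borel_measurable M" by (intro meas_times sa_meas li_measurable[OF open_dom li])
  show "AE P in M. \<bar>sa P * g P\<bar> \<le> 1 * \<bar>sa P * L P\<bar>" using ae by eventually_elim simp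
 qed
 then have gH: "g \<in> H1 w \<Omega>" using LH by (intro H1I[OF wg wg]) (auto simp: H1_iff)
 have "ip (L - g) (L - g) = 0"
 proof -
  have "(LINT P|M. (sa P * L P - sa P * g P)^2) = 0"
   by (rule integral_eq_zero_AE) (use ae in \<open>eventually_elim, simp\<close>)
  then show ?thesis using ip_diff[OF wL[of ex] wL[of ey] wg[of ex] wg[of ey]] by simp
 qed
 then show "g \<in> V" using V_closed[of "\<lambda>_. L" g] L gH by simp
qed

end

section \<open>Mollification\<close>

lemma sigma_finite_lebesgue: "sigma_finite_measure (lebesgue :: plane measure)"
proof
 show "\<exists>A. countable A \<and> A \<subseteq> sets (lebesgue :: plane measure) \<and> \<Union>A = space lebesgue \<and> (\<forall>a\<in>A. emeasure lebesgue a \<noteq> \<infinity>)"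
 proof (intro exI conjI ballI)
  show "countable (range (\<lambda>n::nat. cball (0::plane) (real n)))" by simp
  show "range (\<lambda>n::nat. cball (0::plane) (real n)) \<subseteq> sets lebesgue" by (auto intro!: compact_lebesgue)
  show "\<Union> (range (\<lambda>n::nat. cball (0::plane) (real n))) = space lebesgue"
  proof -
   have "\<exists>n::nat. norm x \<le> real n" for x :: plane by (rule real_arch_simple)
   then show ?thesis by auto
  qed
  show "emeasure lebesgue a \<noteq> \<infinity>" if a: "a \<in> range (\<lambda>n::nat. cball (0::plane) (real n))" for a
  proof -
   obtain n :: nat where n: "a = cball 0 (real n)" using a by blast
   show ?thesis using emeasure_bounded_finite[OF bounded_cball, of "0::plane" "real n"] unfolding n by simp
  qed
 qed
qed

interpretation LL: pair_sigma_finite "lebesgue :: plane measure" "lebesgue :: plane measure"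
 by (intro pair_sigma_finite.intro sigma_finite_lebesgue)

lemma measurable_id_lebesgue: "(\<lambda>x::plane. x) \<in> lebesgue \<rightarrow>\<^sub>M borel"
 by (intro measurable_completion) simp

lemma measurable_kernel:
 fixes k :: "plane \<Rightarrow> real"
 assumes "continuous_on UNIV k"
 shows "(\<lambda>p. k (fst p - snd p)) \<in> borel_measurable (lebesgue \<Otimes>\<^sub>M lebesgue)"
  "(\<lambda>p. k (snd p - fst p)) \<in> borel_measurable (lebesgue \<Otimes>\<^sub>M lebesgue)"
proof -
 have k: "k \<in> borel_measurable borel" using assms by (rule borel_measurable_continuous_onI)
 have f: "fst \<in> lebesgue \<Otimes>\<^sub>M lebesgue \<rightarrow>\<^sub>M (borel :: plane measure)" "snd \<in> lebesgue \<Otimes>\<^sub>M lebesgue \<rightarrow>\<^sub>M (borel :: plane measure)"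
  using measurable_compose[OF measurable_fst measurable_id_lebesgue] measurable_compose[OF measurable_snd measurable_id_lebesgue] by auto
 show "(\<lambda>p. k (fst p - snd p)) \<in> borel_measurable (lebesgue \<Otimes>\<^sub>M lebesgue)"
  by (rule measurable_compose[OF borel_measurable_diff[OF f] k])
 show "(\<lambda>p. k (snd p - fst p)) \<in> borel_measurable (lebesgue \<Otimes>\<^sub>M lebesgue)"
  by (rule measurable_compose[OF borel_measurable_diff[OF f(2,1)] k])
qed

lemma nn_integral_reflect:
 fixes f :: "plane \<Rightarrow> ennreal"
 assumes [measurable]: "f \<in> borel_measurable borel"
 shows "(\<integral>\<^sup>+x. f (t - x) \<partial>lborel) = (\<integral>\<^sup>+x. f x \<partial>lborel)" "(\<integral>\<^sup>+x. f (x - t) \<partial>lborel) = (\<integral>\<^sup>+x. f x \<partial>lborel)"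
proof -
 have "(\<integral>\<^sup>+x. f x \<partial>lborel) = (\<integral>\<^sup>+x. f x \<partial>density (distr lborel borel ((-) t)) (\<lambda>_. 1))"
  using lborel_affine[of "-1" t] by simp
 also have "\<dots> = (\<integral>\<^sup>+x. f (t - x) \<partial>lborel)"
  by (simp add: nn_integral_density nn_integral_distr)
 finally show "(\<integral>\<^sup>+x. f (t - x) \<partial>lborel) = (\<integral>\<^sup>+x. f x \<partial>lborel)" by simp
 have "(\<integral>\<^sup>+x. f x \<partial>lborel) = (\<integral>\<^sup>+x. f x \<partial>distr lborel borel ((+) (- t)))"
  using lborel_distr_plus[of "- t"] by simp
 also have "\<dots> = (\<integral>\<^sup>+x. f (x - t) \<partial>lborel)"
  by (simp add: nn_integral_distr)
 finally show "(\<integral>\<^sup>+x. f (x - t) \<partial>lborel) = (\<integral>\<^sup>+x. f x \<partial>lborel)" by simp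
qed

text \<open>The kernel is supported strictly above the origin, so that a convolution with it samples
 a function only at points further away from the line \<open>y = 0\<close>.\<close>
definition kern :: "real \<Rightarrow> plane \<Rightarrow> real" where
 "kern \<epsilon> P = bump 1 (-\<epsilon>, \<epsilon>) (\<epsilon>, 2 * \<epsilon>) P / (LINT Q|lborel. bump 1 (-\<epsilon>, \<epsilon>) (\<epsilon>, 2 * \<epsilon>) Q)"

lemma kern_facts:
 assumes e: "\<epsilon> > 0"
 shows smooth_kern: "smooth UNIV (kern \<epsilon>)" and kern_ge0: "\<And>P. kern \<epsilon> P \<ge> 0"
  and kern_0: "\<And>P. P \<notin> cbox (-\<epsilon>, \<epsilon>) (\<epsilon>, 2 * \<epsilon>) \<Longrightarrow> kern \<epsilon> P = 0"
  and kern_nz: "\<And>P. kern \<epsilon> P \<noteq> 0 \<Longrightarrow> \<bar>fst P\<bar> < \<epsilon> \<and> \<epsilon> < snd P \<and> snd P < 2 * \<epsilon> \<and> norm P \<le> 3 * \<epsilon>"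
  and nn_integral_kern: "(\<integral>\<^sup>+P. ennreal (kern \<epsilon> P) \<partial>lborel) = 1"
proof -
 let ?b = "bump 1 (-\<epsilon>, \<epsilon>) (\<epsilon>, 2 * \<epsilon>)" and ?B = "box (-\<epsilon>, \<epsilon>) (\<epsilon>, 2 * \<epsilon>) :: plane set"
 have cb: "continuous_on UNIV ?b" by (rule smooth_cont[OF open_UNIV smooth_bump[OF open_UNIV]])
 have b0: "?b P = 0" if "P \<notin> ?B" for P by (rule bump_0) (use that in auto)
 have "integrable (lebesgue_on (cbox (-\<epsilon>, \<epsilon>) (\<epsilon>, 2 * \<epsilon>))) ?b"
  by (rule integrable_continuous_compact[OF compact_cbox continuous_on_subset[OF cb subset_UNIV]])
 moreover have "?b P = 0" if "P \<in> UNIV - cbox (-\<epsilon>, \<epsilon>) (\<epsilon>, 2 * \<epsilon>)" for P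
  by (rule b0) (use that box_subset_cbox in blast)
 ultimately have "integrable lebesgue ?b"
  using integrable_support(1)[of "cbox (-\<epsilon>, \<epsilon>) (\<epsilon>, 2 * \<epsilon>)" UNIV ?b] compact_lebesgue[OF compact_cbox]
  by (simp add: lebesgue_on_UNIV_eq)
 then have bi: "integrable lborel ?b"
  using integrable_completion[of ?b lborel] borel_measurable_continuous_onI[OF cb] by simp
 have "(LINT Q|lborel. ?b Q) \<noteq> 0"
 proof
  assume "(LINT Q|lborel. ?b Q) = 0"
  then have "AE Q in lborel. ?b Q = 0"
   using integral_nonneg_eq_0_iff_AE[OF bi] bump_ge0 by (auto intro!: always_eventually)
  then have "AE Q in lborel. Q \<notin> ?B"
   by eventually_elim (metis bump_pos less_irrefl zero_less_one)
  then have "emeasure lborel ?B = 0"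
   by (subst (asm) AE_iff_measurable[of ?B]) auto
  moreover have "emeasure lborel ?B = ennreal (2 * \<epsilon> * \<epsilon>)"
   using e by (subst emeasure_lborel_box) (auto simp: Basis_prod_def inner_prod_def algebra_simps prod.union_disjoint)
  ultimately show False using e by simp
 qed
 moreover have "(LINT Q|lborel. ?b Q) \<ge> 0" by (rule integral_nonneg_AE) (simp add: bump_ge0)
 ultimately have I: "(LINT Q|lborel. ?b Q) > 0" by linarith
 show "smooth UNIV (kern \<epsilon>)"
  unfolding kern_def[abs_def] divide_inverse using smooth_mult[OF open_UNIV smooth_bump[OF open_UNIV] smooth_const[OF open_UNIV]] .
 show "kern \<epsilon> P \<ge> 0" for P using I bump_ge0 by (simp add: kern_def)
 show "kern \<epsilon> P = 0" if "P \<notin> cbox (-\<epsilon>, \<epsilon>) (\<epsilon>, 2 * \<epsilon>)" for P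
  using b0[of P] that box_subset_cbox by (auto simp: kern_def)
 show "\<bar>fst P\<bar> < \<epsilon> \<and> \<epsilon> < snd P \<and> snd P < 2 * \<epsilon> \<and> norm P \<le> 3 * \<epsilon>" if "kern \<epsilon> P \<noteq> 0" for P
 proof -
  have "P \<in> ?B" using that b0[of P] by (auto simp: kern_def)
  then have *: "\<bar>fst P\<bar> < \<epsilon>" "\<epsilon> < snd P" "snd P < 2 * \<epsilon>" unfolding in_box_plane by auto
  have "norm P \<le> \<bar>fst P\<bar> + \<bar>snd P\<bar>"
   unfolding norm_prod_def using sqrt_sum_squares_le_sum_abs[of "fst P" "snd P"] by simp
  then show ?thesis using * e by auto
 qed
 have "(\<integral>\<^sup>+P. ennreal (kern \<epsilon> P) \<partial>lborel) = ennreal (LINT P|lborel. kern \<epsilon> P)"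
  unfolding kern_def using bi I bump_ge0 by (intro nn_integral_eq_integral) auto
 also have "(LINT P|lborel. kern \<epsilon> P) = 1" unfolding kern_def using I by simp
 finally show "(\<integral>\<^sup>+P. ennreal (kern \<epsilon> P) \<partial>lborel) = 1" by simp
qed

lemma kern_meas: "\<epsilon> > 0 \<Longrightarrow> kern \<epsilon> \<in> borel_measurable borel"
 by (intro borel_measurable_continuous_onI smooth_cont[OF open_UNIV smooth_kern])

lemma kern_cont: "\<epsilon> > 0 \<Longrightarrow> continuous_on UNIV (kern \<epsilon>)"
 by (intro smooth_cont[OF open_UNIV smooth_kern])

lemma nn_integral_kern_shift:
 assumes "\<epsilon> > 0"
 shows "(\<integral>\<^sup>+Q. ennreal (kern \<epsilon> (Q - P)) \<partial>lebesgue) = 1" "(\<integral>\<^sup>+P. ennreal (kern \<epsilon> (Q - P)) \<partial>lebesgue) = 1"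
 using nn_integral_reflect(2)[of "\<lambda>P. ennreal (kern \<epsilon> P)" P] nn_integral_reflect(1)[of "\<lambda>P. ennreal (kern \<epsilon> P)" Q]
  nn_integral_kern[OF assms] kern_meas[OF assms] by (simp_all add: nn_integral_completion)

lemma kern_shift_meas:
 assumes "\<epsilon> > 0"
 shows "(\<lambda>Q. kern \<epsilon> (Q - P)) \<in> borel_measurable lebesgue" "(\<lambda>P. kern \<epsilon> (Q - P)) \<in> borel_measurable lebesgue"
 by (intro lebesgue_measurable_continuous continuous_on_compose2[OF kern_cont[OF assms]] continuous_intros; auto)+

text \<open>Jensen's inequality for the probability density \<open>kern\<close>.\<close>
lemma conv_kern_square_le:
 assumes e: "\<epsilon> > 0" and g: "g \<in> borel_measurable lebesgue"
 shows "ennreal ((conv g (kern \<epsilon>) P)^2) \<le> (\<integral>\<^sup>+Q. ennreal ((g Q)^2 * kern \<epsilon> (Q - P)) \<partial>lebesgue)"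
proof -
 let ?k = "\<lambda>Q. kern \<epsilon> (Q - P)"
 have k: "?k \<in> borel_measurable lebesgue" by (rule kern_shift_meas[OF e])
 have k0: "?k Q \<ge> 0" for Q by (rule kern_ge0[OF e])
 have "ennreal \<bar>conv g (kern \<epsilon>) P\<bar> \<le> (\<integral>\<^sup>+Q. ennreal (\<bar>g Q\<bar> * sqrt (?k Q)) * ennreal (sqrt (?k Q)) \<partial>lebesgue)"
 proof (cases "integrable lebesgue (\<lambda>Q. g Q * ?k Q)")
  case True
  have "ennreal \<bar>conv g (kern \<epsilon>) P\<bar> \<le> (\<integral>\<^sup>+Q. ennreal (norm (g Q * ?k Q)) \<partial>lebesgue)"
   using integral_norm_bound_ennreal[OF True] by (simp add: conv_def)
  also have "\<dots> = (\<integral>\<^sup>+Q. ennreal (\<bar>g Q\<bar> * sqrt (?k Q)) * ennreal (sqrt (?k Q)) \<partial>lebesgue)"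
   using k0 by (intro nn_integral_cong) (simp add: ennreal_mult'[symmetric] abs_mult mult.assoc)
  finally show ?thesis .
 next
  case False
  then show ?thesis by (simp add: conv_def not_integrable_integral_eq)
 qed
 then have "ennreal (\<bar>conv g (kern \<epsilon>) P\<bar>) ^ 2 \<le> (\<integral>\<^sup>+Q. ennreal (\<bar>g Q\<bar> * sqrt (?k Q)) * ennreal (sqrt (?k Q)) \<partial>lebesgue)^2"
  by (rule power_mono) simp
 also have "\<dots> \<le> (\<integral>\<^sup>+Q. (ennreal (\<bar>g Q\<bar> * sqrt (?k Q)))^2 \<partial>lebesgue) * (\<integral>\<^sup>+Q. (ennreal (sqrt (?k Q)))^2 \<partial>lebesgue)"
  by (rule Cauchy_Schwarz_nn_integral) (use g k in auto)
 also have "(\<integral>\<^sup>+Q. (ennreal (sqrt (?k Q)))^2 \<partial>lebesgue) = 1"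
  using k0 nn_integral_kern_shift(1)[OF e, of P] by (simp add: ennreal_power)
 also have "(\<integral>\<^sup>+Q. (ennreal (\<bar>g Q\<bar> * sqrt (?k Q)))^2 \<partial>lebesgue) = (\<integral>\<^sup>+Q. ennreal ((g Q)^2 * ?k Q) \<partial>lebesgue)"
  using k0 by (intro nn_integral_cong) (simp add: ennreal_power power_mult_distrib)
 finally show ?thesis by (simp add: ennreal_power)
qed

text \<open>For a mollification the weight at \<open>P\<close> has to be compared only with its values at the points \<open>Q\<close>
 that the kernel takes into account.\<close>
lemma conv_kern_L2_bound:
 assumes e: "\<epsilon> > 0" and S: "S \<in> sets lebesgue" and g: "g \<in> borel_measurable (lebesgue_on S)"
  and \<omega>: "\<omega> \<in> borel_measurable (lebesgue_on S)" "\<And>P. P \<in> S \<Longrightarrow> \<omega> P \<ge> 0"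
  and F: "\<And>P. P \<in> S \<Longrightarrow> F P = conv (zext S g) (kern \<epsilon>) P"
  and C: "C \<ge> 0" "\<And>P Q. P \<in> S \<Longrightarrow> Q \<in> S \<Longrightarrow> g Q \<noteq> 0 \<Longrightarrow> kern \<epsilon> (Q - P) \<noteq> 0 \<Longrightarrow> \<omega> P \<le> C * \<omega> Q"
  and i: "integrable (lebesgue_on S) (\<lambda>P. (g P)^2 * \<omega> P)" and iF: "integrable (lebesgue_on S) (\<lambda>P. (F P)^2 * \<omega> P)"
 shows "(LINT P|lebesgue_on S. (F P)^2 * \<omega> P) \<le> C * (LINT P|lebesgue_on S. (g P)^2 * \<omega> P)"
proof -
 let ?g = "zext S g" and ?w = "zext S \<omega>" and ?k = "kern \<epsilon>"
 have gm: "?g \<in> borel_measurable lebesgue" and wm: "?w \<in> borel_measurable lebesgue"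
  using g \<omega>(1) zext_measurable[OF S] by blast+
 have w0: "?w P \<ge> 0" for P using \<omega>(2) by (simp add: zext_def)
 have k0: "?k P \<ge> 0" for P by (rule kern_ge0[OF e])
 have kk: "(\<lambda>p. ?k (snd p - fst p)) \<in> borel_measurable (lebesgue \<Otimes>\<^sub>M lebesgue)" by (rule measurable_kernel(2)[OF kern_cont[OF e]])
 have nnS: "(\<integral>\<^sup>+P. ennreal (f P) \<partial>lebesgue_on S) = (\<integral>\<^sup>+P. ennreal (zext S f P) \<partial>lebesgue)" for f
  by (subst nn_integral_restrict_space) (use S in \<open>auto intro!: nn_integral_cong simp: zext_def indicator_def\<close>)
 have "ennreal (LINT P|lebesgue_on S. (F P)^2 * \<omega> P) = (\<integral>\<^sup>+P. ennreal ((F P)^2 * \<omega> P) \<partial>lebesgue_on S)"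
  by (rule nn_integral_eq_integral[symmetric, OF iF]) (auto simp: \<omega>(2))
 also have "\<dots> = (\<integral>\<^sup>+P. ennreal (zext S (\<lambda>P. (F P)^2 * \<omega> P) P) \<partial>lebesgue)" by (rule nnS)
 also have "\<dots> \<le> (\<integral>\<^sup>+P. (\<integral>\<^sup>+Q. ennreal (?w P * ((?g Q)^2 * ?k (Q - P))) \<partial>lebesgue) \<partial>lebesgue)"
 proof (rule nn_integral_mono)
  fix P
  have "ennreal (zext S (\<lambda>P. (F P)^2 * \<omega> P) P) = ennreal (?w P) * ennreal ((zext S F P)^2)"
   using w0[of P] by (simp add: zext_def ennreal_mult'[symmetric] mult.commute)
  also have "\<dots> \<le> ennreal (?w P) * (\<integral>\<^sup>+Q. ennreal ((?g Q)^2 * ?k (Q - P)) \<partial>lebesgue)"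
  proof (cases "P \<in> S")
   case True
   then show ?thesis using conv_kern_square_le[OF e gm, of P] F[OF True] by (intro mult_left_mono) (auto simp: zext_def)
  qed (simp add: zext_def)
  also have "\<dots> = (\<integral>\<^sup>+Q. ennreal (?w P) * ennreal ((?g Q)^2 * ?k (Q - P)) \<partial>lebesgue)"
   by (rule nn_integral_cmult[symmetric]) (intro meas_times borel_measurable_power gm kern_shift_meas[OF e] measurable_compose[OF _ measurable_ennreal])
  also have "\<dots> = (\<integral>\<^sup>+Q. ennreal (?w P * ((?g Q)^2 * ?k (Q - P))) \<partial>lebesgue)"
   using w0 by (intro nn_integral_cong) (simp add: ennreal_mult')
  finally show "ennreal (zext S (\<lambda>P. (F P)^2 * \<omega> P) P) \<le> (\<integral>\<^sup>+Q. ennreal (?w P * ((?g Q)^2 * ?k (Q - P))) \<partial>lebesgue)" .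
 qed
 also have "\<dots> = (\<integral>\<^sup>+Q. (\<integral>\<^sup>+P. ennreal (?w P * ((?g Q)^2 * ?k (Q - P))) \<partial>lebesgue) \<partial>lebesgue)"
 proof (rule LL.Fubini'[symmetric])
  have "(\<lambda>p. ennreal (?w (fst p) * ((?g (snd p))^2 * ?k (snd p - fst p)))) \<in> borel_measurable (lebesgue \<Otimes>\<^sub>M lebesgue)"
   by (intro measurable_compose[OF _ measurable_ennreal] meas_times borel_measurable_power kk
      measurable_compose[OF measurable_fst wm] measurable_compose[OF measurable_snd gm])
  then show "(\<lambda>(P, Q). ennreal (?w P * ((?g Q)^2 * ?k (Q - P)))) \<in> borel_measurable (lebesgue \<Otimes>\<^sub>M lebesgue)"
   by (simp add: case_prod_beta')
 qed
 also have "\<dots> \<le> (\<integral>\<^sup>+Q. ennreal (C * ((?g Q)^2 * ?w Q)) \<partial>lebesgue)"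
 proof (rule nn_integral_mono)
  fix Q
  have "(\<integral>\<^sup>+P. ennreal (?w P * ((?g Q)^2 * ?k (Q - P))) \<partial>lebesgue)
    \<le> (\<integral>\<^sup>+P. ennreal (C * ((?g Q)^2 * ?w Q)) * ennreal (?k (Q - P)) \<partial>lebesgue)"
  proof (rule nn_integral_mono)
   fix P
   have "?w P * ((?g Q)^2 * ?k (Q - P)) \<le> C * ((?g Q)^2 * ?w Q) * ?k (Q - P)"
   proof (cases "P \<in> S \<and> ?g Q \<noteq> 0 \<and> ?k (Q - P) \<noteq> 0")
    case True
    then have "Q \<in> S" by (auto simp: zext_def split: if_splits)
    then have "?w P \<le> C * ?w Q" using C(2)[of P Q] True by (auto simp: zext_def)
    from mult_right_mono[OF this, of "(?g Q)^2 * ?k (Q - P)"] show ?thesis using k0 by (simp add: algebra_simps)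
   next
    case False
    then have "?w P * ((?g Q)^2 * ?k (Q - P)) = 0" by (auto simp: zext_def)
    moreover have "0 \<le> C * ((?g Q)^2 * ?w Q) * ?k (Q - P)"
     by (intro mult_nonneg_nonneg C(1) w0 k0) simp
    ultimately show ?thesis by linarith
   qed
   then show "ennreal (?w P * ((?g Q)^2 * ?k (Q - P))) \<le> ennreal (C * ((?g Q)^2 * ?w Q)) * ennreal (?k (Q - P))"
    using k0 w0 C(1) by (subst ennreal_mult'[symmetric]) (auto intro: ennreal_leI)
  qed
  also have "\<dots> = ennreal (C * ((?g Q)^2 * ?w Q)) * (\<integral>\<^sup>+P. ennreal (?k (Q - P)) \<partial>lebesgue)"
   by (rule nn_integral_cmult) (intro measurable_compose[OF _ measurable_ennreal] kern_shift_meas[OF e])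
  finally show "(\<integral>\<^sup>+P. ennreal (?w P * ((?g Q)^2 * ?k (Q - P))) \<partial>lebesgue) \<le> ennreal (C * ((?g Q)^2 * ?w Q))"
   using nn_integral_kern_shift(2)[OF e, of Q] by simp
 qed
 also have "\<dots> = (\<integral>\<^sup>+Q. ennreal (zext S (\<lambda>Q. C * ((g Q)^2 * \<omega> Q)) Q) \<partial>lebesgue)"
  by (rule nn_integral_cong) (simp add: zext_def)
 also have "\<dots> = (\<integral>\<^sup>+Q. ennreal (C * ((g Q)^2 * \<omega> Q)) \<partial>lebesgue_on S)" by (rule nnS[symmetric])
 also have "\<dots> = ennreal (LINT Q|lebesgue_on S. C * ((g Q)^2 * \<omega> Q))"
  by (rule nn_integral_eq_integral) (use i C(1) in \<open>auto simp: \<omega>(2)\<close>)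
 finally have "ennreal (LINT P|lebesgue_on S. (F P)^2 * \<omega> P) \<le> ennreal (C * (LINT P|lebesgue_on S. (g P)^2 * \<omega> P))" using i by simp
 moreover have "(LINT P|lebesgue_on S. (g P)^2 * \<omega> P) \<ge> 0" by (rule integral_nonneg_AE) (auto intro!: AE_I2 simp: \<omega>(2))
 ultimately show ?thesis using C(1) by (subst (asm) ennreal_le_iff) auto
qed

text \<open>Fubini's theorem moves the kernel to \<open>\<psi>\<close>, which is uniformly continuous.\<close>
lemma conv_kern_test:
 assumes h: "integrable lebesgue h" and e: "\<epsilon> > 0" and c: "continuous_on UNIV \<psi>" and K: "compact K" "\<And>P. P \<notin> K \<Longrightarrow> \<psi> P = 0"
  and d: "\<And>P Q. dist P Q \<le> 3 * \<epsilon> \<Longrightarrow> \<bar>\<psi> P - \<psi> Q\<bar> \<le> \<delta>"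
 shows "\<bar>(LINT P|lebesgue. conv h (kern \<epsilon>) P * \<psi> P) - (LINT P|lebesgue. h P * \<psi> P)\<bar> \<le> \<delta> * (LINT P|lebesgue. \<bar>h P\<bar>)"
proof -
 let ?k = "kern \<epsilon>"
 have hm: "h \<in> borel_measurable lebesgue" using h by simp
 have pm: "\<psi> \<in> borel_measurable lebesgue" by (rule lebesgue_measurable_continuous[OF c])
 have pi: "integrable lebesgue \<psi>"
  using integrable_continuous_compact[OF K(1) continuous_on_subset[OF c subset_UNIV]]
   integrable_support(1)[of K UNIV \<psi>] K(2) compact_lebesgue[OF K(1)]
  by (simp add: lebesgue_on_UNIV_eq)
 obtain B where B: "B \<ge> 0" "\<And>P. \<bar>?k P\<bar> \<le> B"
  by (rule bounded_csupport[OF kern_cont[OF e] compact_cbox[of "(-\<epsilon>, \<epsilon>)" "(\<epsilon>, 2 * \<epsilon>)"]])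
    (use kern_0[OF e] in blast)+
 have prod: "integrable (lebesgue \<Otimes>\<^sub>M lebesgue) (\<lambda>p. B * (h (fst p) * \<psi> (snd p)))"
 proof (intro integrable_mult_right LL.Fubini_integrable)
  show "(\<lambda>p. h (fst p) * \<psi> (snd p)) \<in> borel_measurable (lebesgue \<Otimes>\<^sub>M lebesgue)"
   by (intro meas_times measurable_compose[OF measurable_fst hm] measurable_compose[OF measurable_snd pm])
  show "integrable lebesgue (\<lambda>x. LINT y|lebesgue. norm (h (fst (x, y)) * \<psi> (snd (x, y))))"
   using h by (simp add: abs_mult)
  show "AE x in lebesgue. integrable lebesgue (\<lambda>y. h (fst (x, y)) * \<psi> (snd (x, y)))"
   using pi by (intro AE_I2) simp
 qed
 have joint: "integrable (lebesgue \<Otimes>\<^sub>M lebesgue) (\<lambda>p. h (fst p) * ?k (fst p - snd p) * \<psi> (snd p))"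
 proof (rule integrable_le[OF prod])
  show "(\<lambda>p. h (fst p) * ?k (fst p - snd p) * \<psi> (snd p)) \<in> borel_measurable (lebesgue \<Otimes>\<^sub>M lebesgue)"
   by (intro meas_times measurable_compose[OF measurable_fst hm] measurable_compose[OF measurable_snd pm] measurable_kernel(1) kern_cont[OF e])
  show "AE p in lebesgue \<Otimes>\<^sub>M lebesgue. norm (h (fst p) * ?k (fst p - snd p) * \<psi> (snd p)) \<le> norm (B * (h (fst p) * \<psi> (snd p)))"
  proof (rule AE_I2)
   fix p :: "plane \<times> plane"
   have "\<bar>?k (fst p - snd p)\<bar> * \<bar>h (fst p) * \<psi> (snd p)\<bar> \<le> B * \<bar>h (fst p) * \<psi> (snd p)\<bar>"
    by (rule mult_right_mono[OF B(2)]) simp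
   then show "norm (h (fst p) * ?k (fst p - snd p) * \<psi> (snd p)) \<le> norm (B * (h (fst p) * \<psi> (snd p)))"
    using B(1) by (simp add: abs_mult mult.assoc mult.left_commute)
  qed
 qed
 then have joint': "integrable (lebesgue \<Otimes>\<^sub>M lebesgue) (\<lambda>(Q, P). h Q * ?k (Q - P) * \<psi> P)" by (simp add: case_prod_beta')
 define m where "m Q = (LINT P|lebesgue. ?k (Q - P) * \<psi> P)" for Q
 have "(LINT P|lebesgue. conv h ?k P * \<psi> P) = (LINT P|lebesgue. (LINT Q|lebesgue. h Q * ?k (Q - P) * \<psi> P))"
  unfolding conv_def by simp
 also have "\<dots> = (LINT Q|lebesgue. (LINT P|lebesgue. h Q * ?k (Q - P) * \<psi> P))"
  by (rule LL.Fubini_integral[OF joint'])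
 also have "\<dots> = (LINT Q|lebesgue. h Q * m Q)" by (simp add: m_def mult.assoc)
 finally have eq: "(LINT P|lebesgue. conv h ?k P * \<psi> P) = (LINT Q|lebesgue. h Q * m Q)" .
 have ki: "integrable lebesgue (\<lambda>P. ?k (Q - P))" for Q
  by (rule integrableI_nonneg) (use kern_shift_meas[OF e] kern_ge0[OF e] nn_integral_kern_shift(2)[OF e, of Q] in auto)
 have k1: "(LINT P|lebesgue. ?k (Q - P)) = 1" for Q
  using nn_integral_eq_integral[OF ki, of Q] kern_ge0[OF e] nn_integral_kern_shift(2)[OF e, of Q] by simp
 have kpi: "integrable lebesgue (\<lambda>P. ?k (Q - P) * \<psi> P)" for Q
 proof (rule integrable_le[OF integrable_mult_right[OF pi, of B]])
  show "(\<lambda>P. ?k (Q - P) * \<psi> P) \<in> borel_measurable lebesgue" by (intro meas_times kern_shift_meas[OF e] pm)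
  show "AE P in lebesgue. norm (?k (Q - P) * \<psi> P) \<le> norm (B * \<psi> P)"
   by (rule AE_I2) (simp add: abs_mult mult_right_mono[OF order_trans[OF B(2) abs_ge_self]])
 qed
 have near: "\<bar>m Q - \<psi> Q\<bar> \<le> \<delta>" for Q
 proof -
  have "m Q - \<psi> Q = (LINT P|lebesgue. ?k (Q - P) * \<psi> P) - (LINT P|lebesgue. ?k (Q - P) * \<psi> Q)"
   by (simp add: m_def k1)
  also have "\<dots> = (LINT P|lebesgue. ?k (Q - P) * (\<psi> P - \<psi> Q))"
   using kpi ki by (simp add: right_diff_distrib)
  also have "\<bar>\<dots>\<bar> \<le> (LINT P|lebesgue. ?k (Q - P) * \<delta>)"
  proof (rule order_trans[OF integral_abs_bound], rule integral_mono)
   show "integrable lebesgue (\<lambda>P. \<bar>?k (Q - P) * (\<psi> P - \<psi> Q)\<bar>)"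
    using kpi ki by (simp add: right_diff_distrib)
   show "integrable lebesgue (\<lambda>P. ?k (Q - P) * \<delta>)" using ki by simp
   fix P
   show "\<bar>?k (Q - P) * (\<psi> P - \<psi> Q)\<bar> \<le> ?k (Q - P) * \<delta>"
   proof (cases "?k (Q - P) = 0")
    case False
    then have "dist P Q \<le> 3 * \<epsilon>" using kern_nz[OF e False] by (simp add: dist_norm norm_minus_commute)
    then show ?thesis using d[of P Q] kern_ge0[OF e, of "Q - P"] by (simp add: abs_mult mult_left_mono)
   qed simp
  qed
  also have "\<dots> = \<delta>" by (simp add: k1)
  finally show ?thesis .
 qed
 have hp: "integrable lebesgue (\<lambda>P. h P * \<psi> P)"
 proof -
  obtain B' where B': "\<And>P. \<bar>\<psi> P\<bar> \<le> B'"
   by (rule bounded_csupport[OF c K(1)]) (use K(2) in blast)+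
  show ?thesis
  proof (rule integrable_le[OF integrable_mult_left[OF h, of B']])
   show "AE P in lebesgue. norm (h P * \<psi> P) \<le> norm (h P * B')"
    by (rule AE_I2) (simp add: abs_mult mult_left_mono[OF order_trans[OF B' abs_ge_self]])
  qed (intro meas_times hm pm)
 qed
 have mi: "integrable lebesgue (\<lambda>Q. h Q * m Q)"
  using LL.integrable_fst'[OF joint'] by (simp add: m_def mult.assoc)
 have "(LINT P|lebesgue. conv h ?k P * \<psi> P) - (LINT P|lebesgue. h P * \<psi> P) = (LINT Q|lebesgue. h Q * (m Q - \<psi> Q))"
  unfolding eq using mi hp by (simp add: right_diff_distrib)
 also have "\<bar>\<dots>\<bar> \<le> (LINT Q|lebesgue. \<bar>h Q\<bar> * \<delta>)"
 proof (rule order_trans[OF integral_abs_bound], rule integral_mono)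
  show "integrable lebesgue (\<lambda>Q. \<bar>h Q * (m Q - \<psi> Q)\<bar>)" using mi hp by (simp add: right_diff_distrib)
  show "\<bar>h Q * (m Q - \<psi> Q)\<bar> \<le> \<bar>h Q\<bar> * \<delta>" for Q unfolding abs_mult by (rule mult_left_mono[OF near]) simp
 qed (use h in simp)
 finally show ?thesis by (simp add: mult.commute)
qed

lemma Ck_on_translate: "Ck_on n UNIV f \<Longrightarrow> Ck_on n UNIV (\<lambda>Q. f (Q - P))"
proof (induction n arbitrary: f)
 case 0
 then show ?case by (auto intro!: continuous_on_compose2[of UNIV f] continuous_intros)
next
 case (Suc n)
 show ?case
 proof (rule Ck_on_SucI[OF open_UNIV, where fx="\<lambda>Q. pd ex f (Q - P)" and fy="\<lambda>Q. pd ey f (Q - P)"])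
  fix Q
  have "((\<lambda>Q. Q - P) has_derivative (\<lambda>h. h)) (at Q)" by (auto intro!: derivative_eq_intros)
  from has_derivative_compose[OF this Ck_on_SucD[OF open_UNIV Suc.prems]]
  show "((\<lambda>Q. f (Q - P)) has_derivative (\<lambda>h. fst h * pd ex f (Q - P) + snd h * pd ey f (Q - P))) (at Q)" by simp
 qed (use Suc Ck_on_pd in blast)+
qed

lemma smooth_translate:
 assumes "smooth UNIV f"
 shows "smooth UNIV (\<lambda>Q. f (Q - P))" "pd e (\<lambda>Q. f (Q - P)) Q = pd e f (Q - P)"
proof -
 show "smooth UNIV (\<lambda>Q. f (Q - P))" using assms Ck_on_translate unfolding smooth_def by blast
 show "pd e (\<lambda>Q. f (Q - P)) Q = pd e f (Q - P)" unfolding pd_def by (simp add: algebra_simps)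
qed

lemma pd_at_max:
 assumes "smooth UNIV f" "e \<in> {ex, ey}" "\<And>Q. f Q \<le> f P"
 shows "pd e f P = 0"
proof -
 have "((\<lambda>t. f (P + t *\<^sub>R e)) has_real_derivative pd e f (P + 0 *\<^sub>R e)) (at 0)"
  by (rule pd_field_derivative[OF smooth_Ck[OF assms(1)] assms(2)])
 then have "pd e f (P + 0 *\<^sub>R e) = 0"
  by (rule DERIV_local_max[of _ _ _ 1]) (use assms(3) in auto)
 then show ?thesis by simp
qed

context weighted begin

text \<open>If \<open>h\<close> is supported in \<open>K\<close>, a weak derivative may be tested with functions supported in the half
 plane, because \<open>K\<close> meets the half plane only inside the domain.\<close>
lemma weak_deriv_test_half_plane:
 assumes h: "is_weak_deriv \<Omega> e h g" and e: "e \<in> {ex, ey}"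
  and K: "compact K" "K \<inter> half_plane \<subseteq> \<Omega>" "\<And>P. P \<in> \<Omega> - K \<Longrightarrow> h P = 0" "\<And>P. P \<in> \<Omega> - K \<Longrightarrow> g P = 0"
  and k: "smooth UNIV k" and S: "compact S" "S \<subseteq> half_plane" "\<And>P. P \<notin> S \<Longrightarrow> k P = 0"
 shows "(LINT P|M. h P * pd e k P) = - (LINT P|M. g P * k P)"
proof -
 have KS: "compact (K \<inter> S)" "K \<inter> S \<subseteq> \<Omega>" using K S by (auto intro: compact_Int)
 obtain \<zeta> C where z: "smooth UNIV \<zeta>" "compact C" "C \<subseteq> \<Omega>" "\<And>P. P \<notin> C \<Longrightarrow> \<zeta> P = 0" "\<And>P. P \<in> K \<inter> S \<Longrightarrow> \<zeta> P = 1"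
  "\<And>P. 0 \<le> \<zeta> P" "\<And>P. \<zeta> P \<le> 1"
  by (rule cutoff[OF KS open_dom]) (rule that)
 have zs: "smooth \<Omega> \<zeta>" "smooth \<Omega> k" using smooth_subset[OF open_UNIV] z(1) k by auto
 have t: "(\<lambda>P. \<zeta> P * k P) \<in> testfun \<Omega> {}"
  by (rule scs_emptyI[OF open_dom smooth_mult[OF open_dom zs] z(2,3)]) (use z(4) in auto)
 have k0: "pd e k P = 0" if "P \<notin> S" for P
  by (rule pd_vanishes[OF compact_imp_closed[OF S(1)] S(3) that])
 have "(LINT P|M. h P * pd e (\<lambda>P. \<zeta> P * k P) P) = (LINT P|M. h P * pd e k P)"
 proof (rule lint_cong)
  fix P assume "P \<in> space M"
  then have P: "P \<in> \<Omega>" by simp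
  have m: "pd e (\<lambda>P. \<zeta> P * k P) P = \<zeta> P * pd e k P + pd e \<zeta> P * k P"
   by (rule pd_mult'[OF open_dom P smooth_Ck[OF zs(1)] smooth_Ck[OF zs(2)] e])
  show "h P * pd e (\<lambda>P. \<zeta> P * k P) P = h P * pd e k P"
  proof (cases "P \<in> K \<inter> S")
   case True
   then have "pd e \<zeta> P = 0" using z(5,7) by (intro pd_at_max[OF z(1) e]) simp
   then show ?thesis using True z(5) m by simp
  next
   case False
   then show ?thesis using P K(3)[of P] k0[of P] S(3)[of P] m by auto
  qed
 qed simp
 moreover have "(LINT P|M. g P * (\<zeta> P * k P)) = (LINT P|M. g P * k P)"
 proof (rule lint_cong)
  fix P assume "P \<in> space M"
  then have P: "P \<in> \<Omega>" by simp
  show "g P * (\<zeta> P * k P) = g P * k P"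
   using P K(4)[of P] S(3)[of P] z(5)[of P] by (cases "P \<in> K \<inter> S") auto
 qed simp
 ultimately show ?thesis using weak_derivD(3)[OF h t] by simp
qed

lemma pd_conv_kern:
 assumes h: "is_weak_deriv \<Omega> e h g" and e: "e \<in> {ex, ey}" and hi: "integrable M h"
  and K: "compact K" "K \<inter> half_plane \<subseteq> \<Omega>" "\<And>P. P \<in> \<Omega> - K \<Longrightarrow> h P = 0" "\<And>P. P \<in> \<Omega> - K \<Longrightarrow> g P = 0"
  and \<epsilon>: "\<epsilon> > 0" and P: "P \<in> \<Omega>"
 shows "pd e (conv (zext \<Omega> h) (kern \<epsilon>)) P = conv (zext \<Omega> g) (kern \<epsilon>) P"
proof -
 have hi': "integrable lebesgue (zext \<Omega> h)" using hi zext_integrable[OF open_lebesgue[OF open_dom]] by blast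
 have "pd e (conv (zext \<Omega> h) (kern \<epsilon>)) P = conv (zext \<Omega> h) (\<lambda>P. - pd e (kern \<epsilon>) P) P"
  by (rule smooth_conv(2)[OF hi' smooth_kern[OF \<epsilon>] compact_cbox[of "(-\<epsilon>, \<epsilon>)" "(\<epsilon>, 2 * \<epsilon>)"] kern_0[OF \<epsilon>] e])
 also have "\<dots> = - (LINT Q|M. h Q * pd e (kern \<epsilon>) (Q - P))"
  unfolding conv_def zext_integral[OF open_lebesgue[OF open_dom]] Bochner_Integration.integral_minus[symmetric]
  by (rule lint_cong) (auto simp: zext_def)
 also have "(LINT Q|M. h Q * pd e (kern \<epsilon>) (Q - P)) = (LINT Q|M. h Q * pd e (\<lambda>Q. kern \<epsilon> (Q - P)) Q)"
  by (simp add: smooth_translate(2)[OF smooth_kern[OF \<epsilon>]])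
 also have "\<dots> = - (LINT Q|M. g Q * kern \<epsilon> (Q - P))"
 proof (rule weak_deriv_test_half_plane[OF h e K smooth_translate(1)[OF smooth_kern[OF \<epsilon>]]])
  show "compact (cbox (fst P - \<epsilon>, snd P + \<epsilon>) (fst P + \<epsilon>, snd P + 2 * \<epsilon>))" by (rule compact_cbox)
  show "cbox (fst P - \<epsilon>, snd P + \<epsilon>) (fst P + \<epsilon>, snd P + 2 * \<epsilon>) \<subseteq> half_plane"
   using y_pos[OF P] \<epsilon> by (auto simp: half_plane_def cbox_Pair_eq)
  show "kern \<epsilon> (Q - P) = 0" if "Q \<notin> cbox (fst P - \<epsilon>, snd P + \<epsilon>) (fst P + \<epsilon>, snd P + 2 * \<epsilon>)" for Q
  proof (rule ccontr)
   assume "kern \<epsilon> (Q - P) \<noteq> 0"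
   from kern_nz[OF \<epsilon> this] that show False by (cases Q; cases P) (auto simp: cbox_Pair_eq abs_less_iff)
  qed
 qed
 also have "(LINT Q|M. g Q * kern \<epsilon> (Q - P)) = conv (zext \<Omega> g) (kern \<epsilon>) P"
  unfolding conv_def zext_integral[OF open_lebesgue[OF open_dom]]
  by (rule lint_cong) (auto simp: zext_def)
 finally show ?thesis by simp
qed

text \<open>The mollification is smooth on the whole plane, so its derivatives extend continuously to \<open>T\<close>; its
 support lies within distance \<open>3 * \<epsilon>\<close> of \<open>K\<close>.\<close>
lemma conv_kern_scs:
 assumes hi: "integrable M h" and T: "T \<subseteq> {P. snd P = 0}"
  and K: "compact K" "\<And>P. P \<in> \<Omega> - K \<Longrightarrow> h P = 0"
  and nbhd: "\<And>P Q. P \<in> K \<Longrightarrow> dist P Q < d \<Longrightarrow> snd Q \<ge> 0 \<Longrightarrow> Q \<in> \<Omega> \<union> T"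
  and \<epsilon>: "\<epsilon> > 0" "3 * \<epsilon> < d"
 shows "conv (zext \<Omega> h) (kern \<epsilon>) \<in> testfun \<Omega> T"
proof -
 let ?f = "conv (zext \<Omega> h) (kern \<epsilon>)"
 have hi': "integrable lebesgue (zext \<Omega> h)" using hi zext_integrable[OF open_lebesgue[OF open_dom]] by blast
 have s: "smooth UNIV ?f"
  by (rule smooth_conv(1)[OF hi' smooth_kern[OF \<epsilon>(1)] compact_cbox[of "(-\<epsilon>, \<epsilon>)" "(\<epsilon>, 2 * \<epsilon>)"] kern_0[OF \<epsilon>(1)]])
 define Ke where "Ke = {x + y |x y. x \<in> K \<and> y \<in> cball 0 (3 * \<epsilon>)} \<inter> {P. snd P \<ge> 0}"
 have Kc: "compact Ke" unfolding Ke_def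
  by (intro compact_Int_closed compact_sums K(1) compact_cball closed_Collect_le continuous_intros)
 have Ks: "Ke \<subseteq> \<Omega> \<union> T"
 proof
  fix P assume "P \<in> Ke"
  then obtain x y where "P = x + y" "x \<in> K" "norm y \<le> 3 * \<epsilon>" "snd P \<ge> 0" by (auto simp: Ke_def)
  then show "P \<in> \<Omega> \<union> T" using \<epsilon> by (intro nbhd[of x]) (auto simp: dist_norm)
 qed
 have z: "?f P = 0" if P: "P \<in> \<Omega> \<union> T - Ke" for P
 proof -
  have y: "snd P \<ge> 0" using P y_pos[of P] T by auto
  have "zext \<Omega> h Q * kern \<epsilon> (Q - P) = 0" for Q
  proof (rule ccontr)
   assume n: "zext \<Omega> h Q * kern \<epsilon> (Q - P) \<noteq> 0"
   then have "Q \<in> K" using K(2)[of Q] by (auto simp: zext_def split: if_splits)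
   moreover have "norm (P - Q) \<le> 3 * \<epsilon>" using kern_nz[OF \<epsilon>(1), of "Q - P"] n by (simp add: norm_minus_commute)
   ultimately have "Q + (P - Q) \<in> {x + y |x y. x \<in> K \<and> y \<in> cball 0 (3 * \<epsilon>)}" unfolding mem_cball_0 by blast
   then have "P \<in> Ke" unfolding Ke_def using y by simp
   then show False using P by blast
  qed
  then have "(\<lambda>Q. zext \<Omega> h Q * kern \<epsilon> (Q - P)) = (\<lambda>_. 0)" by (rule ext)
  then show ?thesis unfolding conv_def by simp
 qed
 have c: "continuous_on (\<Omega> \<union> T) ((pd ex ^^ i) ((pd ey ^^ j) ?f))" for i j
  by (rule continuous_on_subset[OF smooth_cont[OF open_UNIV smooth_pd_pow[OF smooth_pd_pow[OF s]]] subset_UNIV]) simp_all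
 have 1: "\<forall>k. Ck_on k \<Omega> ?f" using smooth_subset[OF open_UNIV subset_UNIV s] by (simp add: smooth_def)
 have 2: "continuous_on (\<Omega> \<union> T) ?f" using c[of 0 0] by simp
 show ?thesis
  unfolding smooth_compact_support_def using 1 2 c Kc Ks z by blast
qed

text \<open>The mollifications are test functions, and by the monotonicity of the weight their gradients are
 bounded in norm. They converge as distributions, so \<open>V_weakly_closed\<close> applies. The assumption \<open>B\<close> bounds the
 functions themselves, where the weight has no such monotonicity.\<close>
lemma compactly_supported_in_V:
 assumes wx: "is_weak_deriv \<Omega> ex h gx" and wy: "is_weak_deriv \<Omega> ey h gy"
  and hi: "integrable M h" and gx: "sqi M (\<lambda>P. sb P * gx P)" and gy: "sqi M (\<lambda>P. sb P * gy P)"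
  and T: "T \<subseteq> {P. snd P = 0}"
  and K: "compact K" "K \<subseteq> \<Omega> \<union> T"
   "\<And>P. P \<in> \<Omega> - K \<Longrightarrow> h P = 0" "\<And>P. P \<in> \<Omega> - K \<Longrightarrow> gx P = 0" "\<And>P. P \<in> \<Omega> - K \<Longrightarrow> gy P = 0"
  and d: "d > 0" and nbhd: "\<And>P Q. P \<in> K \<Longrightarrow> dist P Q < d \<Longrightarrow> snd Q \<ge> 0 \<Longrightarrow> Q \<in> \<Omega> \<union> T"
  and C: "C \<ge> 0" "\<And>P Q. P \<in> \<Omega> \<Longrightarrow> Q \<in> \<Omega> \<Longrightarrow> Q \<in> K \<Longrightarrow> dist P Q < d \<Longrightarrow> snd P < snd Q \<Longrightarrow> snd P * w P \<le> C * (snd Q * w Q)"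
  and B: "\<And>\<epsilon>. 0 < \<epsilon> \<Longrightarrow> 3 * \<epsilon> < d \<Longrightarrow> (LINT P|M. (sa P * conv (zext \<Omega> h) (kern \<epsilon>) P)^2) \<le> B"
 shows "h \<in> V"
proof -
 define \<epsilon> where "\<epsilon> n = d / real (n + 2) / 3" for n :: nat
 have e: "\<epsilon> n > 0" "3 * \<epsilon> n < d" for n
 proof -
  show "\<epsilon> n > 0" using d by (simp add: \<epsilon>_def)
  have "3 * (a / 3) = a" for a :: real by simp
  then have "3 * \<epsilon> n = d / real (n + 2)" unfolding \<epsilon>_def .
  also have "\<dots> < d / 1" using d by (intro divide_strict_left_mono) auto
  finally show "3 * \<epsilon> n < d" by simp
 qed
 define \<phi> where "\<phi> n = conv (zext \<Omega> h) (kern (\<epsilon> n))" for n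
 have scs: "\<phi> n \<in> testfun \<Omega> T" for n
  unfolding \<phi>_def by (rule conv_kern_scs[OF hi T K(1,3) nbhd e])
 have KH: "K \<inter> half_plane \<subseteq> \<Omega>" using K(2) T by (auto simp: half_plane_def)
 have H: "\<phi> n \<in> H1 w \<Omega>" for n using scs scs_H1 by blast
 have cl: "is_weak_deriv \<Omega> e (\<phi> n) (pd e (\<phi> n))" if "e \<in> {ex, ey}" for e n
  using weak_deriv_classical[OF open_dom that] scsD(1)[OF scs] by (simp add: smooth_def)
 have D: "(LINT P|M. (sb P * pd e (\<phi> n) P)^2) \<le> C * (LINT P|M. (sb P * g P)^2)"
  if e': "e \<in> {ex, ey}" and g: "is_weak_deriv \<Omega> e h g" "sqi M (\<lambda>P. sb P * g P)" "\<And>P. P \<in> \<Omega> - K \<Longrightarrow> g P = 0" for e g n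
 proof -
  have eqS: "(LINT P|M. (sb P * f P)^2) = (LINT P|M. (f P)^2 * (snd P * w P))"
   "integrable M (\<lambda>P. (sb P * f P)^2) \<longleftrightarrow> integrable M (\<lambda>P. (f P)^2 * (snd P * w P))" for f
   by (rule lint_cong, simp, simp add: power_mult_distrib sb_sq mult.commute,
     rule Bochner_Integration.integrable_cong, simp, simp add: power_mult_distrib sb_sq mult.commute)
  have iF: "sqi M (\<lambda>P. sb P * pd e (\<phi> n) P)"
  proof (rule sqi_bound[of M "\<lambda>P. sb P * wD \<Omega> e (\<phi> n) P" _ 1])
   show "sqi M (\<lambda>P. sb P * wD \<Omega> e (\<phi> n) P)" using H[of n] e' by (auto simp: H1_iff)
   show "(\<lambda>P. sb P * pd e (\<phi> n) P) \<in> borel_measurable M"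
    by (intro meas_times sb_meas li_measurable[OF open_dom weak_derivD(2)[OF cl[OF e']]])
   show "AE P in M. \<bar>sb P * pd e (\<phi> n) P\<bar> \<le> 1 * \<bar>sb P * wD \<Omega> e (\<phi> n) P\<bar>"
    using wD_AE[OF open_dom e' cl[OF e', of n]] by eventually_elim simp
  qed
  show ?thesis
   unfolding eqS(1)
  proof (rule conv_kern_L2_bound[OF e(1)[of n] open_lebesgue[OF open_dom] li_measurable[OF open_dom weak_derivD(2)[OF g(1)]] _ _ _ C(1)])
   show "(\<lambda>P. snd P * w P) \<in> borel_measurable M" by (rule cont_meas) (intro continuous_intros cont_w)
   show "P \<in> \<Omega> \<Longrightarrow> 0 \<le> snd P * w P" for P using y_pos[of P] w_pos[of P] by simp
   show "pd e (\<phi> n) P = conv (zext \<Omega> g) (kern (\<epsilon> n)) P" if "P \<in> \<Omega>" for P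
    unfolding \<phi>_def by (rule pd_conv_kern[OF g(1) e' hi K(1) KH K(3) g(3) e(1) that])
   show "snd P * w P \<le> C * (snd Q * w Q)" if PQ: "P \<in> \<Omega>" "Q \<in> \<Omega>" "g Q \<noteq> 0" "kern (\<epsilon> n) (Q - P) \<noteq> 0" for P Q
   proof (rule C(2)[OF PQ(1,2)])
    show "Q \<in> K" using g(3)[of Q] PQ by blast
    have "dist P Q \<le> 3 * \<epsilon> n" using kern_nz[OF e(1) PQ(4)] by (simp add: dist_norm norm_minus_commute)
    then show "dist P Q < d" using e(2)[of n] by simp
    show "snd P < snd Q" using kern_nz[OF e(1) PQ(4)] e(1)[of n] by simp
   qed
   show "integrable M (\<lambda>P. (g P)^2 * (snd P * w P))" using g(2) eqS(2) by (simp add: sqi_def)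
   show "integrable M (\<lambda>P. (pd e (\<phi> n) P)^2 * (snd P * w P))" using iF eqS(2) by (simp add: sqi_def)
  qed
 qed
 show ?thesis
 proof (rule V_weakly_closed[OF scs_V[OF scs] _ weak_derivD(1)[OF wx]])
  fix n
  have "ip (\<phi> n) (\<phi> n) = (LINT P|M. (sa P * \<phi> n P)^2) + (LINT P|M. (sb P * pd ex (\<phi> n) P)^2) + (LINT P|M. (sb P * pd ey (\<phi> n) P)^2)"
   using ip_eq[OF cl[of ex n] cl[of ey n] cl[of ex n] cl[of ey n]] by (simp add: power2_eq_square)
  also have "\<dots> \<le> B + C * (LINT P|M. (sb P * gx P)^2) + C * (LINT P|M. (sb P * gy P)^2)"
   using D[OF _ wx gx K(4), of n] D[OF _ wy gy K(5), of n] B[OF e, of n] unfolding \<phi>_def by simp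
  finally show "ip (\<phi> n) (\<phi> n) \<le> B + C * (LINT P|M. (sb P * gx P)^2) + C * (LINT P|M. (sb P * gy P)^2)" .
 next
  fix \<psi> assume \<psi>: "\<psi> \<in> testfun \<Omega> {}"
  show "(\<lambda>n. LINT P|M. \<phi> n P * \<psi> P) \<longlonglongrightarrow> (LINT P|M. h P * \<psi> P)"
  proof (rule scs_emptyE[OF \<psi>])
   fix S assume S: "compact S" "S \<subseteq> \<Omega>" "\<And>P. P \<in> \<Omega> - S \<Longrightarrow> \<psi> P = 0"
   let ?p = "zext \<Omega> \<psi>" and ?h = "zext \<Omega> h"
   have hi': "integrable lebesgue ?h" using hi zext_integrable[OF open_lebesgue[OF open_dom]] by blast
   have sp: "smooth UNIV ?p" by (rule smooth_zext[OF open_dom compact_imp_closed[OF S(1)] S(2) scsD(1)[OF \<psi>] S(3)])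
   have cp: "continuous_on UNIV ?p" by (rule smooth_cont[OF open_UNIV sp])
   have zp: "?p P = 0" if "P \<notin> S" for P using S(2,3) that by (auto simp: zext_def)
   have eqi: "(LINT P|M. f P * \<psi> P) = (LINT P|lebesgue. f P * ?p P)" for f
    unfolding zext_integral[OF open_lebesgue[OF open_dom]]
    by (rule lint_cong) (auto simp: zext_def)
   have eqh: "(LINT P|lebesgue. h P * ?p P) = (LINT P|lebesgue. ?h P * ?p P)"
    by (rule lint_cong) (auto simp: zext_def)
   have uc: "uniformly_continuous_on UNIV ?p"
   proof -
    define S' where "S' = {x + y |x y. x \<in> S \<and> y \<in> cball 0 (1::real)}"
    have S': "compact S'" unfolding S'_def by (intro compact_sums S(1) compact_cball)
    have "uniformly_continuous_on S' ?p" by (rule compact_uniformly_continuous[OF continuous_on_subset[OF cp subset_UNIV] S'])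
    show ?thesis
     unfolding uniformly_continuous_on_def
    proof (intro allI impI)
     fix \<eta> :: real assume "\<eta> > 0"
     then obtain \<delta> where \<delta>: "\<delta> > 0" "\<And>x y. x \<in> S' \<Longrightarrow> y \<in> S' \<Longrightarrow> dist y x < \<delta> \<Longrightarrow> dist (?p y) (?p x) < \<eta>"
      using \<open>uniformly_continuous_on S' ?p\<close> unfolding uniformly_continuous_on_def by meson
     have near: "P \<in> S'" "Q \<in> S'" if "dist P Q < min \<delta> 1" "P \<in> S" for P Q
     proof -
      have "norm (Q - P) \<le> 1" "norm (0::plane) \<le> 1" using that by (simp_all add: dist_norm norm_minus_commute)
      then have "P + 0 \<in> S'" "P + (Q - P) \<in> S'" unfolding S'_def mem_cball_0 using that(2) by blast+
      then show "P \<in> S'" "Q \<in> S'" by simp_all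
     qed
     have "dist (?p y) (?p x) < \<eta>" if "dist y x < min \<delta> 1" for x y
     proof -
      consider "x \<in> S" | "y \<in> S" | "x \<notin> S" "y \<notin> S" by blast
      then show ?thesis
      proof cases
       case 1
       then have "x \<in> S'" "y \<in> S'" using near[of x y] that by (auto simp: dist_commute)
       then show ?thesis using \<delta>(2) that by simp
      next
       case 2
       then have "x \<in> S'" "y \<in> S'" using near[of y x] that by auto
       then show ?thesis using \<delta>(2) that by simp
      next
       case 3
       then show ?thesis using zp \<open>\<eta> > 0\<close> by simp
      qed
     qed
     then show "\<exists>d>0. \<forall>x\<in>UNIV. \<forall>x'\<in>UNIV. dist x' x < d \<longrightarrow> dist (?p x') (?p x) < \<eta>"
      using \<delta>(1) by (intro exI[of _ "min \<delta> 1"]) auto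
    qed
   qed
   show ?thesis unfolding eqi eqh
   proof (rule LIMSEQ_I)
    fix r :: real assume r: "r > 0"
    define I where "I = (LINT P|lebesgue. \<bar>?h P\<bar>)"
    have I: "I \<ge> 0" by (simp add: I_def)
    define \<eta> where "\<eta> = r / (I + 1)"
    have \<eta>: "\<eta> > 0" "\<eta> * I < r" using r I by (auto simp: \<eta>_def field_simps)
    obtain \<delta> where \<delta>: "\<delta> > 0" "\<And>x y. dist y x < \<delta> \<Longrightarrow> dist (?p y) (?p x) < \<eta>"
     using uc \<eta>(1) unfolding uniformly_continuous_on_def by (metis UNIV_I)
    obtain N :: nat where N: "real N > d / \<delta>" using reals_Archimedean2 by blast
    show "\<exists>no. \<forall>n\<ge>no. norm ((LINT P|lebesgue. \<phi> n P * ?p P) - (LINT P|lebesgue. ?h P * ?p P)) < r"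
    proof (intro exI allI impI)
     fix n assume n: "n \<ge> N"
     have "3 * \<epsilon> n < \<delta>"
     proof -
      have "d < real N * \<delta>" using N \<delta>(1) by (simp add: field_simps)
      also have "\<dots> \<le> real (n + 2) * \<delta>" using n \<delta>(1) by (intro mult_right_mono) auto
      finally show ?thesis by (simp add: \<epsilon>_def field_simps)
     qed
     then have "\<bar>?p P - ?p Q\<bar> \<le> \<eta>" if "dist P Q \<le> 3 * \<epsilon> n" for P Q
      using \<delta>(2)[of P Q] that by (simp add: dist_real_def)
     from conv_kern_test[OF hi' e(1) cp S(1) zp this]
     have "\<bar>(LINT P|lebesgue. \<phi> n P * ?p P) - (LINT P|lebesgue. ?h P * ?p P)\<bar> \<le> \<eta> * I"
      unfolding \<phi>_def I_def .
     then show "norm ((LINT P|lebesgue. \<phi> n P * ?p P) - (LINT P|lebesgue. ?h P * ?p P)) < r" using \<eta>(2) by simp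
    qed
   qed
  qed
 qed
qed

end

section \<open>Chain rule\<close>

context weighted begin

lemma scs_empty_H1: "testfun \<Omega> {} \<subseteq> H1 w \<Omega>"
proof
 fix \<psi> assume \<psi>: "\<psi> \<in> testfun \<Omega> {}"
 have cl: "is_weak_deriv \<Omega> e \<psi> (pd e \<psi>)" if "e \<in> {ex, ey}" for e
  by (rule weak_deriv_classical[OF open_dom that smooth_Ck[OF scsD(1)[OF \<psi>]]])
 show "\<psi> \<in> H1 w \<Omega>"
 proof (rule scs_emptyE[OF \<psi>])
  fix K assume K: "compact K" "K \<subseteq> \<Omega>" "\<And>P. P \<in> \<Omega> - K \<Longrightarrow> \<psi> P = 0"
  have z: "pd e \<psi> P = 0" if "P \<in> \<Omega> - K" for P e by (rule pd_vanishes_on[OF open_dom K(1) K(3) that])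
  have c: "continuous_on \<Omega> \<psi>" by (rule smooth_cont[OF open_dom scsD(1)[OF \<psi>]])
  have ce: "continuous_on \<Omega> (pd e \<psi>)" if "e \<in> {ex, ey}" for e by (rule smooth_cont[OF open_dom smooth_pd[OF scsD(1)[OF \<psi>] that]])
  have 1: "sqi M (\<lambda>P. sa P * \<psi> P)"
   by (rule sqi_continuous_compact_support[OF continuous_on_mult[OF cont_sa c] K(1,2)]) (simp add: K(3))
  have 2: "sqi M (\<lambda>P. sb P * pd e \<psi> P)" if "e \<in> {ex, ey}" for e
   by (rule sqi_continuous_compact_support[OF continuous_on_mult[OF cont_sb ce[OF that]] K(1,2)])
     (simp add: z)
  show ?thesis by (rule H1I[OF cl cl 1 2 2]) simp_all
 qed
qed

lemma weighted_empty: "weighted \<Omega> {} w"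
 using open_dom half cont_w w_pos scs_empty_H1 by unfold_locales auto

lemma sb_le_sa: "P \<in> \<Omega> \<Longrightarrow> sb P \<le> sa P"
 unfolding sa_def sb_def using w_pos[of P] by (simp add: mult_right_mono)

lemma sqi_mult_bounded:
 assumes "sqi M f" "continuous_on \<Omega> g" "\<And>P. P \<in> \<Omega> \<Longrightarrow> \<bar>g P\<bar> \<le> B"
 shows "sqi M (\<lambda>P. f P * g P)"
proof (rule sqi_bound[OF assms(1), of _ B])
 show "(\<lambda>P. f P * g P) \<in> borel_measurable M" by (intro meas_times cont_meas assms(2) sqiD(1)[OF assms(1)])
 show "AE P in M. \<bar>f P * g P\<bar> \<le> B * \<bar>f P\<bar>"
  by (rule AE_I2) (simp add: abs_mult mult.commute[of "\<bar>f _\<bar>"] mult_right_mono assms(3))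
qed

text \<open>After multiplication with a cutoff function the mollification criterion applies with empty \<open>T\<close>. This
 brings local questions about arbitrary functions of the space back to limits of test functions.\<close>
lemma cutoff_in_V_empty:
 assumes N: "N \<in> H1 w \<Omega>" and z: "smooth UNIV \<zeta>" "compact C" "C \<subseteq> \<Omega>" "\<And>P. P \<notin> C \<Longrightarrow> \<zeta> P = 0"
 shows "(\<lambda>P. N P * \<zeta> P) \<in> H1_zero w \<Omega> {}"
proof -
 interpret Z: weighted \<Omega> "{}" w by (rule weighted_empty)
 have zs: "smooth \<Omega> \<zeta>" by (rule smooth_subset[OF open_UNIV subset_UNIV z(1)])
 have z0: "pd e \<zeta> P = 0" if "P \<notin> C" for P e by (rule pd_vanishes[OF compact_imp_closed[OF z(2)] z(4) that])
 have wd: "is_weak_deriv \<Omega> e (\<lambda>P. N P * \<zeta> P) (\<lambda>P. wD \<Omega> e N P * \<zeta> P + N P * pd e \<zeta> P)" if "e \<in> {ex, ey}" for e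
  by (rule weak_deriv_mult[OF open_dom that H1_wD[OF N that] zs])
 have cz: "continuous_on UNIV \<zeta>" by (rule smooth_cont[OF open_UNIV z(1)])
 have cz': "continuous_on \<Omega> \<zeta>" by (rule continuous_on_subset[OF cz subset_UNIV])
 have cpz: "continuous_on UNIV (pd e \<zeta>)" if "e \<in> {ex, ey}" for e by (rule smooth_cont[OF open_UNIV smooth_pd[OF z(1) that]])
 obtain B where B: "\<And>P. \<bar>\<zeta> P\<bar> \<le> B" by (rule bounded_csupport[OF cz z(2)]) (use z(4) in blast)+
 have sg: "sqi M (\<lambda>P. sb P * (wD \<Omega> e N P * \<zeta> P + N P * pd e \<zeta> P))" if e: "e \<in> {ex, ey}" for e
 proof -
  obtain B' where B': "\<And>P. \<bar>pd e \<zeta> P\<bar> \<le> B'" by (rule bounded_csupport[OF cpz[OF e] z(2)]) (use z0 in blast)+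
  have s1: "sqi M (\<lambda>P. sb P * wD \<Omega> e N P * \<zeta> P)"
   by (rule sqi_mult_bounded[OF _ cz' B]) (use N e in \<open>auto simp: H1_iff\<close>)
  have s2: "sqi M (\<lambda>P. sa P * N P * pd e \<zeta> P)"
   by (rule sqi_mult_bounded[OF _ continuous_on_subset[OF cpz[OF e] subset_UNIV] B']) (use N in \<open>auto simp: H1_iff\<close>)
  have s3: "sqi M (\<lambda>P. sb P * N P * pd e \<zeta> P)"
  proof (rule sqi_bound[OF s2, of _ 1])
   show "(\<lambda>P. sb P * N P * pd e \<zeta> P) \<in> borel_measurable M"
    by (intro meas_times sb_meas li_measurable[OF open_dom weak_derivD(1)[OF H1_wD[OF N e]]] cont_meas continuous_on_subset[OF cpz[OF e] subset_UNIV])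
   show "AE P in M. \<bar>sb P * N P * pd e \<zeta> P\<bar> \<le> 1 * \<bar>sa P * N P * pd e \<zeta> P\<bar>"
   proof (rule AE_I2)
    fix P assume "P \<in> space M"
    then have "\<bar>sb P\<bar> \<le> \<bar>sa P\<bar>" using sb_le_sa[of P] sb_pos[of P] by simp
    from mult_right_mono[OF this, of "\<bar>N P * pd e \<zeta> P\<bar>"]
    show "\<bar>sb P * N P * pd e \<zeta> P\<bar> \<le> 1 * \<bar>sa P * N P * pd e \<zeta> P\<bar>" by (simp add: abs_mult mult.assoc)
   qed
  qed
  show ?thesis using sqi_add[OF s1 s3] by (simp add: distrib_left mult.assoc)
 qed
 have hi: "integrable M (\<lambda>P. N P * \<zeta> P)"
  by (rule li_mult_integrable[OF open_dom weak_derivD(1)[OF H1_wD[OF N, of ex]] z(2,3) cz']) (use z(4) in auto)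
 obtain r where r: "r > 0" "(\<Union>x\<in>C. ball x r) \<subseteq> \<Omega>"
  by (rule compact_subset_open_imp_ball_epsilon_subset[OF z(2) open_dom z(3)])
 define d where "d = r / 2"
 have d: "d > 0" using r by (simp add: d_def)
 define K' where "K' = {x + y |x y. x \<in> C \<and> y \<in> cball 0 d}"
 have K': "compact K'" unfolding K'_def by (intro compact_sums z(2) compact_cball)
 have inK': "P \<in> K'" if "Q \<in> C" "dist P Q \<le> d" for P Q
 proof -
  have "norm (P - Q) \<le> d" using that by (simp add: dist_norm)
  then have "Q + (P - Q) \<in> K'" unfolding K'_def mem_cball_0 using that(1) by blast
  then show ?thesis by simp
 qed
 have K'sub: "K' \<subseteq> \<Omega>"
 proof
  fix P assume "P \<in> K'"
  then obtain x y where xy: "P = x + y" "x \<in> C" "norm y \<le> d" unfolding K'_def mem_cball_0 by blast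
  then have "P \<in> ball x r" using r(1) by (simp add: dist_norm d_def)
  then show "P \<in> \<Omega>" using r(2) xy(2) by blast
 qed
 have comp: "\<exists>c\<ge>0. \<forall>P\<in>K'. \<forall>Q\<in>K'. \<omega> P \<le> c * \<omega> Q" if c: "continuous_on \<Omega> \<omega>" and p: "\<And>P. P \<in> \<Omega> \<Longrightarrow> \<omega> P > 0" for \<omega> :: "plane \<Rightarrow> real"
 proof (cases "K' = {}")
  case False
  have cK: "continuous_on K' \<omega>" by (rule continuous_on_subset[OF c K'sub])
  obtain p1 where p1: "p1 \<in> K'" "\<forall>P\<in>K'. \<omega> P \<le> \<omega> p1" using continuous_attains_sup[OF K' False cK] by blast
  obtain p2 where p2: "p2 \<in> K'" "\<forall>P\<in>K'. \<omega> p2 \<le> \<omega> P" using continuous_attains_inf[OF K' False cK] by blast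
  have pos: "\<omega> p1 > 0" "\<omega> p2 > 0" using p p1(1) p2(1) K'sub by blast+
  have "\<omega> P \<le> \<omega> p1 / \<omega> p2 * \<omega> Q" if "P \<in> K'" "Q \<in> K'" for P Q
  proof -
   have "\<omega> p1 / \<omega> p2 * \<omega> p2 \<le> \<omega> p1 / \<omega> p2 * \<omega> Q" using p2(2) that(2) pos by (intro mult_left_mono) auto
   then show ?thesis using p1(2) that(1) pos by force
  qed
  then show ?thesis using pos by (intro exI[of _ "\<omega> p1 / \<omega> p2"]) auto
 qed auto
 obtain c1 where c1: "c1 \<ge> 0" "\<forall>P\<in>K'. \<forall>Q\<in>K'. snd P * w P \<le> c1 * (snd Q * w Q)"
  using comp[of "\<lambda>P. snd P * w P", OF continuous_on_mult[OF continuous_on_snd[OF continuous_on_id] cont_w] mult_pos_pos[OF y_pos w_pos]] by blast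
 obtain c2 where c2: "c2 \<ge> 0" "\<forall>P\<in>K'. \<forall>Q\<in>K'. (1 + snd P) * w P \<le> c2 * ((1 + snd Q) * w Q)"
  using comp[of "\<lambda>P. (1 + snd P) * w P", OF continuous_on_mult[OF continuous_on_add[OF continuous_on_const continuous_on_snd[OF continuous_on_id]] cont_w]
   mult_pos_pos[OF add_pos_pos[OF zero_less_one y_pos] w_pos]] by blast
 have nbhd: "Q \<in> \<Omega> \<union> {}" if "P \<in> C" "dist P Q < d" for P Q
  using K'sub inK'[OF that(1), of Q] that(2) by (auto simp: dist_commute)
 have "(\<lambda>P. N P * \<zeta> P) \<in> Z.V"
 proof (rule Z.compactly_supported_in_V[OF wd[of ex, simplified] wd[of ey, simplified] hi _ _ _ z(2) _ _ _ _ d nbhd c1(1)])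
  show "sqi M (\<lambda>P. Z.sb P * (wD \<Omega> ex N P * \<zeta> P + N P * pd ex \<zeta> P))" using sg[of ex] by (simp add: Z.sb_def[abs_def] sb_def[abs_def])
  show "sqi M (\<lambda>P. Z.sb P * (wD \<Omega> ey N P * \<zeta> P + N P * pd ey \<zeta> P))" using sg[of ey] by (simp add: Z.sb_def[abs_def] sb_def[abs_def])
  show "snd P * w P \<le> c1 * (snd Q * w Q)" if "P \<in> \<Omega>" "Q \<in> \<Omega>" "Q \<in> C" "dist P Q < d" "snd P < snd Q" for P Q
   using c1(2) inK'[OF that(3), of P] inK'[OF that(3), of Q] that(4) d by auto
  fix \<epsilon> :: real assume e: "0 < \<epsilon>" "3 * \<epsilon> < d"
  let ?F = "conv (zext \<Omega> (\<lambda>P. N P * \<zeta> P)) (kern \<epsilon>)"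
  have "?F \<in> testfun \<Omega> {}"
   by (rule Z.conv_kern_scs[OF hi _ z(2) _ nbhd e]) (use z(4) in auto)
  then have FH: "sqi M (\<lambda>P. sa P * ?F P)" using scs_empty_H1 by (auto simp: H1_iff)
  have eqS: "(LINT P|M. (sa P * f P)^2) = (LINT P|M. (f P)^2 * ((1 + snd P) * w P))"
   "integrable M (\<lambda>P. (sa P * f P)^2) \<longleftrightarrow> integrable M (\<lambda>P. (f P)^2 * ((1 + snd P) * w P))" for f
   by (rule lint_cong, simp, simp add: power_mult_distrib sa_sq mult.commute,
     rule Bochner_Integration.integrable_cong, simp, simp add: power_mult_distrib sa_sq mult.commute)
  have Nz: "sqi M (\<lambda>P. sa P * (N P * \<zeta> P))"
   using sqi_mult_bounded[OF _ cz' B, of "\<lambda>P. sa P * N P"] N by (simp add: H1_iff mult.assoc)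
  have "(LINT P|M. (?F P)^2 * ((1 + snd P) * w P)) \<le> c2 * (LINT P|M. (N P * \<zeta> P)^2 * ((1 + snd P) * w P))"
  proof (rule conv_kern_L2_bound[OF e(1) open_lebesgue[OF open_dom] borel_measurable_integrable[OF hi] _ _ refl c2(1)])
   show "(\<lambda>P. (1 + snd P) * w P) \<in> borel_measurable M" by (rule cont_meas) (intro continuous_intros cont_w)
   show "P \<in> \<Omega> \<Longrightarrow> 0 \<le> (1 + snd P) * w P" for P using y_pos[of P] w_pos[of P] by simp
   show "(1 + snd P) * w P \<le> c2 * ((1 + snd Q) * w Q)" if "P \<in> \<Omega>" "Q \<in> \<Omega>" "N Q * \<zeta> Q \<noteq> 0" "kern \<epsilon> (Q - P) \<noteq> 0" for P Q
   proof -
    have Q: "Q \<in> C" using that(3) z(4)[of Q] by auto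
    have "dist P Q \<le> d" using kern_nz[OF e(1) that(4)] e(2) by (simp add: dist_norm norm_minus_commute)
    then show ?thesis using c2(2) inK'[OF Q, of P] inK'[OF Q, of Q] d by simp
   qed
   show "integrable M (\<lambda>P. (N P * \<zeta> P)^2 * ((1 + snd P) * w P))" using Nz eqS(2) by (simp add: sqi_def)
   show "integrable M (\<lambda>P. (?F P)^2 * ((1 + snd P) * w P))" using FH eqS(2) by (simp add: sqi_def)
  qed
  then show "(LINT P|M. (Z.sa P * ?F P)^2) \<le> c2 * (LINT P|M. (N P * \<zeta> P)^2 * ((1 + snd P) * w P))"
   unfolding eqS(1)[symmetric] by (simp add: Z.sa_def[abs_def] sa_def[abs_def])
 qed (use z z0 in auto)
 then show ?thesis by (simp add: Z.V_def)
qed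

text \<open>Fast convergence in norm implies convergence almost everywhere.\<close>
lemma V_AE_approx:
 assumes u: "u \<in> V"
 obtains \<phi> where "\<And>n. \<phi> n \<in> testfun \<Omega> T" "(\<lambda>n. ip (\<phi> n - u) (\<phi> n - u)) \<longlonglongrightarrow> 0"
  "AE P in M. (\<lambda>n. \<phi> n P) \<longlonglongrightarrow> u P"
proof -
 have uH: "u \<in> H1 w \<Omega>" by (rule V_H1[OF u])
 have "\<forall>n. \<exists>\<phi>. \<phi> \<in> testfun \<Omega> T \<and> H.nrm (u - \<phi>) < inverse (real (Suc n))"
 proof
  fix n
  have "inverse (real (Suc n)) > 0" by simp
  then show "\<exists>\<phi>. \<phi> \<in> testfun \<Omega> T \<and> H.nrm (u - \<phi>) < inverse (real (Suc n))"
   using u unfolding V_iff by blast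
 qed
 from choice[OF this] obtain \<phi> where \<phi>: "\<And>n. \<phi> n \<in> testfun \<Omega> T" "\<And>n. H.nrm (u - \<phi> n) < inverse (real (Suc n))" by blast
 have pH: "\<phi> n \<in> H1 w \<Omega>" for n using \<phi>(1) scs_H1 by blast
 have swap: "ip (u - \<phi> n) (u - \<phi> n) = ip (\<phi> n - u) (\<phi> n - u)" for n
  using uH pH ip_sym[of u "\<phi> n"] by (simp add: H.bil)
 have lim: "(\<lambda>n. ip (\<phi> n - u) (\<phi> n - u)) \<longlonglongrightarrow> 0"
 proof (rule tendsto_sandwich[OF _ _ tendsto_const])
  show "\<forall>\<^sub>F n in sequentially. 0 \<le> ip (\<phi> n - u) (\<phi> n - u)"
   by (intro always_eventually allI H.nonneg H.mem uH pH)
  have "ip (\<phi> n - u) (\<phi> n - u) \<le> (inverse (real (Suc n)))^2" for n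
   unfolding swap[symmetric] H.nrm_sq[OF H.mem(2)[OF uH pH], symmetric]
   by (rule power_mono[OF less_imp_le[OF \<phi>(2)] H.nrm_ge0[OF H.mem(2)[OF uH pH]]])
  then show "\<forall>\<^sub>F n in sequentially. ip (\<phi> n - u) (\<phi> n - u) \<le> (inverse (real (Suc n)))^2" by (intro always_eventually allI)
  show "(\<lambda>n. (inverse (real (Suc n)))^2) \<longlonglongrightarrow> 0" using tendsto_power[OF LIMSEQ_inverse_real_of_nat, of 2] by simp
 qed
 note wp = H1_wD[OF pH] and wu = H1_wD[OF uH]
 have s: "sqi M (\<lambda>P. sa P * \<phi> n P - sa P * u P)" for n
  using uH pH[of n] by (intro sqi_diff) (auto simp: H1_iff)
 have l2: "(\<lambda>n. LINT P|M. norm ((sa P * \<phi> n P - sa P * u P)^2)) \<longlonglongrightarrow> 0"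
 proof (rule tendsto_sandwich[OF _ _ tendsto_const lim])
  show "\<forall>\<^sub>F n in sequentially. 0 \<le> (LINT P|M. norm ((sa P * \<phi> n P - sa P * u P)^2))" by (intro always_eventually allI) simp
  have "(LINT P|M. norm ((sa P * \<phi> n P - sa P * u P)^2)) \<le> ip (\<phi> n - u) (\<phi> n - u)" for n
   using ip_diff[OF wp[of ex n] wp[of ey n] wu[of ex] wu[of ey]] by simp
  then show "\<forall>\<^sub>F n in sequentially. (LINT P|M. norm ((sa P * \<phi> n P - sa P * u P)^2)) \<le> ip (\<phi> n - u) (\<phi> n - u)"
   by (intro always_eventually allI)
 qed
 obtain r where r: "strict_mono r" "AE P in M. (\<lambda>n. (sa P * \<phi> (r n) P - sa P * u P)^2) \<longlonglongrightarrow> 0"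
  using tendsto_L1_AE_subseq[OF _ l2] sqiD(2)[OF s] by blast
 show thesis
 proof (rule that[of "\<lambda>n. \<phi> (r n)"])
  show "\<phi> (r n) \<in> testfun \<Omega> T" for n by (rule \<phi>(1))
  show "(\<lambda>n. ip (\<phi> (r n) - u) (\<phi> (r n) - u)) \<longlonglongrightarrow> 0"
   using LIMSEQ_subseq_LIMSEQ[OF lim r(1)] by (simp add: o_def)
  show "AE P in M. (\<lambda>n. \<phi> (r n) P) \<longlonglongrightarrow> u P"
   using r(2) AE_space
  proof eventually_elim
   fix P assume lim: "(\<lambda>n. (sa P * \<phi> (r n) P - sa P * u P)^2) \<longlonglongrightarrow> 0" and P: "P \<in> space M"
   have sP: "sa P > 0" using sa_pos P by simp
   have "(\<lambda>n. sqrt ((sa P * \<phi> (r n) P - sa P * u P)^2)) \<longlonglongrightarrow> sqrt 0" by (rule tendsto_real_sqrt[OF lim])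
   then have "(\<lambda>n. sa P * \<phi> (r n) P - sa P * u P) \<longlonglongrightarrow> 0" by (simp add: tendsto_rabs_zero_iff)
   then have "(\<lambda>n. inverse (sa P) * (sa P * \<phi> (r n) P - sa P * u P) + u P) \<longlonglongrightarrow> inverse (sa P) * 0 + u P"
    by (intro tendsto_intros)
   then show "(\<lambda>n. \<phi> (r n) P) \<longlonglongrightarrow> u P" using sP by (simp add: right_diff_distrib mult.assoc[symmetric])
  qed
 qed
qed

lemma sqi_test_over_sb:
 assumes \<psi>: "\<psi> \<in> testfun \<Omega> {}"
 shows "sqi M (\<lambda>P. \<psi> P * inverse (sb P))" "(LINT P|M. u P * \<psi> P) = (LINT P|M. (sb P * u P) * (\<psi> P * inverse (sb P)))"
proof -
 show "sqi M (\<lambda>P. \<psi> P * inverse (sb P))"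
 proof (rule scs_emptyE[OF \<psi>])
  fix K assume K: "compact K" "K \<subseteq> \<Omega>" "\<And>P. P \<in> \<Omega> - K \<Longrightarrow> \<psi> P = 0"
  show ?thesis
   by (rule sqi_continuous_compact_support[OF _ K(1,2)])
     (use K(3) sb_pos in \<open>auto intro!: continuous_intros cont_sb smooth_cont[OF open_dom scsD(1)[OF \<psi>]] simp: less_imp_neq[symmetric]\<close>)
 qed
 show "(LINT P|M. u P * \<psi> P) = (LINT P|M. (sb P * u P) * (\<psi> P * inverse (sb P)))"
 proof (rule lint_cong)
  fix P assume "P \<in> space M"
  then have "sb P > 0" using sb_pos by simp
  then show "u P * \<psi> P = (sb P * u P) * (\<psi> P * inverse (sb P))" by (simp add: field_simps)
 qed simp
qed

lemma Ck_on_1_compose: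
 assumes U: "open U" and f: "Ck_on 1 U f" and F: "\<And>t. (F has_real_derivative F' t) (at t)" and F': "continuous_on UNIV F'"
 shows "Ck_on 1 U (\<lambda>P. F (f P))" "P \<in> U \<Longrightarrow> e \<in> {ex, ey} \<Longrightarrow> pd e (\<lambda>P. F (f P)) P = F' (f P) * pd e f P"
proof -
 have f': "Ck_on (Suc 0) U f" using f by simp
 have D: "((\<lambda>P. F (f P)) has_derivative (\<lambda>h. fst h * (F' (f P) * pd ex f P) + snd h * (F' (f P) * pd ey f P))) (at P)" if "P \<in> U" for P
  by (rule has_derivative_chain[where F=F and f=f, OF F Ck_on_SucD[OF U f' that]])
 have c: "continuous_on U (\<lambda>P. F' (f P))"
  by (rule continuous_on_compose2[OF F' Ck_on_continuous[OF U f]]) simp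
 have "Ck_on (Suc 0) U (\<lambda>P. F (f P))"
  by (rule Ck_on_SucI[OF U D]) (use c Ck_on_pd[OF f'] in \<open>auto intro!: continuous_intros\<close>)
 then show "Ck_on 1 U (\<lambda>P. F (f P))" by simp
 show "P \<in> U \<Longrightarrow> e \<in> {ex, ey} \<Longrightarrow> pd e (\<lambda>P. F (f P)) P = F' (f P) * pd e f P"
  using pd_eqI[OF D] by (auto simp: ex_def ey_def)
qed

text \<open>The identity holds for test functions and passes to the limit: \<open>F (\<phi> n)\<close> by the Lipschitz bound,
 and \<open>F' (\<phi> n) - F' u\<close> by dominated convergence along an almost everywhere convergent sequence.\<close>
lemma chain_rule_V:
 assumes u: "u \<in> V" and e: "e \<in> {ex, ey}"
  and F: "\<And>t. (F has_real_derivative F' t) (at t)" and F': "continuous_on UNIV F'" and L: "\<And>t. \<bar>F' t\<bar> \<le> L"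
  and \<psi>: "\<psi> \<in> testfun \<Omega> {}"
 shows "(LINT P|M. F (u P) * pd e \<psi> P) = - (LINT P|M. (F' (u P) * wD \<Omega> e u P) * \<psi> P)"
proof -
 obtain \<phi> where \<phi>: "\<And>n. \<phi> n \<in> testfun \<Omega> T" and lim: "(\<lambda>n. ip (\<phi> n - u) (\<phi> n - u)) \<longlonglongrightarrow> 0"
  and ae: "AE P in M. (\<lambda>n. \<phi> n P) \<longlonglongrightarrow> u P" by (rule V_AE_approx[OF u]) (rule that)
 have uH: "u \<in> H1 w \<Omega>" by (rule V_H1[OF u])
 have pH: "\<phi> n \<in> H1 w \<Omega>" for n using \<phi> scs_H1 by blast
 have c1: "Ck_on 1 \<Omega> (\<phi> n)" for n using scsD(1)[OF \<phi>] by (simp add: smooth_def)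
 have cl: "is_weak_deriv \<Omega> e (\<phi> n) (pd e (\<phi> n))" for n by (rule weak_deriv_classical[OF open_dom e c1])
 note wu = H1_wD[OF uH e]
 have um: "u \<in> borel_measurable M" "wD \<Omega> e u \<in> borel_measurable M"
  by (intro li_measurable[OF open_dom] weak_derivD(1,2)[OF wu])+
 have cF: "continuous_on UNIV F" by (intro continuous_at_imp_continuous_on ballI DERIV_isCont[OF F])
 have Fb: "F \<in> borel_measurable borel" "F' \<in> borel_measurable borel"
  using cF F' by (auto intro: borel_measurable_continuous_onI)
 have Lip: "\<bar>F s - F t\<bar> \<le> L * \<bar>s - t\<bar>" for s t
  using field_differentiable_bound[of UNIV F F' L s t] F L by simp
 have p: "sqi M (\<lambda>P. pd e \<psi> P * inverse (sa P))" "sqi M (\<lambda>P. \<psi> P * inverse (sb P))"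
  by (rule sqi_test_over_sa(1)[OF scs_pd[OF open_dom \<psi> e]], rule sqi_test_over_sb(1)[OF \<psi>])
 have pm: "\<psi> \<in> borel_measurable M" "pd e \<psi> \<in> borel_measurable M"
  by (intro cont_meas smooth_cont[OF open_dom] scsD(1)[OF \<psi>] smooth_pd[OF scsD(1)[OF \<psi>] e])+
 have ip_le: "(LINT P|M. (sa P * \<phi> n P - sa P * u P)^2) \<le> ip (\<phi> n - u) (\<phi> n - u)"
   "(LINT P|M. (sb P * wD \<Omega> e (\<phi> n) P - sb P * wD \<Omega> e u P)^2) \<le> ip (\<phi> n - u) (\<phi> n - u)" for n
  using ip_diff[OF H1_wD[OF pH[of n], of ex] H1_wD[OF pH[of n], of ey] H1_wD[OF uH, of ex] H1_wD[OF uH, of ey]] e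
  by auto
 have sq0: "(\<lambda>n. LINT P|M. (f n P)^2) \<longlonglongrightarrow> 0" if "\<And>n. (LINT P|M. (f n P)^2) \<le> ip (\<phi> n - u) (\<phi> n - u)" for f :: "nat \<Rightarrow> plane \<Rightarrow> real"
  by (rule tendsto_sandwich[OF _ _ tendsto_const lim]) (use that in \<open>auto intro!: always_eventually\<close>)
 have s: "sqi M (\<lambda>P. sa P * \<phi> n P - sa P * u P)" "sqi M (\<lambda>P. sb P * wD \<Omega> e (\<phi> n) P - sb P * wD \<Omega> e u P)" for n
  using uH pH[of n] e by (auto intro!: sqi_diff simp: H1_iff)
 have phm: "\<phi> n \<in> borel_measurable M" "wD \<Omega> e (\<phi> n) \<in> borel_measurable M" for n
  by (intro li_measurable[OF open_dom] weak_derivD(1,2)[OF H1_wD[OF pH e]])+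
 note comp = measurable_compose[OF _ Fb(1)] measurable_compose[OF _ Fb(2)]
 have bound_to_0: "(\<lambda>n. LINT P|M. f n P) \<longlonglongrightarrow> 0"
  if m: "\<And>n. f n \<in> borel_measurable M" and b: "\<And>n P. P \<in> \<Omega> \<Longrightarrow> \<bar>f n P\<bar> \<le> L * \<bar>a n P * b P\<bar>"
   and a: "\<And>n. sqi M (a n)" "\<And>n. (LINT P|M. (a n P)^2) \<le> ip (\<phi> n - u) (\<phi> n - u)" and bs: "sqi M b" for f a b
 proof (rule Lim_null_comparison)
  show "(\<lambda>n. L * (sqrt (LINT P|M. (a n P)^2) * sqrt (LINT P|M. (b P)^2))) \<longlonglongrightarrow> 0"
   using tendsto_mult_right_zero[OF tendsto_mult_left_zero[OF tendsto_real_sqrt[OF sq0[OF a(2)], simplified]]] .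
  show "\<forall>\<^sub>F n in sequentially. norm (LINT P|M. f n P) \<le> L * (sqrt (LINT P|M. (a n P)^2) * sqrt (LINT P|M. (b P)^2))"
  proof (rule always_eventually, rule allI)
   fix n
   have i: "integrable M (\<lambda>P. \<bar>a n P\<bar> * \<bar>b P\<bar>)" by (rule sqi_mult[OF sqi_abs[OF a(1)] sqi_abs[OF bs]])
   have "norm (LINT P|M. f n P) \<le> (LINT P|M. L * (\<bar>a n P\<bar> * \<bar>b P\<bar>))"
   proof (rule order_trans[OF integral_norm_bound], rule integral_mono')
    show "integrable M (\<lambda>P. L * (\<bar>a n P\<bar> * \<bar>b P\<bar>))" using i by simp
    show "norm (f n P) \<le> L * (\<bar>a n P\<bar> * \<bar>b P\<bar>)" if "P \<in> space M" for P using b[of P n] that by (simp add: abs_mult)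
    show "0 \<le> L * (\<bar>a n P\<bar> * \<bar>b P\<bar>)" if "P \<in> space M" for P using L[of 0] by simp
   qed
   also have "\<dots> = L * (LINT P|M. \<bar>a n P\<bar> * \<bar>b P\<bar>)" by simp
   also have "\<dots> \<le> L * (sqrt (LINT P|M. (a n P)^2) * sqrt (LINT P|M. (b P)^2))"
   proof (rule mult_left_mono)
    show "(LINT P|M. \<bar>a n P\<bar> * \<bar>b P\<bar>) \<le> sqrt (LINT P|M. (a n P)^2) * sqrt (LINT P|M. (b P)^2)"
     using order_trans[OF abs_ge_self L2_cauchy_schwarz'[OF sqi_abs[OF a(1)[of n]] sqi_abs[OF bs]]] by simp
   qed (use L[of 0] in simp)
   finally show "norm (LINT P|M. f n P) \<le> L * (sqrt (LINT P|M. (a n P)^2) * sqrt (LINT P|M. (b P)^2))" .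
  qed
 qed
 have L0: "L \<ge> 0" using L[of 0] by simp
 have 1: "(\<lambda>n. LINT P|M. (F (\<phi> n P) - F (u P)) * pd e \<psi> P) \<longlonglongrightarrow> 0"
 proof (rule bound_to_0[OF _ _ s(1) ip_le(1) p(1)])
  show "(\<lambda>P. (F (\<phi> n P) - F (u P)) * pd e \<psi> P) \<in> borel_measurable M" for n
   by (intro meas_times borel_measurable_diff comp phm um pm)
  fix n P assume P: "P \<in> \<Omega>"
  have "\<bar>(F (\<phi> n P) - F (u P)) * pd e \<psi> P\<bar> \<le> (L * \<bar>\<phi> n P - u P\<bar>) * \<bar>pd e \<psi> P\<bar>"
   unfolding abs_mult by (rule mult_right_mono[OF Lip]) simp
  also have "\<dots> = L * \<bar>(sa P * \<phi> n P - sa P * u P) * (pd e \<psi> P * inverse (sa P))\<bar>"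
  proof -
   have "(sa P * \<phi> n P - sa P * u P) * (pd e \<psi> P * inverse (sa P)) = (\<phi> n P - u P) * pd e \<psi> P"
    using sa_pos[OF P] by (simp add: field_simps)
   then show ?thesis by (simp only: abs_mult mult.assoc)
  qed
  finally show "\<bar>(F (\<phi> n P) - F (u P)) * pd e \<psi> P\<bar> \<le> L * \<bar>(sa P * \<phi> n P - sa P * u P) * (pd e \<psi> P * inverse (sa P))\<bar>" .
 qed
 have 2: "(\<lambda>n. LINT P|M. F' (\<phi> n P) * (wD \<Omega> e (\<phi> n) P - wD \<Omega> e u P) * \<psi> P) \<longlonglongrightarrow> 0"
 proof (rule bound_to_0[OF _ _ s(2) ip_le(2) p(2)])
  show "(\<lambda>P. F' (\<phi> n P) * (wD \<Omega> e (\<phi> n) P - wD \<Omega> e u P) * \<psi> P) \<in> borel_measurable M" for n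
   by (intro meas_times borel_measurable_diff comp phm um pm)
  fix n P assume P: "P \<in> \<Omega>"
  have "\<bar>F' (\<phi> n P) * (wD \<Omega> e (\<phi> n) P - wD \<Omega> e u P) * \<psi> P\<bar> \<le> L * (\<bar>wD \<Omega> e (\<phi> n) P - wD \<Omega> e u P\<bar> * \<bar>\<psi> P\<bar>)"
   unfolding abs_mult mult.assoc by (rule mult_right_mono[OF L]) simp
  also have "\<dots> = L * \<bar>(sb P * wD \<Omega> e (\<phi> n) P - sb P * wD \<Omega> e u P) * (\<psi> P * inverse (sb P))\<bar>"
  proof -
   have "(sb P * wD \<Omega> e (\<phi> n) P - sb P * wD \<Omega> e u P) * (\<psi> P * inverse (sb P)) = (wD \<Omega> e (\<phi> n) P - wD \<Omega> e u P) * \<psi> P"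
    using sb_pos[OF P] by (simp add: field_simps)
   then show ?thesis by (simp only: abs_mult)
  qed
  finally show "\<bar>F' (\<phi> n P) * (wD \<Omega> e (\<phi> n) P - wD \<Omega> e u P) * \<psi> P\<bar> \<le> L * \<bar>(sb P * wD \<Omega> e (\<phi> n) P - sb P * wD \<Omega> e u P) * (\<psi> P * inverse (sb P))\<bar>" .
 qed
 have ui: "integrable M (\<lambda>P. wD \<Omega> e u P * \<psi> P)" by (rule li_test[OF open_dom weak_derivD(2)[OF wu] \<psi>])
 have 3: "(\<lambda>n. LINT P|M. F' (\<phi> n P) * (wD \<Omega> e u P * \<psi> P)) \<longlonglongrightarrow> (LINT P|M. F' (u P) * (wD \<Omega> e u P * \<psi> P))"
 proof (rule integral_dominated_convergence[where w="\<lambda>P. L * \<bar>wD \<Omega> e u P * \<psi> P\<bar>"])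
  show "integrable M (\<lambda>P. L * \<bar>wD \<Omega> e u P * \<psi> P\<bar>)" using ui by simp
  show "AE P in M. (\<lambda>n. F' (\<phi> n P) * (wD \<Omega> e u P * \<psi> P)) \<longlonglongrightarrow> F' (u P) * (wD \<Omega> e u P * \<psi> P)"
   using ae
  proof eventually_elim
   fix P assume "(\<lambda>n. \<phi> n P) \<longlonglongrightarrow> u P"
   moreover have "isCont F' (u P)" using F' by (simp add: continuous_on_eq_continuous_at)
   ultimately have "(\<lambda>n. F' (\<phi> n P)) \<longlonglongrightarrow> F' (u P)" by (rule isCont_tendsto_compose[rotated])
   then show "(\<lambda>n. F' (\<phi> n P) * (wD \<Omega> e u P * \<psi> P)) \<longlonglongrightarrow> F' (u P) * (wD \<Omega> e u P * \<psi> P)" by (intro tendsto_intros)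
  qed
  show "AE P in M. norm (F' (\<phi> n P) * (wD \<Omega> e u P * \<psi> P)) \<le> L * \<bar>wD \<Omega> e u P * \<psi> P\<bar>" for n
  proof (rule AE_I2)
   fix P
   show "norm (F' (\<phi> n P) * (wD \<Omega> e u P * \<psi> P)) \<le> L * \<bar>wD \<Omega> e u P * \<psi> P\<bar>"
    unfolding real_norm_def abs_mult[of "F' _"] by (rule mult_right_mono[OF L]) simp
  qed
 qed (intro meas_times comp phm um pm)+
 have i1: "integrable M (\<lambda>P. F (v P) * pd e \<psi> P)" if v: "locally_integrable \<Omega> v" for v
 proof -
  have iv: "integrable M (\<lambda>P. \<bar>F 0 * pd e \<psi> P\<bar> + L * \<bar>v P * pd e \<psi> P\<bar>)"
   using li_test[OF open_dom v scs_pd[OF open_dom \<psi> e]]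
    li_test[OF open_dom continuous_li[OF continuous_on_const, of \<Omega> "F 0"] scs_pd[OF open_dom \<psi> e]] by auto
  show ?thesis
  proof (rule integrable_le[OF iv])
   show "(\<lambda>P. F (v P) * pd e \<psi> P) \<in> borel_measurable M"
    by (intro meas_times comp pm li_measurable[OF open_dom v])
   show "AE P in M. norm (F (v P) * pd e \<psi> P) \<le> norm (\<bar>F 0 * pd e \<psi> P\<bar> + L * \<bar>v P * pd e \<psi> P\<bar>)"
   proof (rule AE_I2)
    fix P
    have "\<bar>F (v P)\<bar> \<le> \<bar>F 0\<bar> + L * \<bar>v P\<bar>" using Lip[of "v P" 0] by simp
    from mult_right_mono[OF this, of "\<bar>pd e \<psi> P\<bar>"]
    show "norm (F (v P) * pd e \<psi> P) \<le> norm (\<bar>F 0 * pd e \<psi> P\<bar> + L * \<bar>v P * pd e \<psi> P\<bar>)"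
     using L0 by (simp add: abs_mult distrib_right mult.assoc)
   qed
  qed
 qed
 have i2: "integrable M (\<lambda>P. F' (v P) * (g P * \<psi> P))" if v: "v \<in> borel_measurable M" and g: "locally_integrable \<Omega> g" for v g
 proof (rule integrable_le[OF integrable_mult_right[OF integrable_abs[OF li_test[OF open_dom g \<psi>]], of L]])
  show "(\<lambda>P. F' (v P) * (g P * \<psi> P)) \<in> borel_measurable M"
   by (intro meas_times comp pm v li_measurable[OF open_dom g])
  show "AE P in M. norm (F' (v P) * (g P * \<psi> P)) \<le> norm (L * \<bar>g P * \<psi> P\<bar>)"
  proof (rule AE_I2)
   fix P
   have "\<bar>F' (v P)\<bar> * \<bar>g P * \<psi> P\<bar> \<le> L * \<bar>g P * \<psi> P\<bar>" by (rule mult_right_mono[OF L]) simp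
   then show "norm (F' (v P) * (g P * \<psi> P)) \<le> norm (L * \<bar>g P * \<psi> P\<bar>)" using L0 by (simp add: abs_mult)
  qed
 qed
 have ibp: "(LINT P|M. F (\<phi> n P) * pd e \<psi> P) = - (LINT P|M. F' (\<phi> n P) * (wD \<Omega> e (\<phi> n) P * \<psi> P))" for n
 proof -
  have "(LINT P|M. F (\<phi> n P) * pd e \<psi> P) = - (LINT P|M. pd e (\<lambda>P. F (\<phi> n P)) P * \<psi> P)"
   by (rule weak_derivD(3)[OF weak_deriv_classical[OF open_dom e Ck_on_1_compose(1)[OF open_dom c1 F F']] \<psi>])
  also have "(LINT P|M. pd e (\<lambda>P. F (\<phi> n P)) P * \<psi> P) = (LINT P|M. F' (\<phi> n P) * (pd e (\<phi> n) P * \<psi> P))"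
   by (rule lint_cong) (simp_all add: Ck_on_1_compose(2)[OF open_dom c1 F F' _ e])
  also have "\<dots> = (LINT P|M. F' (\<phi> n P) * (wD \<Omega> e (\<phi> n) P * \<psi> P))"
  proof (rule integral_cong_AE)
   show "AE P in M. F' (\<phi> n P) * (pd e (\<phi> n) P * \<psi> P) = F' (\<phi> n P) * (wD \<Omega> e (\<phi> n) P * \<psi> P)"
    using wD_AE[OF open_dom e cl[of n]] by eventually_elim simp
  qed (intro meas_times comp phm um pm li_measurable[OF open_dom weak_derivD(2)[OF cl]])+
  finally show ?thesis .
 qed
 have A: "(\<lambda>n. LINT P|M. F (\<phi> n P) * pd e \<psi> P) \<longlonglongrightarrow> (LINT P|M. F (u P) * pd e \<psi> P)"
 proof (rule LIM_zero_cancel)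
  have "(LINT P|M. (F (\<phi> n P) - F (u P)) * pd e \<psi> P) = (LINT P|M. F (\<phi> n P) * pd e \<psi> P) - (LINT P|M. F (u P) * pd e \<psi> P)" for n
   using i1[OF weak_derivD(1)[OF cl[of n]]] i1[OF weak_derivD(1)[OF wu]] by (simp add: left_diff_distrib)
  then show "(\<lambda>n. (LINT P|M. F (\<phi> n P) * pd e \<psi> P) - (LINT P|M. F (u P) * pd e \<psi> P)) \<longlonglongrightarrow> 0" using 1 by simp
 qed
 have Bl: "(\<lambda>n. LINT P|M. F' (\<phi> n P) * (wD \<Omega> e (\<phi> n) P * \<psi> P)) \<longlonglongrightarrow> (LINT P|M. F' (u P) * (wD \<Omega> e u P * \<psi> P))"
 proof -
  have "(LINT P|M. F' (\<phi> n P) * (wD \<Omega> e (\<phi> n) P * \<psi> P))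
   = (LINT P|M. F' (\<phi> n P) * (wD \<Omega> e (\<phi> n) P - wD \<Omega> e u P) * \<psi> P) + (LINT P|M. F' (\<phi> n P) * (wD \<Omega> e u P * \<psi> P))" for n
  proof -
   have "(LINT P|M. F' (\<phi> n P) * (wD \<Omega> e (\<phi> n) P - wD \<Omega> e u P) * \<psi> P)
    = (LINT P|M. F' (\<phi> n P) * (wD \<Omega> e (\<phi> n) P * \<psi> P) - F' (\<phi> n P) * (wD \<Omega> e u P * \<psi> P))"
    by (rule lint_cong) (simp_all add: algebra_simps)
   also have "\<dots> = (LINT P|M. F' (\<phi> n P) * (wD \<Omega> e (\<phi> n) P * \<psi> P)) - (LINT P|M. F' (\<phi> n P) * (wD \<Omega> e u P * \<psi> P))"
    by (rule Bochner_Integration.integral_diff[OF i2[OF phm(1) weak_derivD(2)[OF H1_wD[OF pH e]]] i2[OF phm(1) weak_derivD(2)[OF wu]]])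
   finally show ?thesis by simp
  qed
  then show ?thesis using tendsto_add[OF 2 3] by simp
 qed
 have "(LINT P|M. F (u P) * pd e \<psi> P) = - (LINT P|M. F' (u P) * (wD \<Omega> e u P * \<psi> P))"
  by (rule LIMSEQ_unique[OF A]) (use tendsto_minus[OF Bl] ibp in simp)
 then show ?thesis by (simp add: mult.assoc)
qed

text \<open>Chain rule for functions in the weighted space; it is a local statement, so it is enough to
 cut off and to approximate by test functions.\<close>
lemma chain_rule_H1:
 assumes N: "N \<in> H1 w \<Omega>" and e: "e \<in> {ex, ey}"
  and F: "\<And>t. (F has_real_derivative F' t) (at t)" and F': "continuous_on UNIV F'" and L: "\<And>t. \<bar>F' t\<bar> \<le> L"
  and \<psi>: "\<psi> \<in> testfun \<Omega> {}"
 shows "(LINT P|M. F (N P) * pd e \<psi> P) = - (LINT P|M. (F' (N P) * wD \<Omega> e N P) * \<psi> P)"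
proof (rule scs_emptyE[OF \<psi>])
 fix K assume K: "compact K" "K \<subseteq> \<Omega>" "\<And>P. P \<in> \<Omega> - K \<Longrightarrow> \<psi> P = 0"
 interpret Z: weighted \<Omega> "{}" w by (rule weighted_empty)
 obtain \<zeta> C where z: "smooth UNIV \<zeta>" "compact C" "C \<subseteq> \<Omega>" "\<And>P. P \<notin> C \<Longrightarrow> \<zeta> P = 0" "\<And>P. P \<in> K \<Longrightarrow> \<zeta> P = 1"
  "\<And>P. 0 \<le> \<zeta> P" "\<And>P. \<zeta> P \<le> 1"
  by (rule cutoff[OF K(1,2) open_dom]) (rule that)
 let ?u = "\<lambda>P. N P * \<zeta> P"
 have V: "?u \<in> Z.V" unfolding Z.V_def by (rule cutoff_in_V_empty[OF N z(1-4)])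
 have zs: "smooth \<Omega> \<zeta>" by (rule smooth_subset[OF open_UNIV subset_UNIV z(1)])
 have wd: "is_weak_deriv \<Omega> e ?u (\<lambda>P. wD \<Omega> e N P * \<zeta> P + N P * pd e \<zeta> P)"
  by (rule weak_deriv_mult[OF open_dom e H1_wD[OF N e] zs])
 have Fb: "F' \<in> borel_measurable borel" using F' by (rule borel_measurable_continuous_onI)
 have K0: "pd e \<psi> P = 0" if "P \<in> \<Omega> - K" for P by (rule pd_vanishes_on[OF open_dom K(1,3) that])
 have "(LINT P|M. F (N P) * pd e \<psi> P) = (LINT P|M. F (?u P) * pd e \<psi> P)"
 proof (rule lint_cong)
  fix P assume "P \<in> space M"
  then show "F (N P) * pd e \<psi> P = F (?u P) * pd e \<psi> P" using K0[of P] z(5)[of P] by (cases "P \<in> K") auto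
 qed simp
 also have "\<dots> = - (LINT P|M. (F' (?u P) * wD \<Omega> e ?u P) * \<psi> P)"
  by (rule Z.chain_rule_V[OF V e F F' L \<psi>])
 also have "(LINT P|M. (F' (?u P) * wD \<Omega> e ?u P) * \<psi> P) = (LINT P|M. (F' (N P) * wD \<Omega> e N P) * \<psi> P)"
 proof (rule integral_cong_AE)
  note m = li_measurable[OF open_dom]
  show "(\<lambda>P. (F' (?u P) * wD \<Omega> e ?u P) * \<psi> P) \<in> borel_measurable M"
   by (intro meas_times[of _ _ \<psi>] meas_times[of _ _ "wD \<Omega> e ?u"] measurable_compose[OF _ Fb] m weak_derivD(1)[OF wd] weak_derivD(2)[OF wD_weak_deriv[OF wd]]
     cont_meas smooth_cont[OF open_dom scsD(1)[OF \<psi>]])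
  show "(\<lambda>P. (F' (N P) * wD \<Omega> e N P) * \<psi> P) \<in> borel_measurable M"
   by (intro meas_times measurable_compose[OF _ Fb] m weak_derivD(1,2)[OF H1_wD[OF N e]]
     cont_meas smooth_cont[OF open_dom scsD(1)[OF \<psi>]])
  show "AE P in M. (F' (?u P) * wD \<Omega> e ?u P) * \<psi> P = (F' (N P) * wD \<Omega> e N P) * \<psi> P"
   using wD_AE[OF open_dom e wd] AE_space
  proof eventually_elim
   fix P assume w: "wD \<Omega> e ?u P = wD \<Omega> e N P * \<zeta> P + N P * pd e \<zeta> P" and P: "P \<in> space M"
   show "(F' (?u P) * wD \<Omega> e ?u P) * \<psi> P = (F' (N P) * wD \<Omega> e N P) * \<psi> P"
   proof (cases "P \<in> K")
    case True
    then have "pd e \<zeta> P = 0" using z(5,7) by (intro pd_at_max[OF z(1) e]) simp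
    then show ?thesis using w z(5)[OF True] by simp
   next
    case False
    then show ?thesis using K(3)[of P] P by simp
   qed
  qed
 qed
 finally show ?thesis .
qed

end

lemma max0_square_deriv: "((\<lambda>t. (max t 0)^2) has_real_derivative 2 * max t 0) (at (t::real))"
proof -
 consider "t < 0" | "t = 0" | "t > 0" by linarith
 then show ?thesis
 proof cases
  case 1
  have "((\<lambda>_. 0) has_real_derivative 0) (at t)" by simp
  then have "((\<lambda>t. (max t 0)^2) has_real_derivative 0) (at t)"
   by (rule has_field_derivative_transform_within_open[where S="{..<0}"]) (use 1 in auto)
  then show ?thesis using 1 by simp
 next
  case 2
  have "(\<lambda>h::real. ((max (0 + h) 0)^2 - (max 0 0)^2) / h) = (\<lambda>h. max h 0)"
   by (auto simp: fun_eq_iff max_def power2_eq_square)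
  moreover have "((\<lambda>h::real. max h 0) \<longlongrightarrow> max 0 0) (at 0)"
   by (intro tendsto_max tendsto_ident_at tendsto_const)
  ultimately show ?thesis unfolding DERIV_def 2 by simp
 next
  case 3
  have "((\<lambda>t. t^2) has_real_derivative 2 * t) (at t)" by (auto intro!: derivative_eq_intros)
  then have "((\<lambda>t. (max t 0)^2) has_real_derivative 2 * t) (at t)"
   by (rule has_field_derivative_transform_within_open[where S="{0<..}"]) (use 3 in auto)
  then show ?thesis using 3 by simp
 qed
qed

text \<open>Continuously differentiable approximations of the positive part, with derivatives bounded
 by \<open>1\<close>.\<close>
definition sm_pos :: "real \<Rightarrow> real \<Rightarrow> real" where "sm_pos \<delta> t = sqrt ((max t 0)^2 + \<delta>^2) - \<delta>"
definition sm_pos' :: "real \<Rightarrow> real \<Rightarrow> real" where "sm_pos' \<delta> t = max t 0 / sqrt ((max t 0)^2 + \<delta>^2)"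

lemma sm_pos_facts:
 assumes d: "\<delta> > 0"
 shows "(sm_pos \<delta> has_real_derivative sm_pos' \<delta> t) (at t)" "continuous_on UNIV (sm_pos' \<delta>)"
  "\<bar>sm_pos' \<delta> t\<bar> \<le> 1" "\<bar>sm_pos \<delta> t\<bar> \<le> \<bar>t\<bar>"
proof -
 have pos: "(max t 0)^2 + \<delta>^2 > 0" for t using d by (simp add: add_nonneg_pos)
 have "((\<lambda>t. (max t 0)^2 + \<delta>^2) has_real_derivative 2 * max t 0) (at t)"
  using DERIV_add[OF max0_square_deriv DERIV_const] by simp
 then have "((\<lambda>t. sqrt ((max t 0)^2 + \<delta>^2)) has_real_derivative inverse (sqrt ((max t 0)^2 + \<delta>^2)) / 2 * (2 * max t 0)) (at t)"
  by (rule DERIV_chain2[where f=sqrt and g="\<lambda>t. (max t 0)^2 + \<delta>^2" and x=t, OF DERIV_real_sqrt[OF pos]])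
 note D = DERIV_diff[OF this DERIV_const[of \<delta>]]
 have "inverse s / 2 * (2 * m) - 0 = m / s" for s m :: real by (simp add: field_simps)
 from DERIV_cong[OF D this] show "(sm_pos \<delta> has_real_derivative sm_pos' \<delta> t) (at t)"
  unfolding sm_pos_def[abs_def] sm_pos'_def .
 show "continuous_on UNIV (sm_pos' \<delta>)"
  unfolding sm_pos'_def[abs_def] using pos by (intro continuous_intros) (auto simp: less_imp_neq[symmetric])
 have le: "max t 0 \<le> sqrt ((max t 0)^2 + \<delta>^2)" by (rule real_le_rsqrt) simp
 show "\<bar>sm_pos' \<delta> t\<bar> \<le> 1"
  unfolding sm_pos'_def using le pos[of t] by (simp add: divide_le_eq abs_div_pos)
 have "sqrt ((max t 0)^2 + \<delta>^2) \<le> max t 0 + \<delta>"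
  using d by (intro real_le_lsqrt) (auto simp: power2_sum)
 moreover have "sqrt ((max t 0)^2 + \<delta>^2) \<ge> \<delta>" by (rule real_le_rsqrt) simp
 ultimately show "\<bar>sm_pos \<delta> t\<bar> \<le> \<bar>t\<bar>" unfolding sm_pos_def by auto
qed

lemma sm_pos_limits:
 assumes "\<And>n. d n > 0" "d \<longlonglongrightarrow> 0"
 shows "(\<lambda>n. sm_pos (d n) t) \<longlonglongrightarrow> max t 0" "(\<lambda>n. sm_pos' (d n) t) \<longlonglongrightarrow> (if t > 0 then 1 else 0)"
proof -
 have l: "(\<lambda>n. sqrt ((max t 0)^2 + (d n)^2)) \<longlonglongrightarrow> sqrt ((max t 0)^2 + 0^2)"
  by (intro tendsto_intros assms(2))
 have "(\<lambda>n. sqrt ((max t 0)^2 + (d n)^2) - d n) \<longlonglongrightarrow> sqrt ((max t 0)^2 + 0^2) - 0"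
  by (intro tendsto_diff l assms(2))
 then show "(\<lambda>n. sm_pos (d n) t) \<longlonglongrightarrow> max t 0" by (simp add: sm_pos_def)
 show "(\<lambda>n. sm_pos' (d n) t) \<longlonglongrightarrow> (if t > 0 then 1 else 0)"
 proof (cases "t > 0")
  case True
  have "(\<lambda>n. max t 0 / sqrt ((max t 0)^2 + (d n)^2)) \<longlonglongrightarrow> max t 0 / sqrt ((max t 0)^2 + 0^2)"
   using True by (intro tendsto_divide tendsto_const l) simp
  then show ?thesis using True by (simp add: sm_pos'_def)
 next
  case False
  then have "sm_pos' (d n) t = 0" for n by (simp add: sm_pos'_def)
  then show ?thesis using False by simp
 qed
qed

context weighted begin

text \<open>The chain rule for \<open>sm_pos\<close>, in the limit.\<close>
lemma weak_deriv_pos_part: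
 assumes N: "N \<in> H1 w \<Omega>" and e: "e \<in> {ex, ey}"
 shows "is_weak_deriv \<Omega> e (\<lambda>P. max (N P - c) 0) (\<lambda>P. if N P > c then wD \<Omega> e N P else 0)"
proof -
 define d where "d n = inverse (real (Suc n))" for n
 have d: "d n > 0" for n by (simp add: d_def)
 have d0: "d \<longlonglongrightarrow> 0" unfolding d_def by (rule LIMSEQ_inverse_real_of_nat)
 note wN = H1_wD[OF N e]
 have Nm: "N \<in> borel_measurable M" "wD \<Omega> e N \<in> borel_measurable M"
  by (intro li_measurable[OF open_dom] weak_derivD(1,2)[OF wN])+
 have liN: "locally_integrable \<Omega> (\<lambda>P. N P - c)"
  using li_linear[OF weak_derivD(1)[OF wN] continuous_li[OF continuous_on_const], of 1 "-c" 1] by simp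
 have li_dom: "locally_integrable \<Omega> f" if f: "f \<in> borel_measurable M" and g: "locally_integrable \<Omega> g" and le: "\<And>P. \<bar>f P\<bar> \<le> \<bar>g P\<bar>" for f g :: "plane \<Rightarrow> real"
  unfolding locally_integrable_def
 proof (intro allI impI)
  fix K assume K: "compact K \<and> K \<subseteq> \<Omega>"
  then have Kl: "K \<in> sets lebesgue" using compact_lebesgue by blast
  have "integrable (lebesgue_on K) g" using g K unfolding locally_integrable_def by blast
  moreover have "f \<in> borel_measurable (lebesgue_on K)"
  proof -
   have "zext K f = (\<lambda>P. indicator K P * zext \<Omega> f P)" using K by (auto simp: zext_def fun_eq_iff indicator_def)
   moreover have "(\<lambda>P. indicator K P * zext \<Omega> f P) \<in> borel_measurable lebesgue"
    using f Kl zext_measurable[OF open_lebesgue[OF open_dom]] by (intro meas_times borel_measurable_indicator) auto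
   ultimately show ?thesis using zext_measurable[OF Kl] by simp
  qed
  ultimately show "integrable (lebesgue_on K) f"
   by (rule integrable_le) (simp add: le)
 qed
 have sm: "(\<lambda>P. sm_pos (d n) (N P - c)) \<in> borel_measurable M" "(\<lambda>P. sm_pos' (d n) (N P - c) * wD \<Omega> e N P) \<in> borel_measurable M" for n
  unfolding sm_pos_def sm_pos'_def using Nm by measurable
 have lin: "locally_integrable \<Omega> (\<lambda>P. sm_pos (d n) (N P - c))" "locally_integrable \<Omega> (\<lambda>P. sm_pos' (d n) (N P - c) * wD \<Omega> e N P)" for n
  by (rule li_dom[OF sm(1) liN], rule sm_pos_facts(4)[OF d],
    rule li_dom[OF sm(2) weak_derivD(2)[OF wN]], simp add: abs_mult mult_left_le_one_le sm_pos_facts(3)[OF d])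
 have step: "is_weak_deriv \<Omega> e (\<lambda>P. sm_pos (d n) (N P - c)) (\<lambda>P. sm_pos' (d n) (N P - c) * wD \<Omega> e N P)" for n
  unfolding is_weak_deriv_def
 proof (intro conjI ballI lin)
  fix \<psi> assume \<psi>: "\<psi> \<in> testfun \<Omega> {}"
  show "(LINT P|M. sm_pos (d n) (N P - c) * pd e \<psi> P) = - (LINT P|M. (sm_pos' (d n) (N P - c) * wD \<Omega> e N P) * \<psi> P)"
  proof (rule chain_rule_H1[where F="\<lambda>t. sm_pos (d n) (t - c)" and F'="\<lambda>t. sm_pos' (d n) (t - c)", OF N e _ _ _ \<psi>])
   show "((\<lambda>t. sm_pos (d n) (t - c)) has_real_derivative sm_pos' (d n) (t - c)) (at t)" for t

   proof -
    have "((\<lambda>t. t - c) has_real_derivative 1) (at t)" by (auto intro!: derivative_eq_intros)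
    from DERIV_chain2[OF sm_pos_facts(1)[OF d] this] show ?thesis by simp
   qed
   show "continuous_on UNIV (\<lambda>t. sm_pos' (d n) (t - c))"
    by (rule continuous_on_compose2[OF sm_pos_facts(2)[OF d]]) (auto intro!: continuous_intros)
   show "\<bar>sm_pos' (d n) (t - c)\<bar> \<le> 1" for t by (rule sm_pos_facts(3)[OF d])
  qed
 qed
 have mm: "(\<lambda>P. max (N P - c) 0) \<in> borel_measurable M" "(\<lambda>P. if N P > c then wD \<Omega> e N P else 0) \<in> borel_measurable M"
  using Nm by measurable
 have dct: "(\<lambda>n. LINT P|M. f n P * \<psi> P) \<longlonglongrightarrow> (LINT P|M. f0 P * \<psi> P)"
  if m: "\<And>n. f n \<in> borel_measurable M" "f0 \<in> borel_measurable M" and le: "\<And>n P. \<bar>f n P\<bar> \<le> \<bar>g P\<bar>" and g: "locally_integrable \<Omega> g"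
   and lim: "\<And>P. (\<lambda>n. f n P) \<longlonglongrightarrow> f0 P" and \<psi>: "\<psi> \<in> testfun \<Omega> {}" for f f0 g \<psi>
 proof (rule integral_dominated_convergence[where w="\<lambda>P. \<bar>g P * \<psi> P\<bar>"])
  have pm: "\<psi> \<in> borel_measurable M" by (rule cont_meas[OF smooth_cont[OF open_dom scsD(1)[OF \<psi>]]])
  show "(\<lambda>P. f0 P * \<psi> P) \<in> borel_measurable M" "(\<lambda>P. f n P * \<psi> P) \<in> borel_measurable M" for n
   by (intro meas_times m pm)+
  show "integrable M (\<lambda>P. \<bar>g P * \<psi> P\<bar>)" using li_test[OF open_dom g \<psi>] by simp
  show "AE P in M. (\<lambda>n. f n P * \<psi> P) \<longlonglongrightarrow> f0 P * \<psi> P" by (intro AE_I2 tendsto_intros lim)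
  show "AE P in M. norm (f n P * \<psi> P) \<le> \<bar>g P * \<psi> P\<bar>" for n
   by (rule AE_I2) (simp add: abs_mult mult_right_mono le)
 qed
 show ?thesis
 proof (rule weak_deriv_limit[OF open_dom e _ _ step])
  show "locally_integrable \<Omega> (\<lambda>P. max (N P - c) 0)" by (rule li_dom[OF mm(1) liN]) auto
  show "locally_integrable \<Omega> (\<lambda>P. if N P > c then wD \<Omega> e N P else 0)" by (rule li_dom[OF mm(2) weak_derivD(2)[OF wN]]) auto
  fix \<psi> assume \<psi>: "\<psi> \<in> testfun \<Omega> {}"
  show "(\<lambda>n. LINT P|M. sm_pos (d n) (N P - c) * \<psi> P) \<longlonglongrightarrow> (LINT P|M. max (N P - c) 0 * \<psi> P)"
   by (rule dct[OF sm(1) mm(1) sm_pos_facts(4)[OF d] liN sm_pos_limits(1)[OF d d0] \<psi>])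
  show "(\<lambda>n. LINT P|M. (sm_pos' (d n) (N P - c) * wD \<Omega> e N P) * \<psi> P) \<longlonglongrightarrow> (LINT P|M. (if N P > c then wD \<Omega> e N P else 0) * \<psi> P)"
  proof (rule dct[OF sm(2) mm(2) _ weak_derivD(2)[OF wN] _ \<psi>])
   show "\<bar>sm_pos' (d n) (N P - c) * wD \<Omega> e N P\<bar> \<le> \<bar>wD \<Omega> e N P\<bar>" for n P
    by (simp add: abs_mult mult_left_le_one_le sm_pos_facts(3)[OF d])
   show "(\<lambda>n. sm_pos' (d n) (N P - c) * wD \<Omega> e N P) \<longlonglongrightarrow> (if N P > c then wD \<Omega> e N P else 0)" for P
    using tendsto_mult[OF sm_pos_limits(2)[OF d d0, of "N P - c"] tendsto_const, of "wD \<Omega> e N P"] by (auto split: if_splits)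
  qed
 qed
qed

end

section \<open>The lattice structure of the trace space\<close>

lemma conv_kern_bounded:
 assumes e: "\<epsilon> > 0" and h: "\<And>Q. \<bar>h Q\<bar> \<le> B"
 shows "\<bar>conv h (kern \<epsilon>) P\<bar> \<le> B"
proof -
 have ki: "integrable lebesgue (\<lambda>Q. kern \<epsilon> (Q - P))"
  by (rule integrableI_nonneg) (use kern_shift_meas[OF e] kern_ge0[OF e] nn_integral_kern_shift(1)[OF e, of P] in auto)
 have k1: "(LINT Q|lebesgue. kern \<epsilon> (Q - P)) = 1"
  using nn_integral_eq_integral[OF ki] kern_ge0[OF e] nn_integral_kern_shift(1)[OF e, of P] by simp
 have B: "B \<ge> 0" using h[of 0] by simp
 have "\<bar>conv h (kern \<epsilon>) P\<bar> \<le> (LINT Q|lebesgue. B * kern \<epsilon> (Q - P))"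
  unfolding conv_def
 proof (rule order_trans[OF integral_abs_bound], rule integral_mono')
  show "integrable lebesgue (\<lambda>Q. B * kern \<epsilon> (Q - P))" using ki by simp
  show "\<bar>h Q * kern \<epsilon> (Q - P)\<bar> \<le> B * kern \<epsilon> (Q - P)" for Q
   unfolding abs_mult abs_of_nonneg[OF kern_ge0[OF e]] by (rule mult_right_mono[OF h kern_ge0[OF e]])
  show "0 \<le> B * kern \<epsilon> (Q - P)" for Q using B kern_ge0[OF e] by simp
 qed
 then show ?thesis using k1 by simp
qed

text \<open>The weight may be singular at \<open>y = 0\<close>. It is integrable on bounded sets, and the weight \<open>y w\<close> of the
 gradient does not increase essentially when one moves down; both are needed to mollify upwards.\<close>
locale half_weighted = weighted +
 fixes S :: "real set"
 assumes T_eq: "T = S \<times> {0}" and open_S: "open S" and S_frontier: "\<And>x. x \<in> S \<Longrightarrow> (x, 0) \<in> frontier \<Omega>"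
  and loc_int: "\<And>R. integrable (lebesgue_on \<Omega>) (\<lambda>P. indicator (cball 0 R) P * ((1 + snd P) * w P))"
  and quasi_mono: "\<exists>C\<ge>0. \<forall>P\<in>\<Omega>. \<forall>Q\<in>\<Omega>. dist P Q < 1 \<longrightarrow> snd P < snd Q \<longrightarrow> snd P * w P \<le> C * (snd Q * w Q)"
begin

lemma T_line: "T \<subseteq> {P. snd P = 0}" by (auto simp: T_eq)

text \<open>Where a test function is at least \<open>\<epsilon>\<close>, the boundary portion is uniformly regular: if the
 complement of the domain accumulated at a point of \<open>T\<close>, then the test function, which vanishes
 near that part of the boundary, would vanish at the point.\<close>
lemma superlevel_set:
 assumes \<phi>: "\<phi> \<in> testfun \<Omega> T" and e: "\<epsilon> > 0"
 defines "K \<equiv> {P \<in> \<Omega> \<union> T. \<phi> P \<ge> \<epsilon>}"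
 shows "compact K" "\<exists>d>0. \<forall>P\<in>K. \<forall>Q. dist P Q < d \<longrightarrow> snd Q \<ge> 0 \<longrightarrow> Q \<in> \<Omega> \<union> T"
proof -
 obtain K0 where K0: "compact K0" "K0 \<subseteq> \<Omega> \<union> T" "\<forall>P\<in>(\<Omega> \<union> T) - K0. \<phi> P = 0" using scsD(3)[OF \<phi>] by blast
 have c: "continuous_on (\<Omega> \<union> T) \<phi>" by (rule scsD(2)[OF \<phi>])
 have "P \<in> K0" if "P \<in> \<Omega> \<union> T" "\<phi> P \<ge> \<epsilon>" for P
 proof (rule ccontr)
  assume "P \<notin> K0"
  then have "\<phi> P = 0" using K0(3) that(1) by blast
  then show False using that(2) e by simp
 qed
 then have "K = K0 \<inter> \<phi> -` {\<epsilon>..}" unfolding K_def using K0(2) by blast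
 moreover have "closed (K0 \<inter> \<phi> -` {\<epsilon>..})"
  by (rule continuous_closed_preimage[OF continuous_on_subset[OF c K0(2)] compact_imp_closed[OF K0(1)] closed_atLeast])
 ultimately have cK: "closed K" and KK: "K0 \<inter> K = K" by auto
 show "compact K" using compact_Int_closed[OF K0(1) cK] KK by simp
 define \<G> where "\<G> = {G. open G \<and> (\<forall>Q\<in>G. snd Q \<ge> 0 \<longrightarrow> Q \<in> \<Omega> \<union> T)}"
 have cov: "K \<subseteq> \<Union>\<G>"
 proof
  fix P assume P: "P \<in> K"
  show "P \<in> \<Union>\<G>"
  proof (cases "P \<in> \<Omega>")
   case True
   then show ?thesis using open_dom by (auto simp: \<G>_def)
  next
   case False
   then have PT: "P \<in> T" and pe: "\<phi> P \<ge> \<epsilon>" using P by (auto simp: K_def)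
   then obtain x where x: "P = (x, 0)" "x \<in> S" by (auto simp: T_eq)
   obtain r1 where r1: "r1 > 0" "\<And>x'. dist x' x < r1 \<Longrightarrow> x' \<in> S" using open_S x(2) unfolding open_dist by blast
   obtain r2 where r2: "r2 > 0" "\<And>Q. Q \<in> \<Omega> \<union> T \<Longrightarrow> dist Q P < r2 \<Longrightarrow> dist (\<phi> Q) (\<phi> P) < \<epsilon>"
    using c e PT unfolding continuous_on_iff by (metis UnCI)
   define r where "r = min r1 r2"
   have r: "r > 0" using r1 r2 by (simp add: r_def)
   have "Q \<in> \<Omega> \<union> T" if Q: "Q \<in> ball P r" "snd Q \<ge> 0" for Q
   proof (cases "snd Q = 0")
    case True
    have "dist (fst Q) x \<le> dist Q P" using dist_fst_le[of Q P] by (simp add: x)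
    then have "fst Q \<in> S" using Q(1) by (intro r1(2)) (simp add: r_def dist_commute)
    then show ?thesis using True by (cases Q) (auto simp: T_eq)
   next
    case False
    then have Qp: "snd Q > 0" using Q(2) by simp
    have "Q \<in> \<Omega>"
    proof (rule ccontr)
     assume QO: "Q \<notin> \<Omega>"
     have "P \<in> closure \<Omega>" using S_frontier[OF x(2)] x(1) by (auto simp: frontier_def)
     then obtain A where A: "A \<in> \<Omega>" "dist A P < r" using r unfolding closure_approachable by blast
     have seg: "closed_segment A Q \<subseteq> ball P r \<inter> {Z. snd Z > 0}"
     proof (rule closed_segment_subset)
      have "linear (snd :: plane \<Rightarrow> real)" by (rule linear_snd)
      then have "convex ((snd :: plane \<Rightarrow> real) -` {0<..})" by (rule convex_linear_vimage) (rule convex_real_interval)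
      moreover have "(snd :: plane \<Rightarrow> real) -` {0<..} = {Z. snd Z > 0}" by auto
      ultimately show "convex (ball P r \<inter> {Z. snd Z > 0})" by (intro convex_Int convex_ball) simp
     qed (use A Q Qp y_pos in \<open>auto simp: dist_commute\<close>)
     have "closed_segment A Q \<inter> frontier \<Omega> \<noteq> {}"
      by (rule connected_Int_frontier[OF connected_segment(1)]) (use A QO in auto)
     then obtain Z where Z: "Z \<in> closed_segment A Q" "Z \<in> frontier \<Omega>" by blast
     have Zp: "Z \<in> ball P r" "snd Z > 0" using seg Z(1) by auto
     have "Z \<notin> \<Omega>" using Z(2) open_dom by (simp add: frontier_def interior_open)
     moreover have "Z \<notin> T" using Zp(2) T_line by auto
     ultimately have "Z \<notin> K0" using K0(2) by blast
     then have "open (ball P r - K0)" "Z \<in> ball P r - K0" using Zp compact_imp_closed[OF K0(1)] by auto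
     then obtain s where s: "s > 0" "ball Z s \<subseteq> ball P r - K0" by (meson open_contains_ball)
     have "Z \<in> closure \<Omega>" using Z(2) by (simp add: frontier_def)
     then obtain Y where Y: "Y \<in> \<Omega>" "dist Y Z < s" using s(1) unfolding closure_approachable by blast
     then have "Y \<in> ball Z s" by (simp add: dist_commute)
     then have "Y \<in> ball P r - K0" using s(2) by (rule rev_subsetD)
     then have Y2: "dist Y P < r2" "Y \<notin> K0" by (auto simp: r_def dist_commute)
     have "\<phi> Y = 0" using K0(3) Y(1) Y2(2) by blast
     moreover have "dist (\<phi> Y) (\<phi> P) < \<epsilon>" by (rule r2(2)) (use Y(1) Y2(1) in auto)
     ultimately show False using pe by (simp add: dist_real_def)
    qed
    then show ?thesis by simp
   qed
   then have "ball P r \<in> \<G>" by (auto simp: \<G>_def)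
   moreover have "P \<in> ball P r" using r by simp
   ultimately show ?thesis by blast
  qed
 qed
 obtain d where d: "d > 0" "\<And>x. x \<in> K \<Longrightarrow> \<exists>G\<in>\<G>. ball x d \<subseteq> G"
  by (rule Heine_Borel_lemma[OF \<open>compact K\<close> cov]) (auto simp: \<G>_def)
 have "Q \<in> \<Omega> \<union> T" if PQ: "P \<in> K" "dist P Q < d" "snd Q \<ge> 0" for P Q
 proof -
  obtain G where G: "G \<in> \<G>" "ball P d \<subseteq> G" using d(2)[OF PQ(1)] by blast
  have "Q \<in> G" using G(2) PQ(2) by auto
  then show ?thesis using G(1) PQ(3) by (auto simp: \<G>_def)
 qed
 then show "\<exists>d>0. \<forall>P\<in>K. \<forall>Q. dist P Q < d \<longrightarrow> snd Q \<ge> 0 \<longrightarrow> Q \<in> \<Omega> \<union> T" using d(1) by blast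
qed

lemma integrable_bounded_support:
 fixes f :: "plane \<Rightarrow> real"
 assumes f: "f \<in> borel_measurable M" and B: "\<And>P. P \<in> \<Omega> \<Longrightarrow> \<bar>f P\<bar> \<le> B" and R: "\<And>P. P \<in> \<Omega> \<Longrightarrow> f P \<noteq> 0 \<Longrightarrow> P \<in> cball 0 R"
 shows "integrable M f"
proof -
 have z: "zext \<Omega> (indicator (cball 0 R) :: plane \<Rightarrow> real) = indicator (\<Omega> \<inter> cball 0 R)"
  by (auto simp: zext_def fun_eq_iff indicator_def)
 have "\<Omega> \<inter> cball 0 R \<in> lmeasurable"
  by (rule bounded_set_imp_lmeasurable[OF _ sets.Int[OF open_lebesgue[OF open_dom] compact_lebesgue[OF compact_cball]]])
    (simp add: bounded_Int)
 then have "integrable lebesgue (indicator (\<Omega> \<inter> cball 0 R) :: plane \<Rightarrow> real)"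
  by (auto simp: fmeasurable_def)
 then have i: "integrable M (indicator (cball 0 R) :: plane \<Rightarrow> real)"
  unfolding zext_integrable[OF open_lebesgue[OF open_dom]] z .
 show ?thesis
 proof (rule integrable_le[OF integrable_mult_right[OF i, of B] f AE_I2])
  fix P assume "P \<in> space M"
  then have P: "P \<in> \<Omega>" by simp
  show "norm (f P) \<le> norm (B * indicator (cball 0 R) P)"
   using B[OF P] R[OF P] by (cases "f P = 0") auto
 qed
qed

text \<open>Where the function is positive, \<open>\<phi> > N + \<epsilon> \<ge> \<epsilon>\<close>, so it is supported in the set of \<open>superlevel_set\<close>;
 \<open>0 \<le> h \<le> \<phi>\<close> bounds the mollifications.\<close>
lemma truncation_in_V:
 assumes \<phi>: "\<phi> \<in> testfun \<Omega> T" and N: "N \<in> H1 w \<Omega>" "\<And>P. P \<in> \<Omega> \<Longrightarrow> N P \<ge> 0" and e: "\<epsilon> > 0"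
 shows "(\<lambda>P. max ((\<phi> - N) P - \<epsilon>) 0) \<in> V"
proof -
 let ?z = "\<phi> - N" and ?h = "\<lambda>P. max ((\<phi> - N) P - \<epsilon>) 0"
 let ?g = "\<lambda>e P. if (\<phi> - N) P > \<epsilon> then wD \<Omega> e (\<phi> - N) P else 0"
 define K where "K = {P \<in> \<Omega> \<union> T. \<phi> P \<ge> \<epsilon>}"
 have K: "compact K" unfolding K_def by (rule superlevel_set(1)[OF \<phi> e])
 obtain d0 where d0: "d0 > 0" "\<forall>P\<in>K. \<forall>Q. dist P Q < d0 \<longrightarrow> snd Q \<ge> 0 \<longrightarrow> Q \<in> \<Omega> \<union> T"
  using superlevel_set(2)[OF \<phi> e] unfolding K_def by blast
 define d where "d = min d0 1"
 have d: "d > 0" "d \<le> d0" "d \<le> 1" using d0 by (auto simp: d_def)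
 have zH: "?z \<in> H1 w \<Omega>" using H.mem(2) \<phi> scs_H1 N(1) by blast
 have wd: "is_weak_deriv \<Omega> e' ?h (?g e')" if "e' \<in> {ex, ey}" for e'
  by (rule weak_deriv_pos_part[OF zH that])
 have sg: "sqi M (\<lambda>P. sb P * ?g e' P)" if e': "e' \<in> {ex, ey}" for e'
 proof (rule sqi_bound[of M "\<lambda>P. sb P * wD \<Omega> e' ?z P" _ 1])
  show "sqi M (\<lambda>P. sb P * wD \<Omega> e' ?z P)" using zH e' by (auto simp: H1_iff)
  show "(\<lambda>P. sb P * ?g e' P) \<in> borel_measurable M"
   by (intro meas_times sb_meas li_measurable[OF open_dom weak_derivD(2)[OF wd[OF e']]])
  show "AE P in M. \<bar>sb P * ?g e' P\<bar> \<le> 1 * \<bar>sb P * wD \<Omega> e' ?z P\<bar>" by (rule AE_I2) auto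
 qed
 have off: "\<not> (\<phi> - N) P > \<epsilon>" if P: "P \<in> \<Omega> - K" for P
  using P N(2)[of P] by (auto simp: K_def)
 have h0: "?h P = 0" if "P \<in> \<Omega> - K" for P using off[OF that] by simp
 obtain R where R: "\<And>P. P \<in> K \<Longrightarrow> norm P \<le> R" using compact_imp_bounded[OF K] by (auto simp: bounded_iff)
 obtain B where B: "B \<ge> 0" "\<And>P. P \<in> \<Omega> \<Longrightarrow> \<phi> P \<le> B"
 proof -
  obtain K0 where K0: "compact K0" "K0 \<subseteq> \<Omega> \<union> T" "\<forall>P\<in>(\<Omega> \<union> T) - K0. \<phi> P = 0" using scsD(3)[OF \<phi>] by blast
  have "bounded (\<phi> ` K0)"
   by (intro compact_imp_bounded compact_continuous_image continuous_on_subset[OF scsD(2)[OF \<phi>] K0(2)] K0(1))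
  then obtain b where b: "\<And>P. P \<in> K0 \<Longrightarrow> \<bar>\<phi> P\<bar> \<le> b" by (auto simp: bounded_iff)
  have "\<phi> P \<le> max b 0" if P: "P \<in> \<Omega>" for P
   using b[of P] K0(3) P by (cases "P \<in> K0") (auto simp: max_def)
  then show thesis using that[of "max b 0"] by simp
 qed
 have hB: "\<bar>?h P\<bar> \<le> B" if P: "P \<in> \<Omega>" for P using B(1) B(2)[OF P] N(2)[OF P] e by auto
 have hR: "P \<in> cball 0 R" if "P \<in> \<Omega>" "?h P \<noteq> 0" for P
 proof -
  have "P \<in> K" using h0[of P] that by blast
  then show ?thesis using R by simp
 qed
 have wx: "is_weak_deriv \<Omega> ex ?h (?g ex)" by (rule wd) simp
 have hi: "integrable M ?h"
  by (rule integrable_bounded_support[OF li_measurable[OF open_dom weak_derivD(1)[OF wx]] hB hR])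
 obtain C where C: "C \<ge> 0" "\<forall>P\<in>\<Omega>. \<forall>Q\<in>\<Omega>. dist P Q < 1 \<longrightarrow> snd P < snd Q \<longrightarrow> snd P * w P \<le> C * (snd Q * w Q)"
  using quasi_mono by blast
 show ?thesis
 proof (rule compactly_supported_in_V[OF wd wd hi sg sg T_line K _ _ _ _ d(1) _ C(1)])
  show "K \<subseteq> \<Omega> \<union> T" by (auto simp: K_def)
  show "?h P = 0" "?g ex P = 0" "?g ey P = 0" if "P \<in> \<Omega> - K" for P using h0[OF that] off[OF that] by auto
  show "Q \<in> \<Omega> \<union> T" if "P \<in> K" "dist P Q < d" "snd Q \<ge> 0" for P Q
  proof -
   have "dist P Q < d0" using that(2) d(2) by linarith
   then show ?thesis using d0(2) that(1,3) by blast
  qed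
  show "snd P * w P \<le> C * (snd Q * w Q)" if "P \<in> \<Omega>" "Q \<in> \<Omega>" "Q \<in> K" "dist P Q < d" "snd P < snd Q" for P Q
   using C(2) that d(3) by auto
  fix \<delta> :: real assume \<delta>: "0 < \<delta>" "3 * \<delta> < d"
  let ?F = "conv (zext \<Omega> ?h) (kern \<delta>)"
  show "(LINT P|M. (sa P * ?F P)^2) \<le> (LINT P|M. B^2 * (indicator (cball 0 (R + 1)) P * ((1 + snd P) * w P)))"
  proof (rule integral_mono')
   show "integrable M (\<lambda>P. B^2 * (indicator (cball 0 (R + 1)) P * ((1 + snd P) * w P)))" using loc_int by simp
   fix P assume "P \<in> space M"
   then have P: "P \<in> \<Omega>" by simp
   show nn: "0 \<le> B^2 * (indicator (cball 0 (R + 1)) P * ((1 + snd P) * w P))" using y_pos[OF P] w_pos[OF P] by simp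
   show "(sa P * ?F P)^2 \<le> B^2 * (indicator (cball 0 (R + 1)) P * ((1 + snd P) * w P))"
   proof (cases "P \<in> cball 0 (R + 1)")
    case True
    have "\<bar>?F P\<bar> \<le> B" by (rule conv_kern_bounded[OF \<delta>(1)]) (use hB B(1) in \<open>simp add: zext_def\<close>)
    then have "(?F P)^2 \<le> B^2" using power_mono[of "\<bar>?F P\<bar>" B 2] by simp
    then have "(?F P)^2 * ((1 + snd P) * w P) \<le> B^2 * ((1 + snd P) * w P)"
     using y_pos[OF P] w_pos[OF P] by (intro mult_right_mono) auto
    then show ?thesis using True by (simp add: power_mult_distrib sa_sq[OF P] mult.commute)
   next
    case False
    have "zext \<Omega> ?h Q * kern \<delta> (Q - P) = 0" for Q
    proof (rule ccontr)
     assume n: "zext \<Omega> ?h Q * kern \<delta> (Q - P) \<noteq> 0"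
     then have "Q \<in> K" using h0[of Q] by (cases "Q \<in> \<Omega>") (auto simp: zext_def)
     then have "norm Q \<le> R" by (rule R)
     moreover have "norm (Q - P) \<le> 3 * \<delta>" using kern_nz[OF \<delta>(1), of "Q - P"] n by simp
     moreover have "norm P \<le> norm Q + norm (Q - P)" using norm_triangle_ineq4[of Q "Q - P"] by simp
     ultimately show False using False \<delta>(2) d(3) by simp
    qed
    then have "(\<lambda>Q. zext \<Omega> ?h Q * kern \<delta> (Q - P)) = (\<lambda>_. 0)" by (rule ext)
    then have "?F P = 0" unfolding conv_def by simp
    then show ?thesis using nn by simp
   qed
  qed
 qed simp_all
qed

text \<open>The truncations of \<open>truncation_in_V\<close> are bounded in norm by \<open>\<phi> n - N\<close> and converge in the sense
 of distributions, since the positive part is Lipschitz continuous.\<close>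
lemma pos_part_in_V:
 assumes g: "g \<in> V" and N: "N \<in> H1 w \<Omega>" "\<And>P. P \<in> \<Omega> \<Longrightarrow> N P \<ge> 0"
 shows "(\<lambda>P. max ((g - N) P - 0) 0) \<in> V"
proof -
 obtain \<phi> where \<phi>: "\<And>n. \<phi> n \<in> testfun \<Omega> T" and lim: "(\<lambda>n. ip (\<phi> n - g) (\<phi> n - g)) \<longlonglongrightarrow> 0"
  and "AE P in M. (\<lambda>n. \<phi> n P) \<longlonglongrightarrow> g P" by (rule V_AE_approx[OF g]) (rule that)
 define \<epsilon> where "\<epsilon> n = inverse (real (Suc n))" for n
 have e: "\<epsilon> n > 0" for n by (simp add: \<epsilon>_def)
 have e0: "\<epsilon> \<longlonglongrightarrow> 0" unfolding \<epsilon>_def by (rule LIMSEQ_inverse_real_of_nat)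
 define h where "h n P = max ((\<phi> n - N) P - \<epsilon> n) 0" for n P
 let ?h = "\<lambda>P. max ((g - N) P - 0) 0"
 have hV: "h n \<in> V" for n unfolding h_def[abs_def] by (rule truncation_in_V[OF \<phi> N e])
 have gH: "g \<in> H1 w \<Omega>" by (rule V_H1[OF g])
 have pH: "\<phi> n \<in> H1 w \<Omega>" for n using \<phi> scs_H1 by blast
 have zH: "\<phi> n - N \<in> H1 w \<Omega>" for n by (rule H.mem(2)[OF pH N(1)])
 have zgH: "g - N \<in> H1 w \<Omega>" by (rule H.mem(2)[OF gH N(1)])
 have li: "locally_integrable \<Omega> ?h" by (rule weak_derivD(1)[OF weak_deriv_pos_part[OF zgH, of ex]]) simp
 have "\<exists>K. \<forall>n. ip (\<phi> n - N) (\<phi> n - N) \<le> K"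
 proof -
  have "(\<lambda>n. ip ((\<phi> n - N) - (g - N)) ((\<phi> n - N) - (g - N))) \<longlonglongrightarrow> 0" using lim by simp
  from H.nrm_tendsto(3)[OF zH zgH this zgH] have "Bseq (\<lambda>n. ip (\<phi> n - N) (\<phi> n - N))"
   by (rule convergent_imp_Bseq[OF convergentI])
  then obtain K where "\<And>n. norm (ip (\<phi> n - N) (\<phi> n - N)) \<le> K" by (rule BseqE) auto
  then show ?thesis by (intro exI[of _ K] allI) (simp add: abs_le_D1)
 qed
 then obtain K where K: "\<And>n. ip (\<phi> n - N) (\<phi> n - N) \<le> K" by blast
 show ?thesis
 proof (rule V_weakly_closed[OF hV _ li])
  fix n
  let ?z = "\<phi> n - N"
  let ?g = "\<lambda>e P. if ?z P > \<epsilon> n then wD \<Omega> e ?z P else 0"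
  have wh: "is_weak_deriv \<Omega> e (h n) (?g e)" if "e \<in> {ex, ey}" for e
   unfolding h_def[abs_def] by (rule weak_deriv_pos_part[OF zH that])
  have s: "sqi M (\<lambda>P. sa P * ?z P)" "sqi M (\<lambda>P. sb P * wD \<Omega> ex ?z P)" "sqi M (\<lambda>P. sb P * wD \<Omega> ey ?z P)"
   using zH[of n] by (simp_all add: H1_iff)
  have mono: "(LINT P|M. (s P * a P) * (s P * a P)) \<le> (LINT P|M. (s P * b P) * (s P * b P))"
   if i: "sqi M (\<lambda>P. s P * b P)" and le: "\<And>P. \<bar>a P\<bar> \<le> \<bar>b P\<bar>" for s a b :: "plane \<Rightarrow> real"
  proof (rule integral_mono')
   show "integrable M (\<lambda>P. (s P * b P) * (s P * b P))" by (rule sqi_mult[OF i i])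
   show "(s P * a P) * (s P * a P) \<le> (s P * b P) * (s P * b P)" for P
   proof -
    have "\<bar>s P * a P\<bar> \<le> \<bar>s P * b P\<bar>" unfolding abs_mult by (rule mult_left_mono[OF le]) simp
    then have "(s P * a P)^2 \<le> (s P * b P)^2" by (simp add: abs_le_square_iff)
    then show ?thesis by (simp add: power2_eq_square)
   qed
  qed simp
  have "ip (h n) (h n) \<le> ip ?z ?z"
   unfolding ip_eq[OF wh[of ex, simplified] wh[of ey, simplified] wh[of ex, simplified] wh[of ey, simplified]]
   unfolding ip_def
   by (intro add_mono mono s) (use e[of n] in \<open>auto simp: h_def\<close>)
  then show "ip (h n) (h n) \<le> K" using K[of n] by linarith
 next
  fix \<psi> assume \<psi>: "\<psi> \<in> testfun \<Omega> {}"
  have pm: "\<psi> \<in> borel_measurable M" by (rule cont_meas[OF smooth_cont[OF open_dom scsD(1)[OF \<psi>]]])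
  have pi: "integrable M (\<lambda>P. 1 * \<psi> P)"
   by (rule li_test[OF open_dom continuous_li[OF continuous_on_const] \<psi>])
  have hli: "locally_integrable \<Omega> (h n)" for n
   using weak_derivD(1)[OF H1_wD[OF V_H1[OF hV[of n]], of ex]] by simp
  have s: "sqi M (\<lambda>P. sa P * \<phi> n P - sa P * g P)" for n
   using gH pH[of n] by (intro sqi_diff) (auto simp: H1_iff)
  note t = sqi_test_over_sa(1)[OF \<psi>]
  have le: "\<bar>(LINT P|M. h n P * \<psi> P) - (LINT P|M. ?h P * \<psi> P)\<bar>
    \<le> sqrt (ip (\<phi> n - g) (\<phi> n - g)) * sqrt (LINT P|M. (\<psi> P * inverse (sa P))^2) + \<epsilon> n * (LINT P|M. \<bar>1 * \<psi> P\<bar>)" for n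
  proof -
   let ?a = "\<lambda>P. sa P * \<phi> n P - sa P * g P" and ?b = "\<lambda>P. \<psi> P * inverse (sa P)"
   have ab: "integrable M (\<lambda>P. \<bar>?a P\<bar> * \<bar>?b P\<bar>)" by (rule sqi_mult[OF sqi_abs[OF s] sqi_abs[OF t]])
   have "\<bar>(LINT P|M. h n P * \<psi> P) - (LINT P|M. ?h P * \<psi> P)\<bar> = \<bar>LINT P|M. (h n P - ?h P) * \<psi> P\<bar>"
    using li_test[OF open_dom hli[of n] \<psi>] li_test[OF open_dom li \<psi>] by (simp add: left_diff_distrib)
   also have "\<dots> \<le> (LINT P|M. \<bar>?a P\<bar> * \<bar>?b P\<bar> + \<epsilon> n * \<bar>1 * \<psi> P\<bar>)"
   proof (rule order_trans[OF integral_abs_bound], rule integral_mono')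
    show "integrable M (\<lambda>P. \<bar>?a P\<bar> * \<bar>?b P\<bar> + \<epsilon> n * \<bar>1 * \<psi> P\<bar>)" using ab pi by simp
    fix P assume "P \<in> space M"
    then have sP: "sa P > 0" using sa_pos by simp
    have "\<bar>h n P - ?h P\<bar> \<le> \<bar>\<phi> n P - g P\<bar> + \<epsilon> n" using e[of n] by (simp add: h_def)
    from mult_right_mono[OF this, of "\<bar>\<psi> P\<bar>"]
    have "\<bar>(h n P - ?h P) * \<psi> P\<bar> \<le> \<bar>(\<phi> n P - g P) * \<psi> P\<bar> + \<epsilon> n * \<bar>\<psi> P\<bar>" by (simp add: abs_mult distrib_right)
    moreover have "(\<phi> n P - g P) * \<psi> P = ?a P * ?b P" using sP by (simp add: field_simps)
    ultimately show "\<bar>(h n P - ?h P) * \<psi> P\<bar> \<le> \<bar>?a P\<bar> * \<bar>?b P\<bar> + \<epsilon> n * \<bar>1 * \<psi> P\<bar>"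
     by (simp only: abs_mult[symmetric] mult_1)
    show "0 \<le> \<bar>?a P\<bar> * \<bar>?b P\<bar> + \<epsilon> n * \<bar>1 * \<psi> P\<bar>" using e[of n] by simp
   qed
   also have "\<dots> = (LINT P|M. \<bar>?a P\<bar> * \<bar>?b P\<bar>) + \<epsilon> n * (LINT P|M. \<bar>1 * \<psi> P\<bar>)" using ab pi by simp
   also have "(LINT P|M. \<bar>?a P\<bar> * \<bar>?b P\<bar>) \<le> sqrt (LINT P|M. (?a P)^2) * sqrt (LINT P|M. (?b P)^2)"
    using order_trans[OF abs_ge_self L2_cauchy_schwarz'[OF sqi_abs[OF s[of n]] sqi_abs[OF t]]] by simp
   also have "\<dots> \<le> sqrt (ip (\<phi> n - g) (\<phi> n - g)) * sqrt (LINT P|M. (?b P)^2)"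
   proof (intro mult_right_mono real_sqrt_le_mono)
    show "(LINT P|M. (?a P)^2) \<le> ip (\<phi> n - g) (\<phi> n - g)"
     using ip_diff[OF H1_wD[OF pH[of n], of ex] H1_wD[OF pH[of n], of ey] H1_wD[OF gH, of ex] H1_wD[OF gH, of ey]] by simp
   qed simp
   finally show ?thesis by simp
  qed
  have "(\<lambda>n. (LINT P|M. h n P * \<psi> P) - (LINT P|M. ?h P * \<psi> P)) \<longlonglongrightarrow> 0"
  proof (rule Lim_null_comparison[OF always_eventually])
   show "\<forall>n. norm ((LINT P|M. h n P * \<psi> P) - (LINT P|M. ?h P * \<psi> P)) \<le>
    sqrt (ip (\<phi> n - g) (\<phi> n - g)) * sqrt (LINT P|M. (\<psi> P * inverse (sa P))^2) + \<epsilon> n * (LINT P|M. \<bar>1 * \<psi> P\<bar>)"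
    using le by simp
   have "(\<lambda>n. sqrt (ip (\<phi> n - g) (\<phi> n - g)) * sqrt (LINT P|M. (\<psi> P * inverse (sa P))^2) + \<epsilon> n * (LINT P|M. \<bar>1 * \<psi> P\<bar>))
    \<longlonglongrightarrow> sqrt 0 * sqrt (LINT P|M. (\<psi> P * inverse (sa P))^2) + 0 * (LINT P|M. \<bar>1 * \<psi> P\<bar>)"
    by (intro tendsto_intros lim e0)
   then show "(\<lambda>n. sqrt (ip (\<phi> n - g) (\<phi> n - g)) * sqrt (LINT P|M. (\<psi> P * inverse (sa P))^2) + \<epsilon> n * (LINT P|M. \<bar>1 * \<psi> P\<bar>)) \<longlonglongrightarrow> 0"
    by simp
  qed
  then show "(\<lambda>n. LINT P|M. h n P * \<psi> P) \<longlonglongrightarrow> (LINT P|M. ?h P * \<psi> P)" by (rule LIM_zero_cancel)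
 qed
qed

end

section \<open>The Gamma weight\<close>

lemma step_derivative:
 obtains s B where "\<And>t. (step has_real_derivative s t) (at t)" "\<And>t. t < 0 \<or> t > 1 \<Longrightarrow> s t = 0"
  "\<And>t. \<bar>s t\<bar> \<le> B"
proof -
 define g where "g = (\<lambda>P::plane. step (snd P))"
 define s where "s t = pd ey g (t *\<^sub>R ey)" for t
 have g: "smooth UNIV g" unfolding g_def by (intro smooth_intros) auto
 have D: "(step has_real_derivative s t) (at t)" for t
  using pd_field_derivative[OF smooth_Ck[OF g], of ey 0 t] by (simp add: s_def g_def ey_def)
 have z: "s t = 0" if "t < 0 \<or> t > 1" for t
 proof -
  have "(step has_real_derivative 0) (at t)"
   using that
  proof
   assume "t < 0"
   then show ?thesis
    by (intro has_field_derivative_transform_within_open[OF DERIV_const, where S = "{..<0}"]) (auto simp: step_0)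
  next
   assume "t > 1"
   then show ?thesis
    by (intro has_field_derivative_transform_within_open[OF DERIV_const, where S = "{1<..}"]) (auto simp: step_1)
  qed
  from DERIV_unique[OF D this] show ?thesis .
 qed
 have "continuous_on UNIV (\<lambda>t. pd ey g (t *\<^sub>R ey))"
  by (rule continuous_on_compose2[OF smooth_cont[OF open_UNIV smooth_pd[OF g]]]) (auto intro!: continuous_intros)
 then have "continuous_on {0..1} s" unfolding s_def[abs_def] by (rule continuous_on_subset) simp
 then have "bounded (s ` {0..1})" by (intro compact_imp_bounded compact_continuous_image) auto
 then obtain b where "\<forall>z\<in>s ` {0..1}. norm z \<le> b" unfolding bounded_iff by blast
 then have b: "\<bar>s t\<bar> \<le> b" if "t \<in> {0..1}" for t using that by auto
 have "\<bar>s t\<bar> \<le> max b 0" for t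
  using b[of t] z[of t] by (cases "t \<in> {0..1}") auto
 then show thesis using that D z by blast
qed

lemma pd_product:
 assumes X: "(X has_real_derivative x') (at (fst P))" and Y: "(Y has_real_derivative y') (at (snd P))"
 shows "pd ex (\<lambda>P. X (fst P) * Y (snd P)) P = x' * Y (snd P)"
  "pd ey (\<lambda>P. X (fst P) * Y (snd P)) P = X (fst P) * y'"
proof -
 have "((\<lambda>t. X (fst P + t)) has_real_derivative x') (at 0)"
  using X DERIV_shift[of X x' 0 "fst P"] by (simp add: add.commute)
 then have "((\<lambda>t. X (fst P + t) * Y (snd P)) has_real_derivative x' * Y (snd P)) (at 0)"
  by (rule DERIV_cmult_right)
 then show "pd ex (\<lambda>P. X (fst P) * Y (snd P)) P = x' * Y (snd P)"
  unfolding pd_def by (intro DERIV_imp_deriv) (simp add: ex_def)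
 have "((\<lambda>t. Y (snd P + t)) has_real_derivative y') (at 0)"
  using Y DERIV_shift[of Y y' 0 "snd P"] by (simp add: add.commute)
 then have "((\<lambda>t. X (fst P) * Y (snd P + t)) has_real_derivative X (fst P) * y') (at 0)"
  by (rule DERIV_cmult)
 then show "pd ey (\<lambda>P. X (fst P) * Y (snd P)) P = X (fst P) * y'"
  unfolding pd_def by (intro DERIV_imp_deriv) (simp add: ey_def)
qed

lemma sgn_fst_measurable: "(\<lambda>P::plane. sgn (fst P)) \<in> borel_measurable lebesgue"
proof -
 have "(\<lambda>P::plane. sgn (fst P)) \<in> borel_measurable lborel"
  using measurable_compose[OF borel_measurable_continuous_onI[OF continuous_on_fst[OF continuous_on_id]] borel_measurable_sgn]
  by simp
 then show ?thesis by (rule measurable_completion)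
qed

text \<open>The derivatives extend continuously to the compact support, which may touch \<open>T\<close>.\<close>
lemma scs_bounds:
 assumes U: "open U" and \<phi>: "\<phi> \<in> testfun U T"
 obtains B R where "B \<ge> 0" "\<And>P. P \<in> U \<Longrightarrow> \<bar>\<phi> P\<bar> \<le> B" "\<And>P. P \<in> U \<Longrightarrow> \<bar>pd ex \<phi> P\<bar> \<le> B" "\<And>P. P \<in> U \<Longrightarrow> \<bar>pd ey \<phi> P\<bar> \<le> B"
  "\<And>P. P \<in> U \<Longrightarrow> P \<notin> cball 0 R \<Longrightarrow> \<phi> P = 0 \<and> pd ex \<phi> P = 0 \<and> pd ey \<phi> P = 0"
proof -
 obtain K where K: "compact K" "K \<subseteq> U \<union> T" "\<forall>P\<in>(U \<union> T) - K. \<phi> P = 0" using scsD(3)[OF \<phi>] by blast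
 obtain R where R: "\<And>P. P \<in> K \<Longrightarrow> norm P \<le> R" using compact_imp_bounded[OF K(1)] by (auto simp: bounded_iff)
 have z: "\<phi> P = 0" if "P \<in> U - K" for P using K(3) that by blast
 have zd: "pd e \<phi> P = 0" if "P \<in> U - K" for P e by (rule pd_vanishes_on[OF U K(1) z that])
 have bd: "\<exists>b. \<forall>P\<in>U. \<bar>f P\<bar> \<le> b" if g: "continuous_on (U \<union> T) g" "\<forall>P\<in>U. g P = f P" and f: "\<And>P. P \<in> U - K \<Longrightarrow> f P = 0"
  for f g :: "plane \<Rightarrow> real"
 proof -
  have "bounded (g ` K)"
   by (intro compact_imp_bounded compact_continuous_image continuous_on_subset[OF g(1) K(2)] K(1))
  then obtain b where b: "\<And>P. P \<in> K \<Longrightarrow> \<bar>g P\<bar> \<le> b" by (auto simp: bounded_iff)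
  have "\<bar>f P\<bar> \<le> max b 0" if P: "P \<in> U" for P
  proof (cases "P \<in> K")
   case True then show ?thesis using b[OF True] g(2)[rule_format, OF P] by simp
  next
   case False then show ?thesis using f[of P] P by simp
  qed
  then show ?thesis by blast
 qed
 have ext: "\<exists>g. continuous_on (U \<union> T) g \<and> (\<forall>P\<in>U. g P = (pd ex ^^ i) ((pd ey ^^ j) \<phi>) P)" for i j
  using \<phi> by (simp add: smooth_compact_support_def)
 obtain b0 where b0: "\<forall>P\<in>U. \<bar>\<phi> P\<bar> \<le> b0" using bd[of \<phi> \<phi>, OF scsD(2)[OF \<phi>] _ z] by blast
 obtain gx where gx: "continuous_on (U \<union> T) gx" "\<forall>P\<in>U. gx P = pd ex \<phi> P" using ext[of 1 0] by auto
 obtain gy where gy: "continuous_on (U \<union> T) gy" "\<forall>P\<in>U. gy P = pd ey \<phi> P" using ext[of 0 1] by auto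
 obtain b1 where b1: "\<forall>P\<in>U. \<bar>pd ex \<phi> P\<bar> \<le> b1" using bd[OF gx zd] by blast
 obtain b2 where b2: "\<forall>P\<in>U. \<bar>pd ey \<phi> P\<bar> \<le> b2" using bd[OF gy zd] by blast
 define B where "B = max 0 (max b0 (max b1 b2))"
 have le: "b0 \<le> B" "b1 \<le> B" "b2 \<le> B" "B \<ge> 0" by (auto simp: B_def)
 show thesis
 proof (rule that[of B R])
  show "\<bar>\<phi> P\<bar> \<le> B" "\<bar>pd ex \<phi> P\<bar> \<le> B" "\<bar>pd ey \<phi> P\<bar> \<le> B" if "P \<in> U" for P
   using b0[rule_format, OF that] b1[rule_format, OF that] b2[rule_format, OF that] le by linarith+
  show "\<phi> P = 0 \<and> pd ex \<phi> P = 0 \<and> pd ey \<phi> P = 0" if "P \<in> U" "P \<notin> cball 0 R" for P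
  proof -
   have "P \<in> U - K" using R[of P] that by auto
   then show ?thesis using z zd by blast
  qed
 qed (rule le)
qed

lemma power_weight_integrable:
 assumes a: "a > -1" and R: "R \<ge> 0"
 shows "integrable lborel (\<lambda>P::plane. indicator {-R..R} (fst P) * (indicator {0..R} (snd P) * snd P powr a))"
proof -
 let ?g = "\<lambda>y::real. indicator {0..R} y * y powr a"
 have "(\<lambda>y. y powr a) absolutely_integrable_on {0..R}"
  using has_integral_powr_from_0[OF a R] by (intro nonnegative_absolutely_integrable_1) auto
 then have "integrable lebesgue ?g" by (simp add: set_integrable_def)
 moreover have gm: "?g \<in> borel_measurable lborel" by measurable
 ultimately have g: "integrable lborel ?g" using integrable_completion by blast
 have "integrable (lborel \<Otimes>\<^sub>M lborel) (\<lambda>P::plane. indicator {-R..R} (fst P) * ?g (snd P))"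
 proof (rule lborel_pair.Fubini_integrable)
  show "(\<lambda>P::plane. indicator {-R..R} (fst P) * ?g (snd P)) \<in> borel_measurable (lborel \<Otimes>\<^sub>M lborel)" by measurable
  have "integrable lborel (\<lambda>x. indicator {-R..R} x * (LINT y|lborel. \<bar>?g y\<bar>))"
   by (intro integrable_mult_left integrable_real_indicator) (auto simp: emeasure_lborel_Icc_eq)
  then show "integrable lborel (\<lambda>x. LINT y|lborel. norm (indicator {-R..R} (fst (x, y)) * ?g (snd (x, y))))"
   by (simp add: abs_mult)
  show "AE x in lborel. integrable lborel (\<lambda>y. indicator {-R..R} (fst (x, y)) * ?g (snd (x, y)))"
   using g by simp
 qed
 then show ?thesis by (simp add: lborel_prod)
qed

text \<open>In the second variable the weight is a multiple of the density of a Gamma distribution, which is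
 the invariant distribution of the variance process.\<close>
locale gamma_weight =
 fixes \<Omega> :: "plane set" and \<beta> \<mu> \<gamma> :: real and w :: "plane \<Rightarrow> real"
 assumes open_dom: "open \<Omega>" and half: "\<Omega> \<subseteq> half_plane" and \<beta>: "\<beta> > 0" and \<mu>: "\<mu> > 0" and \<gamma>: "\<gamma> > 0"
  and w_eq: "w = (\<lambda>P. snd P powr (\<beta> - 1) * exp (- \<gamma> * \<bar>fst P\<bar> - \<mu> * snd P))"
begin

abbreviation M :: "plane measure" where "M \<equiv> lebesgue_on \<Omega>"

lemma y_pos: "P \<in> \<Omega> \<Longrightarrow> snd P > 0" using half by (auto simp: half_plane_def)

lemma w_pos: "P \<in> \<Omega> \<Longrightarrow> w P > 0" using y_pos[of P] by (simp add: w_eq)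

lemma cont_w: "continuous_on \<Omega> w"
 unfolding w_eq by (intro continuous_intros) (use y_pos in force)+

lemma yw_eq: "P \<in> \<Omega> \<Longrightarrow> snd P * w P = snd P powr \<beta> * exp (- \<gamma> * \<bar>fst P\<bar> - \<mu> * snd P)"
 using powr_add[of "snd P" 1 "\<beta> - 1"] y_pos[of P] by (simp add: w_eq)

lemma bounded_sets_finite_weight:
 "integrable M (\<lambda>P. indicator (cball 0 R) P * ((1 + snd P) * w P))"
proof (cases "R \<ge> 0")
 case R: True
 let ?f = "\<lambda>P::plane. indicator {-R..R} (fst P) * (indicator {0..R} (snd P) * snd P powr (\<beta> - 1))"
 have "integrable lebesgue ?f"
  using power_weight_integrable[of "\<beta> - 1" R] \<beta> R integrable_completion[of ?f lborel] by auto
 then have f: "integrable M ?f"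
  unfolding zext_integrable[OF open_lebesgue[OF open_dom]] zext_indicator
  by (rule integrable_mult_indicator[OF open_lebesgue[OF open_dom]])
 have "(indicator (cball 0 R) :: plane \<Rightarrow> real) \<in> borel_measurable lebesgue"
  by (rule borel_measurable_indicator[OF compact_lebesgue[OF compact_cball]])
 then have "(indicator (cball 0 R) :: plane \<Rightarrow> real) \<in> borel_measurable M" by (rule measurable_restrict_space1)
 then have m: "(\<lambda>P. indicator (cball 0 R) P * ((1 + snd P) * w P)) \<in> borel_measurable M"
  by (rule meas_times[OF _ continuous_imp_measurable_on_sets_lebesgue[OF _ open_lebesgue[OF open_dom]]])
    (intro continuous_intros cont_w)
 show ?thesis
 proof (rule integrable_le[OF integrable_mult_right[OF f, of "1 + R"] m AE_I2])
  fix P assume "P \<in> space M"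
  then have P: "P \<in> \<Omega>" by simp
  note y = y_pos[OF P]
  show "norm (indicator (cball 0 R) P * ((1 + snd P) * w P)) \<le> norm ((1 + R) * ?f P)"
  proof (cases "P \<in> cball 0 R")
   case True
   then have n: "norm P \<le> R" by simp
   have x: "\<bar>fst P\<bar> \<le> R" and yR: "snd P \<le> R" using abs_fst_snd_le[of P] n by linarith+
   have "exp (- \<gamma> * \<bar>fst P\<bar> - \<mu> * snd P) \<le> 1"
   proof -
    have "0 \<le> \<gamma> * \<bar>fst P\<bar>" "0 \<le> \<mu> * snd P" using \<gamma> \<mu> y by simp_all
    then show ?thesis unfolding exp_le_one_iff by linarith
   qed
   then have "w P \<le> snd P powr (\<beta> - 1)" unfolding w_eq by (simp add: mult_left_le)
   then have "(1 + snd P) * w P \<le> (1 + R) * snd P powr (\<beta> - 1)"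
    using yR y w_pos[OF P] R by (intro mult_mono) auto
   then show ?thesis using True x y yR w_pos[OF P] by (simp add: abs_le_iff)
  qed simp
 qed
next
 case False
 then have "cball 0 R = ({} :: plane set)" by simp
 then show ?thesis by simp
qed

lemma quasi_mono:
 assumes P: "P \<in> \<Omega>" and Q: "Q \<in> \<Omega>" and d: "dist P Q < 1" and y: "snd P < snd Q"
 shows "snd P * w P \<le> exp (\<gamma> + \<mu>) * (snd Q * w Q)"
proof -
 have n: "norm (P - Q) < 1" using d by (simp add: dist_norm)
 have "\<bar>fst (P - Q)\<bar> < 1" "\<bar>snd (P - Q)\<bar> < 1" using abs_fst_snd_le[of "P - Q"] n by linarith+
 then have "\<bar>fst Q\<bar> \<le> \<bar>fst P\<bar> + 1" "snd Q \<le> snd P + 1" by auto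
 then have "\<gamma> * \<bar>fst Q\<bar> \<le> \<gamma> * (\<bar>fst P\<bar> + 1)" "\<mu> * snd Q \<le> \<mu> * (snd P + 1)" using \<gamma> \<mu> by auto
 then have e: "exp (- \<gamma> * \<bar>fst P\<bar> - \<mu> * snd P) \<le> exp (\<gamma> + \<mu> + (- \<gamma> * \<bar>fst Q\<bar> - \<mu> * snd Q))"
  by (simp add: algebra_simps)
 have "snd P powr \<beta> \<le> snd Q powr \<beta>" using y y_pos[OF P] \<beta> by (intro powr_mono2) auto
 then have "snd P * w P \<le> snd Q powr \<beta> * exp (\<gamma> + \<mu> + (- \<gamma> * \<bar>fst Q\<bar> - \<mu> * snd Q))"
  unfolding yw_eq[OF P] using e by (intro mult_mono) auto
 then show ?thesis unfolding yw_eq[OF Q] exp_add[of "\<gamma> + \<mu>"] by (simp add: mult.left_commute)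
qed

lemma scs_H1: "testfun \<Omega> T \<subseteq> H1 w \<Omega>"
proof
 fix \<phi> assume \<phi>: "\<phi> \<in> testfun \<Omega> T"
 have s: "smooth \<Omega> \<phi>" by (rule scsD(1)[OF \<phi>])
 have wd: "is_weak_deriv \<Omega> e \<phi> (pd e \<phi>)" if "e \<in> {ex, ey}" for e
  by (rule weak_deriv_classical[OF open_dom that smooth_Ck[OF s]])
 have wm: "wD \<Omega> e \<phi> \<in> borel_measurable M" if "e \<in> {ex, ey}" for e
  by (rule li_measurable[OF open_dom weak_derivD(2)[OF wD_weak_deriv[OF wd[OF that]]]])
 obtain B R where B: "B \<ge> 0" "\<And>P. P \<in> \<Omega> \<Longrightarrow> \<bar>\<phi> P\<bar> \<le> B" "\<And>P. P \<in> \<Omega> \<Longrightarrow> \<bar>pd ex \<phi> P\<bar> \<le> B" "\<And>P. P \<in> \<Omega> \<Longrightarrow> \<bar>pd ey \<phi> P\<bar> \<le> B"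
  and R: "\<And>P. P \<in> \<Omega> \<Longrightarrow> P \<notin> cball 0 R \<Longrightarrow> \<phi> P = 0 \<and> pd ex \<phi> P = 0 \<and> pd ey \<phi> P = 0"
  by (rule scs_bounds[OF open_dom \<phi>]) (rule that)
 have cm: "h \<in> borel_measurable M" if "continuous_on \<Omega> h" for h :: "plane \<Rightarrow> real"
  by (rule continuous_imp_measurable_on_sets_lebesgue[OF that open_lebesgue[OF open_dom]])
 have "integrable M (H1_density w \<Omega> \<phi>)"
 proof (rule integrable_le[OF integrable_mult_right[OF bounded_sets_finite_weight[of R], of "3 * B^2"]])
  show "H1_density w \<Omega> \<phi> \<in> borel_measurable M"
   unfolding H1_density_def[abs_def] wgrad_sq_def
   by (intro meas_times borel_measurable_add borel_measurable_power wm cm cont_w continuous_intros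
     smooth_cont[OF open_dom s]) auto
  show "AE P in M. norm (H1_density w \<Omega> \<phi> P) \<le> norm (3 * B^2 * (indicator (cball 0 R) P * ((1 + snd P) * w P)))"
   using wD_AE[OF open_dom insertI1 wd[OF insertI1]] wD_AE[OF open_dom insertI2[OF insertI1] wd[OF insertI2[OF insertI1]]] AE_space
  proof eventually_elim
   case (elim P)
   then have P: "P \<in> \<Omega>" by simp
   note y = y_pos[OF P] and wp = w_pos[OF P]
   have eq: "H1_density w \<Omega> \<phi> P = (snd P * ((pd ex \<phi> P)^2 + (pd ey \<phi> P)^2) + (1 + snd P) * (\<phi> P)^2) * w P"
    using elim by (simp add: H1_density_def wgrad_sq_def)
   have nn: "H1_density w \<Omega> \<phi> P \<ge> 0" unfolding eq using y wp by simp
   have sq: "(\<phi> P)^2 \<le> B^2" "(pd ex \<phi> P)^2 \<le> B^2" "(pd ey \<phi> P)^2 \<le> B^2"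
    using B(2-4)[OF P] B(1) by (simp_all add: abs_le_square_iff[symmetric])
   have "snd P * ((pd ex \<phi> P)^2 + (pd ey \<phi> P)^2) \<le> (1 + snd P) * (B^2 + B^2)"
    using y sq by (intro mult_mono) auto
   moreover have "(1 + snd P) * (\<phi> P)^2 \<le> (1 + snd P) * B^2" using y sq by (intro mult_left_mono) auto
   ultimately have "snd P * ((pd ex \<phi> P)^2 + (pd ey \<phi> P)^2) + (1 + snd P) * (\<phi> P)^2 \<le> 3 * B^2 * (1 + snd P)"
    by (simp add: algebra_simps)
   from mult_right_mono[OF this, of "w P"] have le: "H1_density w \<Omega> \<phi> P \<le> 3 * B^2 * ((1 + snd P) * w P)"
    unfolding eq using wp by (simp add: mult.assoc)
   have z: "H1_density w \<Omega> \<phi> P = 0" if "P \<notin> cball 0 R" unfolding eq using R[OF P that] by simp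
   have rn: "3 * B^2 * ((1 + snd P) * w P) \<ge> 0" using y wp by simp
   show ?case
   proof (cases "P \<in> cball 0 R")
    case True
    then show ?thesis using nn le rn by simp
   next
    case False
    then show ?thesis using z by simp
   qed
  qed
 qed
 then show "\<phi> \<in> H1 w \<Omega>" unfolding H1_def using weakly_diffI[OF wd] by simp
qed

text \<open>The test function \<open>v\<close> need not vanish near \<open>T\<close>, and \<open>y w\<close> is not smooth. The functions \<open>f n\<close> are smooth,
 vanish near \<open>y = 0\<close> and approximate \<open>y w\<close>, so \<open>f n * v\<close> can be used in the definition of the weak derivative.\<close>
lemma integration_by_parts_limit:
 assumes g: "is_weak_deriv \<Omega> e g ge" and e: "e \<in> {ex, ey}" and v: "v \<in> testfun \<Omega> (S \<times> {0})"
  and d: "\<And>n. d n > 0" and f: "\<And>n. smooth \<Omega> (f n)" and f0: "\<And>n P. P \<in> \<Omega> \<Longrightarrow> snd P \<le> d n \<Longrightarrow> f n P = 0"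
  and fb: "\<And>n P. P \<in> \<Omega> \<Longrightarrow> \<bar>f n P\<bar> \<le> snd P * w P" and fl: "\<And>P. P \<in> \<Omega> \<Longrightarrow> (\<lambda>n. f n P) \<longlonglongrightarrow> snd P * w P"
  and Fb: "\<And>n P. P \<in> \<Omega> \<Longrightarrow> \<bar>pd e (f n) P\<bar> \<le> C * ((1 + snd P) * w P)"
  and Fl: "\<And>P. P \<in> \<Omega> \<Longrightarrow> (\<lambda>n. pd e (f n) P) \<longlonglongrightarrow> F P" and Fm: "F \<in> borel_measurable M"
  and i: "integrable M (\<lambda>P. ge P * v P * (snd P * w P))" "integrable M (\<lambda>P. g P * pd e v P * (snd P * w P))"
   "integrable M (\<lambda>P. g P * v P * ((1 + snd P) * w P))"
 shows "integrable M (\<lambda>P. g P * v P * F P)"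
  "(LINT P|M. ge P * v P * (snd P * w P)) = - (LINT P|M. g P * pd e v P * (snd P * w P)) - (LINT P|M. g P * v P * F P)"
proof -
 have vs: "smooth \<Omega> v" by (rule scsD(1)[OF v])
 have cm: "h \<in> borel_measurable M" if "continuous_on \<Omega> h" for h :: "plane \<Rightarrow> real"
  by (rule continuous_imp_measurable_on_sets_lebesgue[OF that open_lebesgue[OF open_dom]])
 have vm: "v \<in> borel_measurable M" "pd e v \<in> borel_measurable M" and fm: "f n \<in> borel_measurable M" "pd e (f n) \<in> borel_measurable M" for n
  by (intro cm smooth_cont[OF open_dom] vs f smooth_pd e)+
 have gm: "g \<in> borel_measurable M" "ge \<in> borel_measurable M"
  by (rule li_measurable[OF open_dom weak_derivD(1)[OF g]] li_measurable[OF open_dom weak_derivD(2)[OF g]])+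
 obtain K where K: "compact K" "K \<subseteq> \<Omega> \<union> S \<times> {0}" "\<forall>P\<in>(\<Omega> \<union> S \<times> {0}) - K. v P = 0" using scsD(3)[OF v] by blast
 have test: "(\<lambda>P. f n P * v P) \<in> testfun \<Omega> {}" for n
 proof (rule scs_emptyI[OF open_dom smooth_mult[OF open_dom f vs]])
  have "closed {P::plane. d n \<le> snd P}" by (intro closed_Collect_le continuous_intros)
  then show "compact (K \<inter> {P. d n \<le> snd P})" by (rule compact_Int_closed[OF K(1)])
  show "K \<inter> {P. d n \<le> snd P} \<subseteq> \<Omega>"
  proof
   fix P assume "P \<in> K \<inter> {P. d n \<le> snd P}"
   then have "P \<in> \<Omega> \<union> S \<times> {0}" "snd P > 0" using K(2) d[of n] by auto
   then show "P \<in> \<Omega>" by auto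
  qed
  show "f n P * v P = 0" if "P \<in> \<Omega> - K \<inter> {P. d n \<le> snd P}" for P
   using that f0[of P n] K(3) by (cases "P \<in> K") auto
 qed
 have ppd: "pd e (\<lambda>P. f n P * v P) P = f n P * pd e v P + pd e (f n) P * v P" if "P \<in> \<Omega>" for n P
  by (rule pd_mult'[OF open_dom that smooth_Ck[OF f] smooth_Ck[OF vs] e])
 have dom: "integrable M s \<and> (\<forall>n. integrable M (t n)) \<and> (\<lambda>n. LINT P|M. t n P) \<longlonglongrightarrow> (LINT P|M. s P)"
  if "s \<in> borel_measurable M" "\<And>n. t n \<in> borel_measurable M" "\<And>P. P \<in> \<Omega> \<Longrightarrow> (\<lambda>n. t n P) \<longlonglongrightarrow> s P"
   "integrable M b" "\<And>n P. P \<in> \<Omega> \<Longrightarrow> \<bar>t n P\<bar> \<le> b P" for s b :: "plane \<Rightarrow> real" and t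
 proof -
  have l: "AE P in M. (\<lambda>n. t n P) \<longlonglongrightarrow> s P" by (rule AE_I2) (use that(3) in simp)
  have b: "AE P in M. norm (t n P) \<le> b P" for n by (rule AE_I2) (use that(5) in simp)
  show ?thesis
   using integrable_dominated_convergence[OF that(1,2,4) l b] integrable_dominated_convergence2[OF that(1,2,4) l b]
    integral_dominated_convergence[OF that(1,2,4) l b] by blast
 qed
 have ywm: "(\<lambda>P. snd P * w P) \<in> borel_measurable M" by (intro cm continuous_intros cont_w)
 have bd: "\<bar>a * p * q\<bar> \<le> \<bar>a * p * b\<bar>" if "\<bar>q\<bar> \<le> (b::real)" for a p q b
 proof -
  have "\<bar>q\<bar> \<le> \<bar>b\<bar>" using that by simp
  then show ?thesis unfolding abs_mult[of "a * p"] by (rule mult_left_mono) simp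
 qed
 have 1: "integrable M (\<lambda>P. ge P * v P * (snd P * w P)) \<and> (\<forall>n. integrable M (\<lambda>P. ge P * v P * f n P)) \<and>
  (\<lambda>n. LINT P|M. ge P * v P * f n P) \<longlonglongrightarrow> (LINT P|M. ge P * v P * (snd P * w P))"
  by (rule dom[OF _ _ _ integrable_abs[OF i(1)] bd])
    (auto intro!: meas_times gm vm fm ywm tendsto_intros fl fb)
 have 2: "integrable M (\<lambda>P. g P * pd e v P * (snd P * w P)) \<and> (\<forall>n. integrable M (\<lambda>P. g P * pd e v P * f n P)) \<and>
  (\<lambda>n. LINT P|M. g P * pd e v P * f n P) \<longlonglongrightarrow> (LINT P|M. g P * pd e v P * (snd P * w P))"
  by (rule dom[OF _ _ _ integrable_abs[OF i(2)] bd])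
    (auto intro!: meas_times gm vm fm ywm tendsto_intros fl fb)
 have i3: "integrable M (\<lambda>P. \<bar>g P * v P * (C * ((1 + snd P) * w P))\<bar>)"
  using integrable_abs[OF integrable_mult_right[OF i(3), of C]] by (simp add: mult.left_commute)
 have 3: "integrable M (\<lambda>P. g P * v P * F P) \<and> (\<forall>n. integrable M (\<lambda>P. g P * v P * pd e (f n) P)) \<and>
  (\<lambda>n. LINT P|M. g P * v P * pd e (f n) P) \<longlonglongrightarrow> (LINT P|M. g P * v P * F P)"
  by (rule dom[OF _ _ _ i3 bd])
    (auto intro!: meas_times gm vm fm Fm tendsto_intros Fl Fb)
 have eq: "(LINT P|M. g P * pd e v P * f n P) + (LINT P|M. g P * v P * pd e (f n) P) = - (LINT P|M. ge P * v P * f n P)" for n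
 proof -
  have "(LINT P|M. g P * pd e v P * f n P) + (LINT P|M. g P * v P * pd e (f n) P)
   = (LINT P|M. g P * pd e v P * f n P + g P * v P * pd e (f n) P)" using 2 3 by simp
  also have "\<dots> = (LINT P|M. g P * pd e (\<lambda>P. f n P * v P) P)"
  proof (rule lint_cong)
   fix P assume "P \<in> space M"
   then have P: "P \<in> \<Omega>" by simp
   show "g P * pd e v P * f n P + g P * v P * pd e (f n) P = g P * pd e (\<lambda>P. f n P * v P) P"
    unfolding ppd[OF P] by (simp add: algebra_simps)
  qed simp
  also have "\<dots> = - (LINT P|M. ge P * (f n P * v P))" by (rule weak_derivD(3)[OF g test])
  also have "\<dots> = - (LINT P|M. ge P * v P * f n P)" by (simp add: mult_ac)
  finally show ?thesis .
 qed
 have "(\<lambda>n. (LINT P|M. g P * pd e v P * f n P) + (LINT P|M. g P * v P * pd e (f n) P))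
   \<longlonglongrightarrow> (LINT P|M. g P * pd e v P * (snd P * w P)) + (LINT P|M. g P * v P * F P)"
  using 2 3 by (intro tendsto_add) auto
 moreover have "(\<lambda>n. (LINT P|M. g P * pd e v P * f n P) + (LINT P|M. g P * v P * pd e (f n) P))
   \<longlonglongrightarrow> - (LINT P|M. ge P * v P * (snd P * w P))"
  unfolding eq using 1 by (intro tendsto_minus) auto
 ultimately have "(LINT P|M. g P * pd e v P * (snd P * w P)) + (LINT P|M. g P * v P * F P) = - (LINT P|M. ge P * v P * (snd P * w P))"
  by (rule LIMSEQ_unique)
 then show "(LINT P|M. ge P * v P * (snd P * w P)) = - (LINT P|M. g P * pd e v P * (snd P * w P)) - (LINT P|M. g P * v P * F P)"
  by linarith
 show "integrable M (\<lambda>P. g P * v P * F P)" using 3 by blast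
qed

text \<open>The smooth profile replaces \<open>|x|\<close> by \<open>sqrt (x\<^sup>2 + d\<^sup>2)\<close> and cuts off below \<open>y = d\<close>.\<close>
lemma approximating_profile:
 assumes d: "d > 0"
 defines "X \<equiv> \<lambda>x. exp (- \<gamma> * sqrt (x^2 + d^2))" and "Y \<equiv> \<lambda>y. y powr \<beta> * exp (- \<mu> * y) * step (y / d - 1)"
 shows "smooth \<Omega> (\<lambda>P. X (fst P) * Y (snd P))"
  and "(X has_real_derivative - \<gamma> * (x / sqrt (x^2 + d^2)) * X x) (at x)"
  and "y > 0 \<Longrightarrow> (step has_real_derivative s) (at (y / d - 1)) \<Longrightarrow>
   (Y has_real_derivative ((\<beta> / y - \<mu>) * Y y + y powr \<beta> * exp (- \<mu> * y) * (s / d))) (at y)"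
  and "0 \<le> X x" "X x \<le> exp (- \<gamma> * \<bar>x\<bar>)" "0 \<le> Y y" "Y y \<le> y powr \<beta> * exp (- \<mu> * y)" "y \<le> d \<Longrightarrow> Y y = 0"
proof -
 have s2: "x^2 + d^2 > 0" for x using d by (simp add: add_nonneg_pos)
 have "smooth \<Omega> (\<lambda>P. exp (- \<gamma> * ((fst P * fst P + d^2) powr (1/2))) *
   (snd P powr \<beta> * exp (- \<mu> * snd P) * step ((1 / d) * snd P - 1)))"
  by (intro smooth_intros open_dom) (use s2 y_pos in \<open>auto simp: power2_eq_square\<close>)
 then show "smooth \<Omega> (\<lambda>P. X (fst P) * Y (snd P))"
  by (rule smooth_cong[OF open_dom, rotated]) (use s2 in \<open>simp add: X_def Y_def powr_half_sqrt power2_eq_square\<close>)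
 show "(X has_real_derivative - \<gamma> * (x / sqrt (x^2 + d^2)) * X x) (at x)"
  unfolding X_def using s2[of x] by (auto intro!: derivative_eq_intros simp: field_simps)
 show "(Y has_real_derivative ((\<beta> / y - \<mu>) * Y y + y powr \<beta> * exp (- \<mu> * y) * (s / d))) (at y)"
  if y: "y > 0" and s: "(step has_real_derivative s) (at (y / d - 1))"
 proof -
  have a: "((\<lambda>y. y powr \<beta>) has_real_derivative \<beta> / y * y powr \<beta>) (at y)"
   using has_real_derivative_powr[OF y, of \<beta>] powr_diff[of y \<beta> 1] y by simp
  have b: "((\<lambda>y. exp (- \<mu> * y)) has_real_derivative - \<mu> * exp (- \<mu> * y)) (at y)"
   by (auto intro!: derivative_eq_intros)
  have "((\<lambda>y. y / d - 1) has_real_derivative 1 / d) (at y)" using d by (auto intro!: derivative_eq_intros)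
  from DERIV_chain2[OF s this] have c: "((\<lambda>y. step (y / d - 1)) has_real_derivative s * (1 / d)) (at y)" .
  show ?thesis unfolding Y_def
   by (rule DERIV_cong[OF DERIV_mult[OF DERIV_mult[OF a b] c]]) (simp add: algebra_simps)
 qed
 show "0 \<le> X x" by (simp add: X_def)
 have "\<bar>x\<bar> \<le> sqrt (x^2 + d^2)" by (rule real_le_rsqrt) simp
 then show "X x \<le> exp (- \<gamma> * \<bar>x\<bar>)" using \<gamma> by (simp add: X_def)
 show "0 \<le> Y y" by (simp add: Y_def step_ge0)
 show "Y y \<le> y powr \<beta> * exp (- \<mu> * y)" unfolding Y_def by (rule mult_left_le[OF step_le1]) simp
 show "Y y = 0" if "y \<le> d" unfolding Y_def using that d by (simp add: step_0)
qed

text \<open>The derivative of the cutoff lives on \<open>d \<le> y \<le> 2 d\<close> and has size \<open>1 / d\<close>, thus is dominated by a multiple of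
 \<open>1 / y\<close>, which turns \<open>y w\<close> into the integrable weight \<open>w\<close>; it tends to \<open>0\<close> pointwise.\<close>
lemma weighted_integration_by_parts:
 assumes v: "v \<in> testfun \<Omega> (S \<times> {0})"
  and i: "integrable M (\<lambda>P. ge P * v P * (snd P * w P))" "integrable M (\<lambda>P. g P * v P * ((1 + snd P) * w P))"
 shows "is_weak_deriv \<Omega> ex g ge \<Longrightarrow> integrable M (\<lambda>P. g P * pd ex v P * (snd P * w P)) \<Longrightarrow>
   (LINT P|M. ge P * v P * (snd P * w P)) = - (LINT P|M. g P * pd ex v P * (snd P * w P))
    + \<gamma> * (LINT P|M. g P * v P * (sgn (fst P) * (snd P * w P)))"
  and "is_weak_deriv \<Omega> ey g ge \<Longrightarrow> integrable M (\<lambda>P. g P * pd ey v P * (snd P * w P)) \<Longrightarrow>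
   (LINT P|M. ge P * v P * (snd P * w P)) = - (LINT P|M. g P * pd ey v P * (snd P * w P))
    - (LINT P|M. g P * v P * ((\<beta> - \<mu> * snd P) * w P))"
proof -
 obtain s B where s: "\<And>t. (step has_real_derivative s t) (at t)" "\<And>t. t < 0 \<or> t > 1 \<Longrightarrow> s t = 0" "\<And>t. \<bar>s t\<bar> \<le> B"
  by (rule step_derivative) (rule that)
 define d where "d n = inverse (real (Suc n))" for n
 have d: "d n > 0" for n by (simp add: d_def)
 have d0: "d \<longlonglongrightarrow> 0" unfolding d_def by (rule LIMSEQ_inverse_real_of_nat)
 define X where "X n x = exp (- \<gamma> * sqrt (x^2 + (d n)^2))" for n x
 define Y where "Y n y = y powr \<beta> * exp (- \<mu> * y) * step (y / d n - 1)" for n y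
 define f where "f n P = X n (fst P) * Y n (snd P)" for n P
 note prof = approximating_profile[OF d, folded X_def Y_def]
 have Xl: "(\<lambda>n. X n x) \<longlonglongrightarrow> exp (- \<gamma> * \<bar>x\<bar>)" for x
 proof -
  have "(\<lambda>n. X n x) \<longlonglongrightarrow> exp (- \<gamma> * sqrt (x^2 + 0^2))" unfolding X_def by (intro tendsto_intros d0)
  then show ?thesis by simp
 qed
 have far: "eventually (\<lambda>n. y / d n - 1 > 1) sequentially" if y: "y > 0" for y
 proof -
  have "eventually (\<lambda>n. d n < y / 2) sequentially" using order_tendstoD(2)[OF d0, of "y / 2"] y by simp
  then show ?thesis by eventually_elim (use d in \<open>simp add: field_simps\<close>)
 qed
 have Yl: "(\<lambda>n. Y n y) \<longlonglongrightarrow> y powr \<beta> * exp (- \<mu> * y)" if y: "y > 0" for y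
  by (rule tendsto_eventually, use far[OF y] in eventually_elim) (simp add: Y_def step_1)
 have yw: "snd P * w P = exp (- \<gamma> * \<bar>fst P\<bar>) * (snd P powr \<beta> * exp (- \<mu> * snd P))" if "P \<in> \<Omega>" for P
  unfolding yw_eq[OF that] by (simp add: exp_diff exp_minus field_simps)
 have wY: "w P = exp (- \<gamma> * \<bar>fst P\<bar>) * (snd P powr \<beta> * exp (- \<mu> * snd P)) / snd P" if "P \<in> \<Omega>" for P
  using yw[OF that] y_pos[OF that] by (simp add: field_simps)
 have fs: "smooth \<Omega> (f n)" for n unfolding f_def[abs_def] by (rule prof(1))
 have f0: "f n P = 0" if "snd P \<le> d n" for n P unfolding f_def using prof(8)[OF that] by simp
 have fb: "\<bar>f n P\<bar> \<le> snd P * w P" if P: "P \<in> \<Omega>" for n P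
  unfolding yw[OF P] f_def abs_mult abs_of_nonneg[OF prof(4)] abs_of_nonneg[OF prof(6)]
  by (rule mult_mono[OF prof(5) prof(7) _ prof(6)]) simp
 have fl: "(\<lambda>n. f n P) \<longlonglongrightarrow> snd P * w P" if P: "P \<in> \<Omega>" for P
  unfolding yw[OF P] f_def by (intro tendsto_mult Xl Yl y_pos[OF P])
 have px: "pd ex (f n) P = - \<gamma> * (fst P / sqrt ((fst P)^2 + (d n)^2)) * f n P" if P: "P \<in> \<Omega>" for n P
  using pd_product(1)[OF prof(2) prof(3)[OF y_pos[OF P] s(1)], of n n] unfolding f_def[abs_def] by (simp add: mult.assoc)
 have py: "pd ey (f n) P = (\<beta> / snd P - \<mu>) * f n P +
   X n (fst P) * (snd P powr \<beta> * exp (- \<mu> * snd P)) * (s (snd P / d n - 1) / d n)" if P: "P \<in> \<Omega>" for n P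
  using pd_product(2)[OF prof(2) prof(3)[OF y_pos[OF P] s(1)], of n n] unfolding f_def[abs_def] by (simp add: algebra_simps)
 have cm: "h \<in> borel_measurable M" if "continuous_on \<Omega> h" for h :: "plane \<Rightarrow> real"
  by (rule continuous_imp_measurable_on_sets_lebesgue[OF that open_lebesgue[OF open_dom]])
 note lim = integration_by_parts_limit[where d = d and f = f, OF _ _ v d fs _ fb fl]
 show "(LINT P|M. ge P * v P * (snd P * w P)) = - (LINT P|M. g P * pd ex v P * (snd P * w P))
    + \<gamma> * (LINT P|M. g P * v P * (sgn (fst P) * (snd P * w P)))"
  if wd: "is_weak_deriv \<Omega> ex g ge" and ix: "integrable M (\<lambda>P. g P * pd ex v P * (snd P * w P))"
 proof -
  let ?F = "\<lambda>P. - \<gamma> * (sgn (fst P) * (snd P * w P))"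
  have "(LINT P|M. ge P * v P * (snd P * w P)) = - (LINT P|M. g P * pd ex v P * (snd P * w P)) - (LINT P|M. g P * v P * ?F P)"
  proof (rule lim(2)[OF wd _ _ _ _ _ _ _ i(1) ix i(2), where C = \<gamma>])
   fix P assume P: "P \<in> \<Omega>"
   have q: "\<bar>fst P / sqrt ((fst P)^2 + (d n)^2)\<bar> \<le> 1" for n
   proof -
    have "\<bar>fst P\<bar> \<le> sqrt ((fst P)^2 + (d n)^2)" by (rule real_le_rsqrt) simp
    moreover have "sqrt ((fst P)^2 + (d n)^2) > 0" using d[of n] by (simp add: add_nonneg_pos)
    ultimately show ?thesis by (simp add: abs_div divide_le_eq_1)
   qed
   show "\<bar>pd ex (f n) P\<bar> \<le> \<gamma> * ((1 + snd P) * w P)" for n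
   proof -
    have "\<bar>pd ex (f n) P\<bar> = \<gamma> * (\<bar>fst P / sqrt ((fst P)^2 + (d n)^2)\<bar> * \<bar>f n P\<bar>)"
     unfolding px[OF P] using \<gamma> by (simp add: abs_mult)
    also have "\<dots> \<le> \<gamma> * (1 * (snd P * w P))" using q fb[OF P] \<gamma> by (intro mult_left_mono mult_mono) auto
    also have "\<dots> \<le> \<gamma> * ((1 + snd P) * w P)" using \<gamma> w_pos[OF P] by (intro mult_left_mono) (auto simp: algebra_simps)
    finally show ?thesis .
   qed
   have "(\<lambda>n. fst P / sqrt ((fst P)^2 + (d n)^2)) \<longlonglongrightarrow> sgn (fst P)"
   proof (cases "fst P = 0")
    case False
    then have "(\<lambda>n. fst P / sqrt ((fst P)^2 + (d n)^2)) \<longlonglongrightarrow> fst P / sqrt ((fst P)^2 + 0^2)"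
     by (intro tendsto_intros d0) simp
    then show ?thesis by (simp add: real_sgn_eq)
   qed simp
   from tendsto_mult[OF tendsto_mult[OF tendsto_const[of "- \<gamma>"] this] fl[OF P]]
   show "(\<lambda>n. pd ex (f n) P) \<longlonglongrightarrow> ?F P" unfolding px[OF P] by (simp add: mult.assoc)
  next
   have "(\<lambda>P. sgn (fst P)) \<in> borel_measurable M" by (rule measurable_restrict_space1[OF sgn_fst_measurable])
   then show "?F \<in> borel_measurable M"
    by (rule meas_times[OF borel_measurable_const meas_times[OF _ cm]]) (intro continuous_intros cont_w)
  qed (simp_all add: f0)
  then show ?thesis by (simp add: mult.left_commute)
 qed
 show "(LINT P|M. ge P * v P * (snd P * w P)) = - (LINT P|M. g P * pd ey v P * (snd P * w P))
    - (LINT P|M. g P * v P * ((\<beta> - \<mu> * snd P) * w P))"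
  if wd: "is_weak_deriv \<Omega> ey g ge" and iy: "integrable M (\<lambda>P. g P * pd ey v P * (snd P * w P))"
 proof (rule lim(2)[OF wd _ _ _ _ _ _ _ i(1) iy i(2), where C = "\<beta> + \<mu> + 2 * B"])
  fix P assume P: "P \<in> \<Omega>"
  note y = y_pos[OF P] and wp = w_pos[OF P]
  have B0: "B \<ge> 0" using s(3)[of 0] by simp
  let ?r = "\<lambda>n. X n (fst P) * (snd P powr \<beta> * exp (- \<mu> * snd P)) * (s (snd P / d n - 1) / d n)"
  show "\<bar>pd ey (f n) P\<bar> \<le> (\<beta> + \<mu> + 2 * B) * ((1 + snd P) * w P)" for n
  proof -
   have "\<bar>(\<beta> / snd P - \<mu>) * f n P\<bar> \<le> (\<beta> / snd P + \<mu>) * (snd P * w P)"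
    unfolding abs_mult using fb[OF P] \<beta> \<mu> y by (intro mult_mono) (auto simp: abs_le_iff)
   also have "\<dots> = (\<beta> + \<mu> * snd P) * w P" using y by (simp add: field_simps)
   also have "\<dots> \<le> ((\<beta> + \<mu>) * (1 + snd P)) * w P" using y wp \<beta> \<mu> by (intro mult_right_mono) (auto simp: algebra_simps)
   finally have 1: "\<bar>(\<beta> / snd P - \<mu>) * f n P\<bar> \<le> (\<beta> + \<mu>) * ((1 + snd P) * w P)" by (simp add: mult.assoc)
   have sd: "\<bar>s (snd P / d n - 1) / d n\<bar> \<le> 2 * B / snd P"
   proof (cases "snd P / d n - 1 > 1")
    case True
    then show ?thesis using s(2) B0 y by simp
   next
    case False
    then have "1 / d n \<le> 2 / snd P" using d[of n] y by (simp add: field_simps)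
    then have "\<bar>s (snd P / d n - 1)\<bar> * (1 / d n) \<le> B * (2 / snd P)" using s(3) B0 d[of n] by (intro mult_mono) auto
    then show ?thesis using d[of n] by (simp add: abs_div mult.commute[of B 2])
   qed
   have "\<bar>?r n\<bar> \<le> exp (- \<gamma> * \<bar>fst P\<bar>) * (snd P powr \<beta> * exp (- \<mu> * snd P)) * (2 * B / snd P)"
    unfolding abs_mult[of _ "s (snd P / d n - 1) / d n"]
   proof (rule mult_mono)
    have "X n (fst P) * (snd P powr \<beta> * exp (- \<mu> * snd P)) \<le> exp (- \<gamma> * \<bar>fst P\<bar>) * (snd P powr \<beta> * exp (- \<mu> * snd P))"
     by (rule mult_right_mono[OF prof(5)]) simp
    then show "\<bar>X n (fst P) * (snd P powr \<beta> * exp (- \<mu> * snd P))\<bar> \<le> exp (- \<gamma> * \<bar>fst P\<bar>) * (snd P powr \<beta> * exp (- \<mu> * snd P))"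
     using prof(4)[of n "fst P"] by (simp only: abs_of_nonneg mult_nonneg_nonneg powr_ge_zero exp_ge_zero)
   qed (use sd in auto)
   also have "\<dots> = 2 * B * w P" using wY[OF P] by (simp add: mult_ac)
   also have "\<dots> \<le> 2 * B * ((1 + snd P) * w P)" using B0 wp y by (intro mult_left_mono) (auto simp: algebra_simps)
   finally have 2: "\<bar>?r n\<bar> \<le> 2 * B * ((1 + snd P) * w P)" .
   show ?thesis unfolding py[OF P] distrib_right[of "\<beta> + \<mu>"] by (rule order_trans[OF abs_triangle_ineq add_mono[OF 1 2]])
  qed
  have "(\<lambda>n. ?r n) \<longlonglongrightarrow> 0"
   by (rule tendsto_eventually, use far[OF y] in eventually_elim) (simp add: s(2))
  from tendsto_add[OF tendsto_mult[OF tendsto_const[of "\<beta> / snd P - \<mu>"] fl[OF P]] this]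
  have "(\<lambda>n. pd ey (f n) P) \<longlonglongrightarrow> (\<beta> / snd P - \<mu>) * (snd P * w P) + 0" unfolding py[OF P] .
  moreover have "(\<beta> / snd P - \<mu>) * (snd P * w P) + 0 = (\<beta> - \<mu> * snd P) * w P" using y by (simp add: field_simps)
  ultimately show "(\<lambda>n. pd ey (f n) P) \<longlonglongrightarrow> (\<beta> - \<mu> * snd P) * w P" by (simp only:)
 next
  show "(\<lambda>P. (\<beta> - \<mu> * snd P) * w P) \<in> borel_measurable M" by (intro cm continuous_intros cont_w)
 qed (simp_all add: f0)
qed

sublocale W: half_weighted \<Omega> "Gamma0 \<Omega> \<times> {0}" w "Gamma0 \<Omega>"
proof unfold_locales
 show "\<exists>C\<ge>0. \<forall>P\<in>\<Omega>. \<forall>Q\<in>\<Omega>. dist P Q < 1 \<longrightarrow> snd P < snd Q \<longrightarrow> snd P * w P \<le> C * (snd Q * w Q)"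
  by (rule exI[of _ "exp (\<gamma> + \<mu>)"]) (use quasi_mono in simp)
 show "(x, 0) \<in> frontier \<Omega>" if "x \<in> Gamma0 \<Omega>" for x
  using that interior_subset unfolding Gamma0_def by blast
qed (simp_all add: open_dom half cont_w w_pos scs_H1 bounded_sets_finite_weight Gamma0_def)

end

section \<open>The Heston form\<close>

lemma (in hilbert) bounded_bilinear_limit:
 assumes A: "\<And>u v z. u \<in> H \<Longrightarrow> v \<in> H \<Longrightarrow> z \<in> H \<Longrightarrow> A (u - v) z = A u z - A v z"
   "\<And>u v z. u \<in> H \<Longrightarrow> v \<in> H \<Longrightarrow> z \<in> H \<Longrightarrow> A z (u - v) = A z u - A z v"
  and bd: "\<And>u v. u \<in> H \<Longrightarrow> v \<in> H \<Longrightarrow> \<bar>A u v\<bar> \<le> C * nrm u * nrm v"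
  and X: "\<And>n. X n \<in> H" and L: "L \<in> H" and lim: "(\<lambda>n. B (X n - L) (X n - L)) \<longlonglongrightarrow> 0"
 shows "z \<in> H \<Longrightarrow> (\<lambda>n. A z (X n)) \<longlonglongrightarrow> A z L" "(\<lambda>n. A (X n) (X n)) \<longlonglongrightarrow> A L L"
proof -
 have n0: "(\<lambda>n. nrm (X n - L)) \<longlonglongrightarrow> 0" by (rule nrm_tendsto(1)[OF X L lim L])
 have D: "X n - L \<in> H" for n by (rule mem(2)[OF X L])
 have z: "(\<lambda>n. A z (X n)) \<longlonglongrightarrow> A z L" if z: "z \<in> H" for z
 proof (rule LIM_zero_cancel, rule Lim_null_comparison[OF always_eventually])
  show "\<forall>n. norm (A z (X n) - A z L) \<le> C * nrm z * nrm (X n - L)" using bd[OF z D] A(2)[OF X L z] by simp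
  show "(\<lambda>n. C * nrm z * nrm (X n - L)) \<longlonglongrightarrow> 0" using tendsto_mult[OF tendsto_const n0, of "C * nrm z"] by simp
 qed
 then show "z \<in> H \<Longrightarrow> (\<lambda>n. A z (X n)) \<longlonglongrightarrow> A z L" .
 have "(\<lambda>n. A (X n - L) (X n - L)) \<longlonglongrightarrow> 0"
 proof (rule Lim_null_comparison[OF always_eventually])
  show "\<forall>n. norm (A (X n - L) (X n - L)) \<le> C * nrm (X n - L) * nrm (X n - L)" using bd[OF D D] by simp
  show "(\<lambda>n. C * nrm (X n - L) * nrm (X n - L)) \<longlonglongrightarrow> 0"
   using tendsto_mult[OF tendsto_mult[OF tendsto_const n0] n0, of C] by simp
 qed
 moreover have "(\<lambda>n. A (X n - L) L) \<longlonglongrightarrow> 0"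
 proof (rule Lim_null_comparison[OF always_eventually])
  show "\<forall>n. norm (A (X n - L) L) \<le> C * nrm (X n - L) * nrm L" using bd[OF D L] by simp
  show "(\<lambda>n. C * nrm (X n - L) * nrm L) \<longlonglongrightarrow> 0"
   using tendsto_mult[OF tendsto_mult[OF tendsto_const n0] tendsto_const, of C "nrm L"] by simp
 qed
 ultimately have "(\<lambda>n. A (X n - L) (X n - L) + A (X n - L) L + A L (X n)) \<longlonglongrightarrow> 0 + 0 + A L L"
  by (intro tendsto_add z L)
 moreover have "A (X n - L) (X n - L) + A (X n - L) L + A L (X n) = A (X n) (X n)" for n
  using A(1)[OF X L D] A(1)[OF X L L] A(2)[OF X L X] A(2)[OF X L L] by simp
 ultimately show "(\<lambda>n. A (X n) (X n)) \<longlonglongrightarrow> A L L" by simp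
qed

lemma sqi_dominated:
 fixes f D :: "'a \<Rightarrow> real"
 assumes "f \<in> borel_measurable M" "integrable M D" "\<And>x. x \<in> space M \<Longrightarrow> (f x)^2 \<le> D x"
 shows "sqi M f"
 unfolding sqi_def
proof (intro conjI integrable_le[OF assms(2) _ AE_I2])
 show "norm ((f x)^2) \<le> norm (D x)" if "x \<in> space M" for x
  using assms(3)[OF that] order_trans[OF zero_le_power2 assms(3)[OF that]] by simp
qed (use assms(1) in auto)

context gamma_weight begin

abbreviation "L f \<equiv> sqi M (\<lambda>P. W.sb P * f P)"
abbreviation "Lw f \<equiv> sqi M (\<lambda>P. sqrt (w P) * f P)"

text \<open>The form is a combination of pairings with the weights \<open>y w\<close> and \<open>w\<close>.\<close>
definition br :: "(plane \<Rightarrow> real) \<Rightarrow> (plane \<Rightarrow> real) \<Rightarrow> real" where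
 "br f g = (LINT P|M. f P * g P * (snd P * w P))"

definition bw :: "(plane \<Rightarrow> real) \<Rightarrow> (plane \<Rightarrow> real) \<Rightarrow> real" where
 "bw f g = (LINT P|M. f P * g P * w P)"

lemma cmeas: "continuous_on \<Omega> h \<Longrightarrow> h \<in> borel_measurable M"
 by (rule W.cont_meas)

lemma sqrt_w_meas: "(\<lambda>P. sqrt (w P)) \<in> borel_measurable M"
 by (intro cmeas continuous_on_real_sqrt cont_w)

lemma integrable_cong_dom:
 assumes "integrable M f" "\<And>P. P \<in> \<Omega> \<Longrightarrow> f P = g P" shows "integrable M (g :: plane \<Rightarrow> real)"
proof -
 have "integrable M f \<longleftrightarrow> integrable M g" by (rule Bochner_Integration.integrable_cong) (use assms(2) in auto)
 then show ?thesis using assms(1) by simp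
qed

lemma integral_cong_dom:
 assumes "\<And>P. P \<in> \<Omega> \<Longrightarrow> f P = (g P :: real)" shows "integral\<^sup>L M f = integral\<^sup>L M g"
 by (rule lint_cong) (use assms in auto)

lemma L_integrand: "P \<in> \<Omega> \<Longrightarrow> (W.sb P * f P) * (W.sb P * g P) = f P * g P * (snd P * w P)"
 using W.sb_sq[of P] by (simp add: power2_eq_square mult_ac)

lemma Lw_integrand: "P \<in> \<Omega> \<Longrightarrow> (sqrt (w P) * f P) * (sqrt (w P) * g P) = f P * g P * w P"
 using w_pos[of P] by (simp add: mult_ac)

lemma br_integrable: assumes "L f" "L g" shows "integrable M (\<lambda>P. f P * g P * (snd P * w P))"
 by (rule integrable_cong_dom[OF sqi_mult[OF assms]], rule L_integrand)

lemma bw_integrable: assumes "Lw f" "Lw g" shows "integrable M (\<lambda>P. f P * g P * w P)"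
 by (rule integrable_cong_dom[OF sqi_mult[OF assms]], rule Lw_integrand)

lemma br_integrable': assumes "Lw (\<lambda>P. snd P * f P)" "Lw g" shows "integrable M (\<lambda>P. f P * g P * (snd P * w P))"
 by (rule integrable_cong_dom[OF bw_integrable[OF assms]]) (simp add: mult_ac)

lemma br_eq: "br f g = (LINT P|M. (W.sb P * f P) * (W.sb P * g P))"
 unfolding br_def by (rule integral_cong_dom) (simp add: L_integrand)

lemma bw_eq: "bw f g = (LINT P|M. (sqrt (w P) * f P) * (sqrt (w P) * g P))"
 unfolding bw_def by (rule integral_cong_dom) (simp add: Lw_integrand)

lemma br_sym: "br f g = br g f" unfolding br_def by (simp add: mult.commute)
lemma bw_sym: "bw f g = bw g f" unfolding bw_def by (simp add: mult.commute)

lemma br_self_nonneg: "br f f \<ge> 0" and bw_self_nonneg: "bw f f \<ge> 0"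
 unfolding br_eq bw_eq by (rule Bochner_Integration.integral_nonneg; simp)+

lemma L_AE:
 assumes f: "L f" and g: "g \<in> borel_measurable M" and ae: "AE P in M. g P = f P" shows "L g"
proof (rule sqi_bound[OF f, of _ 1])
 show "(\<lambda>P. W.sb P * g P) \<in> borel_measurable M" using W.sb_meas g by simp
 show "AE P in M. \<bar>W.sb P * g P\<bar> \<le> 1 * \<bar>W.sb P * f P\<bar>" using ae by eventually_elim simp
qed

lemma br_cong:
 assumes "AE P in M. f P = f' P" "f \<in> borel_measurable M" "f' \<in> borel_measurable M" "g \<in> borel_measurable M"
 shows "br f g = br f' g"
 unfolding br_def
proof (rule integral_cong_AE)
 show "AE P in M. f P * g P * (snd P * w P) = f' P * g P * (snd P * w P)" using assms(1) by eventually_elim simp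
qed (intro meas_times assms cmeas continuous_intros cont_w)+

lemma br_lin:
 assumes "L f" "L g" "L h" shows "br (\<lambda>P. a * f P + b * g P) h = a * br f h + b * br g h"
proof -
 have "br (\<lambda>P. a * f P + b * g P) h = (LINT P|M. a * (f P * h P * (snd P * w P)) + b * (g P * h P * (snd P * w P)))"
  unfolding br_def by (simp add: algebra_simps)
 also have "\<dots> = a * br f h + b * br g h"
  unfolding br_def using br_integrable[OF assms(1,3)] br_integrable[OF assms(2,3)] by simp
 finally show ?thesis .
qed

lemma bw_lin:
 assumes "Lw f" "Lw g" "Lw h" shows "bw (\<lambda>P. a * f P + b * g P) h = a * bw f h + b * bw g h"
proof -
 have "bw (\<lambda>P. a * f P + b * g P) h = (LINT P|M. a * (f P * h P * w P) + b * (g P * h P * w P))"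
  unfolding bw_def by (simp add: algebra_simps)
 also have "\<dots> = a * bw f h + b * bw g h"
  unfolding bw_def using bw_integrable[OF assms(1,3)] bw_integrable[OF assms(2,3)] by simp
 finally show ?thesis .
qed

lemma br_CS: assumes "L f" "L g" shows "\<bar>br f g\<bar> \<le> sqrt (br f f) * sqrt (br g g)"
 unfolding br_eq using L2_cauchy_schwarz'[OF assms] by (simp add: power2_eq_square)

lemma bw_CS: assumes "Lw f" "Lw g" shows "\<bar>bw f g\<bar> \<le> sqrt (bw f f) * sqrt (bw g g)"
 unfolding bw_eq using L2_cauchy_schwarz'[OF assms] by (simp add: power2_eq_square)

lemma br_young: assumes "L f" "L g" shows "2 * \<bar>c\<bar> * \<bar>br f g\<bar> \<le> br f f + c^2 * br g g"
proof -
 have "2 * \<bar>c\<bar> * \<bar>br f g\<bar> \<le> 2 * \<bar>c\<bar> * (sqrt (br f f) * sqrt (br g g))"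
  by (rule mult_left_mono[OF br_CS[OF assms]]) simp
 also have "\<dots> \<le> (sqrt (br f f))^2 + (\<bar>c\<bar> * sqrt (br g g))^2"
  using zero_le_power2[of "sqrt (br f f) - \<bar>c\<bar> * sqrt (br g g)"] by (simp add: power2_diff algebra_simps)
 also have "\<dots> = br f f + c^2 * br g g" using br_self_nonneg[of f] br_self_nonneg[of g] by (simp add: power_mult_distrib)
 finally show ?thesis .
qed

definition sg :: "(plane \<Rightarrow> real) \<Rightarrow> plane \<Rightarrow> real" where "sg v P = sgn (fst P) * v P"

lemma sgn_meas: "(\<lambda>P. sgn (fst P)) \<in> borel_measurable M" by (rule measurable_restrict_space1[OF sgn_fst_measurable])

lemma H1_facts:
 assumes u: "u \<in> H1 w \<Omega>"
 shows "u \<in> borel_measurable M" "e \<in> {ex, ey} \<Longrightarrow> wD \<Omega> e u \<in> borel_measurable M"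
  "e \<in> {ex, ey} \<Longrightarrow> L (wD \<Omega> e u)" "L u" "Lw u" "sg u \<in> borel_measurable M" "L (sg u)"
proof -
 show m: "u \<in> borel_measurable M"
  by (rule li_measurable[OF open_dom weak_derivD(1)[OF W.H1_wD[OF u, of ex]]]) simp
 show "wD \<Omega> e u \<in> borel_measurable M" if "e \<in> {ex, ey}"
  by (rule li_measurable[OF open_dom weak_derivD(2)[OF W.H1_wD[OF u that]]])
 show "L (wD \<Omega> e u)" if "e \<in> {ex, ey}" using u that by (auto simp: W.H1_iff)
 have a: "sqi M (\<lambda>P. W.sa P * u P)" using u by (simp add: W.H1_iff)
 show l: "L u"
 proof (rule sqi_bound[OF a, of _ 1])
  show "(\<lambda>P. W.sb P * u P) \<in> borel_measurable M" using W.sb_meas m by simp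
  show "AE P in M. \<bar>W.sb P * u P\<bar> \<le> 1 * \<bar>W.sa P * u P\<bar>"
  proof (rule AE_I2)
   fix P assume "P \<in> space M"
   then have P: "P \<in> \<Omega>" by simp
   have "W.sb P * \<bar>u P\<bar> \<le> W.sa P * \<bar>u P\<bar>" by (rule mult_right_mono[OF W.sb_le_sa[OF P]]) simp
   then show "\<bar>W.sb P * u P\<bar> \<le> 1 * \<bar>W.sa P * u P\<bar>" using W.sb_pos[OF P] W.sa_pos[OF P] by (simp add: abs_mult)
  qed
 qed
 show "Lw u"
 proof (rule sqi_bound[OF a, of _ 1])
  show "(\<lambda>P. sqrt (w P) * u P) \<in> borel_measurable M" using sqrt_w_meas m by simp
  show "AE P in M. \<bar>sqrt (w P) * u P\<bar> \<le> 1 * \<bar>W.sa P * u P\<bar>"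
  proof (rule AE_I2)
   fix P assume "P \<in> space M"
   then have P: "P \<in> \<Omega>" by simp
   have "1 * w P \<le> (1 + snd P) * w P" using y_pos[OF P] w_pos[OF P] by (intro mult_right_mono) auto
   then have "sqrt (w P) \<le> W.sa P" unfolding W.sa_def by (intro real_sqrt_le_mono) simp
   then have "sqrt (w P) * \<bar>u P\<bar> \<le> W.sa P * \<bar>u P\<bar>" by (rule mult_right_mono) simp
   then show "\<bar>sqrt (w P) * u P\<bar> \<le> 1 * \<bar>W.sa P * u P\<bar>" using w_pos[OF P] W.sa_pos[OF P] by (simp add: abs_mult)
  qed
 qed
 show sm: "sg u \<in> borel_measurable M" unfolding sg_def[abs_def] by (intro meas_times sgn_meas m)
 show "L (sg u)"
 proof (rule sqi_bound[OF l, of _ 1])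
  show "(\<lambda>P. W.sb P * sg u P) \<in> borel_measurable M" using W.sb_meas sm by simp
  show "AE P in M. \<bar>W.sb P * sg u P\<bar> \<le> 1 * \<bar>W.sb P * u P\<bar>"
   by (rule AE_I2) (simp add: sg_def abs_mult sgn_real_def)
 qed
qed

lemmas H1_L = H1_facts(3)[where e = ex, simplified] H1_facts(3)[where e = ey, simplified] H1_facts(4,5,7)

lemma ip_br:
 assumes u: "u \<in> H1 w \<Omega>"
 shows "W.ip u u = bw u u + br u u + br (wD \<Omega> ex u) (wD \<Omega> ex u) + br (wD \<Omega> ey u) (wD \<Omega> ey u)"
proof -
 have "(LINT P|M. (W.sa P * u P) * (W.sa P * u P)) = (LINT P|M. u P * u P * w P + u P * u P * (snd P * w P))"
 proof (rule integral_cong_dom)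
  fix P assume "P \<in> \<Omega>"
  from W.sa_sq[OF this] have e: "W.sa P * W.sa P = (1 + snd P) * w P" by (simp add: power2_eq_square)
  have "(W.sa P * u P) * (W.sa P * u P) = (W.sa P * W.sa P) * (u P * u P)" by (simp add: mult_ac)
  then show "(W.sa P * u P) * (W.sa P * u P) = u P * u P * w P + u P * u P * (snd P * w P)"
   unfolding e by (simp add: algebra_simps)
 qed
 also have "\<dots> = bw u u + br u u"
  unfolding br_def bw_def using br_integrable[OF H1_L(3)[OF u] H1_L(3)[OF u]] bw_integrable[OF H1_L(4)[OF u] H1_L(4)[OF u]] by simp
 finally show ?thesis unfolding W.ip_def br_eq[symmetric] by simp
qed

lemma br_le_ip:
 assumes u: "u \<in> H1 w \<Omega>"
 shows "br (wD \<Omega> ex u) (wD \<Omega> ex u) \<le> W.ip u u" "br (wD \<Omega> ey u) (wD \<Omega> ey u) \<le> W.ip u u"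
  "br u u \<le> W.ip u u" "bw u u \<le> W.ip u u" "br (sg u) (sg u) \<le> br u u"
proof -
 show "br (sg u) (sg u) \<le> br u u"
  unfolding br_def
 proof (rule integral_mono[OF br_integrable[OF H1_L(5)[OF u] H1_L(5)[OF u]] br_integrable[OF H1_L(3)[OF u] H1_L(3)[OF u]]])
  fix P assume "P \<in> space M"
  then have P: "P \<in> \<Omega>" by simp
  have "sg u P * sg u P \<le> u P * u P" by (simp add: sg_def sgn_real_def)
  then show "sg u P * sg u P * (snd P * w P) \<le> u P * u P * (snd P * w P)"
   using y_pos[OF P] w_pos[OF P] by (intro mult_right_mono) auto
 qed
qed (use ip_br[OF u] br_self_nonneg bw_self_nonneg in \<open>smt (verit)\<close>)+

lemma br_wD_lin:
 assumes u: "u \<in> H1 w \<Omega>" and v: "v \<in> H1 w \<Omega>" and e: "e \<in> {ex, ey}" and g: "L g" "g \<in> borel_measurable M"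
 shows "br (wD \<Omega> e (\<lambda>P. a * u P + b * v P)) g = a * br (wD \<Omega> e u) g + b * br (wD \<Omega> e v) g"
proof -
 have h: "(\<lambda>P. a * u P + b * v P) \<in> H1 w \<Omega>" by (rule W.H1_linear[OF u v])
 have wd: "weakly_diff \<Omega> e u" "weakly_diff \<Omega> e v" using u v e by (auto simp: H1_def)
 have "br (wD \<Omega> e (\<lambda>P. a * u P + b * v P)) g = br (\<lambda>P. a * wD \<Omega> e u P + b * wD \<Omega> e v P) g"
  by (rule br_cong[OF wD_linear[OF open_dom e wd]])
    (use H1_facts(2)[OF h e] H1_facts(2)[OF u e] H1_facts(2)[OF v e] g in simp_all)
 then show ?thesis using br_lin[OF H1_facts(3)[OF u e] H1_facts(3)[OF v e] g(1)] by simp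
qed

lemma by_parts_br:
 assumes v: "v \<in> testfun \<Omega> (Gamma0 \<Omega> \<times> {0})" and g: "L g" "g \<in> borel_measurable M"
  and i: "integrable M (\<lambda>P. ge P * v P * (snd P * w P))" "integrable M (\<lambda>P. g P * v P * w P)"
 shows "is_weak_deriv \<Omega> ex g ge \<Longrightarrow> br ge v = - br g (wD \<Omega> ex v) + \<gamma> * br g (sg v)"
  and "is_weak_deriv \<Omega> ey g ge \<Longrightarrow> br ge v = - br g (wD \<Omega> ey v) - \<beta> * bw g v + \<mu> * br g v"
proof -
 have vH: "v \<in> H1 w \<Omega>" using v scs_H1 by blast
 have vs: "smooth \<Omega> v" by (rule scsD(1)[OF v])
 have iy: "integrable M (\<lambda>P. g P * v P * (snd P * w P))" by (rule br_integrable[OF g(1) H1_L(3)[OF vH]])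
 have i1: "integrable M (\<lambda>P. g P * v P * ((1 + snd P) * w P))"
  using Bochner_Integration.integrable_add[OF i(2) iy] by (simp add: algebra_simps)
 have wc: "AE P in M. wD \<Omega> e v P = pd e v P" if "e \<in> {ex, ey}" for e
  by (rule wD_AE[OF open_dom that weak_deriv_classical[OF open_dom that smooth_Ck[OF vs]]])
 have pm: "pd e v \<in> borel_measurable M" if "e \<in> {ex, ey}" for e
  by (rule cmeas[OF smooth_cont[OF open_dom smooth_pd[OF vs that]]])
 have Lp: "L (pd e v)" if "e \<in> {ex, ey}" for e
  by (rule L_AE[OF H1_facts(3)[OF vH that] pm[OF that]]) (use wc[OF that] in \<open>eventually_elim, simp\<close>)
 have eq: "br g (wD \<Omega> e v) = br g (pd e v)" if "e \<in> {ex, ey}" for e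
  unfolding br_sym[of g] by (rule br_cong[OF wc[OF that] H1_facts(2)[OF vH that] pm[OF that] g(2)])
 have ip: "integrable M (\<lambda>P. g P * pd e v P * (snd P * w P))" if "e \<in> {ex, ey}" for e
  by (rule br_integrable[OF g(1) Lp[OF that]])
 show "br ge v = - br g (wD \<Omega> ex v) + \<gamma> * br g (sg v)" if wd: "is_weak_deriv \<Omega> ex g ge"
 proof -
  have "br g (sg v) = (LINT P|M. g P * v P * (sgn (fst P) * (snd P * w P)))"
   unfolding br_def sg_def by (simp add: mult_ac)
  then show ?thesis
   using weighted_integration_by_parts(1)[OF v i(1) i1 wd ip[of ex]] eq[of ex] by (simp add: br_def)
 qed
 show "br ge v = - br g (wD \<Omega> ey v) - \<beta> * bw g v + \<mu> * br g v" if wd: "is_weak_deriv \<Omega> ey g ge"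
 proof -
  have "(LINT P|M. g P * v P * ((\<beta> - \<mu> * snd P) * w P)) = (LINT P|M. \<beta> * (g P * v P * w P) - \<mu> * (g P * v P * (snd P * w P)))"
   by (simp add: algebra_simps)
  also have "\<dots> = \<beta> * bw g v - \<mu> * br g v" unfolding br_def bw_def using i(2) iy by simp
  finally show ?thesis
   using weighted_integration_by_parts(2)[OF v i(1) i1 wd ip[of ey]] eq[of ey] by (simp add: br_def)
 qed
qed

end

lemma eight_terms:
 fixes x1 :: real
 assumes "\<bar>x1\<bar> \<le> b1" "\<bar>x2\<bar> \<le> b2" "\<bar>x3\<bar> \<le> b3" "\<bar>x4\<bar> \<le> b4" "\<bar>x5\<bar> \<le> b5" "\<bar>x6\<bar> \<le> b6" "\<bar>x7\<bar> \<le> b7" "\<bar>x8\<bar> \<le> b8"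
 shows "\<bar>x1 + x2 + x3 + x4 - x5 - x6 - x7 + x8\<bar> \<le> b1 + b2 + b3 + b4 + b5 + b6 + b7 + b8"
 using assms[unfolded abs_le_iff] unfolding abs_le_iff by linarith

lemma eight_distrib:
 fixes n :: real
 shows "b1 * n + b2 * n + b3 * n + b4 * n + b5 * n + b6 * n + b7 * n + b8 * n = (b1 + b2 + b3 + b4 + b5 + b6 + b7 + b8) * n"
 by (simp add: distrib_right)

context gamma_weight begin

text \<open>This is \<open>heston_form\<close> in terms of pairings; \<open>a\<close> stands for the coefficient \<open>a\<^sub>1\<close>.\<close>
definition form :: "real \<Rightarrow> real \<Rightarrow> real \<Rightarrow> real \<Rightarrow> (plane \<Rightarrow> real) \<Rightarrow> (plane \<Rightarrow> real) \<Rightarrow> real" where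
 "form \<rho> \<sigma> a r u v = 1 / 2 * (br (wD \<Omega> ex u) (wD \<Omega> ex v) + \<rho> * \<sigma> * br (wD \<Omega> ey u) (wD \<Omega> ex v)
    + \<rho> * \<sigma> * br (wD \<Omega> ex u) (wD \<Omega> ey v) + \<sigma>^2 * br (wD \<Omega> ey u) (wD \<Omega> ey v))
   - \<gamma> / 2 * (br (wD \<Omega> ex u) (sg v) + \<rho> * \<sigma> * br (wD \<Omega> ey u) (sg v))
   - a * br (wD \<Omega> ex u) v + r * bw u v"

lemma heston_form_eq:
 assumes u: "u \<in> H1 w \<Omega>" and v: "v \<in> H1 w \<Omega>" and w: "w = heston_weight \<kappa> \<theta> \<sigma> \<gamma>"
 shows "heston_form r \<kappa> \<theta> \<rho> \<sigma> \<gamma> \<Omega> u v = form \<rho> \<sigma> (\<kappa> * \<rho> / \<sigma> - 1 / 2) r u v"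
proof -
 let ?ux = "wD \<Omega> ex u" and ?uy = "wD \<Omega> ey u" and ?vx = "wD \<Omega> ex v" and ?vy = "wD \<Omega> ey v"
 note i = br_integrable[OF H1_L(1)[OF u] H1_L(1)[OF v]] br_integrable[OF H1_L(2)[OF u] H1_L(1)[OF v]]
   br_integrable[OF H1_L(1)[OF u] H1_L(2)[OF v]] br_integrable[OF H1_L(2)[OF u] H1_L(2)[OF v]]
   br_integrable[OF H1_L(1)[OF u] H1_L(5)[OF v]] br_integrable[OF H1_L(2)[OF u] H1_L(5)[OF v]]
 have 1: "(LINT P|M. (?ux P * ?vx P + \<rho> * \<sigma> * ?uy P * ?vx P + \<rho> * \<sigma> * ?ux P * ?vy P + \<sigma>^2 * ?uy P * ?vy P) * snd P * w P)
   = br ?ux ?vx + \<rho> * \<sigma> * br ?uy ?vx + \<rho> * \<sigma> * br ?ux ?vy + \<sigma>^2 * br ?uy ?vy" (is "?l = _")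
 proof -
  have "?l = (LINT P|M. ?ux P * ?vx P * (snd P * w P) + \<rho> * \<sigma> * (?uy P * ?vx P * (snd P * w P))
    + \<rho> * \<sigma> * (?ux P * ?vy P * (snd P * w P)) + \<sigma>^2 * (?uy P * ?vy P * (snd P * w P)))"
   by (simp add: algebra_simps)
  then show ?thesis unfolding br_def using i by simp
 qed
 have 2: "(LINT P|M. (?ux P + \<rho> * \<sigma> * ?uy P) * v P * sgn (fst P) * snd P * w P) = br ?ux (sg v) + \<rho> * \<sigma> * br ?uy (sg v)" (is "?l = _")
 proof -
  have "?l = (LINT P|M. ?ux P * sg v P * (snd P * w P) + \<rho> * \<sigma> * (?uy P * sg v P * (snd P * w P)))"
   by (simp add: algebra_simps sg_def)
  then show ?thesis unfolding br_def using i by simp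
 qed
 have 3: "(LINT P|M. a * snd P * ?ux P * v P * w P) = a * br ?ux v" for a
 proof -
  have "(LINT P|M. a * snd P * ?ux P * v P * w P) = (LINT P|M. a * (?ux P * v P * (snd P * w P)))" by (simp add: mult_ac)
  then show ?thesis unfolding br_def by simp
 qed
 have 4: "(LINT P|M. r * u P * v P * w P) = r * bw u v"
  unfolding bw_def integral_mult_right_zero[symmetric] by (simp add: mult_ac)
 show ?thesis unfolding heston_form_def Let_def w[symmetric] form_def 1 2 3 4 ..
qed

lemma form_lin1:
 assumes u: "u \<in> H1 w \<Omega>" and v: "v \<in> H1 w \<Omega>" and z: "z \<in> H1 w \<Omega>"
 shows "form \<rho> \<sigma> a r (\<lambda>P. c * u P + d * v P) z = c * form \<rho> \<sigma> a r u z + d * form \<rho> \<sigma> a r v z"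
proof -
 note Lz = H1_L[OF z] and mz = H1_facts(2)[OF z, of ex, simplified] H1_facts(2)[OF z, of ey, simplified] H1_facts(1,6)[OF z]
 note l = br_wD_lin[OF u v, of ex, simplified] br_wD_lin[OF u v, of ey, simplified]
 show ?thesis unfolding form_def
  unfolding l(1)[OF Lz(1) mz(1)] l(1)[OF Lz(2) mz(2)] l(1)[OF Lz(3) mz(3)] l(1)[OF Lz(5) mz(4)]
   l(2)[OF Lz(1) mz(1)] l(2)[OF Lz(2) mz(2)] l(2)[OF Lz(5) mz(4)] bw_lin[OF H1_L(4)[OF u] H1_L(4)[OF v] H1_L(4)[OF z]]
  by (simp add: algebra_simps)
qed

lemma form_lin2:
 assumes u: "u \<in> H1 w \<Omega>" and v: "v \<in> H1 w \<Omega>" and z: "z \<in> H1 w \<Omega>"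
 shows "form \<rho> \<sigma> a r z (\<lambda>P. c * u P + d * v P) = c * form \<rho> \<sigma> a r z u + d * form \<rho> \<sigma> a r z v"
proof -
 note Lz = H1_L[OF z] and mz = H1_facts(2)[OF z, of ex, simplified] H1_facts(2)[OF z, of ey, simplified]
 note l = br_wD_lin[OF u v, of ex, simplified] br_wD_lin[OF u v, of ey, simplified]
 have s: "br h (\<lambda>P. c * u P + d * v P) = c * br h u + d * br h v"
  "br h (sg (\<lambda>P. c * u P + d * v P)) = c * br h (sg u) + d * br h (sg v)" if "L h" for h
 proof -
  show "br h (\<lambda>P. c * u P + d * v P) = c * br h u + d * br h v"
   unfolding br_sym[of h] by (rule br_lin[OF H1_L(3)[OF u] H1_L(3)[OF v] that])
  have "sg (\<lambda>P. c * u P + d * v P) = (\<lambda>P. c * sg u P + d * sg v P)" by (simp add: sg_def fun_eq_iff algebra_simps)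
  then show "br h (sg (\<lambda>P. c * u P + d * v P)) = c * br h (sg u) + d * br h (sg v)"
   unfolding br_sym[of h] using br_lin[OF H1_L(5)[OF u] H1_L(5)[OF v] that] by simp
 qed
 show ?thesis unfolding form_def
  unfolding s[OF Lz(1)] s(2)[OF Lz(2)] bw_sym[of z] bw_lin[OF H1_L(4)[OF u] H1_L(4)[OF v] H1_L(4)[OF z]]
  unfolding br_sym[of "wD \<Omega> ex z"] br_sym[of "wD \<Omega> ey z"]
  unfolding l(1)[OF Lz(1) mz(1)] l(1)[OF Lz(2) mz(2)] l(2)[OF Lz(1) mz(1)] l(2)[OF Lz(2) mz(2)]
  by (simp add: algebra_simps)
qed

lemmas form_ops =
 form_lin1[where c = 1 and d = 1, folded fun_add_eq, simplified] form_lin1[where c = 1 and d = "-1", folded fun_diff_eq, simplified]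
 form_lin2[where c = 1 and d = 1, folded fun_add_eq, simplified] form_lin2[where c = 1 and d = "-1", folded fun_diff_eq, simplified]

lemma form_bounded:
 "\<exists>C. \<forall>u\<in>H1 w \<Omega>. \<forall>v\<in>H1 w \<Omega>. \<bar>form \<rho> \<sigma> a r u v\<bar> \<le> C * W.H.nrm u * W.H.nrm v"
proof (intro exI ballI)
 fix u v assume u: "u \<in> H1 w \<Omega>" and v: "v \<in> H1 w \<Omega>"
 let ?n = "W.H.nrm u * W.H.nrm v"
 have b: "\<bar>br f g\<bar> \<le> ?n" if "L f" "L g" "br f f \<le> W.ip u u" "br g g \<le> W.ip v v" for f g
  using br_CS[OF that(1,2)] mult_mono[OF real_sqrt_le_mono[OF that(3)] real_sqrt_le_mono[OF that(4)]]
   br_self_nonneg[of f] br_self_nonneg[of g] order_trans[OF br_self_nonneg that(3)] by (simp add: W.H.nrm_def)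
 have bw: "\<bar>bw u v\<bar> \<le> ?n"
  using bw_CS[OF H1_L(4)[OF u] H1_L(4)[OF v]] mult_mono[OF real_sqrt_le_mono[OF br_le_ip(4)[OF u]] real_sqrt_le_mono[OF br_le_ip(4)[OF v]]]
   bw_self_nonneg[of u] bw_self_nonneg[of v] order_trans[OF bw_self_nonneg br_le_ip(4)[OF u]] by (simp add: W.H.nrm_def)
 have c: "\<bar>c * x\<bar> \<le> \<bar>c\<bar> * ?n" if "\<bar>x\<bar> \<le> ?n" for c x :: real
  unfolding abs_mult by (rule mult_left_mono[OF that]) simp
 note Lu = H1_L[OF u] and Lv = H1_L[OF v] and iu = br_le_ip[OF u] and iv = br_le_ip[OF v] order_trans[OF br_le_ip(5,3)[OF v]]
 let ?ux = "wD \<Omega> ex u" and ?uy = "wD \<Omega> ey u" and ?vx = "wD \<Omega> ex v" and ?vy = "wD \<Omega> ey v"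
 have sv: "br (sg v) (sg v) \<le> W.ip v v" by (rule order_trans[OF br_le_ip(5)[OF v] br_le_ip(3)[OF v]])
 have t: "\<bar>1/2 * br ?ux ?vx\<bar> \<le> \<bar>1/2\<bar> * ?n" "\<bar>\<rho> * \<sigma> / 2 * br ?uy ?vx\<bar> \<le> \<bar>\<rho> * \<sigma> / 2\<bar> * ?n"
  "\<bar>\<rho> * \<sigma> / 2 * br ?ux ?vy\<bar> \<le> \<bar>\<rho> * \<sigma> / 2\<bar> * ?n" "\<bar>\<sigma>^2 / 2 * br ?uy ?vy\<bar> \<le> \<bar>\<sigma>^2 / 2\<bar> * ?n"
  "\<bar>\<gamma> / 2 * br ?ux (sg v)\<bar> \<le> \<bar>\<gamma> / 2\<bar> * ?n" "\<bar>\<gamma> / 2 * (\<rho> * \<sigma>) * br ?uy (sg v)\<bar> \<le> \<bar>\<gamma> / 2 * (\<rho> * \<sigma>)\<bar> * ?n"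
  "\<bar>a * br ?ux v\<bar> \<le> \<bar>a\<bar> * ?n" "\<bar>r * bw u v\<bar> \<le> \<bar>r\<bar> * ?n"
  by (rule c, rule b[OF Lu(1) Lv(1) iu(1) iv(1)], rule c, rule b[OF Lu(2) Lv(1) iu(2) iv(1)],
    rule c, rule b[OF Lu(1) Lv(2) iu(1) iv(2)], rule c, rule b[OF Lu(2) Lv(2) iu(2) iv(2)],
    rule c, rule b[OF Lu(1) Lv(5) iu(1) sv], rule c, rule b[OF Lu(2) Lv(5) iu(2) sv],
    rule c, rule b[OF Lu(1) Lv(3) iu(1) iv(3)], rule c, rule bw)
 have f: "form \<rho> \<sigma> a r u v = 1/2 * br ?ux ?vx + \<rho> * \<sigma> / 2 * br ?uy ?vx + \<rho> * \<sigma> / 2 * br ?ux ?vy + \<sigma>^2 / 2 * br ?uy ?vy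
   - \<gamma> / 2 * br ?ux (sg v) - \<gamma> / 2 * (\<rho> * \<sigma>) * br ?uy (sg v) - a * br ?ux v + r * bw u v"
  unfolding form_def by (simp add: algebra_simps)
 have "\<bar>form \<rho> \<sigma> a r u v\<bar> \<le> \<bar>1/2\<bar> * ?n + \<bar>\<rho> * \<sigma> / 2\<bar> * ?n + \<bar>\<rho> * \<sigma> / 2\<bar> * ?n + \<bar>\<sigma>^2 / 2\<bar> * ?n
   + \<bar>\<gamma> / 2\<bar> * ?n + \<bar>\<gamma> / 2 * (\<rho> * \<sigma>)\<bar> * ?n + \<bar>a\<bar> * ?n + \<bar>r\<bar> * ?n"
  unfolding f by (rule eight_terms[OF t])
 also have "\<dots> = (\<bar>1/2\<bar> + \<bar>\<rho> * \<sigma> / 2\<bar> + \<bar>\<rho> * \<sigma> / 2\<bar> + \<bar>\<sigma>^2 / 2\<bar> + \<bar>\<gamma> / 2\<bar> + \<bar>\<gamma> / 2 * (\<rho> * \<sigma>)\<bar> + \<bar>a\<bar> + \<bar>r\<bar>) * ?n"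
  by (rule eight_distrib)
 finally show "\<bar>form \<rho> \<sigma> a r u v\<bar> \<le> (\<bar>1/2\<bar> + \<bar>\<rho> * \<sigma> / 2\<bar> + \<bar>\<rho> * \<sigma> / 2\<bar> + \<bar>\<sigma>^2 / 2\<bar> + \<bar>\<gamma> / 2\<bar> + \<bar>\<gamma> / 2 * (\<rho> * \<sigma>)\<bar> + \<bar>a\<bar> + \<bar>r\<bar>) * W.H.nrm u * W.H.nrm v"
  by (rule order_trans) (rule eq_refl, rule mult.assoc[symmetric])
qed

text \<open>Integration by parts with both factors equal to \<open>\<phi>\<close>.\<close>
lemma scs_identities:
 assumes \<phi>: "\<phi> \<in> testfun \<Omega> (Gamma0 \<Omega> \<times> {0})"
 shows "2 * br (wD \<Omega> ex \<phi>) \<phi> = \<gamma> * br \<phi> (sg \<phi>)" "\<mu> * br \<phi> \<phi> = \<beta> * bw \<phi> \<phi> + 2 * br (wD \<Omega> ey \<phi>) \<phi>"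
proof -
 have H: "\<phi> \<in> H1 w \<Omega>" using \<phi> scs_H1 by blast
 note Lf = H1_L[OF H] and iw = bw_integrable[OF H1_L(4)[OF H] H1_L(4)[OF H]]
 have wx: "is_weak_deriv \<Omega> ex \<phi> (wD \<Omega> ex \<phi>)" and wy: "is_weak_deriv \<Omega> ey \<phi> (wD \<Omega> ey \<phi>)"
  by (rule W.H1_wD[OF H], simp)+
 show "2 * br (wD \<Omega> ex \<phi>) \<phi> = \<gamma> * br \<phi> (sg \<phi>)"
  using by_parts_br(1)[OF \<phi> Lf(3) H1_facts(1)[OF H] br_integrable[OF Lf(1) Lf(3)] iw wx] br_sym[of \<phi> "wD \<Omega> ex \<phi>"] by simp
 show "\<mu> * br \<phi> \<phi> = \<beta> * bw \<phi> \<phi> + 2 * br (wD \<Omega> ey \<phi>) \<phi>"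
  using by_parts_br(2)[OF \<phi> Lf(3) H1_facts(1)[OF H] br_integrable[OF Lf(2) Lf(3)] iw wy] br_sym[of \<phi> "wD \<Omega> ey \<phi>"] by simp
qed

text \<open>With \<open>N = \<integral> \<phi>\<^sup>2 w\<close>, \<open>Y = \<integral> y \<phi>\<^sup>2 w\<close> and \<open>E = \<integral> y (\<phi>\<^sub>x\<^sup>2 + \<sigma>\<^sup>2 \<phi>\<^sub>y\<^sup>2) w\<close>, the constant \<open>c\<close> satisfies \<open>Y \<le> c (N + E)\<close>.
 The principal part and the term of order zero amount to at least \<open>k (N + E)\<close>, and the other terms take away
 at most half of it when \<open>\<gamma>\<close> is small.\<close>
lemma coercive_on_tests:
 assumes \<phi>: "\<phi> \<in> testfun \<Omega> (Gamma0 \<Omega> \<times> {0})" and \<sigma>: "\<sigma> \<noteq> 0" and \<rho>: "\<bar>\<rho>\<bar> < 1" and r: "r > 0"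
  and c: "c = 2 * \<beta> / \<mu> + 4 / (\<mu>^2 * \<sigma>^2)" and k: "k = min ((1 - \<bar>\<rho>\<bar>) / 2) r" and small: "\<gamma> * (1 / 2 + (1 + \<bar>a\<bar>) * c) \<le> k"
 shows "k / 2 / (1 + c + 1 / \<sigma>^2) * W.ip \<phi> \<phi> \<le> form \<rho> \<sigma> a r \<phi> \<phi>"
proof -
 have H: "\<phi> \<in> H1 w \<Omega>" using \<phi> scs_H1 by blast
 note Lf = H1_L[OF H]
 define X where "X = br (wD \<Omega> ex \<phi>) (wD \<Omega> ex \<phi>)"
 define Z where "Z = br (wD \<Omega> ey \<phi>) (wD \<Omega> ey \<phi>)"
 define Y where "Y = br \<phi> \<phi>"
 define N where "N = bw \<phi> \<phi>"
 define E where "E = X + \<sigma>^2 * Z"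
 define p where "p = br (wD \<Omega> ex \<phi>) (wD \<Omega> ey \<phi>)"
 define s1 where "s1 = br (wD \<Omega> ex \<phi>) (sg \<phi>)"
 define s2 where "s2 = br (wD \<Omega> ey \<phi>) (sg \<phi>)"
 define t where "t = br (wD \<Omega> ex \<phi>) \<phi>"
 define t' where "t' = br (wD \<Omega> ey \<phi>) \<phi>"
 define y where "y = br \<phi> (sg \<phi>)"
 have nn: "X \<ge> 0" "Z \<ge> 0" "Y \<ge> 0" "N \<ge> 0" by (simp_all add: X_def Z_def Y_def N_def br_self_nonneg bw_self_nonneg)
 have ss: "br (sg \<phi>) (sg \<phi>) \<le> Y" using br_le_ip(5)[OF H] by (simp add: Y_def)
 have 1: "2 * \<bar>\<sigma>\<bar> * \<bar>p\<bar> \<le> E" using br_young[OF Lf(1) Lf(2), of \<sigma>] by (simp add: p_def E_def X_def Z_def)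
 have 2: "2 * \<bar>s1\<bar> \<le> X + Y" using br_young[OF Lf(1) Lf(5), of 1] ss by (simp add: s1_def X_def)
 have 3: "2 * \<bar>\<sigma>\<bar> * \<bar>s2\<bar> \<le> Y + \<sigma>^2 * Z" using br_young[OF Lf(5) Lf(2), of \<sigma>] ss by (simp add: s2_def Z_def br_sym)
 have 4: "\<bar>y\<bar> \<le> Y" using br_young[OF Lf(3) Lf(5), of 1] ss by (simp add: y_def Y_def)
 have t: "2 * t = \<gamma> * y" and Y: "\<mu> * Y = \<beta> * N + 2 * t'"
  using scs_identities[OF \<phi>] by (simp_all add: t_def t'_def y_def Y_def N_def)
 have 5: "\<mu> * \<bar>t'\<bar> \<le> Z + \<mu>^2 / 4 * Y" using br_young[OF Lf(2) Lf(3), of "\<mu> / 2"] \<mu> by (simp add: t'_def Z_def Y_def power_divide)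
 have "\<mu> * (\<mu> * Y) \<le> \<mu> * (\<beta> * N) + 2 * (Z + \<mu>^2 / 4 * Y)"
 proof -
  have "\<mu> * t' \<le> \<mu> * \<bar>t'\<bar>" using \<mu> by simp
  then have "\<mu> * t' \<le> Z + \<mu>^2 / 4 * Y" using 5 by linarith
  then have le: "2 * (\<mu> * t') \<le> 2 * (Z + \<mu>^2 / 4 * Y)" by (rule mult_left_mono) simp
  have eq: "\<mu> * (\<beta> * N + 2 * t') = \<mu> * (\<beta> * N) + 2 * (\<mu> * t')" by (simp add: algebra_simps)
  show ?thesis unfolding Y eq by (rule add_left_mono[OF le])
 qed
 moreover have "\<mu> * (\<mu> * Y) = \<mu>^2 * Y" "\<mu>^2 / 4 * Y = \<mu>^2 * Y / 4" by (simp_all add: power2_eq_square)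
 ultimately have "\<mu>^2 * Y \<le> \<mu> * (\<beta> * N) + 2 * (Z + \<mu>^2 * Y / 4)" by (simp only:)
 moreover have "b \<le> s + 2 * (Z' + b / 4) \<Longrightarrow> b \<le> 2 * s + 4 * Z'" for b s Z' :: real by simp
 ultimately have "\<mu>^2 * Y \<le> 2 * (\<mu> * (\<beta> * N)) + 4 * Z" by blast
 then have Yle: "\<mu>^2 * Y \<le> 2 * \<mu> * \<beta> * N + 4 * Z" by (simp only: mult.assoc)
 have s2p: "\<sigma>^2 > 0" "\<mu>^2 > 0" using \<sigma> \<mu> by auto
 have c0: "c \<ge> 0" using \<beta> \<mu> s2p by (simp add: c)
 have "Y \<le> (2 * \<mu> * \<beta> * N + 4 * Z) / \<mu>^2" using Yle s2p by (simp add: pos_le_divide_eq mult.commute)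
 also have "\<dots> = 2 * \<beta> / \<mu> * N + 4 / (\<mu>^2 * \<sigma>^2) * (\<sigma>^2 * Z)"
  using s2p \<mu> \<sigma> by (simp add: add_divide_distrib power2_eq_square)
 also have "\<dots> \<le> c * N + c * E"
 proof (intro add_mono mult_mono)
  show "2 * \<beta> / \<mu> \<le> c" "4 / (\<mu>^2 * \<sigma>^2) \<le> c" using \<beta> \<mu> s2p by (auto simp: c)
 qed (use nn s2p c0 in \<open>auto simp: E_def\<close>)
 finally have Yc: "Y \<le> c * (N + E)" by (simp add: distrib_left)
 have En: "E \<ge> 0" "\<sigma>^2 * Z \<ge> 0" using nn s2p by (auto simp: E_def)
 have q: "1 / 2 * (X + \<rho> * \<sigma> * p + \<rho> * \<sigma> * p + \<sigma>^2 * Z) \<ge> (1 - \<bar>\<rho>\<bar>) / 2 * E"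
 proof -
  have "\<bar>\<rho>\<bar> * (2 * \<bar>\<sigma>\<bar> * \<bar>p\<bar>) \<le> \<bar>\<rho>\<bar> * E" by (rule mult_left_mono[OF 1]) simp
  then have "2 * \<bar>\<rho> * \<sigma> * p\<bar> \<le> \<bar>\<rho>\<bar> * E" by (simp add: abs_mult mult_ac)
  moreover have "2 * \<bar>s\<bar> \<le> b \<Longrightarrow> (E - b) / 2 \<le> E / 2 + s" for b s :: real
   using abs_ge_minus_self[of s] by (simp add: field_simps)
  ultimately have "(E - \<bar>\<rho>\<bar> * E) / 2 \<le> E / 2 + \<rho> * \<sigma> * p" by blast
  moreover have "(E - \<bar>\<rho>\<bar> * E) / 2 = (1 - \<bar>\<rho>\<bar>) / 2 * E" by (simp add: left_diff_distrib)
  moreover have "E / 2 + \<rho> * \<sigma> * p = 1 / 2 * (X + \<rho> * \<sigma> * p + \<rho> * \<sigma> * p + \<sigma>^2 * Z)" by (simp add: E_def)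
  ultimately show ?thesis by (simp only:)
 qed
 have g: "\<gamma> / 2 * (s1 + \<rho> * \<sigma> * s2) \<le> \<gamma> / 2 * (E / 2 + Y)"
 proof (rule mult_left_mono)
  have "\<bar>\<rho>\<bar> * (2 * \<bar>\<sigma>\<bar> * \<bar>s2\<bar>) \<le> 1 * (2 * \<bar>\<sigma>\<bar> * \<bar>s2\<bar>)" using \<rho> by (intro mult_right_mono) auto
  then have "2 * \<bar>\<rho> * \<sigma> * s2\<bar> \<le> Y + \<sigma>^2 * Z" using 3 by (simp add: abs_mult mult_ac)
  moreover have "a + b \<le> (x + z) / 2 + y" if "2 * \<bar>a\<bar> \<le> x + y" "2 * \<bar>b\<bar> \<le> y + z" for a b x y z :: real
   using that abs_ge_self[of a] abs_ge_self[of b] by (simp add: field_simps)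
  ultimately show "s1 + \<rho> * \<sigma> * s2 \<le> E / 2 + Y" using 2 unfolding E_def by blast
 qed (use \<gamma> in simp)
 have h: "a * t \<le> \<gamma> / 2 * (\<bar>a\<bar> * Y)"
 proof -
  have "a * t = \<gamma> / 2 * (a * y)" using t by (simp add: field_simps)
  also have "\<dots> \<le> \<gamma> / 2 * (\<bar>a\<bar> * Y)"
  proof (rule mult_left_mono)
   have "a * y \<le> \<bar>a\<bar> * \<bar>y\<bar>" using abs_ge_self[of "a * y"] by (simp add: abs_mult)
   also have "\<dots> \<le> \<bar>a\<bar> * Y" using 4 by (rule mult_left_mono) simp
   finally show "a * y \<le> \<bar>a\<bar> * Y" .
  qed (use \<gamma> in simp)
  finally show ?thesis .
 qed
 have f: "form \<rho> \<sigma> a r \<phi> \<phi> = 1 / 2 * (X + \<rho> * \<sigma> * p + \<rho> * \<sigma> * p + \<sigma>^2 * Z) - \<gamma> / 2 * (s1 + \<rho> * \<sigma> * s2) - a * t + r * N"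
  unfolding form_def X_def p_def Z_def s1_def s2_def t_def N_def br_sym[of "wD \<Omega> ey \<phi>" "wD \<Omega> ex \<phi>"] ..
 have kk: "k \<le> (1 - \<bar>\<rho>\<bar>) / 2" "k \<le> r" "k > 0" unfolding k by (rule min.cobounded1, rule min.cobounded2) (use \<rho> r in simp)
 have "\<gamma> / 2 * (E / 2 + Y) + \<gamma> / 2 * (\<bar>a\<bar> * Y) = \<gamma> / 2 * (E / 2 + (1 + \<bar>a\<bar>) * Y)" by (simp add: algebra_simps)
 also have "\<dots> \<le> \<gamma> / 2 * ((E + N) / 2 + (1 + \<bar>a\<bar>) * (c * (N + E)))"
  using nn En Yc \<gamma> by (intro mult_left_mono add_mono) auto
 also have "\<dots> = (\<gamma> * (1 / 2 + (1 + \<bar>a\<bar>) * c)) * ((N + E) / 2)" by (simp add: algebra_simps add_divide_distrib)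
 also have "\<dots> \<le> k * ((N + E) / 2)" using nn En by (intro mult_right_mono[OF small]) simp
 finally have small': "\<gamma> / 2 * (E / 2 + Y) + \<gamma> / 2 * (\<bar>a\<bar> * Y) \<le> k * ((N + E) / 2)" .
 have "k * E \<le> (1 - \<bar>\<rho>\<bar>) / 2 * E" "k * N \<le> r * N" by (rule mult_right_mono[OF kk(1) En(1)], rule mult_right_mono[OF kk(2) nn(4)])
 then have low: "k / 2 * (N + E) \<le> form \<rho> \<sigma> a r \<phi> \<phi>"
 proof -
  have sum: "t0 \<le> q0 - g0 - h0 + n0" if "e0 \<le> e1" "e1 \<le> q0" "g0 \<le> g1" "h0 \<le> h1" "g1 + h1 \<le> s0" "n1 \<le> n0" "t0 = e0 + n1 - s0"
   for t0 q0 g0 h0 n0 e0 e1 g1 h1 s0 n1 :: real using that by linarith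
  show ?thesis unfolding f
   by (rule sum[OF \<open>k * E \<le> (1 - \<bar>\<rho>\<bar>) / 2 * E\<close> q g h small' \<open>k * N \<le> r * N\<close>]) (simp add: field_simps)
 qed
 have "W.ip \<phi> \<phi> = N + Y + X + Z" using ip_br[OF H] by (simp add: X_def Z_def Y_def N_def)
 also have "\<dots> \<le> (1 + c + 1 / \<sigma>^2) * (N + E)"
 proof -
  have "Z = 1 / \<sigma>^2 * (\<sigma>^2 * Z)" using s2p by simp
  also have "\<dots> \<le> 1 / \<sigma>^2 * (N + E)" using nn s2p by (intro mult_left_mono) (auto simp: E_def)
  finally have "Z \<le> 1 / \<sigma>^2 * (N + E)" .
  moreover have "N + X \<le> N + E" using En by (simp add: E_def)
  ultimately show ?thesis using Yc by (simp add: distrib_right)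
 qed
 finally have ipl: "W.ip \<phi> \<phi> \<le> (1 + c + 1 / \<sigma>^2) * (N + E)" .
 have D: "1 + c + 1 / \<sigma>^2 > 0" using c0 s2p by (simp add: add_pos_nonneg)
 have "k / 2 / (1 + c + 1 / \<sigma>^2) * W.ip \<phi> \<phi> \<le> k / 2 / (1 + c + 1 / \<sigma>^2) * ((1 + c + 1 / \<sigma>^2) * (N + E))"
  using kk D by (intro mult_left_mono[OF ipl]) simp
 also have "\<dots> = k / 2 * (N + E)"
 proof -
  have "x / d * (d * y) = x * y" if "d > 0" for x d y :: real using that by simp
  from this[OF D] show ?thesis .
 qed
 finally show ?thesis using low by linarith
qed

lemma form_continuous:
 assumes X: "\<And>n. X n \<in> H1 w \<Omega>" and u: "u \<in> H1 w \<Omega>" and lim: "(\<lambda>n. W.ip (X n - u) (X n - u)) \<longlonglongrightarrow> 0"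
 shows "z \<in> H1 w \<Omega> \<Longrightarrow> (\<lambda>n. form \<rho> \<sigma> a r z (X n)) \<longlonglongrightarrow> form \<rho> \<sigma> a r z u"
  "(\<lambda>n. form \<rho> \<sigma> a r (X n) (X n)) \<longlonglongrightarrow> form \<rho> \<sigma> a r u u"
proof -
 obtain C where C: "\<And>u' v. u' \<in> H1 w \<Omega> \<Longrightarrow> v \<in> H1 w \<Omega> \<Longrightarrow> \<bar>form \<rho> \<sigma> a r u' v\<bar> \<le> C * W.H.nrm u' * W.H.nrm v"
  using form_bounded by blast
 note l = W.H.bounded_bilinear_limit[where A = "form \<rho> \<sigma> a r", OF form_ops(2) form_ops(4) C X u lim]
 show "(\<lambda>n. form \<rho> \<sigma> a r z (X n)) \<longlonglongrightarrow> form \<rho> \<sigma> a r z u" if "z \<in> H1 w \<Omega>" by (rule l(1)) (use that in auto)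
 show "(\<lambda>n. form \<rho> \<sigma> a r (X n) (X n)) \<longlonglongrightarrow> form \<rho> \<sigma> a r u u" by (rule l(2)) auto
qed

lemma coercive:
 assumes u: "u \<in> W.V" and "\<sigma> \<noteq> 0" "\<bar>\<rho>\<bar> < 1" "r > 0"
  and "c = 2 * \<beta> / \<mu> + 4 / (\<mu>^2 * \<sigma>^2)" "k = min ((1 - \<bar>\<rho>\<bar>) / 2) r" "\<gamma> * (1 / 2 + (1 + \<bar>a\<bar>) * c) \<le> k"
 shows "k / 2 / (1 + c + 1 / \<sigma>^2) * W.ip u u \<le> form \<rho> \<sigma> a r u u"
proof -
 obtain \<phi> where \<phi>: "\<And>n. \<phi> n \<in> testfun \<Omega> (Gamma0 \<Omega> \<times> {0})"
  and lim: "(\<lambda>n. W.ip (\<phi> n - u) (\<phi> n - u)) \<longlonglongrightarrow> 0" and "AE P in M. (\<lambda>n. \<phi> n P) \<longlonglongrightarrow> u P"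
  by (rule W.V_AE_approx[OF u]) (rule that)
 have H: "\<phi> n \<in> H1 w \<Omega>" for n using \<phi> scs_H1 by blast
 have uH: "u \<in> H1 w \<Omega>" by (rule W.V_H1[OF u])
 show ?thesis
 proof (rule LIMSEQ_le[OF tendsto_mult[OF tendsto_const W.H.nrm_tendsto(3)[OF H uH lim uH]] form_continuous(2)[OF H uH lim]])
  show "\<exists>N. \<forall>n\<ge>N. k / 2 / (1 + c + 1 / \<sigma>^2) * W.ip (\<phi> n) (\<phi> n) \<le> form \<rho> \<sigma> a r (\<phi> n) (\<phi> n)"
   using coercive_on_tests[OF \<phi> assms(2-)] by blast
 qed
qed

end

section \<open>Barriers\<close>

context gamma_weight begin

text \<open>The weights of the second order space are exactly such that the operator maps into \<open>L\<^sup>2\<close>.\<close>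
lemma H2_facts:
 assumes m: "m \<in> H2 w \<Omega>"
 shows "m \<in> H1 w \<Omega>" "e \<in> {ex, ey} \<Longrightarrow> Lw (\<lambda>P. (1 + snd P) * wD \<Omega> e m P)"
  "e \<in> {ex, ey} \<Longrightarrow> e' \<in> {ex, ey} \<Longrightarrow> Lw (\<lambda>P. snd P * wD \<Omega> e' (wD \<Omega> e m) P)"
  "e \<in> {ex, ey} \<Longrightarrow> e' \<in> {ex, ey} \<Longrightarrow> is_weak_deriv \<Omega> e' (wD \<Omega> e m) (wD \<Omega> e' (wD \<Omega> e m))"
proof -
 define D where "D P = (snd P)^2 * whess_sq \<Omega> m P + (1 + snd P)^2 * wgrad_sq \<Omega> m P + (1 + snd P) * (m P)^2" for P
 have D: "integrable M (\<lambda>P. D P * w P)" using m by (simp add: H2_def D_def)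
 have wd: "is_weak_deriv \<Omega> e m (wD \<Omega> e m)" if "e \<in> {ex, ey}" for e
  using m that by (intro weakly_diffD) (auto simp: H2_def)
 show wdd: "is_weak_deriv \<Omega> e' (wD \<Omega> e m) (wD \<Omega> e' (wD \<Omega> e m))" if "e \<in> {ex, ey}" "e' \<in> {ex, ey}" for e e'
 proof (rule weakly_diffD)
  have "\<forall>e\<in>{ex, ey}. \<forall>e'\<in>{ex, ey}. weakly_diff \<Omega> e (wD \<Omega> e' m)" using m unfolding H2_def by blast
  then show "weakly_diff \<Omega> e' (wD \<Omega> e m)" using that by blast
 qed
 note me = li_measurable[OF open_dom weak_derivD(1)[OF wd[OF insertI1]]]
  and md = li_measurable[OF open_dom weak_derivD(2)[OF wd]] and mdd = li_measurable[OF open_dom weak_derivD(2)[OF wdd]]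
 have ym: "snd \<in> borel_measurable M" by (intro cmeas continuous_intros)
 have sq: "sqi M (\<lambda>P. sqrt (w P) * f P)" if "f \<in> borel_measurable M" "\<And>P. P \<in> \<Omega> \<Longrightarrow> (f P)^2 \<le> D P" for f
 proof (rule sqi_dominated[OF _ D])
  show "(\<lambda>P. sqrt (w P) * f P) \<in> borel_measurable M" using sqrt_w_meas that(1) by simp
  fix P assume "P \<in> space M"
  then have P: "P \<in> \<Omega>" by simp
  show "(sqrt (w P) * f P)^2 \<le> D P * w P"
   using mult_right_mono[OF that(2)[OF P], of "w P"] w_pos[OF P] by (simp add: power_mult_distrib mult.commute)
 qed
 have gn: "wgrad_sq \<Omega> u P \<ge> 0" "whess_sq \<Omega> u P \<ge> 0" for u P by (simp_all add: wgrad_sq_def whess_sq_def)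
 have g1: "(wD \<Omega> e m P)^2 \<le> wgrad_sq \<Omega> m P" if "e \<in> {ex, ey}" for e P using that by (auto simp: wgrad_sq_def)
 have g2: "(wD \<Omega> e' (wD \<Omega> e m) P)^2 \<le> whess_sq \<Omega> m P" if "e \<in> {ex, ey}" "e' \<in> {ex, ey}" for e e' P
  using that by (auto simp: whess_sq_def wgrad_sq_def)
 show "Lw (\<lambda>P. (1 + snd P) * wD \<Omega> e m P)" if e: "e \<in> {ex, ey}" for e
 proof (rule sq)
  show "(\<lambda>P. (1 + snd P) * wD \<Omega> e m P) \<in> borel_measurable M" using ym md[OF e] by simp
  fix P assume P: "P \<in> \<Omega>"
  have "(1 + snd P)^2 * (wD \<Omega> e m P)^2 \<le> (1 + snd P)^2 * wgrad_sq \<Omega> m P" by (rule mult_left_mono[OF g1[OF e]]) simp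
  moreover have "(snd P)^2 * whess_sq \<Omega> m P \<ge> 0" "(1 + snd P) * (m P)^2 \<ge> 0" using gn y_pos[OF P] by simp_all
  ultimately show "((1 + snd P) * wD \<Omega> e m P)^2 \<le> D P" unfolding D_def power_mult_distrib by linarith
 qed
 show "Lw (\<lambda>P. snd P * wD \<Omega> e' (wD \<Omega> e m) P)" if e: "e \<in> {ex, ey}" "e' \<in> {ex, ey}" for e e'
 proof (rule sq)
  show "(\<lambda>P. snd P * wD \<Omega> e' (wD \<Omega> e m) P) \<in> borel_measurable M" using ym mdd[OF e] by simp
  fix P assume P: "P \<in> \<Omega>"
  have "(snd P)^2 * (wD \<Omega> e' (wD \<Omega> e m) P)^2 \<le> (snd P)^2 * whess_sq \<Omega> m P" by (rule mult_left_mono[OF g2[OF e]]) simp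
  moreover have "(1 + snd P)^2 * wgrad_sq \<Omega> m P \<ge> 0" "(1 + snd P) * (m P)^2 \<ge> 0" using gn y_pos[OF P] by simp_all
  ultimately show "(snd P * wD \<Omega> e' (wD \<Omega> e m) P)^2 \<le> D P" unfolding D_def power_mult_distrib by linarith
 qed
 have "integrable M (H1_density w \<Omega> m)"
 proof (rule integrable_le[OF D _ AE_I2])
  show "H1_density w \<Omega> m \<in> borel_measurable M"
   unfolding H1_density_def[abs_def] wgrad_sq_def
   by (intro meas_times borel_measurable_add borel_measurable_power borel_measurable_const md me ym W.w_meas) auto
  fix P assume "P \<in> space M"
  then have P: "P \<in> \<Omega>" by simp
  have y: "snd P \<ge> 0" using y_pos[OF P] by simp
  have "snd P \<le> (1 + snd P)^2" using y by (simp add: power2_eq_square algebra_simps)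
  then have "snd P * wgrad_sq \<Omega> m P \<le> (1 + snd P)^2 * wgrad_sq \<Omega> m P" by (rule mult_right_mono[OF _ gn(1)])
  moreover have "(snd P)^2 * whess_sq \<Omega> m P \<ge> 0" using gn by simp
  ultimately have "snd P * wgrad_sq \<Omega> m P + (1 + snd P) * (m P)^2 \<le> D P" unfolding D_def by linarith
  from mult_right_mono[OF this, of "w P"] have "H1_density w \<Omega> m P \<le> D P * w P"
   unfolding H1_density_def using w_pos[OF P] by simp
  moreover have "0 \<le> H1_density w \<Omega> m P" unfolding H1_density_def using gn y w_pos[OF P] by simp
  ultimately show "norm (H1_density w \<Omega> m P) \<le> norm (D P * w P)" by simp
 qed
 then show "m \<in> H1 w \<Omega>" unfolding H1_def using weakly_diffI[OF wd] by simp
qed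

lemma Lw_bound:
 assumes "Lw f" "g \<in> borel_measurable M" "\<And>P. P \<in> \<Omega> \<Longrightarrow> \<bar>g P\<bar> \<le> C * \<bar>f P\<bar>" shows "Lw g"
proof (rule sqi_bound[OF assms(1)])
 show "(\<lambda>P. sqrt (w P) * g P) \<in> borel_measurable M" using sqrt_w_meas assms(2) by simp
 show "AE P in M. \<bar>sqrt (w P) * g P\<bar> \<le> C * \<bar>sqrt (w P) * f P\<bar>"
 proof (rule AE_I2)
  fix P assume "P \<in> space M"
  then have P: "P \<in> \<Omega>" by simp
  have "\<bar>sqrt (w P)\<bar> * \<bar>g P\<bar> \<le> \<bar>sqrt (w P)\<bar> * (C * \<bar>f P\<bar>)" by (rule mult_left_mono[OF assms(3)[OF P]]) simp
  then show "\<bar>sqrt (w P) * g P\<bar> \<le> C * \<bar>sqrt (w P) * f P\<bar>" by (simp add: abs_mult mult.left_commute)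
 qed
qed

lemma Lw_lin: assumes "Lw f" "Lw g" shows "Lw (\<lambda>P. a * f P + b * g P)"
 using sqi_add[OF sqi_scale[OF assms(1), of a] sqi_scale[OF assms(2), of b]] by (simp add: algebra_simps)

lemma bw_functional:
 assumes G: "Lw G" and u: "u \<in> H1 w \<Omega>" shows "\<bar>bw G u\<bar> \<le> sqrt (bw G G) * W.H.nrm u"
 using bw_CS[OF G H1_L(4)[OF u]] mult_left_mono[OF real_sqrt_le_mono[OF br_le_ip(4)[OF u]], of "sqrt (bw G G)"]
  bw_self_nonneg[of G] by (simp add: W.H.nrm_def)

lemma bw_lin2:
 assumes "Lw G" "u \<in> H1 w \<Omega>" "v \<in> H1 w \<Omega>"
 shows "bw G (\<lambda>P. a * u P + b * v P) = a * bw G u + b * bw G v"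
 unfolding bw_sym[of G] by (rule bw_lin[OF H1_L(4)[OF assms(2)] H1_L(4)[OF assms(3)] assms(1)])

text \<open>The mixed term is split into two equal halves, one of which is integrated by parts in \<open>x\<close> and the
 other one in \<open>y\<close>. The boundary terms with \<open>sgn x\<close> cancel those in the form.\<close>
lemma green_on_tests:
 assumes m: "m \<in> H2 w \<Omega>" and v: "v \<in> testfun \<Omega> (Gamma0 \<Omega> \<times> {0})"
  and \<sigma>: "\<sigma> \<noteq> 0" and p: "\<beta> = 2 * \<kappa> * \<theta> / \<sigma>^2" "\<mu> = 2 * \<kappa> / \<sigma>^2" and b1: "r - q = \<kappa> * \<theta> * \<rho> / \<sigma>"
 shows "Lw (heston_op r q \<kappa> \<theta> \<rho> \<sigma> \<Omega> m)"
  "form \<rho> \<sigma> (\<kappa> * \<rho> / \<sigma> - 1 / 2) r m v = bw (heston_op r q \<kappa> \<theta> \<rho> \<sigma> \<Omega> m) v"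
proof -
 let ?x = "wD \<Omega> ex m" and ?y = "wD \<Omega> ey m"
 let ?xx = "wD \<Omega> ex ?x" and ?xy = "wD \<Omega> ey ?x" and ?yy = "wD \<Omega> ey ?y"
 let ?A = "heston_op r q \<kappa> \<theta> \<rho> \<sigma> \<Omega> m"
 have mH: "m \<in> H1 w \<Omega>" by (rule H2_facts(1)[OF m])
 have vH: "v \<in> H1 w \<Omega>" using v scs_H1 by blast
 note Lm = H1_L[OF mH] and Lv = H1_L[OF vH]
 have mx: "?x \<in> borel_measurable M" and my: "?y \<in> borel_measurable M" by (rule H1_facts(2)[OF mH], simp)+
 have ym: "snd \<in> borel_measurable M" by (intro cmeas continuous_intros)
 have S: "Lw (\<lambda>P. snd P * ?xx P)" "Lw (\<lambda>P. snd P * ?xy P)" "Lw (\<lambda>P. snd P * ?yy P)"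
  by (rule H2_facts(3)[OF m], simp, simp)+
 have W1: "Lw ?x" "Lw (\<lambda>P. snd P * ?x P)" "Lw ?y" "Lw (\<lambda>P. snd P * ?y P)"
 proof -
  have k: "Lw g" if e: "e \<in> {ex, ey}" and g: "g \<in> borel_measurable M" "\<And>P. P \<in> \<Omega> \<Longrightarrow> \<bar>g P\<bar> \<le> (1 + snd P) * \<bar>wD \<Omega> e m P\<bar>" for e g
  proof (rule Lw_bound[OF H2_facts(2)[OF m e] g(1), of 1])
   fix P assume P: "P \<in> \<Omega>"
   show "\<bar>g P\<bar> \<le> 1 * \<bar>(1 + snd P) * wD \<Omega> e m P\<bar>" using g(2)[OF P] y_pos[OF P] by (simp add: abs_mult)
  qed
  have l: "\<bar>f P\<bar> \<le> (1 + snd P) * \<bar>f P\<bar>" "\<bar>snd P * f P\<bar> \<le> (1 + snd P) * \<bar>f P\<bar>" if "P \<in> \<Omega>" for f :: "plane \<Rightarrow> real" and P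
   using y_pos[OF that] by (simp_all add: abs_mult distrib_right)
  show "Lw ?x" by (rule k[of ex], simp, rule mx, rule l(1))
  show "Lw (\<lambda>P. snd P * ?x P)" by (rule k[of ex], simp, rule meas_times[OF ym mx], rule l(2))
  show "Lw ?y" by (rule k[of ey], simp, rule my, rule l(1))
  show "Lw (\<lambda>P. snd P * ?y P)" by (rule k[of ey], simp, rule meas_times[OF ym my], rule l(2))
 qed
 have Aeq: "?A = (\<lambda>P. 1 * (1 * ((- 1 / 2) * (snd P * ?xx P) + (- \<rho> * \<sigma>) * (snd P * ?xy P)) + 1 * ((- (\<sigma>^2) / 2) * (snd P * ?yy P) + (- (r - q)) * ?x P))
   + 1 * (1 * ((1 / 2) * (snd P * ?x P) + (- \<kappa> * \<theta>) * ?y P) + 1 * (\<kappa> * (snd P * ?y P) + r * m P)))"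
  unfolding heston_op_def Let_def by (simp add: fun_eq_iff algebra_simps)
 show "Lw ?A" unfolding Aeq by (intro Lw_lin S W1 H1_L(4)[OF mH])
 have yb: "bw (\<lambda>P. snd P * f P) v = br f v" for f unfolding bw_def br_def by (simp add: mult_ac)
 have bA: "bw ?A v = - 1 / 2 * br ?xx v - \<rho> * \<sigma> * br ?xy v - (\<sigma>^2) / 2 * br ?yy v - (r - q) * bw ?x v
   + 1 / 2 * br ?x v - \<kappa> * \<theta> * bw ?y v + \<kappa> * br ?y v + r * bw m v"
  unfolding Aeq yb[symmetric]
  by (subst bw_lin, (intro Lw_lin S W1 H1_L(4)[OF mH] H1_L(4)[OF vH])+)+ (simp add: left_diff_distrib)
 note iv = br_integrable'[OF _ H1_L(4)[OF vH]] and iw = bw_integrable[OF _ H1_L(4)[OF vH]]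
 have dd: "is_weak_deriv \<Omega> ex ?x ?xx" "is_weak_deriv \<Omega> ey ?x ?xy" "is_weak_deriv \<Omega> ey ?y ?yy"
  by (rule H2_facts(4)[OF m], simp, simp)+
 have dxy: "is_weak_deriv \<Omega> ex ?y ?xy"
  by (rule weak_deriv_symmetric[OF open_dom W.H1_wD[OF mH] W.H1_wD[OF mH] dd(2)]) auto
 have e1: "br ?xx v = - br ?x (wD \<Omega> ex v) + \<gamma> * br ?x (sg v)"
  by (rule by_parts_br(1)[OF v Lm(1) mx iv[OF S(1)] iw[OF W1(1)] dd(1)])
 have e2: "br ?xy v = - br ?y (wD \<Omega> ex v) + \<gamma> * br ?y (sg v)"
  by (rule by_parts_br(1)[OF v Lm(2) my iv[OF S(2)] iw[OF W1(3)] dxy])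
 have e3: "br ?xy v = - br ?x (wD \<Omega> ey v) - \<beta> * bw ?x v + \<mu> * br ?x v"
  by (rule by_parts_br(2)[OF v Lm(1) mx iv[OF S(2)] iw[OF W1(1)] dd(2)])
 have e4: "br ?yy v = - br ?y (wD \<Omega> ey v) - \<beta> * bw ?y v + \<mu> * br ?y v"
  by (rule by_parts_br(2)[OF v Lm(2) my iv[OF S(3)] iw[OF W1(3)] dd(3)])
 have c: "\<sigma>^2 / 2 * \<beta> = \<kappa> * \<theta>" "\<sigma>^2 / 2 * \<mu> = \<kappa>" "\<rho> * \<sigma> / 2 * \<beta> = r - q" "\<rho> * \<sigma> / 2 * \<mu> = \<kappa> * \<rho> / \<sigma>"
  using \<sigma> b1 by (simp_all add: p power2_eq_square field_simps)
 have "bw ?A v = - 1 / 2 * (- br ?x (wD \<Omega> ex v) + \<gamma> * br ?x (sg v))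
   - \<rho> * \<sigma> / 2 * (- br ?y (wD \<Omega> ex v) + \<gamma> * br ?y (sg v))
   - (- (\<rho> * \<sigma> / 2) * br ?x (wD \<Omega> ey v) - (\<rho> * \<sigma> / 2 * \<beta>) * bw ?x v + (\<rho> * \<sigma> / 2 * \<mu>) * br ?x v)
   - (- (\<sigma>^2 / 2) * br ?y (wD \<Omega> ey v) - (\<sigma>^2 / 2 * \<beta>) * bw ?y v + (\<sigma>^2 / 2 * \<mu>) * br ?y v)
   - (r - q) * bw ?x v + 1 / 2 * br ?x v - \<kappa> * \<theta> * bw ?y v + \<kappa> * br ?y v + r * bw m v"
 proof -
  have "\<rho> * \<sigma> * br ?xy v = \<rho> * \<sigma> / 2 * br ?xy v + \<rho> * \<sigma> / 2 * br ?xy v" by simp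
  also have "\<dots> = \<rho> * \<sigma> / 2 * (- br ?y (wD \<Omega> ex v) + \<gamma> * br ?y (sg v))
   + \<rho> * \<sigma> / 2 * (- br ?x (wD \<Omega> ey v) - \<beta> * bw ?x v + \<mu> * br ?x v)"
   by (simp only: e2[symmetric] e3[symmetric])
  finally show ?thesis unfolding bA e1 e4 by (simp add: algebra_simps)
 qed
 then show "form \<rho> \<sigma> (\<kappa> * \<rho> / \<sigma> - 1 / 2) r m v = bw ?A v"
  unfolding c form_def by (simp add: algebra_simps)
qed

lemma green:
 assumes m: "m \<in> H2 w \<Omega>" and v: "v \<in> W.V"
  and p: "\<sigma> \<noteq> 0" "\<beta> = 2 * \<kappa> * \<theta> / \<sigma>^2" "\<mu> = 2 * \<kappa> / \<sigma>^2" "r - q = \<kappa> * \<theta> * \<rho> / \<sigma>"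
 shows "Lw (heston_op r q \<kappa> \<theta> \<rho> \<sigma> \<Omega> m)"
  "form \<rho> \<sigma> (\<kappa> * \<rho> / \<sigma> - 1 / 2) r m v = bw (heston_op r q \<kappa> \<theta> \<rho> \<sigma> \<Omega> m) v"
proof -
 let ?A = "heston_op r q \<kappa> \<theta> \<rho> \<sigma> \<Omega> m"
 obtain \<phi> where \<phi>: "\<And>n. \<phi> n \<in> testfun \<Omega> (Gamma0 \<Omega> \<times> {0})"
  and lim: "(\<lambda>n. W.ip (\<phi> n - v) (\<phi> n - v)) \<longlonglongrightarrow> 0" and "AE P in M. (\<lambda>n. \<phi> n P) \<longlonglongrightarrow> v P"
  by (rule W.V_AE_approx[OF v]) (rule that)
 have H: "\<phi> n \<in> H1 w \<Omega>" for n using \<phi> scs_H1 by blast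
 have vH: "v \<in> H1 w \<Omega>" by (rule W.V_H1[OF v])
 show A: "Lw ?A" by (rule green_on_tests(1)[OF m \<phi>[of 0] p])
 have d: "bw ?A (\<phi> n) - bw ?A v = bw ?A (\<phi> n - v)" for n
  using bw_lin2[OF A H[of n] vH, of 1 "-1", folded fun_diff_eq] by simp
 have "(\<lambda>n. bw ?A (\<phi> n)) \<longlonglongrightarrow> bw ?A v"
 proof (rule LIM_zero_cancel, rule Lim_null_comparison[OF always_eventually])
  show "\<forall>n. norm (bw ?A (\<phi> n) - bw ?A v) \<le> sqrt (bw ?A ?A) * W.H.nrm (\<phi> n - v)"
   unfolding d using bw_functional[OF A W.H.mem(2)[OF H vH]] by simp
  show "(\<lambda>n. sqrt (bw ?A ?A) * W.H.nrm (\<phi> n - v)) \<longlonglongrightarrow> 0"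
   using tendsto_mult[OF tendsto_const W.H.nrm_tendsto(1)[OF H vH lim vH], of "sqrt (bw ?A ?A)"] by simp
 qed
 moreover have "(\<lambda>n. form \<rho> \<sigma> (\<kappa> * \<rho> / \<sigma> - 1 / 2) r m (\<phi> n)) \<longlonglongrightarrow> form \<rho> \<sigma> (\<kappa> * \<rho> / \<sigma> - 1 / 2) r m v"
  by (rule form_continuous(1)[OF H vH lim H2_facts(1)[OF m]])
 ultimately show "form \<rho> \<sigma> (\<kappa> * \<rho> / \<sigma> - 1 / 2) r m v = bw ?A v"
  unfolding green_on_tests(2)[OF m \<phi> p] by (metis LIMSEQ_unique)
qed

lemma ip_zero_AE:
 assumes u: "u \<in> H1 w \<Omega>" and z: "W.ip u u \<le> 0" shows "AE P in M. u P = 0"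
proof -
 have "bw u u = 0" using br_le_ip(4)[OF u] z bw_self_nonneg[of u] by linarith
 then have "(LINT P|M. (sqrt (w P) * u P) * (sqrt (w P) * u P)) = 0" unfolding bw_eq .
 then have "AE P in M. (sqrt (w P) * u P) * (sqrt (w P) * u P) = 0"
  by (subst (asm) integral_nonneg_eq_0_iff_AE[OF sqi_mult[OF H1_L(4)[OF u] H1_L(4)[OF u]]]) auto
 with AE_space show ?thesis
 proof eventually_elim
  case (elim P)
  then have "P \<in> \<Omega>" by simp
  from w_pos[OF this] show ?case using elim by simp
 qed
qed

text \<open>The positive part \<open>h\<close> of \<open>z = u - m\<close> is an admissible test function, and \<open>z\<close> and \<open>h\<close> have the same
 derivatives where \<open>h\<close> or its derivatives do not vanish.\<close>
lemma comparison:
 assumes u: "u \<in> W.V" and m: "m \<in> H1 w \<Omega>" and mV: "(\<lambda>P. - min (m P) 0) \<in> W.V"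
  and eu: "\<And>v. v \<in> W.V \<Longrightarrow> form \<rho> \<sigma> a r u v = bw f v" and em: "\<And>v. v \<in> W.V \<Longrightarrow> form \<rho> \<sigma> a r m v = bw G v"
  and L: "Lw f" "Lw G" and le: "AE P in M. f P \<le> G P"
  and c: "c > 0" "\<And>v. v \<in> W.V \<Longrightarrow> c * W.ip v v \<le> form \<rho> \<sigma> a r v v"
 shows "AE P in M. u P \<le> m P"
proof -
 define n where "n P = - min (m P) 0" for P
 define z where "z = u - m"
 define h where "h P = max (z P - 0) 0" for P
 have nV: "n \<in> W.V" using mV by (simp add: n_def[abs_def])
 have uH: "u \<in> H1 w \<Omega>" by (rule W.V_H1[OF u])
 \<comment> \<open>Adding the negative part \<open>n\<close> of \<open>m\<close> makes the subtracted function nonnegative.\<close>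
 have "(\<lambda>P. max (((u + n) - (m + n)) P - 0) 0) \<in> W.V"
 proof (rule W.pos_part_in_V[OF W.V.mem(1)[OF u nV] W.H.mem(1)[OF m W.V_H1[OF nV]]])
  show "0 \<le> (m + n) P" for P by (simp add: n_def min_def)
 qed
 then have hV: "h \<in> W.V" by (simp add: h_def[abs_def] z_def)
 have hH: "h \<in> H1 w \<Omega>" by (rule W.V_H1[OF hV])
 have zH: "z \<in> H1 w \<Omega>" unfolding z_def by (rule W.H.mem(2)[OF uH m])
 have wh: "AE P in M. wD \<Omega> e h P = (if z P > 0 then wD \<Omega> e z P else 0)" if "e \<in> {ex, ey}" for e
  by (rule wD_AE[OF open_dom that]) (use W.weak_deriv_pos_part[OF zH that, of 0] in \<open>simp add: h_def[abs_def]\<close>)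
 have same: "br (wD \<Omega> e z) g = br (wD \<Omega> e h) g"
  if e: "e \<in> {ex, ey}" and g: "g \<in> borel_measurable M" "AE P in M. z P \<le> 0 \<longrightarrow> g P = 0" for e g
  unfolding br_def
 proof (rule integral_cong_AE)
  show "AE P in M. wD \<Omega> e z P * g P * (snd P * w P) = wD \<Omega> e h P * g P * (snd P * w P)"
   using wh[OF e] g(2) by eventually_elim (auto simp: not_less)
 qed (intro meas_times H1_facts(2)[OF zH e] H1_facts(2)[OF hH e] g cmeas continuous_intros cont_w)+
 have gz: "AE P in M. z P \<le> 0 \<longrightarrow> wD \<Omega> e h P = 0" if "e \<in> {ex, ey}" for e using wh[OF that] by eventually_elim simp
 have hz: "AE P in M. z P \<le> 0 \<longrightarrow> h P = 0" "AE P in M. z P \<le> 0 \<longrightarrow> sg h P = 0" by (simp_all add: h_def sg_def)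
 have sx: "br (wD \<Omega> e z) (wD \<Omega> ex h) = br (wD \<Omega> e h) (wD \<Omega> ex h)" "br (wD \<Omega> e z) (wD \<Omega> ey h) = br (wD \<Omega> e h) (wD \<Omega> ey h)"
  "br (wD \<Omega> e z) h = br (wD \<Omega> e h) h" "br (wD \<Omega> e z) (sg h) = br (wD \<Omega> e h) (sg h)" if "e \<in> {ex, ey}" for e
  by (rule same[OF that H1_facts(2)[OF hH] gz], simp, simp, rule same[OF that H1_facts(2)[OF hH] gz], simp, simp,
    rule same[OF that H1_facts(1)[OF hH] hz(1)], rule same[OF that H1_facts(6)[OF hH] hz(2)])
 have bz: "bw z h = bw h h" unfolding bw_def by (rule integral_cong_dom) (simp add: h_def max_def)
 have "form \<rho> \<sigma> a r h h = form \<rho> \<sigma> a r z h" unfolding form_def bz sx[of ex, simplified] sx[of ey, simplified] ..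
 also have "\<dots> = bw f h - bw G h"
  unfolding z_def form_ops(2)[OF uH m hH] eu[OF hV] em[OF hV] ..
 also have "\<dots> \<le> 0"
 proof -
  have "bw f h \<le> bw G h"
   unfolding bw_def
  proof (rule integral_mono_AE[OF bw_integrable[OF L(1) H1_L(4)[OF hH]] bw_integrable[OF L(2) H1_L(4)[OF hH]]])
   show "AE P in M. f P * h P * w P \<le> G P * h P * w P"
    using le AE_space
   proof eventually_elim
    case (elim P)
    then have "P \<in> \<Omega>" by simp
    then show ?case using w_pos[of P] elim by (intro mult_right_mono) (auto simp: h_def)
   qed
  qed
  then show ?thesis by simp
 qed
 finally have "c * W.ip h h \<le> 0" using c(2)[OF hV] by linarith
 then have "W.ip h h \<le> 0" using c(1) by (simp add: mult_le_0_iff)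
 from ip_zero_AE[OF hH this] show ?thesis by eventually_elim (simp add: h_def z_def max_def split: if_splits)
qed

lemma L2_Lw: assumes "f \<in> L2 w \<Omega>" shows "Lw f"
 unfolding sqi_def
proof
 have f: "f \<in> borel_measurable M" "integrable M (\<lambda>P. (f P)^2 * w P)" using assms by (auto simp: L2_def)
 show "(\<lambda>P. sqrt (w P) * f P) \<in> borel_measurable M" using sqrt_w_meas f(1) by simp
 show "integrable M (\<lambda>P. (sqrt (w P) * f P)^2)"
  by (rule integrable_cong_dom[OF f(2)]) (use w_pos in \<open>simp add: power_mult_distrib less_imp_le mult.commute\<close>)
qed

lemma solution_between_barriers:
 assumes hw: "w = heston_weight \<kappa> \<theta> \<sigma> \<gamma>"
  and p: "\<sigma> \<noteq> 0" "\<beta> = 2 * \<kappa> * \<theta> / \<sigma>^2" "\<mu> = 2 * \<kappa> / \<sigma>^2" "r - q = \<kappa> * \<theta> * \<rho> / \<sigma>"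
  and \<rho>: "\<bar>\<rho>\<bar> < 1" and r: "r > 0"
  and c: "c = 2 * \<beta> / \<mu> + 4 / (\<mu>^2 * \<sigma>^2)" and k: "k = min ((1 - \<bar>\<rho>\<bar>) / 2) r"
  and small: "\<gamma> * (1 / 2 + (1 + \<bar>\<kappa> * \<rho> / \<sigma> - 1 / 2\<bar>) * c) \<le> k"
  and up: "U \<in> H2 w \<Omega>" "(\<lambda>P. - min (U P) 0) \<in> W.V" and lo: "m \<in> H2 w \<Omega>" "(\<lambda>P. max (m P) 0) \<in> W.V"
  and f: "f \<in> L2 w \<Omega>"
  and bd: "AE P in M. heston_op r q \<kappa> \<theta> \<rho> \<sigma> \<Omega> m P \<le> f P \<and> f P \<le> heston_op r q \<kappa> \<theta> \<rho> \<sigma> \<Omega> U P"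
 shows "\<exists>u\<in>W.V. (\<forall>v\<in>W.V. heston_form r \<kappa> \<theta> \<rho> \<sigma> \<gamma> \<Omega> u v = (LINT P|M. f P * v P * w P)) \<and>
   (AE P in M. m P \<le> u P \<and> u P \<le> U P)"
  and "\<And>u u'. u \<in> W.V \<Longrightarrow> u' \<in> W.V \<Longrightarrow>
   (\<forall>v\<in>W.V. heston_form r \<kappa> \<theta> \<rho> \<sigma> \<gamma> \<Omega> u v = (LINT P|M. f P * v P * w P)) \<Longrightarrow>
   (\<forall>v\<in>W.V. heston_form r \<kappa> \<theta> \<rho> \<sigma> \<gamma> \<Omega> u' v = (LINT P|M. f P * v P * w P)) \<Longrightarrow> AE P in M. u P = u' P"
proof -
 define a where "a = \<kappa> * \<rho> / \<sigma> - 1 / 2"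
 define c0 where "c0 = k / 2 / (1 + c + 1 / \<sigma>^2)"
 have cp: "c \<ge> 0" unfolding c using \<beta> \<mu> by simp
 have kp: "k > 0" unfolding k using \<rho> r by simp
 have c0: "c0 > 0" unfolding c0_def using cp kp by (intro divide_pos_pos add_pos_nonneg) auto
 have co: "c0 * W.ip v v \<le> form \<rho> \<sigma> a r v v" if "v \<in> W.V" for v
  unfolding c0_def by (rule coercive[OF that p(1) \<rho> r c k small[folded a_def]])
 have hf: "heston_form r \<kappa> \<theta> \<rho> \<sigma> \<gamma> \<Omega> u v = form \<rho> \<sigma> a r u v" if "u \<in> W.V" "v \<in> W.V" for u v
  unfolding a_def by (rule heston_form_eq[OF W.V_H1[OF that(1)] W.V_H1[OF that(2)] hw])
 have Lf: "Lw f" by (rule L2_Lw[OF f])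
 obtain C where C: "\<And>u v. u \<in> H1 w \<Omega> \<Longrightarrow> v \<in> H1 w \<Omega> \<Longrightarrow> \<bar>form \<rho> \<sigma> a r u v\<bar> \<le> C * W.H.nrm u * W.H.nrm v"
  using form_bounded by blast
 note H = W.V_H1
 have "\<exists>u\<in>W.V. \<forall>v\<in>W.V. form \<rho> \<sigma> a r u v = bw f v"
 proof (rule W.V.lax_milgram[where A = "form \<rho> \<sigma> a r" and F = "bw f", OF _ _ _ _ _ co c0])
  show "form \<rho> \<sigma> a r (x *\<^sub>R u) z = x * form \<rho> \<sigma> a r u z" if "u \<in> W.V" "z \<in> W.V" for x u z
   unfolding fun_scale_eq using form_lin1[OF H[OF that(1)] H[OF that(1)] H[OF that(2)], of \<rho> \<sigma> a r x 0] by simp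
  show "form \<rho> \<sigma> a r z (x *\<^sub>R u) = x * form \<rho> \<sigma> a r z u" if "u \<in> W.V" "z \<in> W.V" for x u z
   unfolding fun_scale_eq using form_lin2[OF H[OF that(1)] H[OF that(1)] H[OF that(2)], of \<rho> \<sigma> a r x 0] by simp
  show "bw f (x *\<^sub>R u) = x * bw f u" if "u \<in> W.V" for x u
   unfolding fun_scale_eq using bw_lin2[OF Lf H[OF that] H[OF that], of x 0] by simp
  show "bw f (u + v) = bw f u + bw f v" if "u \<in> W.V" "v \<in> W.V" for u v
   unfolding fun_add_eq using bw_lin2[OF Lf H[OF that(1)] H[OF that(2)], of 1 1] by simp
  show "\<bar>bw f u\<bar> \<le> sqrt (bw f f) * W.V.nrm u" if "u \<in> W.V" for u by (rule bw_functional[OF Lf H[OF that]])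
  show "\<bar>form \<rho> \<sigma> a r u v\<bar> \<le> C * W.V.nrm u * W.V.nrm v" if "u \<in> W.V" "v \<in> W.V" for u v by (rule C[OF H[OF that(1)] H[OF that(2)]])
  show "form \<rho> \<sigma> a r (u + v) z = form \<rho> \<sigma> a r u z + form \<rho> \<sigma> a r v z" if "u \<in> W.V" "v \<in> W.V" "z \<in> W.V" for u v z
   by (rule form_ops(1)[OF H[OF that(1)] H[OF that(2)] H[OF that(3)]])
  show "form \<rho> \<sigma> a r z (u + v) = form \<rho> \<sigma> a r z u + form \<rho> \<sigma> a r z v" if "u \<in> W.V" "v \<in> W.V" "z \<in> W.V" for u v z
   by (rule form_ops(3)[OF H[OF that(1)] H[OF that(2)] H[OF that(3)]])
 qed
 then obtain u where u: "u \<in> W.V" and eu: "\<And>v. v \<in> W.V \<Longrightarrow> form \<rho> \<sigma> a r u v = bw f v" by blast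
 have uU: "AE P in M. u P \<le> U P"
 proof (rule comparison[OF u H2_facts(1)[OF up(1)] up(2) eu _ Lf green(1)[OF up(1) u p] _ c0 co])
  show "form \<rho> \<sigma> a r U v = bw (heston_op r q \<kappa> \<theta> \<rho> \<sigma> \<Omega> U) v" if "v \<in> W.V" for v
   unfolding a_def by (rule green(2)[OF up(1) that p])
  show "AE P in M. f P \<le> heston_op r q \<kappa> \<theta> \<rho> \<sigma> \<Omega> U P" using bd by eventually_elim simp
 qed
 have neg: "form \<rho> \<sigma> a r (\<lambda>P. - g P) v = - form \<rho> \<sigma> a r g v" if "g \<in> H1 w \<Omega>" "v \<in> H1 w \<Omega>" for g v
  using form_lin1[OF that(1) that(1) that(2), of \<rho> \<sigma> a r "-1" 0] by simp
 have bneg: "bw (\<lambda>P. - g P) v = - bw g v" for g v unfolding bw_def by simp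
 have lneg: "Lw (\<lambda>P. - g P)" if "Lw g" for g using sqi_scale[OF that, of "-1"] by simp
 have uV: "(\<lambda>P. - u P) \<in> W.V" using W.V_linear[OF u u, of "-1" 0] by simp
 have mH: "m \<in> H1 w \<Omega>" by (rule H2_facts(1)[OF lo(1)])
 have "AE P in M. - u P \<le> - m P"
 proof (rule comparison[OF uV _ _ _ _ lneg[OF Lf] lneg[OF green(1)[OF lo(1) u p]] _ c0 co])
  show "(\<lambda>P. - m P) \<in> H1 w \<Omega>" using W.H1_linear[OF mH mH, of "-1" 0] by simp
  have "(\<lambda>P. - min (- m P) 0) = (\<lambda>P. max (m P) 0)" by (simp add: fun_eq_iff min_def max_def)
  then show "(\<lambda>P. - min (- m P) 0) \<in> W.V" using lo(2) by simp
  show "form \<rho> \<sigma> a r (\<lambda>P. - u P) v = bw (\<lambda>P. - f P) v" if "v \<in> W.V" for v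
   unfolding neg[OF H[OF u] H[OF that]] bneg eu[OF that] ..
  show "form \<rho> \<sigma> a r (\<lambda>P. - m P) v = bw (\<lambda>P. - heston_op r q \<kappa> \<theta> \<rho> \<sigma> \<Omega> m P) v" if "v \<in> W.V" for v
   unfolding neg[OF mH H[OF that]] bneg unfolding a_def green(2)[OF lo(1) that p] ..
  show "AE P in M. - f P \<le> - heston_op r q \<kappa> \<theta> \<rho> \<sigma> \<Omega> m P" using bd by eventually_elim simp
 qed
 with uU have "AE P in M. m P \<le> u P \<and> u P \<le> U P" by eventually_elim simp
 then show "\<exists>u\<in>W.V. (\<forall>v\<in>W.V. heston_form r \<kappa> \<theta> \<rho> \<sigma> \<gamma> \<Omega> u v = (LINT P|M. f P * v P * w P)) \<and>
   (AE P in M. m P \<le> u P \<and> u P \<le> U P)"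
  using u eu hf[OF u] unfolding bw_def by (intro bexI[of _ u]) auto
 show "AE P in M. u P = u' P" if uu: "u \<in> W.V" "u' \<in> W.V"
  "\<forall>v\<in>W.V. heston_form r \<kappa> \<theta> \<rho> \<sigma> \<gamma> \<Omega> u v = (LINT P|M. f P * v P * w P)"
  "\<forall>v\<in>W.V. heston_form r \<kappa> \<theta> \<rho> \<sigma> \<gamma> \<Omega> u' v = (LINT P|M. f P * v P * w P)" for u u'
 proof -
  have d: "u - u' \<in> W.V" by (rule W.V.mem(2)[OF uu(1,2)])
  have "form \<rho> \<sigma> a r (u - u') (u - u') = 0"
   unfolding form_ops(2)[OF H[OF uu(1)] H[OF uu(2)] H[OF d]]
   using uu(3)[rule_format, OF d] uu(4)[rule_format, OF d] hf[OF uu(1) d] hf[OF uu(2) d] by simp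
  then have "W.ip (u - u') (u - u') \<le> 0" using co[OF d] c0 by (simp add: mult_le_0_iff)
  from ip_zero_AE[OF H[OF d] this] show ?thesis by eventually_elim simp
 qed
qed

end

theorem theorem3p16:
 fixes r q \<kappa> \<theta> \<rho> \<sigma> :: real
 assumes "\<sigma> \<noteq> 0" "-1 < \<rho>" "\<rho> < 1" "\<kappa> > 0" "\<theta> > 0" "r \<ge> 0" "q \<ge> 0"
  and "r - q - \<kappa> * \<theta> * \<rho> / \<sigma> = 0"
 shows "\<exists>\<gamma>\<^sub>0>0. \<forall>\<gamma>. 0 < \<gamma> \<and> \<gamma> < \<gamma>\<^sub>0 \<longrightarrow>
  (\<forall>\<Omega>. heston_domain \<Omega> \<and> r > 0 \<longrightarrow>
   (let w = heston_weight \<kappa> \<theta> \<sigma> \<gamma>;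
      A = heston_op r q \<kappa> \<theta> \<rho> \<sigma> \<Omega>;
      V = H1_zero w \<Omega> (Gamma0 \<Omega> \<times> {0})
    in \<forall>M m f.
     M \<in> H2 w \<Omega> \<and> m \<in> H2 w \<Omega> \<and>
     (\<lambda>P. max (m P) 0) \<in> V \<and> (\<lambda>P. - min (M P) 0) \<in> V \<and>
     (AE P in lebesgue_on \<Omega>. m P \<le> M P) \<and>
     (AE P in lebesgue_on \<Omega>. A m P \<le> A M P) \<and>
     f \<in> L2 w \<Omega> \<and>
     (AE P in lebesgue_on \<Omega>. A m P \<le> f P \<and> f P \<le> A M P) \<longrightarrow>
     (let solution = (\<lambda>u. u \<in> V \<and>
        (\<forall>v\<in>V. heston_form r \<kappa> \<theta> \<rho> \<sigma> \<gamma> \<Omega> u v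
         = (LINT P|lebesgue_on \<Omega>. f P * v P * w P)) \<and>
        (AE P in lebesgue_on \<Omega>. m P \<le> u P \<and> u P \<le> M P))
     in (\<exists>u. solution u) \<and>
       (domain_conditions \<Omega> \<and>
       (\<exists>\<phi>\<in>H2 w \<Omega>.
         (AE P in lebesgue_on \<Omega>. A \<phi> P \<ge> 0) \<and>
         (AE P in lebesgue_on \<Omega>. A (\<lambda>Q. m Q + \<phi> Q) P > 0) \<and>
         (AE P in lebesgue_on \<Omega>. \<phi> P \<ge> 0) \<and>
         (\<lambda>P. (1 + snd P) * \<phi> P) \<in> L2 w \<Omega> \<and>
         (\<lambda>P. sqrt (1 + snd P) * A \<phi> P) \<in> L2 w \<Omega> \<and>
         esssup (lebesgue_on \<Omega>) (\<lambda>P. ereal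
          ((1 + snd P) * (M P + \<phi> P) / A (\<lambda>Q. m Q + \<phi> Q) P)) < \<infinity>) \<longrightarrow>
       (\<forall>u\<^sub>1 u\<^sub>2. solution u\<^sub>1 \<and> solution u\<^sub>2 \<longrightarrow>
         (AE P in lebesgue_on \<Omega>. u\<^sub>1 P = u\<^sub>2 P))))))"
proof -
 define \<beta> \<mu> where "\<beta> = 2 * \<kappa> * \<theta> / \<sigma>\<^sup>2" and "\<mu> = 2 * \<kappa> / \<sigma>\<^sup>2"
 define c where "c = 2 * \<beta> / \<mu> + 4 / (\<mu>\<^sup>2 * \<sigma>\<^sup>2)"
 define k where "k = min ((1 - \<bar>\<rho>\<bar>) / 2) r"
 \<comment> \<open>The indefinite terms of the form are at most \<open>\<gamma> * D\<close> times half of the quantity that \<open>k\<close> bounds from below.\<close>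
 define D where "D = 1 / 2 + (1 + \<bar>\<kappa> * \<rho> / \<sigma> - 1 / 2\<bar>) * c"
 define \<gamma>\<^sub>0 where "\<gamma>\<^sub>0 = (if r > 0 then k / D else 1)"
 have pos: "\<beta> > 0" "\<mu> > 0" using assms(1,4,5) by (simp_all add: \<beta>_def \<mu>_def)
 have "c \<ge> 0" unfolding c_def using pos by simp
 then have D: "D > 0" unfolding D_def by (intro add_pos_nonneg mult_nonneg_nonneg) auto
 have \<rho>: "\<bar>\<rho>\<bar> < 1" using assms(2,3) by simp
 have g0: "\<gamma>\<^sub>0 > 0" using D \<rho> by (simp add: \<gamma>\<^sub>0_def k_def)
 show ?thesis (is "\<exists>\<gamma>\<^sub>0>0. \<forall>\<gamma>. _ \<longrightarrow> (\<forall>\<Omega>. _ \<longrightarrow> ?C \<gamma> \<Omega>)")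
 proof (intro exI[of _ \<gamma>\<^sub>0] conjI g0 allI impI)
  fix \<gamma> \<Omega> assume gam: "0 < \<gamma> \<and> \<gamma> < \<gamma>\<^sub>0" and dom: "heston_domain \<Omega> \<and> 0 < r"
  define w where "w = heston_weight \<kappa> \<theta> \<sigma> \<gamma>"
  interpret gamma_weight \<Omega> \<beta> \<mu> \<gamma> w
  proof
   show "w = (\<lambda>P. snd P powr (\<beta> - 1) * exp (- \<gamma> * \<bar>fst P\<bar> - \<mu> * snd P))"
    by (simp add: w_def heston_weight_def fun_eq_iff Let_def \<beta>_def \<mu>_def split_beta)
  qed (use dom pos gam in \<open>auto simp: heston_domain_def\<close>)
  have "\<gamma> < k / D" using gam dom by (simp add: \<gamma>\<^sub>0_def)
  then have small: "\<gamma> * D \<le> k" using D by (simp add: pos_less_divide_eq)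
  have b1: "r - q = \<kappa> * \<theta> * \<rho> / \<sigma>" using assms(8) by simp
  note core = solution_between_barriers[OF w_def assms(1) \<beta>_def \<mu>_def b1 \<rho> conjunct2[OF dom] c_def k_def small[unfolded D_def]]
  show "?C \<gamma> \<Omega>"
   unfolding w_def[symmetric] Let_def W.V_def[symmetric]
  proof (intro allI impI conjI)
   fix U m f
   assume h: "U \<in> H2 w \<Omega> \<and> m \<in> H2 w \<Omega> \<and> (\<lambda>P. max (m P) 0) \<in> W.V \<and> (\<lambda>P. - min (U P) 0) \<in> W.V \<and>
     (AE P in lebesgue_on \<Omega>. m P \<le> U P) \<and>
     (AE P in lebesgue_on \<Omega>. heston_op r q \<kappa> \<theta> \<rho> \<sigma> \<Omega> m P \<le> heston_op r q \<kappa> \<theta> \<rho> \<sigma> \<Omega> U P) \<and>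
     f \<in> L2 w \<Omega> \<and>
     (AE P in lebesgue_on \<Omega>. heston_op r q \<kappa> \<theta> \<rho> \<sigma> \<Omega> m P \<le> f P \<and> f P \<le> heston_op r q \<kappa> \<theta> \<rho> \<sigma> \<Omega> U P)"
   from h have h': "U \<in> H2 w \<Omega>" "(\<lambda>P. - min (U P) 0) \<in> W.V" "m \<in> H2 w \<Omega>" "(\<lambda>P. max (m P) 0) \<in> W.V" "f \<in> L2 w \<Omega>"
    "AE P in lebesgue_on \<Omega>. heston_op r q \<kappa> \<theta> \<rho> \<sigma> \<Omega> m P \<le> f P \<and> f P \<le> heston_op r q \<kappa> \<theta> \<rho> \<sigma> \<Omega> U P" by blast+
   show "\<exists>u. u \<in> W.V \<and> (\<forall>v\<in>W.V. heston_form r \<kappa> \<theta> \<rho> \<sigma> \<gamma> \<Omega> u v = (LINT P|lebesgue_on \<Omega>. f P * v P * w P)) \<and>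
     (AE P in lebesgue_on \<Omega>. m P \<le> u P \<and> u P \<le> U P)"
    using core(1)[OF h'] by blast
   fix u\<^sub>1 u\<^sub>2
   assume s: "(u\<^sub>1 \<in> W.V \<and> (\<forall>v\<in>W.V. heston_form r \<kappa> \<theta> \<rho> \<sigma> \<gamma> \<Omega> u\<^sub>1 v = (LINT P|lebesgue_on \<Omega>. f P * v P * w P)) \<and>
     (AE P in lebesgue_on \<Omega>. m P \<le> u\<^sub>1 P \<and> u\<^sub>1 P \<le> U P)) \<and>
     u\<^sub>2 \<in> W.V \<and> (\<forall>v\<in>W.V. heston_form r \<kappa> \<theta> \<rho> \<sigma> \<gamma> \<Omega> u\<^sub>2 v = (LINT P|lebesgue_on \<Omega>. f P * v P * w P)) \<and>
     (AE P in lebesgue_on \<Omega>. m P \<le> u\<^sub>2 P \<and> u\<^sub>2 P \<le> U P)"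
   then show "AE P in lebesgue_on \<Omega>. u\<^sub>1 P = u\<^sub>2 P" using core(2)[OF h', of u\<^sub>1 u\<^sub>2] by blast
  qed
 qed
qed

end
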